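(* Let $R$ be a ring and let $A$ be an $R$-algebra of rank $n$. Then for all $m=1,\ldots,n$ there is an isomorphism $A^{(m)}\cong A^{(1,\ldots,1,n-m)}$, where the sequence $(1,\ldots,1,n-m)$ contains $m$ ones followed by $n-m$.
   Context: All rings and algebras are associative, commutative and unital. An $R$-module is of rank $n$ if it is finitely generated, projective and locally free of constant rank $n$; an $R$-algebra of rank $n$ is an $R$-algebra that is of rank $n$ as an $R$-module. For an $R$-algebra $A$ of rank $n$, an $R$-algebra $R'$ and $a\in A\otimes_R R'$, let $P_a(X)\in R'[X]$ be the characteristic polynomial $\det(X\cdot\mathrm{Id}-a)$ of multiplication by $a$ on $A\otimes_R R'$; for an $R$-algebra $B$ it is also viewed in $(B\otimes_R R')[X]$. The $m$-closure $A^{(m)}$ is an $R$-algebra with $R$-algebra maps $\alpha_i\colon A\to A^{(m)}$ ($i=1,\ldots,m$) such that: (i) for every $R$-algebra $R'$ and $a\in A\otimes_R R'$, $\prod_{i=1}^m(X-(\alpha_i\otimes\mathrm{Id})(a))$ divides $P_a(X)$ in $(A^{(m)}\otimes_R R')[X]$; and (ii) for every $R$-algebra $B$ with $R$-algebra maps $\beta_i\colon A\to B$ ($i=1,\ldots,m$) such that for every $R$-algebra $R'$ and $a\in A\otimes_R R'$ the polynomial $\prod_{i=1}^m(X-(\beta_i\otimes\mathrm{Id})(a))$ divides $P_a(X)$ in $(B\otimes_R R')[X]$, there is a unique $R$-algebra map $\varphi\colon A^{(m)}\to B$ with $\varphi\circ\alpha_i=\beta_i$ for all $i$. It exists and is unique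 up to unique isomorphism. Polynomial laws: for an $R$-module $M$ let $\underline{M}$ be the functor from $R$-algebras to sets sending $S$ to $M\otimes_R S$ and a morphism $f$ to $\mathrm{Id}_M\otimes f$. A polynomial law $f\colon\underline{M}\to\underline{N}$ is a natural transformation, with components $f_S\colon M\otimes_R S\to N\otimes_R S$. It is homogeneous of degree $d$ if $f_S(sx)=s^df_S(x)$ for all $R$-algebras $S$, $s\in S$, $x\in M\otimes_R S$. A linear map $M\to N$ is viewed as a polynomial law homogeneous of degree $1$. The norm law $s_n\colon\underline{A}\to\underline{R}$ sends $a\in A\otimes_R S$ to the determinant of multiplication by $a$ on $A\otimes_R S$; it is homogeneous of degree $n$. For an $R$-algebra $C$ it is also viewed as a law $\underline{A}\to\underline{C}$ via $R\to C$. For $n_1,\ldots,n_t$ with $\sum n_i=n$, $A^{(n_1,\ldots,n_t)}$ denotes an $R$-algebra $C$ given with polynomial laws $\delta_i\colon\underline{A}\to\underline{C}$ ($i=1,\ldots,t$), with $\delta_i$ homogeneous of degree $n_i$, such that $s_n=\prod_i\delta_i$ as polynomial laws, and such that $(C,(\delta_i)_i)$ is universal with this property: for every $R$-algebra $B$ with polynomial laws $\beta_i\colon\underline{A}\to\underline{B}$, $\beta_i$ homogeneous of degree $n_i$, with $s_n=\prod_i\beta_i$, there is a unique $R$-algebra map $\varphi\colon C\to B$ with $\varphi\circ\delta_i=\beta_i$ for all $i$.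
   Formalization: The laws δ_i and the competing β_i are required to be multiplicative (f(1)=1, f(xy)=f(x)f(y)) besides homogeneous; with homogeneity alone the claim fails: for A=R a field, n=m=1, A^(1,0) would be R[u,1/u], while A^(1)=R. *)

theory Defs
  imports "HOL-Algebra.UnivPoly" "HOL-Algebra.Divisibility" "HOL-Combinatorics.Permutations" "HOL-Library.Multiset"
begin

section \<open>Modules, algebras and their homomorphisms\<close>

text \<open>
  All rings are commutative with unit. An algebra over a ring \<open>R\<close> is an instance of the library
  locale \<^locale>\<open>algebra\<close>, which requires both \<open>R\<close> and the algebra to be commutative rings.
\<close>

definition module_hom ::
  "('s, 'x) ring_scheme \<Rightarrow> ('s, 'm) module \<Rightarrow> ('s, 'n) module \<Rightarrow> ('m \<Rightarrow> 'n) set" where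
  "module_hom S M N =
     {h \<in> carrier M \<rightarrow> carrier N.
        (\<forall>x\<in>carrier M. \<forall>y\<in>carrier M. h (x \<oplus>\<^bsub>M\<^esub> y) = h x \<oplus>\<^bsub>N\<^esub> h y) \<and>
        (\<forall>s\<in>carrier S. \<forall>x\<in>carrier M. h (s \<odot>\<^bsub>M\<^esub> x) = s \<odot>\<^bsub>N\<^esub> h x)}"

definition alg_hom ::
  "('r, 'x) ring_scheme \<Rightarrow> ('r, 'a) module \<Rightarrow> ('r, 'b) module \<Rightarrow> ('a \<Rightarrow> 'b) set" where
  "alg_hom R A B =
     {h \<in> ring_hom A B. \<forall>r\<in>carrier R. \<forall>x\<in>carrier A. h (r \<odot>\<^bsub>A\<^esub> x) = r \<odot>\<^bsub>B\<^esub> h x}"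

definition alg_iso ::
  "('r, 'x) ring_scheme \<Rightarrow> ('r, 'a) module \<Rightarrow> ('r, 'b) module \<Rightarrow> ('a \<Rightarrow> 'b) set" where
  "alg_iso R A B = {h \<in> alg_hom R A B. bij_betw h (carrier A) (carrier B)}"

text \<open>
  The free module on a set \<open>I\<close>: finitely supported families. It is only ever used as a module; its
  ring operations \<open>mult\<close> and \<open>one\<close> are irrelevant.
\<close>

definition free_module :: "('s, 'x) ring_scheme \<Rightarrow> 'i set \<Rightarrow> ('s, 'i \<Rightarrow> 's) module" where
  "free_module S I =
     \<lparr>carrier = {f \<in> I \<rightarrow>\<^sub>E carrier S. finite {i \<in> I. f i \<noteq> \<zero>\<^bsub>S\<^esub>}},
      monoid.mult = undefined, monoid.one = undefined,
      ring.zero = (\<lambda>i\<in>I. \<zero>\<^bsub>S\<^esub>),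
      ring.add = (\<lambda>f g. \<lambda>i\<in>I. f i \<oplus>\<^bsub>S\<^esub> g i),
      smult = (\<lambda>c f. \<lambda>i\<in>I. c \<otimes>\<^bsub>S\<^esub> f i)\<rparr>"

definition retract_of_free ::
  "('s, 'x) ring_scheme \<Rightarrow> ('s, 'm) module \<Rightarrow> 'i set \<Rightarrow> ('m \<Rightarrow> 'i \<Rightarrow> 's) \<Rightarrow> (('i \<Rightarrow> 's) \<Rightarrow> 'm) \<Rightarrow> bool"
  where
  "retract_of_free S M I \<iota> \<pi> \<longleftrightarrow>
     \<iota> \<in> module_hom S M (free_module S I) \<and>
     \<pi> \<in> module_hom S (free_module S I) M \<and>
     (\<forall>x\<in>carrier M. \<pi> (\<iota> x) = x)"

text \<open>
  Projective means: direct summand of a free module. Index sets taken from the type of \<open>M\<close> suffice,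
  because a projective module is a retract of the free module on its own carrier.
\<close>

definition projective_module :: "('s, 'x) ring_scheme \<Rightarrow> ('s, 'm) module \<Rightarrow> bool" where
  "projective_module S M \<longleftrightarrow> (\<exists>(I :: 'm set) \<iota> \<pi>. retract_of_free S M I \<iota> \<pi>)"

definition finitely_generated_module :: "('s, 'x) ring_scheme \<Rightarrow> ('s, 'm) module \<Rightarrow> bool" where
  "finitely_generated_module S M \<longleftrightarrow>
     (\<exists>G. finite G \<and> G \<subseteq> carrier M \<and>
        (\<forall>y\<in>carrier M. \<exists>c\<in>G \<rightarrow> carrier S. y = (\<Oplus>\<^bsub>M\<^esub>x\<in>G. c x \<odot>\<^bsub>M\<^esub> x)))"

definition free_of_rank :: "('s, 'x) ring_scheme \<Rightarrow> ('s, 'm) module \<Rightarrow> nat \<Rightarrow> bool" where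
  "free_of_rank S M n \<longleftrightarrow>
     (\<exists>h\<in>module_hom S M (free_module S {..<n}).
        bij_betw h (carrier M) (carrier (free_module S {..<n})))"


section \<open>Tensor products\<close>

text \<open>
  A finite formal sum of symbols \<open>m \<otimes> n\<close> is represented by the multiset of its summands, and
  \<open>M \<otimes>\<^sub>R N\<close> is the quotient by the congruence generated by bilinearity. No formal negatives are
  needed: \<open>(\<ominus>m) \<otimes> n\<close> is inverse to \<open>m \<otimes> n\<close> by \<open>add_left\<close> and \<open>zero_left\<close>.
\<close>

inductive tensor_eq ::
  "('r, 'x) ring_scheme \<Rightarrow> ('r, 'm) module \<Rightarrow> ('r, 'n) module \<Rightarrow>
   ('m \<times> 'n) multiset \<Rightarrow> ('m \<times> 'n) multiset \<Rightarrow> bool"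
  for R M N where
    refl: "set_mset u \<subseteq> carrier M \<times> carrier N \<Longrightarrow> tensor_eq R M N u u"
  | sym: "tensor_eq R M N u v \<Longrightarrow> tensor_eq R M N v u"
  | trans: "tensor_eq R M N u v \<Longrightarrow> tensor_eq R M N v w \<Longrightarrow> tensor_eq R M N u w"
  | sum: "tensor_eq R M N u v \<Longrightarrow> tensor_eq R M N u' v' \<Longrightarrow> tensor_eq R M N (u + u') (v + v')"
  | zero_left: "y \<in> carrier N \<Longrightarrow> tensor_eq R M N {#(\<zero>\<^bsub>M\<^esub>, y)#} {#}"
  | add_left: "x \<in> carrier M \<Longrightarrow> x' \<in> carrier M \<Longrightarrow> y \<in> carrier N \<Longrightarrow>
      tensor_eq R M N {#(x \<oplus>\<^bsub>M\<^esub> x', y)#} {#(x, y), (x', y)#}"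
  | add_right: "x \<in> carrier M \<Longrightarrow> y \<in> carrier N \<Longrightarrow> y' \<in> carrier N \<Longrightarrow>
      tensor_eq R M N {#(x, y \<oplus>\<^bsub>N\<^esub> y')#} {#(x, y), (x, y')#}"
  | scalar: "r \<in> carrier R \<Longrightarrow> x \<in> carrier M \<Longrightarrow> y \<in> carrier N \<Longrightarrow>
      tensor_eq R M N {#(r \<odot>\<^bsub>M\<^esub> x, y)#} {#(x, r \<odot>\<^bsub>N\<^esub> y)#}"

definition tensor_class ::
  "('r, 'x) ring_scheme \<Rightarrow> ('r, 'm) module \<Rightarrow> ('r, 'n) module \<Rightarrow>
   ('m \<times> 'n) multiset \<Rightarrow> ('m \<times> 'n) multiset set" where
  "tensor_class R M N u = {v. tensor_eq R M N u v}"

abbreviation pure_tensor ::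
  "('r, 'x) ring_scheme \<Rightarrow> ('r, 'm) module \<Rightarrow> ('r, 'n) module \<Rightarrow>
   'm \<Rightarrow> 'n \<Rightarrow> ('m \<times> 'n) multiset set" where
  "pure_tensor R M N x y \<equiv> tensor_class R M N {#(x, y)#}"

text \<open>
  The base change \<open>M \<otimes>\<^sub>R S\<close> of \<open>M\<close> along an \<open>R\<close>-algebra \<open>S\<close>, as a module over the ring \<open>S\<close>. If \<open>M\<close>
  is an \<open>R\<close>-algebra this is an \<open>S\<close>-algebra; if \<open>M\<close> is just a module, then \<open>mult\<close> and \<open>one\<close> are
  to be ignored. The operations are defined on representatives; each union is over
  representatives that all yield the same class.
\<close>

definition tensor ::
  "('r, 'x) ring_scheme \<Rightarrow> ('r, 'm) module \<Rightarrow> ('r, 's) module \<Rightarrow>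
   ('s, ('m \<times> 's) multiset set) module" where
  "tensor R M S =
     \<lparr>carrier = tensor_class R M S ` {u. set_mset u \<subseteq> carrier M \<times> carrier S},
      monoid.mult = (\<lambda>a b. \<Union>u\<in>a. \<Union>v\<in>b. tensor_class R M S
        (\<Sum>p\<in>#u. {#(fst p \<otimes>\<^bsub>M\<^esub> fst q, snd p \<otimes>\<^bsub>S\<^esub> snd q). q \<in># v#})),
      monoid.one = pure_tensor R M S \<one>\<^bsub>M\<^esub> \<one>\<^bsub>S\<^esub>,
      ring.zero = tensor_class R M S {#},
      ring.add = (\<lambda>a b. \<Union>u\<in>a. \<Union>v\<in>b. tensor_class R M S (u + v)),
      smult = (\<lambda>s a. \<Union>u\<in>a. tensor_class R M S (image_mset (\<lambda>(x, t). (x, s \<otimes>\<^bsub>S\<^esub> t)) u))\<rparr>"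

text \<open>The map \<open>h \<otimes> k : M \<otimes>\<^sub>R S \<rightarrow> N \<otimes>\<^sub>R T\<close>; only the target modules enter the formula.\<close>

definition tensor_map ::
  "('r, 'x) ring_scheme \<Rightarrow> ('r, 'n) module \<Rightarrow> ('r, 't) module \<Rightarrow> ('m \<Rightarrow> 'n) \<Rightarrow> ('s \<Rightarrow> 't) \<Rightarrow>
   ('m \<times> 's) multiset set \<Rightarrow> ('n \<times> 't) multiset set" where
  "tensor_map R N T h k a = (\<Union>u\<in>a. tensor_class R N T (image_mset (map_prod h k) u))"


section \<open>Modules and algebras of rank \<open>n\<close>\<close>

definition fraction ::
  "('r, 'x) ring_scheme \<Rightarrow> 'r set \<Rightarrow> 'r \<Rightarrow> 'r \<Rightarrow> ('r \<times> 'r) set" where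
  "fraction R P a s =
     {(b, t). b \<in> carrier R \<and> t \<in> carrier R - P \<and>
        (\<exists>u\<in>carrier R - P. u \<otimes>\<^bsub>R\<^esub> (t \<otimes>\<^bsub>R\<^esub> a) = u \<otimes>\<^bsub>R\<^esub> (s \<otimes>\<^bsub>R\<^esub> b))}"

text \<open>The localization of \<open>R\<close> at a prime ideal \<open>P\<close>, as an \<open>R\<close>-algebra.\<close>

definition localization ::
  "('r, 'x) ring_scheme \<Rightarrow> 'r set \<Rightarrow> ('r, ('r \<times> 'r) set) module" where
  "localization R P =
     \<lparr>carrier = {fraction R P a s | a s. a \<in> carrier R \<and> s \<in> carrier R - P},
      monoid.mult = (\<lambda>x y. \<Union>(a, s)\<in>x. \<Union>(b, t)\<in>y. fraction R P (a \<otimes>\<^bsub>R\<^esub> b) (s \<otimes>\<^bsub>R\<^esub> t)),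
      monoid.one = fraction R P \<one>\<^bsub>R\<^esub> \<one>\<^bsub>R\<^esub>,
      ring.zero = fraction R P \<zero>\<^bsub>R\<^esub> \<one>\<^bsub>R\<^esub>,
      ring.add = (\<lambda>x y. \<Union>(a, s)\<in>x. \<Union>(b, t)\<in>y.
        fraction R P (a \<otimes>\<^bsub>R\<^esub> t \<oplus>\<^bsub>R\<^esub> b \<otimes>\<^bsub>R\<^esub> s) (s \<otimes>\<^bsub>R\<^esub> t)),
      smult = (\<lambda>r x. \<Union>(a, s)\<in>x. fraction R P (r \<otimes>\<^bsub>R\<^esub> a) s)\<rparr>"

text \<open>The localization \<open>M\<^sub>P\<close> of a module is \<open>M \<otimes>\<^sub>R R\<^sub>P\<close>.\<close>

definition module_of_rank :: "('r, 'x) ring_scheme \<Rightarrow> ('r, 'm) module \<Rightarrow> nat \<Rightarrow> bool" where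
  "module_of_rank R M n \<longleftrightarrow>
     module R M \<and> finitely_generated_module R M \<and> projective_module R M \<and>
     (\<forall>P. primeideal P R \<longrightarrow>
        free_of_rank (localization R P) (tensor R M (localization R P)) n)"

definition algebra_of_rank :: "('r, 'x) ring_scheme \<Rightarrow> ('r, 'a) module \<Rightarrow> nat \<Rightarrow> bool" where
  "algebra_of_rank R A n \<longleftrightarrow> algebra R A \<and> module_of_rank R A n"


section \<open>Determinants, norms and characteristic polynomials\<close>

definition matrix_det ::
  "('s, 'x) ring_scheme \<Rightarrow> nat \<Rightarrow> (nat \<Rightarrow> nat \<Rightarrow> 's) \<Rightarrow> 's" where
  "matrix_det S k a =
     (\<Oplus>\<^bsub>S\<^esub>\<sigma>\<in>{\<sigma>. \<sigma> permutes {..<k}}. add_pow S (sign \<sigma>) (\<Otimes>\<^bsub>S\<^esub>i\<in>{..<k}. a i (\<sigma> i)))"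

definition free_basis :: "('s, 'x) ring_scheme \<Rightarrow> nat \<Rightarrow> nat \<Rightarrow> nat \<Rightarrow> 's" where
  "free_basis S k j = (\<lambda>i\<in>{..<k}. if i = j then \<one>\<^bsub>S\<^esub> else \<zero>\<^bsub>S\<^esub>)"

text \<open>
  The determinant of an endomorphism \<open>\<phi>\<close> of a finitely generated projective \<open>S\<close>-module \<open>M\<close>
  (Goldman, Bourbaki): write \<open>M \<oplus> Q = S\<^sup>k\<close> and take the determinant of \<open>\<phi> \<oplus> id\<^sub>Q\<close>. With \<open>\<iota>\<close> and \<open>\<pi>\<close>
  the inclusion of and the projection onto \<open>M\<close>, so that \<open>Q\<close> is the kernel of \<open>\<pi>\<close>, that
  endomorphism of \<open>S\<^sup>k\<close> is \<open>id - \<iota> \<circ> \<pi> + \<iota> \<circ> \<phi> \<circ> \<pi>\<close>. The result does not depend on the choices.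
\<close>

definition endo_det :: "('s, 'x) ring_scheme \<Rightarrow> ('s, 'm) module \<Rightarrow> ('m \<Rightarrow> 'm) \<Rightarrow> 's" where
  "endo_det S M \<phi> =
     (THE d. \<exists>k \<iota> \<pi>. retract_of_free S M {..<k} \<iota> \<pi> \<and>
        d = matrix_det S k (\<lambda>i j.
              (free_basis S k j i \<ominus>\<^bsub>S\<^esub> \<iota> (\<pi> (free_basis S k j)) i)
                \<oplus>\<^bsub>S\<^esub> \<iota> (\<phi> (\<pi> (free_basis S k j))) i))"

definition algebra_norm ::
  "('r, 'x) ring_scheme \<Rightarrow> ('r, 'a) module \<Rightarrow> ('r, 's) module \<Rightarrow> ('a \<times> 's) multiset set \<Rightarrow> 's" where
  "algebra_norm R A S a = endo_det S (tensor R A S) (\<lambda>x. a \<otimes>\<^bsub>tensor R A S\<^esub> x)"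

text \<open>
  \<^term>\<open>UP S\<close> carries the scalar multiplication by \<open>S\<close>; here it is replaced by that of the ring \<open>R\<close>
  over which \<open>S\<close> is an algebra.
\<close>

definition poly_algebra :: "('r, 's) module \<Rightarrow> ('r, nat \<Rightarrow> 's) module" where
  "poly_algebra S =
     \<lparr>carrier = carrier (UP S), monoid.mult = monoid.mult (UP S), monoid.one = monoid.one (UP S),
      ring.zero = ring.zero (UP S), ring.add = ring.add (UP S),
      smult = (\<lambda>r p i. r \<odot>\<^bsub>S\<^esub> p i)\<rparr>"

text \<open>
  For \<open>a\<close> in \<open>A \<otimes>\<^sub>R S\<close>, the endomorphism \<open>X \<cdot> Id - a\<close> lives on \<open>(A \<otimes>\<^sub>R S)[X] = A \<otimes>\<^sub>R S[X]\<close>, where it is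
  multiplication by \<open>1 \<otimes> X - a\<close>.
\<close>

definition char_poly ::
  "('r, 'x) ring_scheme \<Rightarrow> ('r, 'a) module \<Rightarrow> ('r, 's) module \<Rightarrow>
   ('a \<times> 's) multiset set \<Rightarrow> nat \<Rightarrow> 's" where
  "char_poly R A S a =
     algebra_norm R A (poly_algebra S)
       (pure_tensor R A (poly_algebra S) \<one>\<^bsub>A\<^esub> (up_ring.monom (UP S) \<one>\<^bsub>S\<^esub> 1)
          \<ominus>\<^bsub>tensor R A (poly_algebra S)\<^esub>
        tensor_map R A (poly_algebra S) id (\<lambda>s. up_ring.monom (UP S) s 0) a)"


section \<open>The \<open>m\<close>-closure\<close>

text \<open>
  Quantification over all algebras is quantification over all algebras carried by subsets of one
  type \<open>'u\<close>, which plays the role of a universe. If \<open>'u\<close> is infinite and carries \<open>R\<close> and \<open>A\<close>, then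
  up to isomorphism it contains the polynomial rings over \<open>R\<close> in finitely many variables, their
  quotients, and all algebras generated over \<open>R\<close> by at most \<open>|'u|\<close> elements, so that the
  conditions below do not depend on the choice of \<open>'u\<close>.
\<close>

definition linear_factors_divide ::
  "'u ring \<Rightarrow> ('u, 'u) module \<Rightarrow> nat \<Rightarrow> ('u, 'u) module \<Rightarrow> (nat \<Rightarrow> 'u \<Rightarrow> 'u) \<Rightarrow> bool" where
  "linear_factors_divide R A m B \<beta> \<longleftrightarrow>
     (\<forall>(S :: ('u, 'u) module) a. algebra R S \<and> a \<in> carrier (tensor R A S) \<longrightarrow>
        (\<Otimes>\<^bsub>UP (tensor R B S)\<^esub>i\<in>{..<m}.
            up_ring.monom (UP (tensor R B S)) \<one>\<^bsub>tensor R B S\<^esub> 1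
              \<ominus>\<^bsub>UP (tensor R B S)\<^esub>
            up_ring.monom (UP (tensor R B S)) (tensor_map R B S (\<beta> i) id a) 0)
        divides\<^bsub>UP (tensor R B S)\<^esub>
        (\<lambda>j. pure_tensor R B S \<one>\<^bsub>B\<^esub> (char_poly R A S a j)))"

definition is_m_closure ::
  "'u ring \<Rightarrow> ('u, 'u) module \<Rightarrow> nat \<Rightarrow> ('u, 'u) module \<Rightarrow> (nat \<Rightarrow> 'u \<Rightarrow> 'u) \<Rightarrow> bool" where
  "is_m_closure R A m C \<alpha> \<longleftrightarrow>
     algebra R C \<and> (\<forall>i<m. \<alpha> i \<in> alg_hom R A C) \<and> linear_factors_divide R A m C \<alpha> \<and>
     (\<forall>(B :: ('u, 'u) module) \<beta>.
        algebra R B \<and> (\<forall>i<m. \<beta> i \<in> alg_hom R A B) \<and> linear_factors_divide R A m B \<beta> \<longrightarrow>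
        (\<exists>!\<phi>. \<phi> \<in> alg_hom R C B \<and> \<phi> \<in> extensional (carrier C) \<and>
              (\<forall>i<m. \<forall>x\<in>carrier A. \<phi> (\<alpha> i x) = \<beta> i x)))"


section \<open>Polynomial laws and factorizations of the norm\<close>

type_synonym 'u law = "('u, 'u) module \<Rightarrow> ('u \<times> 'u) multiset set \<Rightarrow> ('u \<times> 'u) multiset set"

definition poly_law :: "'u ring \<Rightarrow> ('u, 'u) module \<Rightarrow> ('u, 'u) module \<Rightarrow> 'u law \<Rightarrow> bool" where
  "poly_law R M N f \<longleftrightarrow>
     (\<forall>S. algebra R S \<longrightarrow> f S \<in> carrier (tensor R M S) \<rightarrow> carrier (tensor R N S)) \<and>
     (\<forall>S T h x. algebra R S \<and> algebra R T \<and> h \<in> alg_hom R S T \<and> x \<in> carrier (tensor R M S) \<longrightarrow>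
        f T (tensor_map R M T id h x) = tensor_map R N T id h (f S x))"

definition homogeneous_law ::
  "'u ring \<Rightarrow> ('u, 'u) module \<Rightarrow> ('u, 'u) module \<Rightarrow> nat \<Rightarrow> 'u law \<Rightarrow> bool" where
  "homogeneous_law R M N d f \<longleftrightarrow>
     (\<forall>S s x. algebra R S \<and> s \<in> carrier S \<and> x \<in> carrier (tensor R M S) \<longrightarrow>
        f S (s \<odot>\<^bsub>tensor R M S\<^esub> x) = (s [^]\<^bsub>S\<^esub> d) \<odot>\<^bsub>tensor R N S\<^esub> f S x)"

definition multiplicative_law ::
  "'u ring \<Rightarrow> ('u, 'u) module \<Rightarrow> ('u, 'u) module \<Rightarrow> 'u law \<Rightarrow> bool" where
  "multiplicative_law R A B f \<longleftrightarrow>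
     (\<forall>S. algebra R S \<longrightarrow>
        f S \<one>\<^bsub>tensor R A S\<^esub> = \<one>\<^bsub>tensor R B S\<^esub> \<and>
        (\<forall>x\<in>carrier (tensor R A S). \<forall>y\<in>carrier (tensor R A S).
           f S (x \<otimes>\<^bsub>tensor R A S\<^esub> y) = f S x \<otimes>\<^bsub>tensor R B S\<^esub> f S y))"

text \<open>The norm law of \<open>A\<close>, viewed as a law from \<open>A\<close> to \<open>B\<close> via the structure map of \<open>B\<close>.\<close>

definition norm_law :: "'u ring \<Rightarrow> ('u, 'u) module \<Rightarrow> ('u, 'u) module \<Rightarrow> 'u law" where
  "norm_law R A B S a = pure_tensor R B S \<one>\<^bsub>B\<^esub> (algebra_norm R A S a)"

text \<open>
  The factors are required to be multiplicative laws, as in Ferrand's theory of the norm functor.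
  Homogeneity alone does not suffice for the intended universal object: a factorization
  \<open>s\<^sub>n = \<delta>\<^sub>0 \<cdot> \<delta>\<^sub>1\<close> could be rescaled to \<open>(u \<cdot> \<delta>\<^sub>0) \<cdot> (u\<inverse> \<cdot> \<delta>\<^sub>1)\<close> by any unit \<open>u\<close>, and for \<open>A = R\<close>, \<open>n = 1\<close>
  and degrees \<open>(1, 0)\<close> the universal algebra would be \<open>R[u, u\<inverse>]\<close> instead of \<open>R\<close>.
\<close>

definition norm_factorization ::
  "'u ring \<Rightarrow> ('u, 'u) module \<Rightarrow> nat list \<Rightarrow> ('u, 'u) module \<Rightarrow> (nat \<Rightarrow> 'u law) \<Rightarrow> bool" where
  "norm_factorization R A ns B \<beta> \<longleftrightarrow>
     (\<forall>i<length ns. poly_law R A B (\<beta> i) \<and> homogeneous_law R A B (ns ! i) (\<beta> i) \<and>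
        multiplicative_law R A B (\<beta> i)) \<and>
     (\<forall>S a. algebra R S \<and> a \<in> carrier (tensor R A S) \<longrightarrow>
        norm_law R A B S a = (\<Otimes>\<^bsub>tensor R B S\<^esub>i\<in>{..<length ns}. \<beta> i S a))"

definition is_universal_norm_factorization ::
  "'u ring \<Rightarrow> ('u, 'u) module \<Rightarrow> nat list \<Rightarrow> ('u, 'u) module \<Rightarrow> (nat \<Rightarrow> 'u law) \<Rightarrow> bool" where
  "is_universal_norm_factorization R A ns C \<delta> \<longleftrightarrow>
     algebra R C \<and> norm_factorization R A ns C \<delta> \<and>
     (\<forall>(B :: ('u, 'u) module) \<beta>.
        algebra R B \<and> norm_factorization R A ns B \<beta> \<longrightarrow>
        (\<exists>!\<phi>. \<phi> \<in> alg_hom R C B \<and> \<phi> \<in> extensional (carrier C) \<and>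
              (\<forall>i<length ns. \<forall>S a. algebra R S \<and> a \<in> carrier (tensor R A S) \<longrightarrow>
                 tensor_map R B S \<phi> id (\<delta> i S a) = \<beta> i S a)))"

end

theory Submission
  imports "Jordan_Normal_Form.Determinant" "HOL-Algebra.Free_Abelian_Groups" "HOL-Algebra.Ring_Divisibility" Defs
begin

text \<open>
  The two algebras represent the same functor. Let \<open>N\<close> be the norm law of \<open>A\<close>, so that
  \<open>P\<^sub>a(X) = N(X - a)\<close>, and let \<open>B\<close> be an \<open>R\<close>-algebra. Homomorphisms from the \<open>m\<close>-closure to \<open>B\<close> are
  families of algebra homomorphisms \<open>\<beta>\<^sub>1, \<dots>, \<beta>\<^sub>m : A \<rightarrow> B\<close> such that \<open>\<Prod>(X - \<beta>\<^sub>i(a))\<close> always divides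
  \<open>P\<^sub>a(X)\<close>; homomorphisms from the other algebra to \<open>B\<close> are factorizations \<open>N = \<delta>\<^sub>1 \<cdots> \<delta>\<^sub>m \<gamma>\<close> into
  multiplicative laws, with \<open>\<delta>\<^sub>i\<close> of degree \<open>1\<close> and \<open>\<gamma>\<close> of degree \<open>n - m\<close>. The proof passes from one
  kind of data to the other.

  From roots to a factorization: replacing \<open>a\<close> by \<open>-a\<close>, the product \<open>\<Prod>(X + \<beta>\<^sub>i(a))\<close> divides \<open>N(X + a)\<close>
  (\<open>linear_factors_divide_iff\<close>). This product is monic and therefore not a zero divisor, so the quotient is
  unique. Its value at \<open>X = 0\<close> is the \<open>cofactor\<close> \<open>\<gamma>(a)\<close>, which satisfies \<open>N(a) = \<Prod>\<beta>\<^sub>i(a) \<cdot> \<gamma>(a)\<close>. The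
  uniqueness of quotients makes \<open>\<gamma>\<close> a law (\<open>cofactor_natural\<close>), a multiplicative one (\<open>cofactor_mult\<close>), and
  the only law that completes the \<open>\<beta>\<^sub>i\<close> to the norm (\<open>cofactor_unique\<close>). It is homogeneous of degree \<open>n - m\<close>
  because \<open>X\<^sup>m \<gamma>(X) = N(X) = X\<^sup>n\<close> (\<open>cofactor_scalar\<close>).

  From a factorization to roots: a law of degree \<open>1\<close> is additive (\<open>homogeneous_one_additive\<close>), so a
  multiplicative one is induced by an algebra homomorphism (\<open>degree_one_law_is_alg_hom\<close>). Evaluating the
  factorization at \<open>X + a\<close> shows the divisibility (\<open>factorization_roots\<close>).

  All this rests on properties of the norm of a projective algebra. For a dual basis \<open>(l\<^sub>i, g\<^sub>i)\<close> the
  determinant of \<open>\<phi>\<close> is that of the matrix \<open>1 + (l\<^sub>i(\<phi> g\<^sub>j - g\<^sub>j))\<close>. It is independent of the dual basis by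
  the identity \<open>det (1 + U V) = det (1 + V U)\<close> (\<open>dual_det_unique\<close>), and in this form it is multiplicative and
  compatible with base change. The same identity over the localizations of \<open>R\<close>, where \<open>A\<close> is free of
  rank \<open>n\<close>, gives \<open>N(s) = s\<^sup>n\<close> (\<open>norm_scalar\<close>).

  The variable \<open>X\<close> enters by evaluating laws at the algebra \<open>S[X]\<close>. As laws live on algebras carried by the
  type \<open>'u\<close>, a copy of \<open>S[X]\<close> inside \<open>'u\<close> is used (\<open>poly_u\<close>); it exists because \<open>'u\<close> is infinite.
\<close>

section \<open>Determinants over rings given by a carrier\<close>

text \<open>
  Determinant identities over commutative rings with carrier in the type \<open>'s\<close> follow from those in a
  single ring that surjects onto all of them. Such a ring is the product of
  all commutative ring structures on subsets of \<open>'s\<close>: here it becomes a type of class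
  \<^class>\<open>comm_ring_1\<close>, so that identities between determinants of matrices over that class can be
  projected to any ring that is given by a carrier. The extra factor \<open>int\<close> keeps \<open>0 \<noteq> 1\<close>
  even if every ring on \<open>'s\<close> is trivial.
\<close>

typedef 's cring_product =
  "{p :: ('s ring \<Rightarrow> 's) \<times> int. \<forall>S. if cring S then fst p S \<in> carrier S else fst p S = undefined}"
proof -
  have "(\<lambda>S. if cring S then \<zero>\<^bsub>S\<^esub> else undefined, 0) \<in>
    {p :: ('s ring \<Rightarrow> 's) \<times> int. \<forall>S. if cring S then fst p S \<in> carrier S else fst p S = undefined}"
    by (auto simp: cring_def ring.ring_simprules)
  then show ?thesis by blast
qed

setup_lifting type_definition_cring_product

instantiation cring_product :: (type) comm_ring_1
begin
lift_definition zero_cring_product :: "'a cring_product"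
  is "(\<lambda>S. if cring S then \<zero>\<^bsub>S\<^esub> else undefined, 0)"
  by (auto simp: cring_def ring.ring_simprules)
lift_definition one_cring_product :: "'a cring_product"
  is "(\<lambda>S. if cring S then \<one>\<^bsub>S\<^esub> else undefined, 1)"
  by (auto simp: cring_def ring.ring_simprules)
lift_definition plus_cring_product :: "'a cring_product \<Rightarrow> 'a cring_product \<Rightarrow> 'a cring_product"
  is "\<lambda>p q. (\<lambda>S. if cring S then fst p S \<oplus>\<^bsub>S\<^esub> fst q S else undefined, snd p + snd q)"
  by (auto simp: cring_def ring.ring_simprules)
lift_definition times_cring_product :: "'a cring_product \<Rightarrow> 'a cring_product \<Rightarrow> 'a cring_product"
  is "\<lambda>p q. (\<lambda>S. if cring S then fst p S \<otimes>\<^bsub>S\<^esub> fst q S else undefined, snd p * snd q)"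
  by (auto simp: cring_def ring.ring_simprules)
lift_definition uminus_cring_product :: "'a cring_product \<Rightarrow> 'a cring_product"
  is "\<lambda>p. (\<lambda>S. if cring S then \<ominus>\<^bsub>S\<^esub> fst p S else undefined, - snd p)"
  by (auto simp: cring_def ring.ring_simprules)
lift_definition minus_cring_product :: "'a cring_product \<Rightarrow> 'a cring_product \<Rightarrow> 'a cring_product"
  is "\<lambda>p q. (\<lambda>S. if cring S then fst p S \<ominus>\<^bsub>S\<^esub> fst q S else undefined, snd p - snd q)"
  by (auto simp: cring_def ring.ring_simprules)
instance
proof
  fix a b c :: "'a cring_product"
  show "a * b * c = a * (b * c)"
    by transfer (auto simp: fun_eq_iff cring.cring_simprules algebra_simps)
  show "a * b = b * a"
    by transfer (auto simp: fun_eq_iff cring.cring_simprules algebra_simps)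
  show "1 * a = a"
    by transfer (auto simp: fun_eq_iff prod_eq_iff cring.cring_simprules algebra_simps)
  show "a + b + c = a + (b + c)"
    by transfer (auto simp: fun_eq_iff cring.cring_simprules algebra_simps)
  show "a + b = b + a"
    by transfer (auto simp: fun_eq_iff cring.cring_simprules algebra_simps)
  show "0 + a = a"
    by transfer (auto simp: fun_eq_iff prod_eq_iff cring.cring_simprules algebra_simps)
  show "- a + a = 0"
    by transfer (auto simp: fun_eq_iff prod_eq_iff cring.cring_simprules algebra_simps)
  show "a - b = a + - b"
    by transfer (auto simp: fun_eq_iff cring.cring_simprules algebra_simps a_minus_def)
  show "(a + b) * c = a * c + b * c"
    by transfer (auto simp: fun_eq_iff cring.cring_simprules algebra_simps)
  show "(0::'a cring_product) \<noteq> 1"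
    by transfer auto
qed
end

text \<open>
  The projection to the factor \<open>S\<close>, and a section of it. The factors are indexed by plain ring
  records, whence the truncation.
\<close>

lift_definition factor_at :: "('s, 'x) ring_scheme \<Rightarrow> 's cring_product \<Rightarrow> 's"
  is "\<lambda>S p. fst p (ring.truncate S)" .

lift_definition point_at :: "('s, 'x) ring_scheme \<Rightarrow> 's \<Rightarrow> 's cring_product"
  is "\<lambda>S x. (\<lambda>T. if cring T then (if T = ring.truncate S \<and> x \<in> carrier T then x else \<zero>\<^bsub>T\<^esub>) else undefined, 0)"
  by (auto simp: cring_def ring.ring_simprules)

lemma truncate_simps:
  "carrier (ring.truncate S) = carrier S" "mult (ring.truncate S) = mult S"
  "one (ring.truncate S) = one S" "ring.zero (ring.truncate S) = ring.zero S" "add (ring.truncate S) = add S"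
  by (simp_all add: ring.truncate_def)

lemma cring_truncate: assumes "cring S" shows "cring (ring.truncate S)"
proof -
  interpret cring S by fact
  show ?thesis
    by (rule cringI)
      (auto intro!: abelian_groupI comm_monoidI simp: truncate_simps a_ac m_ac r_distr
       intro: l_neg exI[of _ "a_inv S _"])
qed

lemma permutes_less: "p permutes {..<k} \<Longrightarrow> i < k \<Longrightarrow> p i < (k::nat)"
  using permutes_in_image[of p "{..<k}" i] by simp

lemma det_unit_block_lower:
  fixes V M :: "nat \<Rightarrow> nat \<Rightarrow> 'a::comm_ring_1"
  shows "det (mat (l + k) (l + k) (\<lambda>(i, j).
      if i < l then (if j < l then (if i = j then 1 else 0) else V i j)
      else (if j < l then 0 else M (i - l) (j - l)))) = det (mat k k (\<lambda>(i, j). M i j))"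
proof (induction l arbitrary: V)
  case 0
  show ?case by simp
next
  case (Suc l)
  let ?B = "mat (l + k) (l + k) (\<lambda>(i, j).
      if i < l then (if j < l then (if i = j then 1 else 0) else V (Suc i) (Suc j))
      else (if j < l then 0 else M (i - l) (j - l)))"
  let ?A = "mat 1 1 (\<lambda>_. 1 :: 'a)"
  let ?V = "mat 1 (l + k) (\<lambda>(i, j). if j < l then 0 else V 0 (Suc j))"
  have "mat (Suc l + k) (Suc l + k) (\<lambda>(i, j).
      if i < Suc l then (if j < Suc l then (if i = j then 1 else 0) else V i j)
      else (if j < Suc l then 0 else M (i - Suc l) (j - Suc l))) =
    four_block_mat ?A ?V (0\<^sub>m (l + k) 1) ?B"
    by (rule eq_matI) (auto simp: gr0_conv_Suc less_Suc_eq_0_disj not_less)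
  then show ?case
    using Suc.IH[of "\<lambda>i j. V (Suc i) (Suc j)"]
    by (simp add: det_four_block_mat_lower_left_zero_col[of _ _ "l + k"] det_single)
qed

lemma det_unit_block_upper:
  fixes V M :: "nat \<Rightarrow> nat \<Rightarrow> 'a::comm_ring_1"
  shows "det (mat (l + k) (l + k) (\<lambda>(i, j).
      if i < l then (if j < l then M i j else 0)
      else (if j < l then V i j else if i = j then 1 else 0))) = det (mat l l (\<lambda>(i, j). M i j))"
proof (induction k)
  case 0
  show ?case by (auto intro!: arg_cong[where f=det] cong_mat)
next
  case (Suc k)
  let ?B = "mat (l + k) (l + k) (\<lambda>(i, j).
      if i < l then (if j < l then M i j else 0)
      else (if j < l then V i j else if i = j then 1 else 0))"
  let ?V = "mat 1 (l + k) (\<lambda>(i, j). if j < l then V (l + k) j else 0)"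
  have "mat (l + Suc k) (l + Suc k) (\<lambda>(i, j).
      if i < l then (if j < l then M i j else 0)
      else (if j < l then V i j else if i = j then 1 else 0)) =
    four_block_mat ?B (0\<^sub>m (l + k) 1) ?V (mat 1 1 (\<lambda>_. 1 :: 'a))"
    by (rule eq_matI) (auto simp: less_Suc_eq)
  then show ?case
    using Suc.IH by (simp add: det_four_block_mat_upper_right_zero_col[of _ "l + k"] det_single)
qed

text \<open>
  Both sides are the determinant of the block matrix \<open>(1, V; -U, 1)\<close>: multiplying it from the left by
  a unipotent block matrix clears either of its off-diagonal blocks.
\<close>

lemma det_one_plus_mult_commute_mat:
  fixes U V :: "'a::comm_ring_1 mat"
  assumes U: "U \<in> carrier_mat k l" and V: "V \<in> carrier_mat l k"
  shows "det (1\<^sub>m k + U * V) = det (1\<^sub>m l + V * U)"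
proof -
  let ?N = "four_block_mat (1\<^sub>m l) V (- U) (1\<^sub>m k)"
  let ?P = "four_block_mat (1\<^sub>m l) (- V) (0\<^sub>m k l) (1\<^sub>m k)"
  let ?Q = "four_block_mat (1\<^sub>m l) (0\<^sub>m l k) U (1\<^sub>m k)"
  note [simp] = U V
  have carr: "?N \<in> carrier_mat (l + k) (l + k)" "?P \<in> carrier_mat (l + k) (l + k)"
    "?Q \<in> carrier_mat (l + k) (l + k)" by simp_all
  have dims: "dim_row U = k" "dim_col U = l" "dim_row V = l" "dim_col V = k"
    using assms unfolding carrier_mat_def by auto
  have mat_index_eta: "mat p p (\<lambda>(i, j). 1\<^sub>m p $$ (i, j)) = (1\<^sub>m p :: 'a mat)" for p
    by (rule eq_matI) auto
  have "?P = mat (l + k) (l + k) (\<lambda>(i, j).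
      if i < l then (if j < l then (if i = j then 1 else 0) else (- V) $$ (i, j - l))
      else (if j < l then 0 else 1\<^sub>m k $$ (i - l, j - l)))"
    by (rule eq_matI) (auto simp: dims)
  then have P: "det ?P = 1"
    using det_unit_block_lower[where M = "\<lambda>i j. 1\<^sub>m k $$ (i, j)" and V = "\<lambda>i j. (- V) $$ (i, j - l)" and l = l and k = k]
    by (simp only: mat_index_eta) simp
  have "?Q = mat (l + k) (l + k) (\<lambda>(i, j).
      if i < l then (if j < l then 1\<^sub>m l $$ (i, j) else 0)
      else (if j < l then U $$ (i - l, j) else if i = j then 1 else 0))"
    by (rule eq_matI) (auto simp: dims)
  then have Q: "det ?Q = 1"
    using det_unit_block_upper[where M = "\<lambda>i j. 1\<^sub>m l $$ (i, j)" and V = "\<lambda>i j. U $$ (i - l, j)" and l = l and k = k]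
    by (simp only: mat_index_eta) simp
  have "?P * ?N = four_block_mat (1\<^sub>m l + V * U) (0\<^sub>m l k) (- U) (1\<^sub>m k)"
    by (subst mult_four_block_mat[of _ l l _ k _ k _ _ l _ k]) (auto simp: dims intro!: cong_four_block_mat)
  also have "\<dots> = mat (l + k) (l + k) (\<lambda>(i, j).
      if i < l then (if j < l then (1\<^sub>m l + V * U) $$ (i, j) else 0)
      else (if j < l then (- U) $$ (i - l, j) else if i = j then 1 else 0))"
    by (rule eq_matI) (auto simp: dims)
  finally have "det (?P * ?N) = det (mat l l (\<lambda>(i, j). (1\<^sub>m l + V * U) $$ (i, j)))"
    by (simp only: det_unit_block_upper)
  also have "mat l l (\<lambda>(i, j). (1\<^sub>m l + V * U) $$ (i, j)) = 1\<^sub>m l + V * U"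
    by (rule eq_matI) (auto simp: dims)
  finally have 1: "det ?N = det (1\<^sub>m l + V * U)"
    using P by (simp add: det_mult[OF carr(2,1)])
  have "?Q * ?N = four_block_mat (1\<^sub>m l) V (0\<^sub>m k l) (1\<^sub>m k + U * V)"
    by (subst mult_four_block_mat[of _ l l _ k _ k _ _ l _ k]) (auto simp: dims intro!: cong_four_block_mat)
  also have "\<dots> = mat (l + k) (l + k) (\<lambda>(i, j).
      if i < l then (if j < l then (if i = j then 1 else 0) else V $$ (i, j - l))
      else (if j < l then 0 else (1\<^sub>m k + U * V) $$ (i - l, j - l)))"
    by (rule eq_matI) (auto simp: dims)
  finally have "det (?Q * ?N) = det (mat k k (\<lambda>(i, j). (1\<^sub>m k + U * V) $$ (i, j)))"
    using det_unit_block_lower[where M = "\<lambda>i j. (1\<^sub>m k + U * V) $$ (i, j)" and V = "\<lambda>i j. V $$ (i, j - l)" and l = l and k = k]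
    by (simp only:)
  also have "mat k k (\<lambda>(i, j). (1\<^sub>m k + U * V) $$ (i, j)) = 1\<^sub>m k + U * V"
    by (rule eq_matI) (auto simp: dims)
  finally show ?thesis
    using Q 1 by (simp add: det_mult[OF carr(3,1)])
qed

context cring
begin

lemma factor_at_simps:
  "factor_at R p \<in> carrier R" "factor_at R 0 = \<zero>" "factor_at R 1 = \<one>"
  "factor_at R (p + q) = factor_at R p \<oplus> factor_at R q"
  "factor_at R (p * q) = factor_at R p \<otimes> factor_at R q"
  "factor_at R (- p) = \<ominus> factor_at R p"
  "x \<in> carrier R \<Longrightarrow> factor_at R (point_at R x) = x"
proof -
  have c: "cring (ring.truncate R)" by (rule cring_truncate) (rule is_cring)
  show 1: "factor_at R p \<in> carrier R" for p
    using c by (transfer) (metis truncate_simps(1))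
  show "factor_at R 0 = \<zero>" "factor_at R 1 = \<one>"
    using c by (transfer; simp add: truncate_simps)+
  show add: "factor_at R (p + q) = factor_at R p \<oplus> factor_at R q" for p q
    using c by (transfer; simp add: truncate_simps)+
  show "factor_at R (p * q) = factor_at R p \<otimes> factor_at R q"
    using c by (transfer; simp add: truncate_simps)+
  show "x \<in> carrier R \<Longrightarrow> factor_at R (point_at R x) = x"
    using c by (transfer; simp add: truncate_simps)+
  have "factor_at R 0 = \<zero>"
    using c by (transfer; simp add: truncate_simps)+
  then have "factor_at R (- p) \<oplus> factor_at R p = \<zero>" using add[of "-p" p] by simp
  then show "factor_at R (- p) = \<ominus> factor_at R p" using 1 by (simp add: minus_equality)
qed

lemma factor_at_sum: "factor_at R (sum f A) = (\<Oplus>x\<in>A. factor_at R (f x))"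
  by (induction A rule: infinite_finite_induct)
     (auto simp: factor_at_simps finsum_infinite intro!: finsum_insert[symmetric])

lemma factor_at_prod: "factor_at R (prod f A) = (\<Otimes>x\<in>A. factor_at R (f x))"
  by (induction A rule: infinite_finite_induct)
     (auto simp: factor_at_simps intro!: finprod_insert[symmetric])

text \<open>
  The projections are ring homomorphisms, so they commute with the Leibniz formula; this carries
  determinant identities over to carrier-based rings.
\<close>

lemma factor_at_det:
  "factor_at R (det (mat k k (\<lambda>(i, j). a i j))) = matrix_det R k (\<lambda>i j. factor_at R (a i j))"
proof -
  have sg: "factor_at R (signof p * x) = add_pow R (sign p) (factor_at R x)" for p :: "nat \<Rightarrow> nat" and x
    by (cases p rule: sign_cases)
      (auto simp: factor_at_simps add_pow_def a_inv_def int_pow_def2 nat_pow_def)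
  have "factor_at R (det (mat k k (\<lambda>(i, j). a i j))) =
     (\<Oplus>p\<in>{p. p permutes {0..<k}}. factor_at R (signof p * (\<Prod>i = 0..<k. mat k k (\<lambda>(i, j). a i j) $$ (i, p i))))"
    by (subst det_def'[of _ k]) (simp_all only: factor_at_sum mat_carrier)
  also have "\<dots> = matrix_det R k (\<lambda>i j. factor_at R (a i j))"
    unfolding matrix_det_def sg factor_at_prod lessThan_atLeast0
    by (auto simp: factor_at_simps permutes_in_image intro!: finsum_cong' finprod_closed arg_cong[where f="add_pow R _"] finprod_cong' add.int_pow_closed)
  finally show ?thesis .
qed

lemma matrix_det_cong:
  "(\<And>i j. i < k \<Longrightarrow> j < k \<Longrightarrow> a i j = b i j) \<Longrightarrow> (\<And>i j. i < k \<Longrightarrow> j < k \<Longrightarrow> b i j \<in> carrier R) \<Longrightarrow>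
    matrix_det R k a = matrix_det R k b"
  unfolding matrix_det_def
  by (intro finsum_cong' refl arg_cong[where f="add_pow R _"] finprod_cong')
   (auto simp: permutes_less intro!: add.int_pow_closed finprod_closed)

lemma matrix_det_one_plus_mult_commute:
  assumes U: "\<And>i a. i < k \<Longrightarrow> a < l \<Longrightarrow> U i a \<in> carrier R"
    and V: "\<And>a j. a < l \<Longrightarrow> j < k \<Longrightarrow> V a j \<in> carrier R"
  shows "matrix_det R k (\<lambda>i j. (if i = j then \<one> else \<zero>) \<oplus> (\<Oplus>a\<in>{..<l}. U i a \<otimes> V a j)) =
    matrix_det R l (\<lambda>a b. (if a = b then \<one> else \<zero>) \<oplus> (\<Oplus>i\<in>{..<k}. V a i \<otimes> U i b))"
proof -
  define U' where "U' = mat k l (\<lambda>(i, a). point_at R (U i a))"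
  define V' where "V' = mat l k (\<lambda>(a, j). point_at R (V a j))"
  have fa_if: "factor_at R (if b then 1 else 0) = (if b then \<one> else \<zero>)" for b
    by (simp add: factor_at_simps)
  have "det (1\<^sub>m k + U' * V') = det (1\<^sub>m l + V' * U')"
    by (rule det_one_plus_mult_commute_mat) (auto simp: U'_def V'_def)
  moreover have "1\<^sub>m k + U' * V' = mat k k (\<lambda>(i, j). (if i = j then 1 else 0) +
      (\<Sum>a<l. point_at R (U i a) * point_at R (V a j)))"
    by (rule eq_matI) (auto simp: U'_def V'_def scalar_prod_def lessThan_atLeast0)
  moreover have "1\<^sub>m l + V' * U' = mat l l (\<lambda>(a, b). (if a = b then 1 else 0) +
      (\<Sum>i<k. point_at R (V a i) * point_at R (U i b)))"
    by (rule eq_matI) (auto simp: U'_def V'_def scalar_prod_def lessThan_atLeast0)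
  ultimately have eq: "matrix_det R k (\<lambda>i j. (if i = j then \<one> else \<zero>) \<oplus>
        (\<Oplus>a\<in>{..<l}. factor_at R (point_at R (U i a)) \<otimes> factor_at R (point_at R (V a j)))) =
      matrix_det R l (\<lambda>a b. (if a = b then \<one> else \<zero>) \<oplus>
        (\<Oplus>i\<in>{..<k}. factor_at R (point_at R (V a i)) \<otimes> factor_at R (point_at R (U i b))))"
    using factor_at_det[of k "\<lambda>i j. (if i = j then 1 else 0) + (\<Sum>a<l. point_at R (U i a) * point_at R (V a j))"]
      factor_at_det[of l "\<lambda>a b. (if a = b then 1 else 0) + (\<Sum>i<k. point_at R (V a i) * point_at R (U i b))"]
    by (simp add: factor_at_simps(4,5) factor_at_sum fa_if)
  show ?thesis
    using U V
    by (subst (1 2) matrix_det_cong[OF _ _, symmetric]; (subst eq)?)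
      (auto simp: factor_at_simps intro!: finsum_cong' eq)
qed

lemma matrix_det_mult:
  assumes U: "\<And>i j. i < k \<Longrightarrow> j < k \<Longrightarrow> U i j \<in> carrier R"
    and V: "\<And>i j. i < k \<Longrightarrow> j < k \<Longrightarrow> V i j \<in> carrier R"
  shows "matrix_det R k (\<lambda>i j. \<Oplus>a\<in>{..<k}. U i a \<otimes> V a j) = matrix_det R k U \<otimes> matrix_det R k V"
proof -
  define U' where "U' = mat k k (\<lambda>(i, a). point_at R (U i a))"
  define V' where "V' = mat k k (\<lambda>(a, j). point_at R (V a j))"
  have "det (U' * V') = det U' * det V'"
    by (rule det_mult) (auto simp: U'_def V'_def)
  moreover have "U' * V' = mat k k (\<lambda>(i, j). (\<Sum>a<k. point_at R (U i a) * point_at R (V a j)))"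
    by (rule eq_matI) (auto simp: U'_def V'_def scalar_prod_def lessThan_atLeast0)
  ultimately have eq: "matrix_det R k (\<lambda>i j. (\<Oplus>a\<in>{..<k}. factor_at R (point_at R (U i a)) \<otimes> factor_at R (point_at R (V a j)))) =
      matrix_det R k (\<lambda>i j. factor_at R (point_at R (U i j))) \<otimes> matrix_det R k (\<lambda>i j. factor_at R (point_at R (V i j)))"
    using factor_at_det[of k "\<lambda>i j. (\<Sum>a<k. point_at R (U i a) * point_at R (V a j))"]
      factor_at_det[of k "\<lambda>i j. point_at R (U i j)"] factor_at_det[of k "\<lambda>i j. point_at R (V i j)"]
    by (simp add: factor_at_simps(4,5) factor_at_sum U'_def V'_def)
  have 1: "matrix_det R k (\<lambda>i j. factor_at R (point_at R (U i j))) = matrix_det R k U"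
    "matrix_det R k (\<lambda>i j. factor_at R (point_at R (V i j))) = matrix_det R k V"
    using U V by (auto intro!: matrix_det_cong simp: factor_at_simps)
  have 2: "matrix_det R k (\<lambda>i j. (\<Oplus>a\<in>{..<k}. factor_at R (point_at R (U i a)) \<otimes> factor_at R (point_at R (V a j)))) =
    matrix_det R k (\<lambda>i j. (\<Oplus>a\<in>{..<k}. U i a \<otimes> V a j))"
    using U V by (auto intro!: matrix_det_cong finsum_cong' simp: factor_at_simps)
  show ?thesis using eq unfolding 1 2 .
qed

lemma matrix_det_scalar:
  assumes s: "s \<in> carrier R"
  shows "matrix_det R k (\<lambda>i j. if i = j then s else \<zero>) = s [^] k"
proof -
  have pow: "factor_at R (p ^ k) = factor_at R p [^] k" for p and k :: nat
    by (induction k) (auto simp: factor_at_simps m_comm)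
  have "mat k k (\<lambda>(i, j). if i = j then point_at R s else 0) = point_at R s \<cdot>\<^sub>m 1\<^sub>m k"
    by (rule eq_matI) auto
  then have "det (mat k k (\<lambda>(i, j). if i = j then point_at R s else 0)) = point_at R s ^ k"
    by simp
  then have "matrix_det R k (\<lambda>i j. factor_at R (if i = j then point_at R s else 0)) = s [^] k"
    using factor_at_det[of k "\<lambda>i j. if i = j then point_at R s else 0"] s
    by (simp add: factor_at_simps pow)
  then show ?thesis using s
    by (simp add: factor_at_simps if_distrib cong: if_cong)
qed

lemma matrix_det_closed:
  "(\<And>i j. i < k \<Longrightarrow> j < k \<Longrightarrow> a i j \<in> carrier R) \<Longrightarrow> matrix_det R k a \<in> carrier R"
  unfolding matrix_det_def
  by (auto intro!: finsum_closed add.int_pow_closed finprod_closed simp: permutes_less)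

end

lemma matrix_det_hom:
  assumes "cring R" "cring S" and h: "h \<in> ring_hom R S"
    and a: "\<And>i j. i < k \<Longrightarrow> j < k \<Longrightarrow> a i j \<in> carrier R"
  shows "h (matrix_det R k a) = matrix_det S k (\<lambda>i j. h (a i j))"
proof -
  interpret ring_hom_cring R S h
    using assms(1-3) by (simp add: ring_hom_cring_def ring_hom_cring_axioms_def)
  have pow: "h (add_pow R (sign p) x) = add_pow S (sign p) (h x)" if "x \<in> carrier R" for p :: "nat \<Rightarrow> nat" and x
    using that hom_a_inv[of x]
    by (cases p rule: sign_cases)
      (auto simp: add_pow_def a_inv_def int_pow_def2 nat_pow_def)
  have "h (matrix_det R k a) = (\<Oplus>\<^bsub>S\<^esub>\<sigma>\<in>{\<sigma>. \<sigma> permutes {..<k}}. h (add_pow R (sign \<sigma>) (\<Otimes>\<^bsub>R\<^esub>i\<in>{..<k}. a i (\<sigma> i))))"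
    unfolding matrix_det_def
    by (subst hom_finsum) (auto simp: a permutes_less o_def intro!: R.add.int_pow_closed R.finprod_closed)
  also have "\<dots> = matrix_det S k (\<lambda>i j. h (a i j))"
    unfolding matrix_det_def
    by (intro S.finsum_cong' refl)
      (auto simp: a permutes_less pow o_def hom_finprod R.finprod_closed intro!: S.add.int_pow_closed S.finprod_closed arg_cong[where f="add_pow S _"])
  finally show ?thesis .
qed

section \<open>Homomorphisms of modules and algebras\<close>

lemma module_homI:
  "\<lbrakk>\<And>x. x \<in> carrier M \<Longrightarrow> h x \<in> carrier N;
    \<And>x y. x \<in> carrier M \<Longrightarrow> y \<in> carrier M \<Longrightarrow> h (x \<oplus>\<^bsub>M\<^esub> y) = h x \<oplus>\<^bsub>N\<^esub> h y;
    \<And>s x. s \<in> carrier S \<Longrightarrow> x \<in> carrier M \<Longrightarrow> h (s \<odot>\<^bsub>M\<^esub> x) = s \<odot>\<^bsub>N\<^esub> h x\<rbrakk> \<Longrightarrow> h \<in> module_hom S M N"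
  by (auto simp: module_hom_def)

lemma module_homD:
  assumes "h \<in> module_hom S M N"
  shows "x \<in> carrier M \<Longrightarrow> h x \<in> carrier N"
    and "x \<in> carrier M \<Longrightarrow> y \<in> carrier M \<Longrightarrow> h (x \<oplus>\<^bsub>M\<^esub> y) = h x \<oplus>\<^bsub>N\<^esub> h y"
    and "s \<in> carrier S \<Longrightarrow> x \<in> carrier M \<Longrightarrow> h (s \<odot>\<^bsub>M\<^esub> x) = s \<odot>\<^bsub>N\<^esub> h x"
  using assms by (auto simp: module_hom_def)

lemma module_hom_zero:
  assumes h: "h \<in> module_hom S M N" and M: "module S M" and N: "module S N"
  shows "h \<zero>\<^bsub>M\<^esub> = \<zero>\<^bsub>N\<^esub>"
proof -
  interpret M: module S M by fact
  interpret N: module S N by fact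
  have "h \<zero>\<^bsub>M\<^esub> = h (\<zero>\<^bsub>S\<^esub> \<odot>\<^bsub>M\<^esub> \<zero>\<^bsub>M\<^esub>)" by simp
  also have "\<dots> = \<zero>\<^bsub>S\<^esub> \<odot>\<^bsub>N\<^esub> h \<zero>\<^bsub>M\<^esub>" by (rule module_homD[OF h]) simp_all
  also have "\<dots> = \<zero>\<^bsub>N\<^esub>" by (simp add: module_homD[OF h])
  finally show ?thesis .
qed

lemma module_hom_id: "id \<in> module_hom S M M"
  by (rule module_homI) auto

lemma module_hom_comp:
  "h \<in> module_hom S M N \<Longrightarrow> k \<in> module_hom S N L \<Longrightarrow> k \<circ> h \<in> module_hom S M L"
  by (rule module_homI) (auto simp: module_homD)

lemma alg_homI:
  "\<lbrakk>\<And>x. x \<in> carrier A \<Longrightarrow> h x \<in> carrier B;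
    \<And>x y. x \<in> carrier A \<Longrightarrow> y \<in> carrier A \<Longrightarrow> h (x \<oplus>\<^bsub>A\<^esub> y) = h x \<oplus>\<^bsub>B\<^esub> h y;
    \<And>x y. x \<in> carrier A \<Longrightarrow> y \<in> carrier A \<Longrightarrow> h (x \<otimes>\<^bsub>A\<^esub> y) = h x \<otimes>\<^bsub>B\<^esub> h y;
    h \<one>\<^bsub>A\<^esub> = \<one>\<^bsub>B\<^esub>;
    \<And>s x. s \<in> carrier R \<Longrightarrow> x \<in> carrier A \<Longrightarrow> h (s \<odot>\<^bsub>A\<^esub> x) = s \<odot>\<^bsub>B\<^esub> h x\<rbrakk> \<Longrightarrow> h \<in> alg_hom R A B"
  by (auto simp: alg_hom_def ring_hom_def)

lemma alg_homD:
  assumes "h \<in> alg_hom R A B"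
  shows "x \<in> carrier A \<Longrightarrow> h x \<in> carrier B"
    and "x \<in> carrier A \<Longrightarrow> y \<in> carrier A \<Longrightarrow> h (x \<oplus>\<^bsub>A\<^esub> y) = h x \<oplus>\<^bsub>B\<^esub> h y"
    and "x \<in> carrier A \<Longrightarrow> y \<in> carrier A \<Longrightarrow> h (x \<otimes>\<^bsub>A\<^esub> y) = h x \<otimes>\<^bsub>B\<^esub> h y"
    and "h \<one>\<^bsub>A\<^esub> = \<one>\<^bsub>B\<^esub>"
    and "s \<in> carrier R \<Longrightarrow> x \<in> carrier A \<Longrightarrow> h (s \<odot>\<^bsub>A\<^esub> x) = s \<odot>\<^bsub>B\<^esub> h x"
    and "h \<in> ring_hom A B"
  using assms by (auto simp: alg_hom_def ring_hom_def)

lemma alg_hom_module_hom: "h \<in> alg_hom R A B \<Longrightarrow> h \<in> module_hom R A B"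
  by (rule module_homI) (auto dest: alg_homD)

lemma alg_hom_id: "id \<in> alg_hom R A A"
  by (rule alg_homI) auto

lemma alg_hom_comp: "h \<in> alg_hom R A B \<Longrightarrow> k \<in> alg_hom R B D \<Longrightarrow> k \<circ> h \<in> alg_hom R A D"
  by (rule alg_homI) (auto simp: alg_homD)

lemma alg_hom_cong:
  assumes h: "h \<in> alg_hom R A B" and A: "algebra R A" and eq: "\<And>x. x \<in> carrier A \<Longrightarrow> k x = h x"
  shows "k \<in> alg_hom R A B"
proof -
  interpret A: algebra R A by fact
  have A': "cring A" "module R A" by (rule A.M_cring) (rule A.module)
  show ?thesis
    by (rule alg_homI) (simp_all add: eq alg_homD[OF h] cring.cring_simprules[OF A'(1)] module.smult_closed[OF A'(2)])
qed

lemma algebra_facts: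
  assumes "algebra R S" shows "cring S" "module R S" "cring R"
    "\<And>a x y. a \<in> carrier R \<Longrightarrow> x \<in> carrier S \<Longrightarrow> y \<in> carrier S \<Longrightarrow> (a \<odot>\<^bsub>S\<^esub> x) \<otimes>\<^bsub>S\<^esub> y = a \<odot>\<^bsub>S\<^esub> (x \<otimes>\<^bsub>S\<^esub> y)"
  using assms by (rule algebra.M_cring algebra.module algebra.R_cring algebra.smult_assoc2; assumption?)+

lemma alg_hom_zero: "h \<in> alg_hom R A B \<Longrightarrow> algebra R A \<Longrightarrow> algebra R B \<Longrightarrow> h \<zero>\<^bsub>A\<^esub> = \<zero>\<^bsub>B\<^esub>"
  by (rule module_hom_zero[OF alg_hom_module_hom algebra_facts(2) algebra_facts(2)])

section \<open>Tensor products\<close>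

text \<open>
  The tensor product \<open>M \<otimes>\<^sub>R S\<close> is accessed through three facts: it is generated by pure tensors
  (\<open>tensor_induct\<close>), pure tensors are bilinear, and every bilinear map factors through it
  (\<open>tensor_lift\<close>).
\<close>

locale base_change =
  fixes R :: "('r, 'x) ring_scheme" and M :: "('r, 'm) module" and S :: "('r, 's) module"
  assumes module_M: "module R M" and algebra_S: "algebra R S"
begin

sublocale M: module R M by (rule module_M)
sublocale S: cring S using algebra_S by (rule algebra.M_cring)
sublocale SM: module R S using algebra_S by (rule algebra.module)

lemma smult_mult: 
  "\<lbrakk>a \<in> carrier R; x \<in> carrier S; y \<in> carrier S\<rbrakk> \<Longrightarrow> x \<otimes>\<^bsub>S\<^esub> (a \<odot>\<^bsub>S\<^esub> y) = a \<odot>\<^bsub>S\<^esub> (x \<otimes>\<^bsub>S\<^esub> y)"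
  using algebra_facts(4)[OF algebra_S, of a y x] by (simp add: S.m_comm)

abbreviation "supported u \<equiv> set_mset u \<subseteq> carrier M \<times> carrier S"
abbreviation "T \<equiv> tensor R M S"
abbreviation "cls \<equiv> tensor_class R M S"
abbreviation "pure \<equiv> pure_tensor R M S"

lemma tensor_eq_supported: "tensor_eq R M S u v \<Longrightarrow> supported u \<and> supported v"
  by (induction rule: tensor_eq.induct) auto

lemma cls_eq: "tensor_eq R M S u v \<Longrightarrow> cls u = cls v"
  unfolding tensor_class_def by (blast intro: tensor_eq.sym tensor_eq.trans)

lemma cls_refl: "supported u \<Longrightarrow> u \<in> cls u"
  unfolding tensor_class_def by (simp add: tensor_eq.refl)

lemma cls_UN:
  assumes "supported u" "\<And>v. tensor_eq R M S u v \<Longrightarrow> F v = F u"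
  shows "(\<Union>v\<in>cls u. F v) = F u"
proof -
  have "\<And>v. v \<in> cls u \<Longrightarrow> F v = F u" using assms(2) by (auto simp: tensor_class_def)
  with cls_refl[OF assms(1)] show ?thesis by blast
qed

lemma carrierE:
  assumes "a \<in> carrier T" obtains u where "supported u" "a = cls u"
  using assms by (auto simp: tensor_def)

lemma cls_closed: "supported u \<Longrightarrow> cls u \<in> carrier T"
  by (auto simp: tensor_def)

lemma add_cls: "supported u \<Longrightarrow> supported v \<Longrightarrow> cls u \<oplus>\<^bsub>T\<^esub> cls v = cls (u + v)"
proof -
  assume u: "supported u" and v: "supported v"
  have 1: "(\<Union>v'\<in>cls v. cls (u' + v')) = cls (u' + v)" if "supported u'" for u'
    using v that by (rule_tac cls_UN) (simp_all add: cls_eq tensor_eq.sum tensor_eq.refl tensor_eq.sym)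
  have "(\<Union>u'\<in>cls u. \<Union>v'\<in>cls v. cls (u' + v')) = (\<Union>v'\<in>cls v. cls (u + v'))"
    using u v by (intro cls_UN)
      (simp_all add: 1 tensor_eq_supported cls_eq tensor_eq.sum tensor_eq.refl tensor_eq.sym)
  then show ?thesis using u by (simp add: tensor_def 1)
qed

lemma zero_cls: "\<zero>\<^bsub>T\<^esub> = cls {#}"
  by (simp add: tensor_def)

lemma tensor_induct [consumes 1, case_names zero pure add]:
  assumes "a \<in> carrier T" and zero: "P \<zero>\<^bsub>T\<^esub>"
    and pure: "\<And>x s. x \<in> carrier M \<Longrightarrow> s \<in> carrier S \<Longrightarrow> P (pure x s)"
    and add: "\<And>a b. a \<in> carrier T \<Longrightarrow> b \<in> carrier T \<Longrightarrow> P a \<Longrightarrow> P b \<Longrightarrow> P (a \<oplus>\<^bsub>T\<^esub> b)"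
  shows "P a"
proof -
  obtain u where u: "supported u" "a = cls u" using assms(1) by (rule carrierE)
  have "supported u \<Longrightarrow> P (cls u)" for u
  proof (induction u)
    case empty show ?case using zero by (simp add: zero_cls)
  next
    case (add p u)
    then have p: "fst p \<in> carrier M" "snd p \<in> carrier S" "p \<in> carrier M \<times> carrier S" and u: "supported u" by auto
    have "P (cls {#p#} \<oplus>\<^bsub>T\<^esub> cls u)"
      using add.IH u pure[OF p(1,2)] p(3) by (intro assms(4) cls_closed) simp_all
    then show ?case using add.prems by (subst (asm) add_cls) auto
  qed
  then show ?thesis using u by simp
qed

lemma pure_closed: "x \<in> carrier M \<Longrightarrow> s \<in> carrier S \<Longrightarrow> pure x s \<in> carrier T"
  by (auto intro: cls_closed)

lemma pure_add_left:
  "\<lbrakk>x \<in> carrier M; y \<in> carrier M; s \<in> carrier S\<rbrakk> \<Longrightarrow> pure (x \<oplus>\<^bsub>M\<^esub> y) s = pure x s \<oplus>\<^bsub>T\<^esub> pure y s"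
  using cls_eq[OF tensor_eq.add_left[of x M y s S R]] by (subst add_cls) (simp_all add: add_mset_commute)

lemma pure_add_right:
  "\<lbrakk>x \<in> carrier M; s \<in> carrier S; t \<in> carrier S\<rbrakk> \<Longrightarrow> pure x (s \<oplus>\<^bsub>S\<^esub> t) = pure x s \<oplus>\<^bsub>T\<^esub> pure x t"
  using cls_eq[OF tensor_eq.add_right[of x M s S t R]] by (subst add_cls) (simp_all add: add_mset_commute)

lemma pure_smult:
  "\<lbrakk>r \<in> carrier R; x \<in> carrier M; s \<in> carrier S\<rbrakk> \<Longrightarrow> pure (r \<odot>\<^bsub>M\<^esub> x) s = pure x (r \<odot>\<^bsub>S\<^esub> s)"
  by (intro cls_eq tensor_eq.scalar)

lemma pure_zero_left: "s \<in> carrier S \<Longrightarrow> pure \<zero>\<^bsub>M\<^esub> s = \<zero>\<^bsub>T\<^esub>"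
  unfolding zero_cls by (intro cls_eq tensor_eq.zero_left)

lemma pure_zero_right: "x \<in> carrier M \<Longrightarrow> pure x \<zero>\<^bsub>S\<^esub> = \<zero>\<^bsub>T\<^esub>"
  using pure_smult[of "\<zero>\<^bsub>R\<^esub>" x "\<zero>\<^bsub>S\<^esub>"] by (simp add: pure_zero_left)

lemma tensor_abelian_monoid: "abelian_monoid T"
proof (rule abelian_monoidI)
  fix x y z assume "x \<in> carrier T" "y \<in> carrier T" "z \<in> carrier T"
  then show "(x \<oplus>\<^bsub>T\<^esub> y) \<oplus>\<^bsub>T\<^esub> z = x \<oplus>\<^bsub>T\<^esub> (y \<oplus>\<^bsub>T\<^esub> z)"
    by (elim carrierE) (simp add: add_cls add_ac)
next
  fix x y assume "x \<in> carrier T" "y \<in> carrier T"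
  then show "x \<oplus>\<^bsub>T\<^esub> y \<in> carrier T" "x \<oplus>\<^bsub>T\<^esub> y = y \<oplus>\<^bsub>T\<^esub> x"
    by (elim carrierE; simp add: add_cls add_ac cls_closed)+
next
  show "\<zero>\<^bsub>T\<^esub> \<in> carrier T" by (simp add: zero_cls cls_closed)
  fix x assume "x \<in> carrier T"
  then show "\<zero>\<^bsub>T\<^esub> \<oplus>\<^bsub>T\<^esub> x = x"
    by (elim carrierE) (simp add: add_cls zero_cls)
qed

sublocale tensor: abelian_monoid T by (rule tensor_abelian_monoid)

end

locale base_change_map = base_change R M S + target: base_change R N U
  for R :: "('r, 'x) ring_scheme" and M :: "('r, 'm) module" and S :: "('r, 's) module"
    and N :: "('r, 'n) module" and U :: "('r, 'u) module" +
  fixes h :: "'m \<Rightarrow> 'n" and k :: "'s \<Rightarrow> 'u"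
  assumes h: "h \<in> module_hom R M N" and k: "k \<in> module_hom R S U"
begin

abbreviation "tm \<equiv> tensor_map R N U h k"

lemma tensor_eq_image:
  "tensor_eq R M S u v \<Longrightarrow> tensor_eq R N U (image_mset (map_prod h k) u) (image_mset (map_prod h k) v)"
proof (induction rule: tensor_eq.induct)
  case (refl u) then show ?case by (intro tensor_eq.refl) (auto simp: module_homD[OF h] module_homD[OF k])
next
  case (sym u v) show ?case by (rule tensor_eq.sym) (rule sym.IH)
next
  case (trans u v w) then show ?case by (blast intro: tensor_eq.trans)
next
  case (sum u v u' v') then show ?case by (auto intro: tensor_eq.sum)
next
  case (zero_left y)
  then show ?case
    by (simp add: module_hom_zero[OF h module_M target.module_M] tensor_eq.zero_left module_homD[OF k])
next
  case (add_left x x' y)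
  then show ?case using tensor_eq.add_left[of "h x" N "h x'" "k y" U R]
    by (simp add: module_homD[OF k] module_homD[OF h])
next
  case (add_right x y y')
  then show ?case using tensor_eq.add_right[of "h x" N "k y" U "k y'" R]
    by (simp add: module_homD[OF k] module_homD[OF h])
next
  case (scalar r x y)
  then show ?case using tensor_eq.scalar[of r R "h x" N "k y" U]
    by (simp add: module_homD[OF k] module_homD[OF h])
qed

lemma tm_cls: "supported u \<Longrightarrow> tm (cls u) = target.cls (image_mset (map_prod h k) u)"
  unfolding tensor_map_def
  by (rule cls_UN) (simp_all add: target.cls_eq tensor_eq_image tensor_eq.sym)

lemma image_supported: "supported u \<Longrightarrow> target.supported (image_mset (map_prod h k) u)"
  by (auto simp: module_homD[OF h] module_homD[OF k])

lemma tm_closed: "a \<in> carrier T \<Longrightarrow> tm a \<in> carrier target.T"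
  using image_supported by (elim carrierE) (simp add: tm_cls target.cls_closed)

lemma tm_pure: "x \<in> carrier M \<Longrightarrow> s \<in> carrier S \<Longrightarrow> tm (pure x s) = target.pure (h x) (k s)"
  by (subst tm_cls) auto

lemma tm_add: "a \<in> carrier T \<Longrightarrow> b \<in> carrier T \<Longrightarrow> tm (a \<oplus>\<^bsub>T\<^esub> b) = tm a \<oplus>\<^bsub>target.T\<^esub> tm b"
proof (elim carrierE)
  fix u v assume "supported u" "supported v" "a = cls u" "b = cls v"
  moreover from this(1,2) have "supported (u + v)" by auto
  ultimately show ?thesis
    using image_supported[of u] image_supported[of v] by (simp only: add_cls tm_cls target.add_cls image_mset_union)
qed

lemma tm_zero: "tm \<zero>\<^bsub>T\<^esub> = \<zero>\<^bsub>target.T\<^esub>"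
  by (simp add: zero_cls target.zero_cls tm_cls)

end

context base_change begin

lemma mult_module_hom: "s \<in> carrier S \<Longrightarrow> (\<lambda>t. s \<otimes>\<^bsub>S\<^esub> t) \<in> module_hom R S S"
  by (rule module_homI) (auto simp: S.r_distr smult_mult)

lemma smult_eq_map: "s \<odot>\<^bsub>T\<^esub> a = tensor_map R M S id (\<lambda>t. s \<otimes>\<^bsub>S\<^esub> t) a"
  by (simp add: tensor_def tensor_map_def map_prod_def id_def)

lemma base_change_smult: "s \<in> carrier S \<Longrightarrow> base_change_map R M S M S id (\<lambda>t. s \<otimes>\<^bsub>S\<^esub> t)"
  by unfold_locales (auto intro: mult_module_hom module_hom_id)

lemma smult_closed: "s \<in> carrier S \<Longrightarrow> a \<in> carrier T \<Longrightarrow> s \<odot>\<^bsub>T\<^esub> a \<in> carrier T"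
  unfolding smult_eq_map by (rule base_change_map.tm_closed[OF base_change_smult])

lemma smult_pure: "s \<in> carrier S \<Longrightarrow> x \<in> carrier M \<Longrightarrow> t \<in> carrier S \<Longrightarrow> s \<odot>\<^bsub>T\<^esub> pure x t = pure x (s \<otimes>\<^bsub>S\<^esub> t)"
  unfolding smult_eq_map by (subst base_change_map.tm_pure[OF base_change_smult]) auto

lemma smult_add: "s \<in> carrier S \<Longrightarrow> a \<in> carrier T \<Longrightarrow> b \<in> carrier T \<Longrightarrow>
    s \<odot>\<^bsub>T\<^esub> (a \<oplus>\<^bsub>T\<^esub> b) = s \<odot>\<^bsub>T\<^esub> a \<oplus>\<^bsub>T\<^esub> s \<odot>\<^bsub>T\<^esub> b"
  unfolding smult_eq_map by (rule base_change_map.tm_add[OF base_change_smult])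

lemma smult_zero: "s \<in> carrier S \<Longrightarrow> s \<odot>\<^bsub>T\<^esub> \<zero>\<^bsub>T\<^esub> = \<zero>\<^bsub>T\<^esub>"
  unfolding smult_eq_map by (rule base_change_map.tm_zero[OF base_change_smult])

lemma zero_smult: "a \<in> carrier T \<Longrightarrow> \<zero>\<^bsub>S\<^esub> \<odot>\<^bsub>T\<^esub> a = \<zero>\<^bsub>T\<^esub>"
  by (induction rule: tensor_induct) (auto simp: smult_zero smult_pure pure_zero_right smult_add)

lemma add_smult: "a \<in> carrier T \<Longrightarrow> s \<in> carrier S \<Longrightarrow> t \<in> carrier S \<Longrightarrow>
    (s \<oplus>\<^bsub>S\<^esub> t) \<odot>\<^bsub>T\<^esub> a = s \<odot>\<^bsub>T\<^esub> a \<oplus>\<^bsub>T\<^esub> t \<odot>\<^bsub>T\<^esub> a"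
  by (induction rule: tensor_induct)
    (simp_all add: smult_zero smult_pure pure_add_right smult_add S.l_distr tensor.a_ac smult_closed)

lemma one_smult: "a \<in> carrier T \<Longrightarrow> \<one>\<^bsub>S\<^esub> \<odot>\<^bsub>T\<^esub> a = a"
  by (induction rule: tensor_induct) (simp_all add: smult_zero smult_pure smult_add)

lemma mult_smult: "a \<in> carrier T \<Longrightarrow> s \<in> carrier S \<Longrightarrow> t \<in> carrier S \<Longrightarrow>
    (s \<otimes>\<^bsub>S\<^esub> t) \<odot>\<^bsub>T\<^esub> a = s \<odot>\<^bsub>T\<^esub> (t \<odot>\<^bsub>T\<^esub> a)"
  by (induction rule: tensor_induct)
    (simp_all add: smult_zero smult_pure smult_add S.m_assoc smult_closed)

lemma tensor_module: "module S T"
proof (rule moduleI)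
  show "cring S" by (rule S.is_cring)
  show "abelian_group T"
  proof (rule abelian_groupI)
    fix x assume x: "x \<in> carrier T"
    have "(\<ominus>\<^bsub>S\<^esub> \<one>\<^bsub>S\<^esub>) \<odot>\<^bsub>T\<^esub> x \<oplus>\<^bsub>T\<^esub> x = (\<ominus>\<^bsub>S\<^esub> \<one>\<^bsub>S\<^esub> \<oplus>\<^bsub>S\<^esub> \<one>\<^bsub>S\<^esub>) \<odot>\<^bsub>T\<^esub> x"
      using x by (subst add_smult) (simp_all add: one_smult)
    then show "\<exists>y\<in>carrier T. y \<oplus>\<^bsub>T\<^esub> x = \<zero>\<^bsub>T\<^esub>"
      using x by (intro bexI[of _ "(\<ominus>\<^bsub>S\<^esub> \<one>\<^bsub>S\<^esub>) \<odot>\<^bsub>T\<^esub> x"]) (simp_all add: S.l_neg zero_smult smult_closed)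
  qed (auto simp: tensor.a_ac)
qed (auto simp: smult_closed add_smult smult_add mult_smult one_smult)

sublocale tensor: module S T by (rule tensor_module)

end

text \<open>
  A tensor is represented by a multiset of pairs, and a bilinear map is extended to multisets by
  summing its values with multiplicity. This is the additivity of that extension.
\<close>

lemma (in abelian_monoid) finsum_mset_add:
  assumes "\<And>x. x \<in> insert p (set_mset u) \<Longrightarrow> f x \<in> carrier G"
  shows "(\<Oplus>x\<in>set_mset (add_mset p u). add_pow G (count (add_mset p u) x) (f x)) =
     f p \<oplus> (\<Oplus>x\<in>set_mset u. add_pow G (count u x) (f x))"
proof (cases "p \<in># u")
  case False
  then have "(\<Oplus>x\<in>set_mset (add_mset p u). add_pow G (count (add_mset p u) x) (f x)) =
     add_pow G (count (add_mset p u) p) (f p) \<oplus>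
      (\<Oplus>x\<in>set_mset u. add_pow G (count (add_mset p u) x) (f x))"
    using assms by (simp add: finsum_insert Pi_def)
  also have "(\<Oplus>x\<in>set_mset u. add_pow G (count (add_mset p u) x) (f x)) = (\<Oplus>x\<in>set_mset u. add_pow G (count u x) (f x))"
    using False assms by (intro finsum_cong') auto
  finally have eq: "(\<Oplus>x\<in>set_mset (add_mset p u). add_pow G (count (add_mset p u) x) (f x)) =
     add_pow G (count (add_mset p u) p) (f p) \<oplus> (\<Oplus>x\<in>set_mset u. add_pow G (count u x) (f x))" .
  have "count u p = 0" using False by (simp add: count_eq_zero_iff)
  then show ?thesis using assms by (subst eq) simp
next
  case True
  define B where "B = set_mset u - {p}"
  let ?A = B
  have B: "finite B" "p \<notin> B" "\<And>x. x \<in> B \<Longrightarrow> x \<in># u" "\<And>x. x \<in> B \<Longrightarrow> p \<noteq> x" by (auto simp: B_def)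
  have u: "set_mset (add_mset p u) = insert p ?A" "set_mset u = insert p ?A" using True by (auto simp: B_def)
  have "(\<Oplus>x\<in>insert p ?A. add_pow G (count (add_mset p u) x) (f x)) =
     add_pow G (Suc (count u p)) (f p) \<oplus> (\<Oplus>x\<in>?A. add_pow G (count (add_mset p u) x) (f x))"
    using assms B by (subst finsum_insert) (auto simp: Pi_def)
  also have "(\<Oplus>x\<in>?A. add_pow G (count (add_mset p u) x) (f x)) = (\<Oplus>x\<in>?A. add_pow G (count u x) (f x))"
    using assms B by (intro finsum_cong') auto
  finally have 1: "(\<Oplus>x\<in>insert p ?A. add_pow G (count (add_mset p u) x) (f x)) =
     add_pow G (Suc (count u p)) (f p) \<oplus> (\<Oplus>x\<in>?A. add_pow G (count u x) (f x))" .
  have 2: "(\<Oplus>x\<in>insert p ?A. add_pow G (count u x) (f x)) =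
     add_pow G (count u p) (f p) \<oplus> (\<Oplus>x\<in>?A. add_pow G (count u x) (f x))"
    using assms B by (subst finsum_insert) (auto simp: Pi_def)
  have [simp]: "f p \<in> carrier G" "(\<Oplus>x\<in>?A. add_pow G (count u x) (f x)) \<in> carrier G" using assms B by (auto intro!: finsum_closed)
  have "add_pow G (Suc i) y \<oplus> z = y \<oplus> (add_pow G i y \<oplus> z)" if "y \<in> carrier G" "z \<in> carrier G" for i y z
    using that by (simp add: add.nat_pow_Suc2 a_assoc del: add.nat_pow_Suc)
  then show ?thesis by (simp only: u 1 2) simp
qed

context base_change begin

lemma tensor_lift:
  assumes "abelian_monoid N"
    and cl: "\<And>x s. x \<in> carrier M \<Longrightarrow> s \<in> carrier S \<Longrightarrow> b x s \<in> carrier N"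
    and zero: "\<And>s. s \<in> carrier S \<Longrightarrow> b \<zero>\<^bsub>M\<^esub> s = \<zero>\<^bsub>N\<^esub>"
    and add1: "\<And>x y s. x \<in> carrier M \<Longrightarrow> y \<in> carrier M \<Longrightarrow> s \<in> carrier S \<Longrightarrow>
          b (x \<oplus>\<^bsub>M\<^esub> y) s = b x s \<oplus>\<^bsub>N\<^esub> b y s"
    and add2: "\<And>x s t. x \<in> carrier M \<Longrightarrow> s \<in> carrier S \<Longrightarrow> t \<in> carrier S \<Longrightarrow>
          b x (s \<oplus>\<^bsub>S\<^esub> t) = b x s \<oplus>\<^bsub>N\<^esub> b x t"
    and scal: "\<And>r x s. r \<in> carrier R \<Longrightarrow> x \<in> carrier M \<Longrightarrow> s \<in> carrier S \<Longrightarrow>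
          b (r \<odot>\<^bsub>M\<^esub> x) s = b x (r \<odot>\<^bsub>S\<^esub> s)"
  obtains f where "f \<in> carrier T \<rightarrow> carrier N"
    "\<And>x s. x \<in> carrier M \<Longrightarrow> s \<in> carrier S \<Longrightarrow> f (pure x s) = b x s"
    "\<And>a b. a \<in> carrier T \<Longrightarrow> b \<in> carrier T \<Longrightarrow> f (a \<oplus>\<^bsub>T\<^esub> b) = f a \<oplus>\<^bsub>N\<^esub> f b"
    "f \<zero>\<^bsub>T\<^esub> = \<zero>\<^bsub>N\<^esub>"
proof -
  interpret N: abelian_monoid N by fact
  define F where "F u = (\<Oplus>\<^bsub>N\<^esub>p\<in>set_mset u. add_pow N (count u p) (case p of (x, s) \<Rightarrow> b x s))" for u
  have F0: "F {#} = \<zero>\<^bsub>N\<^esub>" by (simp add: F_def)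
  have F1: "supported (add_mset p u) \<Longrightarrow> F (add_mset p u) = (case p of (x, s) \<Rightarrow> b x s) \<oplus>\<^bsub>N\<^esub> F u" for p u
    unfolding F_def by (rule N.finsum_mset_add) (auto intro: cl)
  have Fcl: "supported u \<Longrightarrow> F u \<in> carrier N" for u
    unfolding F_def by (intro N.finsum_closed) (auto intro!: N.add.nat_pow_closed cl)
  have Fadd: "supported u \<Longrightarrow> supported v \<Longrightarrow> F (u + v) = F u \<oplus>\<^bsub>N\<^esub> F v" for u v
  proof (induction u)
    case (add p u)
    then have [simp]: "(case p of (x, s) \<Rightarrow> b x s) \<in> carrier N" "F u \<in> carrier N" "F v \<in> carrier N"
      using Fcl[of u] Fcl[of v] by (auto intro!: cl)
    have "F (add_mset p (u + v)) = (case p of (x, s) \<Rightarrow> b x s) \<oplus>\<^bsub>N\<^esub> F (u + v)"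
      using add.prems by (intro F1) auto
    moreover have "F (add_mset p u) = (case p of (x, s) \<Rightarrow> b x s) \<oplus>\<^bsub>N\<^esub> F u"
      using add.prems by (intro F1) auto
    ultimately show ?case using add by (simp add: N.a_ac)
  qed (simp add: F0 Fcl)
  have Fs: "F {#(x, s)#} = b x s" if "x \<in> carrier M" "s \<in> carrier S" for x s
    using F1[of "(x, s)" "{#}"] that by (simp add: F0 cl)
  have F2: "F {#(x, s), (y, t)#} = b x s \<oplus>\<^bsub>N\<^esub> b y t"
    if "x \<in> carrier M" "s \<in> carrier S" "y \<in> carrier M" "t \<in> carrier S" for x s y t
    using F1[of "(x, s)" "{#(y, t)#}"] that by (simp add: Fs cl)
  have Feq: "tensor_eq R M S u v \<Longrightarrow> F u = F v" for u v
  proof (induction rule: tensor_eq.induct)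
    case (sum u v u' v')
    then show ?case by (simp add: Fadd tensor_eq_supported)
  qed (simp_all add: Fs F0 F2 zero add1 add2 scal)
  define f where "f a = (THE y. y \<in> F ` a)" for a
  have f: "f (cls u) = F u" if "supported u" for u
    unfolding f_def
  proof (rule the_equality)
    show "F u \<in> F ` cls u" using cls_refl[OF that] by blast
    fix y assume "y \<in> F ` cls u" then show "y = F u"
      by (auto simp: tensor_class_def Feq)
  qed
  show ?thesis
  proof (rule that[of f])
    show "f \<in> carrier T \<rightarrow> carrier N" by (auto elim!: carrierE simp: f Fcl)
    show "f (pure x s) = b x s" if "x \<in> carrier M" "s \<in> carrier S" for x s
      using that by (simp add: f Fs)
    show "f (a \<oplus>\<^bsub>T\<^esub> b) = f a \<oplus>\<^bsub>N\<^esub> f b" if "a \<in> carrier T" "b \<in> carrier T" for a b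
      using that by (elim carrierE) (simp add: f add_cls Fadd)
    show "f \<zero>\<^bsub>T\<^esub> = \<zero>\<^bsub>N\<^esub>" by (simp add: zero_cls f F0)
  qed
qed

end

section \<open>Base change of algebras\<close>

locale algebra_base_change =
  fixes R :: "('r, 'x) ring_scheme" and A :: "('r, 'm) module" and S :: "('r, 's) module"
  assumes algebra_A: "algebra R A" and algebra_S': "algebra R S"
begin

sublocale A: cring A using algebra_A by (rule algebra.M_cring)
sublocale base_change R A S
  by (rule base_change.intro) (rule algebra.module[OF algebra_A], rule algebra_S')

lemma A_mult_module_hom: "x \<in> carrier A \<Longrightarrow> (\<lambda>y. x \<otimes>\<^bsub>A\<^esub> y) \<in> module_hom R A A"
proof (rule module_homI)
  fix s y assume *: "s \<in> carrier R" "x \<in> carrier A" "y \<in> carrier A"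
  then show "x \<otimes>\<^bsub>A\<^esub> (s \<odot>\<^bsub>A\<^esub> y) = s \<odot>\<^bsub>A\<^esub> (x \<otimes>\<^bsub>A\<^esub> y)"
    using algebra_facts(4)[OF algebra_A, of s y x] by (simp add: A.m_comm)
qed (auto simp: A.r_distr)

lemma base_change_mult:
  "x \<in> carrier A \<Longrightarrow> s \<in> carrier S \<Longrightarrow> base_change_map R A S A S (\<lambda>y. x \<otimes>\<^bsub>A\<^esub> y) (\<lambda>t. s \<otimes>\<^bsub>S\<^esub> t)"
  by unfold_locales (auto intro: mult_module_hom A_mult_module_hom)

text \<open>
  The product of two representatives, written with images of multisets so that the compatibility of
  \<open>h \<otimes> k\<close> with the tensor congruence can be reused to show that multiplication is well defined.
\<close>

definition mmult :: "('m \<times> 's) multiset \<Rightarrow> ('m \<times> 's) multiset \<Rightarrow> ('m \<times> 's) multiset" where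
  "mmult u v = (\<Sum>p\<in>#u. image_mset (map_prod (\<lambda>y. fst p \<otimes>\<^bsub>A\<^esub> y) (\<lambda>t. snd p \<otimes>\<^bsub>S\<^esub> t)) v)"

lemma mmult_add_mset: "mmult (add_mset p u) v =
   image_mset (map_prod (\<lambda>y. fst p \<otimes>\<^bsub>A\<^esub> y) (\<lambda>t. snd p \<otimes>\<^bsub>S\<^esub> t)) v + mmult u v"
  by (simp add: mmult_def)

lemma mmult_empty: "mmult {#} v = {#}"
  by (simp add: mmult_def)

lemma mmult_add: "mmult (u + u') v = mmult u v + mmult u' v"
  by (simp add: mmult_def)

lemma mmult_add_right: "mmult u (v + v') = mmult u v + mmult u v'"
  by (induction u) (simp_all add: mmult_add_mset mmult_empty)

lemma mmult_empty_right: "mmult u {#} = {#}"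
  by (induction u) (simp_all add: mmult_add_mset mmult_empty)

lemma mmult_single: "mmult {#(x, s)#} {#(y, t)#} = {#(x \<otimes>\<^bsub>A\<^esub> y, s \<otimes>\<^bsub>S\<^esub> t)#}"
  by (simp add: mmult_def)

lemma mmult_commute: "supported u \<Longrightarrow> supported v \<Longrightarrow> mmult u v = mmult v u"
proof (induction u)
  case empty show ?case by (simp add: mmult_empty mmult_empty_right)
next
  case (add p u)
  have "mmult {#p#} v = mmult v {#p#}" using add.prems(2)
  proof (induction v)
    case empty show ?case by (simp add: mmult_empty mmult_empty_right)
  next
    case (add q v)
    have "mmult {#p#} {#q#} = mmult {#q#} {#p#}"
      using add.prems \<open>supported (add_mset p u)\<close>
      by (cases p; cases q) (auto simp: mmult_single A.m_comm S.m_comm)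
    then show ?case
      using add mmult_add_right[of "{#p#}" "{#q#}" v] mmult_add[of "{#q#}" v "{#p#}"] by simp
  qed
  then show ?case
    using add mmult_add_right[of v "{#p#}" u] mmult_add[of "{#p#}" u v] by simp
qed

lemma mmult_supported: "supported u \<Longrightarrow> supported v \<Longrightarrow> supported (mmult u v)"
proof (induction u)
  case (add p u)
  then have "\<forall>q\<in>#v. fst p \<otimes>\<^bsub>A\<^esub> fst q \<in> carrier A \<and> snd p \<otimes>\<^bsub>S\<^esub> snd q \<in> carrier S"
    by (auto intro!: A.m_closed S.m_closed)
  then show ?case using add by (auto simp: mmult_add_mset)
qed (simp add: mmult_empty)

lemma mmult_cong_right:
  "supported u \<Longrightarrow> tensor_eq R A S v v' \<Longrightarrow> tensor_eq R A S (mmult u v) (mmult u v')"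
proof (induction u)
  case empty show ?case by (simp add: mmult_empty tensor_eq.refl)
next
  case (add p u)
  then have "fst p \<in> carrier A" "snd p \<in> carrier S" by auto
  from base_change_map.tensor_eq_image[OF base_change_mult[OF this] add.prems(2)] add
  show ?case by (simp add: mmult_add_mset tensor_eq.sum)
qed

lemma mmult_cong_left:
  assumes u: "tensor_eq R A S u u'" and v: "supported v"
  shows "tensor_eq R A S (mmult u v) (mmult u' v)"
  using mmult_cong_right[OF v u] tensor_eq_supported[OF u] mmult_commute[OF _ v, of u] mmult_commute[OF _ v, of u']
  by simp

lemma mult_cls: "supported u \<Longrightarrow> supported v \<Longrightarrow> cls u \<otimes>\<^bsub>T\<^esub> cls v = cls (mmult u v)"
proof -
  assume u: "supported u" and v: "supported v"
  have eq: "cls (mmult u' v') = cls (mmult u v)"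
    if u': "tensor_eq R A S u u'" and v': "tensor_eq R A S v v'" for u' v'
  proof -
    have "cls (mmult u v) = cls (mmult u' v)" by (rule cls_eq) (rule mmult_cong_left[OF u' v])
    also have "\<dots> = cls (mmult u' v')"
      using tensor_eq_supported[OF u'] by (intro cls_eq mmult_cong_right v') simp
    finally show ?thesis by simp
  qed
  have 1: "(\<Union>v'\<in>cls v. cls (mmult u' v')) = cls (mmult u' v)" if "supported u'" for u'
    using v that by (rule_tac cls_UN) (simp_all add: cls_eq mmult_cong_right tensor_eq.sym)
  have "(\<Union>u'\<in>cls u. \<Union>v'\<in>cls v. cls (mmult u' v')) = (\<Union>v'\<in>cls v. cls (mmult u v'))"
  proof (rule cls_UN)
    fix u' assume u': "tensor_eq R A S u u'"
    show "(\<Union>v'\<in>cls v. cls (mmult u' v')) = (\<Union>v'\<in>cls v. cls (mmult u v'))"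
      using tensor_eq_supported[OF u'] eq[OF u' tensor_eq.refl[OF v]] by (simp add: 1)
  qed (rule u)
  moreover have "cls u \<otimes>\<^bsub>T\<^esub> cls v = (\<Union>u'\<in>cls u. \<Union>v'\<in>cls v. cls (mmult u' v'))"
    by (simp add: tensor_def mmult_def map_prod_def case_prod_unfold)
  ultimately show ?thesis using u by (simp add: 1)
qed

lemma one_cls: "\<one>\<^bsub>T\<^esub> = pure \<one>\<^bsub>A\<^esub> \<one>\<^bsub>S\<^esub>"
  by (simp add: tensor_def)

lemma mult_closed: "a \<in> carrier T \<Longrightarrow> b \<in> carrier T \<Longrightarrow> a \<otimes>\<^bsub>T\<^esub> b \<in> carrier T"
  by (elim carrierE) (simp add: mult_cls mmult_supported cls_closed)

lemma mult_comm: "a \<in> carrier T \<Longrightarrow> b \<in> carrier T \<Longrightarrow> a \<otimes>\<^bsub>T\<^esub> b = b \<otimes>\<^bsub>T\<^esub> a"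
proof (elim carrierE)
  fix u v assume "supported u" "supported v" "a = cls u" "b = cls v"
  then show ?thesis using mmult_commute[of u v] by (simp add: mult_cls)
qed

lemma mult_pure:
  "\<lbrakk>x \<in> carrier A; s \<in> carrier S; y \<in> carrier A; t \<in> carrier S\<rbrakk> \<Longrightarrow>
    pure x s \<otimes>\<^bsub>T\<^esub> pure y t = pure (x \<otimes>\<^bsub>A\<^esub> y) (s \<otimes>\<^bsub>S\<^esub> t)"
  by (subst mult_cls) (simp_all add: mmult_single)

lemma mult_add: "a \<in> carrier T \<Longrightarrow> b \<in> carrier T \<Longrightarrow> c \<in> carrier T \<Longrightarrow>
    (a \<oplus>\<^bsub>T\<^esub> b) \<otimes>\<^bsub>T\<^esub> c = a \<otimes>\<^bsub>T\<^esub> c \<oplus>\<^bsub>T\<^esub> b \<otimes>\<^bsub>T\<^esub> c"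
proof (elim carrierE)
  fix u v w assume "supported u" "supported v" "supported w" "a = cls u" "b = cls v" "c = cls w"
  then show ?thesis by (simp add: mult_cls add_cls mmult_supported mmult_add)
qed

lemma mult_add_right: "a \<in> carrier T \<Longrightarrow> b \<in> carrier T \<Longrightarrow> c \<in> carrier T \<Longrightarrow>
    c \<otimes>\<^bsub>T\<^esub> (a \<oplus>\<^bsub>T\<^esub> b) = c \<otimes>\<^bsub>T\<^esub> a \<oplus>\<^bsub>T\<^esub> c \<otimes>\<^bsub>T\<^esub> b"
  using mult_add[of a b c] by (simp add: mult_comm)

lemma mult_zero: "a \<in> carrier T \<Longrightarrow> a \<otimes>\<^bsub>T\<^esub> \<zero>\<^bsub>T\<^esub> = \<zero>\<^bsub>T\<^esub>"
  by (elim carrierE) (simp add: zero_cls mult_cls mmult_empty_right)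

lemma zero_mult: "a \<in> carrier T \<Longrightarrow> \<zero>\<^bsub>T\<^esub> \<otimes>\<^bsub>T\<^esub> a = \<zero>\<^bsub>T\<^esub>"
  using mult_zero[of a] by (simp add: mult_comm)

lemma mult_assoc:
  assumes a: "a \<in> carrier T" and b: "b \<in> carrier T" and c: "c \<in> carrier T"
  shows "(a \<otimes>\<^bsub>T\<^esub> b) \<otimes>\<^bsub>T\<^esub> c = a \<otimes>\<^bsub>T\<^esub> (b \<otimes>\<^bsub>T\<^esub> c)"
  using a
proof (induction rule: tensor_induct)
  case zero show ?case using b c by (simp add: zero_mult mult_closed)
next
  case (add a a') then show ?case using b c by (simp add: mult_add mult_closed)
next
  case (pure x s)
  note x = pure
  show ?case using b
  proof (induction rule: tensor_induct)
    case zero show ?case using x c by (simp add: zero_mult mult_zero pure_closed)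
  next
    case (add b b')
    then show ?case using x c by (simp add: mult_add mult_add_right mult_closed pure_closed)
  next
    case (pure y t)
    note y = pure
    show ?case using c
    proof (induction rule: tensor_induct)
      case zero show ?case using x y by (simp add: mult_zero pure_closed mult_closed)
    next
      case (add b b')
      then show ?case using x y by (simp add: mult_add_right mult_closed pure_closed)
    next
      case (pure z r)
      then show ?case using x y by (simp add: mult_pure A.m_assoc S.m_assoc)
    qed
  qed
qed

lemma one_mult: "a \<in> carrier T \<Longrightarrow> \<one>\<^bsub>T\<^esub> \<otimes>\<^bsub>T\<^esub> a = a"
  by (induction rule: tensor_induct)
    (simp_all add: one_cls mult_zero pure_closed mult_pure mult_add_right)

lemma smult_mult_assoc:
  assumes s: "s \<in> carrier S" and a: "a \<in> carrier T" and b: "b \<in> carrier T"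
  shows "(s \<odot>\<^bsub>T\<^esub> a) \<otimes>\<^bsub>T\<^esub> b = s \<odot>\<^bsub>T\<^esub> (a \<otimes>\<^bsub>T\<^esub> b)"
  using a
proof (induction rule: tensor_induct)
  case zero show ?case using s b by (simp add: zero_mult smult_zero)
next
  case (add a a') then show ?case using s b by (simp add: mult_add mult_closed smult_add smult_closed)
next
  case (pure x t)
  note x = pure
  show ?case using b
  proof (induction rule: tensor_induct)
    case zero show ?case using s x by (simp add: mult_zero smult_zero pure_closed smult_closed)
  next
    case (add b b')
    then show ?case using s x by (simp add: mult_add_right mult_closed smult_add smult_closed pure_closed)
  next
    case (pure y r)
    then show ?case using s x by (simp add: mult_pure smult_pure S.m_assoc)
  qed
qed

lemma tensor_algebra: "algebra S T"
proof (rule algebraI)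
  show "cring T"
  proof (rule cringI)
    show "abelian_group T" by (rule tensor.abelian_group_axioms)
    show "Group.comm_monoid T"
    proof (rule comm_monoidI)
      show "\<one>\<^bsub>T\<^esub> \<in> carrier T" by (simp add: one_cls pure_closed)
    qed (fact mult_closed mult_assoc one_mult mult_comm)+
  qed (rule mult_add)
qed (auto simp: S.is_cring smult_closed add_smult smult_add mult_smult one_smult smult_mult_assoc)

sublocale tensor: algebra S T by (rule tensor_algebra)
sublocale tensor: cring T by (rule tensor.M_cring)

end

section \<open>Functoriality\<close>

lemma base_change_mapI:
  "\<lbrakk>module R M; algebra R S; module R N; algebra R U; h \<in> module_hom R M N; k \<in> module_hom R S U\<rbrakk>
    \<Longrightarrow> base_change_map R M S N U h k"
  by (simp add: base_change_map_def base_change_map_axioms_def base_change_def)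

lemma tensor_map_comp:
  assumes 1: "base_change_map R M S N U h k" and 2: "base_change_map R N U L V h' k'"
    and a: "a \<in> carrier (tensor R M S)"
  shows "tensor_map R L V h' k' (tensor_map R N U h k a) = tensor_map R L V (h' \<circ> h) (k' \<circ> k) a"
proof -
  interpret A: base_change_map R M S N U h k by fact
  interpret B: base_change_map R N U L V h' k' by fact
  interpret AB: base_change_map R M S L V "h' \<circ> h" "k' \<circ> k"
    by (rule base_change_mapI)
      (fact A.module_M A.algebra_S B.target.module_M B.target.algebra_S
        module_hom_comp[OF A.h B.h] module_hom_comp[OF A.k B.k])+
  show ?thesis
    using a
    by (induction rule: A.tensor_induct)
      (simp_all add: A.tm_zero B.tm_zero AB.tm_zero[unfolded o_def] A.tm_pure B.tm_pure AB.tm_pure[unfolded o_def]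
        A.tm_add B.tm_add AB.tm_add[unfolded o_def] A.tm_closed module_homD[OF A.h] module_homD[OF A.k])
qed

lemma tensor_map_cong:
  assumes 1: "base_change_map R M S N U h k" and 2: "base_change_map R M S N U h' k'"
    and eq: "\<And>x. x \<in> carrier M \<Longrightarrow> h x = h' x" "\<And>s. s \<in> carrier S \<Longrightarrow> k s = k' s"
    and a: "a \<in> carrier (tensor R M S)"
  shows "tensor_map R N U h k a = tensor_map R N U h' k' a"
proof -
  interpret A: base_change_map R M S N U h k by fact
  interpret B: base_change_map R M S N U h' k' by fact
  show ?thesis
    using a
    by (induction rule: A.tensor_induct)
      (simp_all add: A.tm_zero B.tm_zero A.tm_pure B.tm_pure A.tm_add B.tm_add eq)
qed

lemma tensor_map_ident:
  assumes M: "module R M" and S: "algebra R S"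
    and eq: "\<And>x. x \<in> carrier M \<Longrightarrow> h x = x" "\<And>s. s \<in> carrier S \<Longrightarrow> k s = s"
    and a: "a \<in> carrier (tensor R M S)"
  shows "tensor_map R M S h k a = a"
proof -
  interpret M: module R M by fact
  interpret SM: module R S using S by (rule algebra_facts)
  interpret A: base_change_map R M S M S h k
    by (rule base_change_mapI) (auto intro!: module_homI simp: M S eq)
  show ?thesis
    using a by (induction rule: A.tensor_induct) (simp_all add: A.tm_zero A.tm_pure A.tm_add eq)
qed

lemma tensor_map_id:
  assumes "module R M" "algebra R S" "a \<in> carrier (tensor R M S)"
  shows "tensor_map R M S id id a = a"
  by (rule tensor_map_ident[OF assms(1,2) _ _ assms(3)]) simp_all

lemma (in base_change_map) tm_smult:
  assumes k': "\<And>s t. s \<in> carrier S \<Longrightarrow> t \<in> carrier S \<Longrightarrow> k (s \<otimes>\<^bsub>S\<^esub> t) = k' s \<otimes>\<^bsub>U\<^esub> k t"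
    and s: "s \<in> carrier S" "k' s \<in> carrier U" and a: "a \<in> carrier T"
  shows "tm (s \<odot>\<^bsub>T\<^esub> a) = k' s \<odot>\<^bsub>target.T\<^esub> tm a"
  using a
  by (induction rule: tensor_induct)
    (use s in \<open>simp_all add: smult_zero tm_zero target.smult_zero tm_pure tm_add smult_pure
      smult_closed smult_add tm_closed target.smult_add target.smult_pure
      k' module_homD[OF h] module_homD[OF k]\<close>)

locale algebra_base_change_map = algebra_base_change R A S + target: algebra_base_change R B U
  for R :: "('r, 'x) ring_scheme" and A :: "('r, 'm) module" and S :: "('r, 's) module"
    and B :: "('r, 'n) module" and U :: "('r, 'u) module" +
  fixes h :: "'m \<Rightarrow> 'n" and k :: "'s \<Rightarrow> 'u"
  assumes h_alg: "h \<in> alg_hom R A B" and k_alg: "k \<in> alg_hom R S U"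
begin

sublocale base_change_map R A S B U h k
  by (rule base_change_mapI)
    (fact module_M algebra_S target.module_M target.algebra_S
      alg_hom_module_hom[OF h_alg] alg_hom_module_hom[OF k_alg])+

lemma tm_mult:
  assumes a: "a \<in> carrier T" and b: "b \<in> carrier T"
  shows "tm (a \<otimes>\<^bsub>T\<^esub> b) = tm a \<otimes>\<^bsub>target.T\<^esub> tm b"
  using a
proof (induction rule: tensor_induct)
  case zero show ?case using b by (simp add: zero_mult target.zero_mult tm_zero tm_closed)
next
  case (add a a') then show ?case using b by (simp add: mult_add mult_closed tm_add target.mult_add tm_closed)
next
  case (pure x t)
  note x = pure
  show ?case using b
  proof (induction rule: tensor_induct)
    case zero show ?case using x by (simp add: mult_zero target.mult_zero pure_closed tm_zero tm_closed)
  next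
    case (add b b')
    then show ?case using x
      by (simp add: mult_add_right mult_closed tm_add target.mult_add_right tm_closed pure_closed)
  next
    case (pure y r)
    then show ?case using x
      by (simp add: mult_pure target.mult_pure tm_pure alg_homD[OF h_alg] alg_homD[OF k_alg])
  qed
qed

lemma tm_one: "tm \<one>\<^bsub>T\<^esub> = \<one>\<^bsub>target.T\<^esub>"
  by (simp add: one_cls target.one_cls tm_pure alg_homD[OF h_alg] alg_homD[OF k_alg])

lemma tm_ring_hom: "tm \<in> ring_hom T target.T"
  by (rule ring_hom_memI) (simp_all add: tm_closed tm_mult tm_add tm_one)

sublocale tm: ring_hom_cring T target.T tm
  by unfold_locales (rule tm_ring_hom)

lemma tm_alg_smult:
  "s \<in> carrier S \<Longrightarrow> a \<in> carrier T \<Longrightarrow> tm (s \<odot>\<^bsub>T\<^esub> a) = k s \<odot>\<^bsub>target.T\<^esub> tm a"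
  by (rule tm_smult[where k' = k]) (simp_all add: alg_homD[OF k_alg])

end

lemma algebra_base_change_mapI:
  "\<lbrakk>algebra R A; algebra R S; algebra R B; algebra R U; h \<in> alg_hom R A B; k \<in> alg_hom R S U\<rbrakk>
    \<Longrightarrow> algebra_base_change_map R A S B U h k"
  by (simp add: algebra_base_change_map_def algebra_base_change_map_axioms_def algebra_base_change_def)

section \<open>The ring as an algebra over itself\<close>

text \<open>
  The base ring as the initial algebra. Laws are evaluated at it to recover maps between the modules
  themselves, because \<open>M \<otimes>\<^sub>R R = M\<close>.
\<close>

definition self_algebra :: "('r, 'x) ring_scheme \<Rightarrow> ('r, 'r) module" where
  "self_algebra R = \<lparr>carrier = carrier R, monoid.mult = monoid.mult R, monoid.one = monoid.one R,
      ring.zero = ring.zero R, ring.add = ring.add R, module.smult = monoid.mult R\<rparr>"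

lemma self_algebra_simps [simp]:
  "carrier (self_algebra R) = carrier R" "x \<otimes>\<^bsub>self_algebra R\<^esub> y = x \<otimes>\<^bsub>R\<^esub> y"
  "\<one>\<^bsub>self_algebra R\<^esub> = \<one>\<^bsub>R\<^esub>" "\<zero>\<^bsub>self_algebra R\<^esub> = \<zero>\<^bsub>R\<^esub>"
  "x \<oplus>\<^bsub>self_algebra R\<^esub> y = x \<oplus>\<^bsub>R\<^esub> y" "x \<odot>\<^bsub>self_algebra R\<^esub> y = x \<otimes>\<^bsub>R\<^esub> y"
  by (simp_all add: self_algebra_def)

lemma self_algebra_algebra: assumes "cring R" shows "algebra R (self_algebra R)"
proof -
  interpret cring R by fact
  have "cring (self_algebra R)"
    by (rule cringI) (auto intro!: abelian_groupI comm_monoidI intro: l_neg exI[of _ "a_inv R _"]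
      simp: a_ac m_ac r_distr)
  then show ?thesis
    by (intro algebraI) (auto simp: l_distr r_distr m_assoc is_cring)
qed

lemma structure_map:
  assumes "algebra R S"
  shows "(\<lambda>r. r \<odot>\<^bsub>S\<^esub> \<one>\<^bsub>S\<^esub>) \<in> alg_hom R (self_algebra R) S"
proof -
  interpret S: cring S using assms by (rule algebra_facts)
  interpret module R S using assms by (rule algebra_facts)
  note sm = algebra_facts(4)[OF assms]
  show ?thesis
    by (rule alg_homI) (simp_all add: smult_l_distr smult_assoc1 sm)
qed

lemma tensor_self_unique:
  assumes M: "module R M" and a: "a \<in> carrier (tensor R M (self_algebra R))"
  shows "\<exists>!x. x \<in> carrier M \<and> a = pure_tensor R M (self_algebra R) x \<one>\<^bsub>R\<^esub>"
proof -
  interpret base_change R M "self_algebra R"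
    using M by (intro base_change.intro self_algebra_algebra) (simp_all add: module_def)
  have "\<exists>x\<in>carrier M. a = pure x \<one>\<^bsub>R\<^esub>" using a
  proof (induction rule: tensor_induct)
    case zero then show ?case by (intro bexI[of _ "\<zero>\<^bsub>M\<^esub>"]) (simp_all add: pure_zero_left)
  next
    case (pure x s)
    then show ?case 
      by (intro bexI[of _ "s \<odot>\<^bsub>M\<^esub> x"]) (simp_all add: pure_smult M.R.m_comm)
  next
    case (add a b)
    then obtain x y where "x \<in> carrier M" "y \<in> carrier M" "a = pure x \<one>\<^bsub>R\<^esub>" "b = pure y \<one>\<^bsub>R\<^esub>" by blast
    then show ?case by (intro bexI[of _ "x \<oplus>\<^bsub>M\<^esub> y"]) (simp_all add: pure_add_left)
  qed
  moreover obtain f where f: "\<And>x s. x \<in> carrier M \<Longrightarrow> s \<in> carrier R \<Longrightarrow> f (pure x s) = s \<odot>\<^bsub>M\<^esub> x"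
    by (rule tensor_lift[of M "\<lambda>x s. s \<odot>\<^bsub>M\<^esub> x"])
      (auto simp: M.smult_r_distr M.smult_l_distr M.smult_assoc1[symmetric] M.R.m_comm M.abelian_monoid_axioms)
  have "f (pure x \<one>\<^bsub>R\<^esub>) = x" if "x \<in> carrier M" for x
    using f[of x "\<one>\<^bsub>R\<^esub>"] that by simp
  ultimately show ?thesis by metis
qed

lemma (in base_change) linear_form_lift:
  assumes l: "l \<in> module_hom R M (self_algebra R)"
  obtains l' where "l' \<in> module_hom S T (self_algebra S)"
    "\<And>x s. x \<in> carrier M \<Longrightarrow> s \<in> carrier S \<Longrightarrow> l' (pure x s) = l x \<odot>\<^bsub>S\<^esub> s"
proof -
  note l' = module_homD[OF l, simplified]
  obtain f where f: "f \<in> carrier T \<rightarrow> carrier S"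
    "\<And>x s. x \<in> carrier M \<Longrightarrow> s \<in> carrier S \<Longrightarrow> f (pure x s) = l x \<odot>\<^bsub>S\<^esub> s"
    "\<And>a b. a \<in> carrier T \<Longrightarrow> b \<in> carrier T \<Longrightarrow> f (a \<oplus>\<^bsub>T\<^esub> b) = f a \<oplus>\<^bsub>S\<^esub> f b"
    "f \<zero>\<^bsub>T\<^esub> = \<zero>\<^bsub>S\<^esub>"
  proof (rule tensor_lift[of S "\<lambda>x s. l x \<odot>\<^bsub>S\<^esub> s"])
    have "l \<zero>\<^bsub>M\<^esub> = \<zero>\<^bsub>R\<^esub>"
      using module_hom_zero[OF l module_M algebra_facts(2)[OF self_algebra_algebra]] M.R.is_cring by simp
    then show "l \<zero>\<^bsub>M\<^esub> \<odot>\<^bsub>S\<^esub> s = \<zero>\<^bsub>S\<^esub>" if "s \<in> carrier S" for s using that by simp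
  qed (auto simp: l' SM.smult_l_distr SM.smult_r_distr SM.smult_assoc1[symmetric] M.R.m_comm S.abelian_monoid_axioms)
  show ?thesis
  proof (rule that)
    show "f \<in> module_hom S T (self_algebra S)"
    proof (rule module_homI)
      fix s x assume s: "s \<in> carrier S" and x: "x \<in> carrier T"
      from x show "f (s \<odot>\<^bsub>T\<^esub> x) = s \<odot>\<^bsub>self_algebra S\<^esub> f x"
        by (induction rule: tensor_induct)
          (use s f(1) in \<open>auto simp: smult_zero f(2-) smult_pure smult_mult l' smult_add smult_closed S.r_distr Pi_def\<close>)
    qed (use f in auto)
  qed (rule f(2))
qed

section \<open>Polynomial rings\<close>

lemma (in abelian_monoid) finsum_lessThan_Suc:
  "(\<And>i. i \<le> n \<Longrightarrow> f i \<in> carrier G) \<Longrightarrow> (\<Oplus>i\<in>{..<Suc n}. f i) = (\<Oplus>i\<in>{..<n}. f i) \<oplus> f n"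
  by (simp add: lessThan_Suc finsum_insert Pi_def a_comm finsum_closed)

text \<open>
  Three models of a polynomial ring occur: \<^term>\<open>UP S\<close>, a copy of it inside the universe, and the base
  change \<open>B \<otimes>\<^sub>R S[X]\<close>, which is a polynomial ring over \<open>B \<otimes>\<^sub>R S\<close> without consisting of polynomials.
  The locale axiomatizes what they share: constants \<open>c\<close>, a variable \<open>X\<close> and coefficient maps, subject
  to the rules by which multiplication by constants and by \<open>X\<close> acts on coefficients.
\<close>

locale poly_ring = Z: cring Z + Q: cring Q
  for Z :: "('z, 'x) ring_scheme" and Q :: "('q, 'y) ring_scheme" +
  fixes c :: "'z \<Rightarrow> 'q" and X :: 'q and coef :: "nat \<Rightarrow> 'q \<Rightarrow> 'z"
  assumes c_hom: "c \<in> ring_hom Z Q" and X_closed [simp]: "X \<in> carrier Q"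
    and coef_closed [simp]: "p \<in> carrier Q \<Longrightarrow> coef j p \<in> carrier Z"
    and coef_add: "p \<in> carrier Q \<Longrightarrow> q \<in> carrier Q \<Longrightarrow> coef j (p \<oplus>\<^bsub>Q\<^esub> q) = coef j p \<oplus>\<^bsub>Z\<^esub> coef j q"
    and coef_const_mult: "z \<in> carrier Z \<Longrightarrow> p \<in> carrier Q \<Longrightarrow> coef j (c z \<otimes>\<^bsub>Q\<^esub> p) = z \<otimes>\<^bsub>Z\<^esub> coef j p"
    and coef_one: "coef j \<one>\<^bsub>Q\<^esub> = (if j = 0 then \<one>\<^bsub>Z\<^esub> else \<zero>\<^bsub>Z\<^esub>)"
    and coef_X_mult: "p \<in> carrier Q \<Longrightarrow> coef j (X \<otimes>\<^bsub>Q\<^esub> p) = (case j of 0 \<Rightarrow> \<zero>\<^bsub>Z\<^esub> | Suc i \<Rightarrow> coef i p)"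
    and expand: "p \<in> carrier Q \<Longrightarrow>
      \<exists>N. \<forall>n\<ge>N. p = (\<Oplus>\<^bsub>Q\<^esub>j\<in>{..<n}. c (coef j p) \<otimes>\<^bsub>Q\<^esub> X [^]\<^bsub>Q\<^esub> j)"
begin

lemma c_closed [simp]: "z \<in> carrier Z \<Longrightarrow> c z \<in> carrier Q"
  using c_hom by (rule ring_hom_closed)

sublocale c: ring_hom_cring Z Q c
  by unfold_locales (rule c_hom)

lemma coef_zero: "coef j \<zero>\<^bsub>Q\<^esub> = \<zero>\<^bsub>Z\<^esub>"
  using coef_const_mult[of "\<zero>\<^bsub>Z\<^esub>" "\<one>\<^bsub>Q\<^esub>" j] by simp

lemma coef_X_pow: "coef j (X [^]\<^bsub>Q\<^esub> (i::nat)) = (if j = i then \<one>\<^bsub>Z\<^esub> else \<zero>\<^bsub>Z\<^esub>)"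
proof (induction i arbitrary: j)
  case 0 then show ?case by (simp add: coef_one)
next
  case (Suc i)
  then show ?case by (simp add: Q.m_comm[of _ X] coef_X_mult split: nat.split)
qed

lemma coef_term: "z \<in> carrier Z \<Longrightarrow> coef j (c z \<otimes>\<^bsub>Q\<^esub> X [^]\<^bsub>Q\<^esub> (i::nat)) = (if j = i then z else \<zero>\<^bsub>Z\<^esub>)"
  by (simp add: coef_const_mult coef_X_pow)

lemma coef_sum:
  assumes "\<And>i. z i \<in> carrier Z"
  shows "coef j (\<Oplus>\<^bsub>Q\<^esub>i\<in>{..<n}. c (z i) \<otimes>\<^bsub>Q\<^esub> X [^]\<^bsub>Q\<^esub> i) = (if j < n then z j else \<zero>\<^bsub>Z\<^esub>)"
proof (induction n)
  case 0 then show ?case by (simp add: coef_zero)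
next
  case (Suc n)
  have "(\<Oplus>\<^bsub>Q\<^esub>i\<in>{..<Suc n}. c (z i) \<otimes>\<^bsub>Q\<^esub> X [^]\<^bsub>Q\<^esub> i) = (\<Oplus>\<^bsub>Q\<^esub>i\<in>{..<n}. c (z i) \<otimes>\<^bsub>Q\<^esub> X [^]\<^bsub>Q\<^esub> i) \<oplus>\<^bsub>Q\<^esub> c (z n) \<otimes>\<^bsub>Q\<^esub> X [^]\<^bsub>Q\<^esub> n"
    using assms by (intro Q.finsum_lessThan_Suc) simp
  then show ?case
    using Suc assms by (simp add: coef_add coef_term Q.finsum_closed Pi_def less_Suc_eq)
qed

lemma coef_bound:
  assumes "p \<in> carrier Q" shows "\<exists>N. \<forall>j\<ge>N. coef j p = \<zero>\<^bsub>Z\<^esub>"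
proof -
  obtain N where "p = (\<Oplus>\<^bsub>Q\<^esub>j\<in>{..<N}. c (coef j p) \<otimes>\<^bsub>Q\<^esub> X [^]\<^bsub>Q\<^esub> j)"
    using expand[OF assms] by auto
  then have "coef j p = (if j < N then coef j p else \<zero>\<^bsub>Z\<^esub>)" for j
    using coef_sum[of "\<lambda>j. coef j p" j N] assms by simp
  then show ?thesis by (metis not_less)
qed

lemma coef_eqI:
  assumes p: "p \<in> carrier Q" and q: "q \<in> carrier Q" and eq: "\<And>j. coef j p = coef j q"
  shows "p = q"
proof -
  obtain M where M: "\<And>n. n \<ge> M \<Longrightarrow> p = (\<Oplus>\<^bsub>Q\<^esub>j\<in>{..<n}. c (coef j p) \<otimes>\<^bsub>Q\<^esub> X [^]\<^bsub>Q\<^esub> j)"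
    using expand[OF p] by auto
  obtain N where N: "\<And>n. n \<ge> N \<Longrightarrow> q = (\<Oplus>\<^bsub>Q\<^esub>j\<in>{..<n}. c (coef j q) \<otimes>\<^bsub>Q\<^esub> X [^]\<^bsub>Q\<^esub> j)"
    using expand[OF q] by auto
  show ?thesis using M[of "max M N"] N[of "max M N"] eq by simp
qed

text \<open>
  The product of \<open>X + z\<close> and \<open>w\<close> has \<open>w\<^sub>j + z w\<^sub>j\<^sub>+\<^sub>1\<close> as its coefficient of degree \<open>j + 1\<close>. If all of them
  vanish, so do all coefficients of \<open>w\<close>, by descending induction from a degree beyond which they vanish.
\<close>

lemma X_plus_const_cancel:
  assumes z: "z \<in> carrier Z" and w: "w \<in> carrier Q" and eq: "(X \<oplus>\<^bsub>Q\<^esub> c z) \<otimes>\<^bsub>Q\<^esub> w = \<zero>\<^bsub>Q\<^esub>"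
  shows "w = \<zero>\<^bsub>Q\<^esub>"
proof -
  have rec: "coef j w \<oplus>\<^bsub>Z\<^esub> z \<otimes>\<^bsub>Z\<^esub> coef (Suc j) w = \<zero>\<^bsub>Z\<^esub>" for j
  proof -
    have "\<zero>\<^bsub>Z\<^esub> = coef (Suc j) ((X \<oplus>\<^bsub>Q\<^esub> c z) \<otimes>\<^bsub>Q\<^esub> w)" by (simp add: eq coef_zero)
    then show ?thesis using z w by (simp add: Q.l_distr coef_add coef_X_mult coef_const_mult)
  qed
  obtain N where "\<forall>j\<ge>N. coef j w = \<zero>\<^bsub>Z\<^esub>" using coef_bound[OF w] by (elim exE)
  then have N: "\<And>j. j \<ge> N \<Longrightarrow> coef j w = \<zero>\<^bsub>Z\<^esub>" by simp
  have down: "coef (N - k) w = \<zero>\<^bsub>Z\<^esub>" for k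
  proof (induction k)
    case (Suc k)
    show ?case
    proof (cases "k < N")
      case True
      then have "Suc (N - Suc k) = N - k" by simp
      then have "coef (N - Suc k) w \<oplus>\<^bsub>Z\<^esub> z \<otimes>\<^bsub>Z\<^esub> \<zero>\<^bsub>Z\<^esub> = \<zero>\<^bsub>Z\<^esub>" using rec[of "N - Suc k"] Suc by (simp only:)
      then show ?thesis using w z by simp
    next
      case False then show ?thesis using Suc by simp
    qed
  qed (simp add: N)
  have "coef j w = \<zero>\<^bsub>Z\<^esub>" for j
    using N[of j] down[of "N - j"] by (cases "j \<ge> N") simp_all
  then show ?thesis using w by (intro coef_eqI) (simp_all add: coef_zero)
qed

lemma prod_X_plus_const_cancel:
  assumes fin: "finite I" and z: "\<And>i. i \<in> I \<Longrightarrow> z i \<in> carrier Z"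
    and v: "v \<in> carrier Q" and w: "w \<in> carrier Q"
    and eq: "(\<Otimes>\<^bsub>Q\<^esub>i\<in>I. X \<oplus>\<^bsub>Q\<^esub> c (z i)) \<otimes>\<^bsub>Q\<^esub> v = (\<Otimes>\<^bsub>Q\<^esub>i\<in>I. X \<oplus>\<^bsub>Q\<^esub> c (z i)) \<otimes>\<^bsub>Q\<^esub> w"
  shows "v = w"
proof -
  have "u = \<zero>\<^bsub>Q\<^esub>" if "(\<Otimes>\<^bsub>Q\<^esub>i\<in>I. X \<oplus>\<^bsub>Q\<^esub> c (z i)) \<otimes>\<^bsub>Q\<^esub> u = \<zero>\<^bsub>Q\<^esub>" "u \<in> carrier Q" for u
    using fin z that
  proof (induction I)
    case (insert i I)
    let ?Y = "X \<oplus>\<^bsub>Q\<^esub> c (z i)" and ?P = "\<Otimes>\<^bsub>Q\<^esub>i\<in>I. X \<oplus>\<^bsub>Q\<^esub> c (z i)"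
    have zi: "z i \<in> carrier Z" and zI: "\<And>j. j \<in> I \<Longrightarrow> z j \<in> carrier Z" using insert.prems by auto
    have Y: "?Y \<in> carrier Q" using zi by simp
    have P: "?P \<in> carrier Q" using zI by (auto intro!: Q.finprod_closed)
    have "(\<Otimes>\<^bsub>Q\<^esub>i\<in>insert i I. X \<oplus>\<^bsub>Q\<^esub> c (z i)) = ?Y \<otimes>\<^bsub>Q\<^esub> ?P"
      using insert.hyps zi zI by (intro Q.finprod_insert) auto
    then have "?Y \<otimes>\<^bsub>Q\<^esub> (?P \<otimes>\<^bsub>Q\<^esub> u) = \<zero>\<^bsub>Q\<^esub>"
      using insert.prems(2) Q.m_assoc[OF Y P insert.prems(3)] by (simp only:)
    then have "?P \<otimes>\<^bsub>Q\<^esub> u = \<zero>\<^bsub>Q\<^esub>"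
      by (rule X_plus_const_cancel[OF zi Q.m_closed[OF P insert.prems(3)]])
    then show ?case using insert.IH[OF zI] insert.prems(3) by blast
  qed simp
  note cancel = this
  let ?P = "\<Otimes>\<^bsub>Q\<^esub>i\<in>I. X \<oplus>\<^bsub>Q\<^esub> c (z i)"
  have P: "?P \<in> carrier Q" using z by (auto intro!: Q.finprod_closed)
  have "?P \<otimes>\<^bsub>Q\<^esub> (v \<ominus>\<^bsub>Q\<^esub> w) = ?P \<otimes>\<^bsub>Q\<^esub> v \<ominus>\<^bsub>Q\<^esub> ?P \<otimes>\<^bsub>Q\<^esub> w"
    using P v w by (simp only: a_minus_def Q.r_distr Q.r_minus Q.a_inv_closed)
  also have "\<dots> = \<zero>\<^bsub>Q\<^esub>"
    unfolding eq using P w by (simp only: a_minus_def Q.r_neg Q.m_closed)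
  finally have "v \<ominus>\<^bsub>Q\<^esub> w = \<zero>\<^bsub>Q\<^esub>" by (rule cancel) (use v w in simp)
  then have "(v \<ominus>\<^bsub>Q\<^esub> w) \<oplus>\<^bsub>Q\<^esub> w = w" using w by simp
  then show ?thesis using v w by (simp add: a_minus_def Q.a_assoc Q.l_neg)
qed

lemma ring_hom_eqI:
  assumes T: "cring T" and f: "f \<in> ring_hom Q T" and g: "g \<in> ring_hom Q T"
    and c: "\<And>z. z \<in> carrier Z \<Longrightarrow> f (c z) = g (c z)" and X: "f X = g X" and p: "p \<in> carrier Q"
  shows "f p = g p"
proof -
  interpret T: cring T by fact
  interpret f: ring_hom_cring Q T f by unfold_locales (rule f)
  interpret g: ring_hom_cring Q T g by unfold_locales (rule g)
  obtain N where N: "p = (\<Oplus>\<^bsub>Q\<^esub>j\<in>{..<N}. c (coef j p) \<otimes>\<^bsub>Q\<^esub> X [^]\<^bsub>Q\<^esub> j)"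
    using expand[OF p] by auto
  have "f (\<Oplus>\<^bsub>Q\<^esub>j\<in>{..<N}. c (coef j p) \<otimes>\<^bsub>Q\<^esub> X [^]\<^bsub>Q\<^esub> j) = g (\<Oplus>\<^bsub>Q\<^esub>j\<in>{..<N}. c (coef j p) \<otimes>\<^bsub>Q\<^esub> X [^]\<^bsub>Q\<^esub> j)"
    using p by (auto simp: f.hom_finsum g.hom_finsum Pi_def o_def c X intro!: T.finsum_cong')
  then show ?thesis using N by simp
qed

lemma UP_coeff: "p \<in> carrier (UP Z) \<Longrightarrow> up_ring.coeff (UP Z) p n = p n"
  by (simp add: UP_def)

lemma UP_iso:
  "\<exists>E. E \<in> ring_hom (UP Z) Q \<and> (\<forall>p\<in>carrier (UP Z). \<forall>j. coef j (E p) = p j) \<and>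
    (\<forall>w\<in>carrier Q. (\<lambda>j. coef j w) \<in> carrier (UP Z) \<and> E (\<lambda>j. coef j w) = w) \<and>
    (\<forall>z\<in>carrier Z. E (up_ring.monom (UP Z) z 0) = c z) \<and>
    E (up_ring.monom (UP Z) \<one>\<^bsub>Z\<^esub> 1) = X"
proof -
  interpret U: UP_pre_univ_prop Z Q c "UP Z" by unfold_locales simp
  let ?E = "eval Z Q c X"
  have E: "?E \<in> ring_hom (UP Z) Q" by (rule U.eval_ring_hom) simp
  have coefE: "coef j (?E p) = p j" if p: "p \<in> carrier (UP Z)" for p j
  proof -
    have pc: "p i \<in> carrier Z" for i using U.coeff_closed[OF p, of i] by (simp add: UP_coeff p)
    have "?E p = (\<Oplus>\<^bsub>Q\<^esub>i\<in>{..<Suc (deg Z p)}. c (p i) \<otimes>\<^bsub>Q\<^esub> X [^]\<^bsub>Q\<^esub> i)"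
      using p by (simp add: U.eval_on_carrier UP_coeff lessThan_Suc_atMost)
    then have "coef j (?E p) = (if j < Suc (deg Z p) then p j else \<zero>\<^bsub>Z\<^esub>)"
      by (simp add: coef_sum pc del: lessThan_Suc)
    then show ?thesis using U.deg_aboveD[of p j] p by (auto simp: UP_coeff)
  qed
  have up: "(\<lambda>j. coef j w) \<in> carrier (UP Z)" if w: "w \<in> carrier Q" for w
  proof -
    obtain N where "\<forall>j\<ge>N. coef j w = \<zero>\<^bsub>Z\<^esub>" using coef_bound[OF w] by (elim exE)
    then have "bound \<zero>\<^bsub>Z\<^esub> N (\<lambda>j. coef j w)" by (auto intro: bound.intro)
    then show ?thesis using w by (auto simp: UP_def intro!: mem_upI)
  qed
  have "?E (\<lambda>j. coef j w) = w" if "w \<in> carrier Q" for w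
    using up[OF that] coefE that ring_hom_closed[OF E] by (intro coef_eqI) auto
  then show ?thesis
    using E coefE up U.eval_const[OF X_closed] U.eval_monom1[OF X_closed]
    by (intro exI[of _ ?E]) simp
qed

lemma evaluation:
  assumes "cring T" and f: "f \<in> ring_hom Z T" and t: "t \<in> carrier T"
  shows "\<exists>g\<in>ring_hom Q T. (\<forall>z\<in>carrier Z. g (c z) = f z) \<and> g X = t"
proof -
  obtain E where E': "E \<in> ring_hom (UP Z) Q \<and> (\<forall>p\<in>carrier (UP Z). \<forall>j. coef j (E p) = p j) \<and>
    (\<forall>w\<in>carrier Q. (\<lambda>j. coef j w) \<in> carrier (UP Z) \<and> E (\<lambda>j. coef j w) = w) \<and>
    (\<forall>z\<in>carrier Z. E (up_ring.monom (UP Z) z 0) = c z) \<and>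
    E (up_ring.monom (UP Z) \<one>\<^bsub>Z\<^esub> 1) = X" using UP_iso by (elim exE)
  then have E: "E \<in> ring_hom (UP Z) Q"
    "\<And>p j. p \<in> carrier (UP Z) \<Longrightarrow> coef j (E p) = p j"
    "\<And>w. w \<in> carrier Q \<Longrightarrow> (\<lambda>j. coef j w) \<in> carrier (UP Z) \<and> E (\<lambda>j. coef j w) = w"
    "\<And>z. z \<in> carrier Z \<Longrightarrow> E (up_ring.monom (UP Z) z 0) = c z"
    "E (up_ring.monom (UP Z) \<one>\<^bsub>Z\<^esub> 1) = X" by blast+
  interpret T: cring T by fact
  interpret f: ring_hom_cring Z T f by unfold_locales (rule f)
  interpret U: UP_pre_univ_prop Z T f "UP Z" by unfold_locales simp
  let ?\<Psi> = "\<lambda>w j. coef j w"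
  have E\<Psi>: "\<And>p. p \<in> carrier (UP Z) \<Longrightarrow> ?\<Psi> (E p) = p" by (auto simp: E(2))
  interpret E: ring_hom_cring "UP Z" Q E by unfold_locales (rule E(1))
  have \<Psi>: "?\<Psi> \<in> ring_hom Q (UP Z)"
  proof (rule ring_hom_memI)
    fix v w assume v: "v \<in> carrier Q" and w: "w \<in> carrier Q"
    show "?\<Psi> v \<in> carrier (UP Z)" using E(3)[OF v] by simp
    have "?\<Psi> (v \<otimes>\<^bsub>Q\<^esub> w) = ?\<Psi> (E (?\<Psi> v) \<otimes>\<^bsub>Q\<^esub> E (?\<Psi> w))" using E(3)[OF v] E(3)[OF w] by simp
    also have "\<dots> = ?\<Psi> (E (?\<Psi> v \<otimes>\<^bsub>UP Z\<^esub> ?\<Psi> w))" using E(3)[OF v] E(3)[OF w] by simp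
    also have "\<dots> = ?\<Psi> v \<otimes>\<^bsub>UP Z\<^esub> ?\<Psi> w" using E(3)[OF v] E(3)[OF w] by (intro E\<Psi>) simp
    finally show "?\<Psi> (v \<otimes>\<^bsub>Q\<^esub> w) = ?\<Psi> v \<otimes>\<^bsub>UP Z\<^esub> ?\<Psi> w" .
    have "?\<Psi> (v \<oplus>\<^bsub>Q\<^esub> w) = ?\<Psi> (E (?\<Psi> v) \<oplus>\<^bsub>Q\<^esub> E (?\<Psi> w))" using E(3)[OF v] E(3)[OF w] by simp
    also have "\<dots> = ?\<Psi> (E (?\<Psi> v \<oplus>\<^bsub>UP Z\<^esub> ?\<Psi> w))" using E(3)[OF v] E(3)[OF w] by simp
    also have "\<dots> = ?\<Psi> v \<oplus>\<^bsub>UP Z\<^esub> ?\<Psi> w" using E(3)[OF v] E(3)[OF w] by (intro E\<Psi>) simp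
    finally show "?\<Psi> (v \<oplus>\<^bsub>Q\<^esub> w) = ?\<Psi> v \<oplus>\<^bsub>UP Z\<^esub> ?\<Psi> w" .
  next
    show "?\<Psi> \<one>\<^bsub>Q\<^esub> = \<one>\<^bsub>UP Z\<^esub>" using E\<Psi>[of "\<one>\<^bsub>UP Z\<^esub>"] by simp
  qed
  let ?e = "eval Z T f t"
  have e: "?e \<in> ring_hom (UP Z) T" by (rule U.eval_ring_hom) (rule t)
  show ?thesis
  proof (intro bexI[of _ "?e \<circ> ?\<Psi>"] conjI ballI)
    show "?e \<circ> ?\<Psi> \<in> ring_hom Q T" by (rule ring_hom_trans[OF \<Psi> e])
    show "(?e \<circ> ?\<Psi>) (c z) = f z" if "z \<in> carrier Z" for z
      using that E\<Psi>[of "up_ring.monom (UP Z) z 0"] by (simp add: E(4) U.eval_const t)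
    show "(?e \<circ> ?\<Psi>) X = t"
      using E\<Psi>[of "up_ring.monom (UP Z) \<one>\<^bsub>Z\<^esub> 1"] U.eval_monom1[OF t] by (simp add: E(5)[unfolded One_nat_def])
  qed
qed

end

text \<open>
  A homomorphism that acts by \<open>f\<close> on constants and by \<open>X \<mapsto> t X'\<close> on the variable multiplies the
  coefficient of degree \<open>j\<close> by \<open>t\<^sup>j\<close>. The case of a variable \<open>t\<close> detects homogeneity.
\<close>

lemma poly_ring_hom_coef:
  assumes 1: "poly_ring Z Q c X coef" and 2: "poly_ring Z' Q' c' X' coef'" and f: "f \<in> ring_hom Z Z'"
    and g: "g \<in> ring_hom Q Q'" and gc: "\<And>z. z \<in> carrier Z \<Longrightarrow> g (c z) = c' (f z)"
    and t: "t \<in> carrier Z'" and gX: "g X = c' t \<otimes>\<^bsub>Q'\<^esub> X'" and p: "p \<in> carrier Q"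
  shows "coef' j (g p) = f (coef j p) \<otimes>\<^bsub>Z'\<^esub> t [^]\<^bsub>Z'\<^esub> j"
proof -
  interpret A: poly_ring Z Q c X coef by fact
  interpret B: poly_ring Z' Q' c' X' coef' by fact
  interpret g: ring_hom_cring Q Q' g by unfold_locales (rule g)
  interpret f: ring_hom_cring Z Z' f by unfold_locales (rule f)
  obtain N where N: "\<forall>n\<ge>N. p = (\<Oplus>\<^bsub>Q\<^esub>j\<in>{..<n}. c (coef j p) \<otimes>\<^bsub>Q\<^esub> X [^]\<^bsub>Q\<^esub> j)"
    using A.expand[OF p] by (elim exE)
  let ?n = "max N (Suc j)"
  have "g p = g (\<Oplus>\<^bsub>Q\<^esub>j\<in>{..<?n}. c (coef j p) \<otimes>\<^bsub>Q\<^esub> X [^]\<^bsub>Q\<^esub> j)"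
    using N[rule_format, of ?n] by simp
  also have "\<dots> = (\<Oplus>\<^bsub>Q'\<^esub>j\<in>{..<?n}. g (c (coef j p) \<otimes>\<^bsub>Q\<^esub> X [^]\<^bsub>Q\<^esub> j))"
    using p by (subst g.hom_finsum) (auto simp: o_def)
  also have "\<dots> = (\<Oplus>\<^bsub>Q'\<^esub>j\<in>{..<?n}. c' (f (coef j p) \<otimes>\<^bsub>Z'\<^esub> t [^]\<^bsub>Z'\<^esub> j) \<otimes>\<^bsub>Q'\<^esub> X' [^]\<^bsub>Q'\<^esub> j)"
    using p t by (intro B.Q.finsum_cong') (auto simp: gc gX B.Q.nat_pow_distrib B.Q.m_assoc)
  finally have "coef' j (g p) = (if j < ?n then f (coef j p) \<otimes>\<^bsub>Z'\<^esub> t [^]\<^bsub>Z'\<^esub> j else \<zero>\<^bsub>Z'\<^esub>)"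
    using B.coef_sum[of "\<lambda>j. f (coef j p) \<otimes>\<^bsub>Z'\<^esub> t [^]\<^bsub>Z'\<^esub> j" j ?n] p t by simp
  moreover have "j < ?n" by simp
  ultimately show ?thesis by simp
qed

lemma poly_ring_map:
  assumes 1: "poly_ring Z Q c X coef" and 2: "poly_ring Z' Q' c' X' coef'" and f: "f \<in> ring_hom Z Z'"
  shows "\<exists>g\<in>ring_hom Q Q'. (\<forall>z\<in>carrier Z. g (c z) = c' (f z)) \<and> g X = X' \<and>
    (\<forall>p\<in>carrier Q. \<forall>j. coef' j (g p) = f (coef j p))"
proof -
  interpret A: poly_ring Z Q c X coef by fact
  interpret B: poly_ring Z' Q' c' X' coef' by fact
  have cf: "c' \<circ> f \<in> ring_hom Z Q'" by (rule ring_hom_trans[OF f B.c_hom])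
  obtain g where g: "g \<in> ring_hom Q Q'" "\<forall>z\<in>carrier Z. g (c z) = (c' \<circ> f) z" "g X = X'"
    using A.evaluation[OF B.Q.is_cring cf B.X_closed] by (elim bexE conjE)
  have "coef' j (g p) = f (coef j p)" if p: "p \<in> carrier Q" for p j
  proof -
    have "coef' j (g p) = f (coef j p) \<otimes>\<^bsub>Z'\<^esub> \<one>\<^bsub>Z'\<^esub> [^]\<^bsub>Z'\<^esub> j"
      using g by (intro poly_ring_hom_coef[OF 1 2 f g(1) _ _ _ p]) simp_all
    then show ?thesis using ring_hom_closed[OF f A.coef_closed[OF p]] by simp
  qed
  then show ?thesis using g by (intro bexI[of _ g]) simp_all
qed

section \<open>Polynomial algebras\<close>

locale polynomial_algebra = poly_ring S P c X coef
  for R :: "('r, 'x) ring_scheme" and S :: "('r, 's) module" and P :: "('r, 'p) module"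
    and c X coef +
  assumes alg_S: "algebra R S" and alg_P: "algebra R P" and c_alg: "c \<in> alg_hom R S P"
    and coef_hom: "coef j \<in> module_hom R P S"
begin

lemma alg_evaluation:
  assumes T: "algebra R T" and f: "f \<in> alg_hom R S T" and t: "t \<in> carrier T"
  shows "\<exists>g\<in>alg_hom R P T. (\<forall>z\<in>carrier S. g (c z) = f z) \<and> g X = t"
proof -
  obtain g where g: "g \<in> ring_hom P T" "\<forall>z\<in>carrier S. g (c z) = f z" "g X = t"
    using evaluation[OF algebra_facts(1)[OF T] alg_homD(6)[OF f] t] by blast
  interpret RP: module R P using alg_P by (rule algebra_facts)
  interpret RT: module R T using T by (rule algebra_facts)
  interpret RS: module R S using alg_S by (rule algebra_facts)
  interpret T: cring T using T by (rule algebra_facts)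
  have "g (r \<odot>\<^bsub>P\<^esub> p) = r \<odot>\<^bsub>T\<^esub> g p" if r: "r \<in> carrier R" and p: "p \<in> carrier P" for r p
  proof -
    have "r \<odot>\<^bsub>P\<^esub> p = (r \<odot>\<^bsub>P\<^esub> \<one>\<^bsub>P\<^esub>) \<otimes>\<^bsub>P\<^esub> p"
      using r p by (simp add: algebra_facts(4)[OF alg_P])
    also have "r \<odot>\<^bsub>P\<^esub> \<one>\<^bsub>P\<^esub> = c (r \<odot>\<^bsub>S\<^esub> \<one>\<^bsub>S\<^esub>)" using r by (simp add: alg_homD[OF c_alg])
    finally have "g (r \<odot>\<^bsub>P\<^esub> p) = f (r \<odot>\<^bsub>S\<^esub> \<one>\<^bsub>S\<^esub>) \<otimes>\<^bsub>T\<^esub> g p"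
      using r p by (simp add: ring_hom_mult[OF g(1)] g(2))
    also have "\<dots> = r \<odot>\<^bsub>T\<^esub> g p"
      using r ring_hom_closed[OF g(1) p] by (simp add: alg_homD[OF f] algebra_facts(4)[OF T])
    finally show ?thesis .
  qed
  then have "g \<in> alg_hom R P T" using g(1) by (simp add: alg_hom_def)
  then show ?thesis using g by blast
qed

text \<open>
  \<open>B \<otimes>\<^sub>R S[X] = (B \<otimes>\<^sub>R S)[X]\<close>. The coefficient maps are the base changes of those of \<open>S[X]\<close>, which are
  only linear over \<open>R\<close>, so each axiom is checked on pure tensors and extended additively.
\<close>

lemma base_change_poly_ring:
  assumes B: "algebra R B"
  shows "poly_ring (tensor R B S) (tensor R B P) (tensor_map R B P id c)
    (pure_tensor R B P \<one>\<^bsub>B\<^esub> X) (\<lambda>j. tensor_map R B S id (coef j))"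
proof -
  interpret c': algebra_base_change_map R B S B P id c
    by (rule algebra_base_change_mapI) (auto simp: B alg_S alg_P c_alg alg_hom_id)
  interpret co: base_change_map R B P B S id "coef j" for j
    by (rule base_change_mapI) (auto simp: B alg_S alg_P coef_hom module_hom_id algebra_facts(2)[OF B])
  let ?X = "pure_tensor R B P \<one>\<^bsub>B\<^esub> X"
  note coefs = co.tm_zero co.tm_add co.tm_closed co.tm_pure id_def[symmetric]
  have X: "?X \<in> carrier (tensor R B P)" by (simp add: c'.target.pure_closed)
  have Xpow: "?X [^]\<^bsub>tensor R B P\<^esub> (i::nat) = pure_tensor R B P \<one>\<^bsub>B\<^esub> (X [^]\<^bsub>P\<^esub> i)" for i
    by (induction i) (simp_all add: c'.target.one_cls c'.target.mult_pure)
  have pure_sum: "pure_tensor R B P b (\<Oplus>\<^bsub>P\<^esub>j\<in>{..<n}. f j) =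
      (\<Oplus>\<^bsub>tensor R B P\<^esub>j\<in>{..<n}. pure_tensor R B P b (f j))"
    if "b \<in> carrier B" "\<And>j. f j \<in> carrier P" for b f and n :: nat
    by (induction n) (simp_all add: that c'.target.pure_zero_right c'.target.pure_add_right Q.finsum_lessThan_Suc
        c'.target.tensor.finsum_lessThan_Suc Q.finsum_closed Pi_def c'.target.pure_closed del: lessThan_Suc)
  show ?thesis
  proof (intro poly_ring.intro poly_ring_axioms.intro c'.tensor.M_cring c'.target.tensor.M_cring)
    show "c'.tm \<in> ring_hom (tensor R B S) (tensor R B P)" by (rule c'.tm_ring_hom)
    show "?X \<in> carrier (tensor R B P)" by (rule X)
  next
    fix p q j assume p: "p \<in> carrier (tensor R B P)" and q: "q \<in> carrier (tensor R B P)"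
    show "co.tm j p \<in> carrier (tensor R B S)" using p by (rule co.tm_closed)
    show "co.tm j (p \<oplus>\<^bsub>tensor R B P\<^esub> q) = co.tm j p \<oplus>\<^bsub>tensor R B S\<^esub> co.tm j q"
      using p q by (rule co.tm_add)
  next
    fix z p j assume z: "z \<in> carrier (tensor R B S)" and p: "p \<in> carrier (tensor R B P)"
    show "co.tm j (c'.tm z \<otimes>\<^bsub>tensor R B P\<^esub> p) = z \<otimes>\<^bsub>tensor R B S\<^esub> co.tm j p"
      using z
    proof (induction rule: c'.tensor_induct)
      case zero then show ?case using p by (simp add: c'.tm_zero c'.target.zero_mult c'.zero_mult coefs)
    next
      case (add a a') then show ?case
        using p by (simp add: c'.tm_add c'.tm_closed c'.target.mult_add c'.mult_add coefs c'.target.mult_closed)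
    next
      case (pure b s)
      note bs = pure
      show ?case using p
      proof (induction rule: c'.target.tensor_induct)
        case zero then show ?case using bs by (simp add: c'.tm_pure c'.target.mult_zero c'.mult_zero coefs c'.pure_closed c'.target.pure_closed)
      next
        case (add a a') then show ?case
          using bs by (simp add: c'.tm_pure c'.target.mult_add_right c'.mult_add_right coefs c'.target.mult_closed c'.pure_closed c'.target.pure_closed)
      next
        case (pure y p) then show ?case
          using bs by (simp add: c'.tm_pure c'.target.mult_pure c'.mult_pure coefs coef_const_mult)
      qed
    qed
  next
    fix j show "co.tm j \<one>\<^bsub>tensor R B P\<^esub> = (if j = 0 then \<one>\<^bsub>tensor R B S\<^esub> else \<zero>\<^bsub>tensor R B S\<^esub>)"
      by (simp add: c'.target.one_cls coefs coef_one c'.one_cls c'.pure_zero_right)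
  next
    fix p j assume "p \<in> carrier (tensor R B P)"
    then show "co.tm j (?X \<otimes>\<^bsub>tensor R B P\<^esub> p) = (case j of 0 \<Rightarrow> \<zero>\<^bsub>tensor R B S\<^esub> | Suc i \<Rightarrow> co.tm i p)"
      by (induction rule: c'.target.tensor_induct)
        (auto simp: c'.target.mult_zero X coefs c'.target.mult_pure coef_X_mult c'.pure_zero_right
          c'.target.mult_add_right c'.target.mult_closed split: nat.splits)
  next
    fix p assume "p \<in> carrier (tensor R B P)"
    then show "\<exists>N. \<forall>n\<ge>N. p = (\<Oplus>\<^bsub>tensor R B P\<^esub>j\<in>{..<n}. c'.tm (co.tm j p) \<otimes>\<^bsub>tensor R B P\<^esub> ?X [^]\<^bsub>tensor R B P\<^esub> j)"
    proof (induction rule: c'.target.tensor_induct)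
      case zero
      then show ?case
        by (simp add: coefs c'.tm_zero c'.target.zero_mult Xpow c'.target.pure_closed)
    next
      case (add a b)
      then obtain M N where M: "\<And>n. n \<ge> M \<Longrightarrow> a = (\<Oplus>\<^bsub>tensor R B P\<^esub>j\<in>{..<n}. c'.tm (co.tm j a) \<otimes>\<^bsub>tensor R B P\<^esub> ?X [^]\<^bsub>tensor R B P\<^esub> j)"
        and N: "\<And>n. n \<ge> N \<Longrightarrow> b = (\<Oplus>\<^bsub>tensor R B P\<^esub>j\<in>{..<n}. c'.tm (co.tm j b) \<otimes>\<^bsub>tensor R B P\<^esub> ?X [^]\<^bsub>tensor R B P\<^esub> j)"
        by blast
      have "a \<oplus>\<^bsub>tensor R B P\<^esub> b = (\<Oplus>\<^bsub>tensor R B P\<^esub>j\<in>{..<n}. c'.tm (co.tm j (a \<oplus>\<^bsub>tensor R B P\<^esub> b)) \<otimes>\<^bsub>tensor R B P\<^esub> ?X [^]\<^bsub>tensor R B P\<^esub> j)"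
        if n: "n \<ge> max M N" for n
      proof -
        have "(\<Oplus>\<^bsub>tensor R B P\<^esub>j\<in>{..<n}. c'.tm (co.tm j (a \<oplus>\<^bsub>tensor R B P\<^esub> b)) \<otimes>\<^bsub>tensor R B P\<^esub> ?X [^]\<^bsub>tensor R B P\<^esub> j) =
          (\<Oplus>\<^bsub>tensor R B P\<^esub>j\<in>{..<n}. c'.tm (co.tm j a) \<otimes>\<^bsub>tensor R B P\<^esub> ?X [^]\<^bsub>tensor R B P\<^esub> j \<oplus>\<^bsub>tensor R B P\<^esub> c'.tm (co.tm j b) \<otimes>\<^bsub>tensor R B P\<^esub> ?X [^]\<^bsub>tensor R B P\<^esub> j)"
          using add(1,2) by (intro c'.target.tensor.finsum_cong')
            (auto simp: coefs c'.tm_add c'.tm_closed c'.target.mult_add Xpow c'.target.pure_closed intro!: c'.target.mult_closed)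
        also have "\<dots> = (\<Oplus>\<^bsub>tensor R B P\<^esub>j\<in>{..<n}. c'.tm (co.tm j a) \<otimes>\<^bsub>tensor R B P\<^esub> ?X [^]\<^bsub>tensor R B P\<^esub> j) \<oplus>\<^bsub>tensor R B P\<^esub>
            (\<Oplus>\<^bsub>tensor R B P\<^esub>j\<in>{..<n}. c'.tm (co.tm j b) \<otimes>\<^bsub>tensor R B P\<^esub> ?X [^]\<^bsub>tensor R B P\<^esub> j)"
          using add(1,2) by (intro c'.target.tensor.finsum_addf)
            (auto simp: coefs c'.tm_closed Xpow c'.target.pure_closed intro!: c'.target.mult_closed)
        finally show ?thesis using M[of n] N[of n] n by simp
      qed
      then show ?case by blast
    next
      case (pure b p)
      obtain N where N: "\<And>n. n \<ge> N \<Longrightarrow> p = (\<Oplus>\<^bsub>P\<^esub>j\<in>{..<n}. c (coef j p) \<otimes>\<^bsub>P\<^esub> X [^]\<^bsub>P\<^esub> j)"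
        using expand[OF pure(2)] by auto
      have "pure_tensor R B P b p = (\<Oplus>\<^bsub>tensor R B P\<^esub>j\<in>{..<n}. c'.tm (co.tm j (pure_tensor R B P b p)) \<otimes>\<^bsub>tensor R B P\<^esub> ?X [^]\<^bsub>tensor R B P\<^esub> j)"
        if "n \<ge> N" for n
      proof -
        have "pure_tensor R B P b p = pure_tensor R B P b (\<Oplus>\<^bsub>P\<^esub>j\<in>{..<n}. c (coef j p) \<otimes>\<^bsub>P\<^esub> X [^]\<^bsub>P\<^esub> j)"
          using N[OF that] by simp
        also have "\<dots> = (\<Oplus>\<^bsub>tensor R B P\<^esub>j\<in>{..<n}. pure_tensor R B P b (c (coef j p) \<otimes>\<^bsub>P\<^esub> X [^]\<^bsub>P\<^esub> j))"
          using pure by (intro pure_sum) auto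
        also have "\<dots> = (\<Oplus>\<^bsub>tensor R B P\<^esub>j\<in>{..<n}. c'.tm (co.tm j (pure_tensor R B P b p)) \<otimes>\<^bsub>tensor R B P\<^esub> ?X [^]\<^bsub>tensor R B P\<^esub> j)"
          using pure by (simp add: coefs c'.tm_pure Xpow c'.target.mult_pure)
        finally show ?thesis .
      qed
      then show ?case by blast
    qed
  qed
qed

end

section \<open>Polynomial algebras inside the universe\<close>

lemma poly_algebra_simps [simp]:
  "carrier (poly_algebra S) = carrier (UP S)" "x \<otimes>\<^bsub>poly_algebra S\<^esub> y = x \<otimes>\<^bsub>UP S\<^esub> y"
  "\<one>\<^bsub>poly_algebra S\<^esub> = \<one>\<^bsub>UP S\<^esub>" "\<zero>\<^bsub>poly_algebra S\<^esub> = \<zero>\<^bsub>UP S\<^esub>"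
  "x \<oplus>\<^bsub>poly_algebra S\<^esub> y = x \<oplus>\<^bsub>UP S\<^esub> y" "r \<odot>\<^bsub>poly_algebra S\<^esub> p = (\<lambda>i. r \<odot>\<^bsub>S\<^esub> p i)"
  by (simp_all add: poly_algebra_def)

lemma poly_algebra_polynomial:
  fixes S :: "('r, 's) module"
  assumes S: "algebra R S"
  shows "polynomial_algebra R S (poly_algebra S) (\<lambda>s. up_ring.monom (UP S) s 0)
    (up_ring.monom (UP S) \<one>\<^bsub>S\<^esub> 1) (\<lambda>j p. p j)"
proof -
  interpret S: cring S using S by (rule algebra_facts)
  interpret RS: module R S using S by (rule algebra_facts)
  interpret U: UP_cring S "UP S" by unfold_locales
  have co: "p \<in> carrier (UP S) \<Longrightarrow> up_ring.coeff (UP S) p n = p n" for p n by (simp add: UP_def)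
  have cl: "p \<in> carrier (UP S) \<Longrightarrow> p n \<in> carrier S" for p n using U.coeff_closed[of p n] by (simp add: co)
  have addj: "p \<in> carrier (UP S) \<Longrightarrow> q \<in> carrier (UP S) \<Longrightarrow> (p \<oplus>\<^bsub>UP S\<^esub> q) j = p j \<oplus>\<^bsub>S\<^esub> q j" for p q j
    using U.coeff_add[of p q j] by (simp add: co del: U.coeff_add)
  have smj: "z \<in> carrier S \<Longrightarrow> p \<in> carrier (UP S) \<Longrightarrow> (z \<odot>\<^bsub>UP S\<^esub> p) j = z \<otimes>\<^bsub>S\<^esub> p j" for z p j
    using U.coeff_smult[of z p j] by (simp add: co del: U.coeff_smult)
  have rsm: "r \<in> carrier R \<Longrightarrow> p \<in> carrier (UP S) \<Longrightarrow> (\<lambda>i. r \<odot>\<^bsub>S\<^esub> p i) = (r \<odot>\<^bsub>S\<^esub> \<one>\<^bsub>S\<^esub>) \<odot>\<^bsub>UP S\<^esub> p" for r p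
    by (rule ext) (simp add: smj algebra_facts(4)[OF S] cl)
  have rr: "r \<odot>\<^bsub>S\<^esub> \<one>\<^bsub>S\<^esub> \<in> carrier S" if "r \<in> carrier R" for r using that by simp
  have rm: "(a \<otimes>\<^bsub>R\<^esub> b) \<odot>\<^bsub>S\<^esub> \<one>\<^bsub>S\<^esub> = (a \<odot>\<^bsub>S\<^esub> \<one>\<^bsub>S\<^esub>) \<otimes>\<^bsub>S\<^esub> (b \<odot>\<^bsub>S\<^esub> \<one>\<^bsub>S\<^esub>)"
    if "a \<in> carrier R" "b \<in> carrier R" for a b
    using that by (simp add: algebra_facts(4)[OF S] RS.smult_assoc1)
  have one0: "\<one>\<^bsub>UP S\<^esub> j = (if j = 0 then \<one>\<^bsub>S\<^esub> else \<zero>\<^bsub>S\<^esub>)" for j by (simp add: UP_def)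
  have Pc: "cring (poly_algebra S)"
    by (rule cringI)
      (auto intro!: abelian_groupI comm_monoidI intro: U.P.l_neg exI[of _ "a_inv (UP S) _"]
        simp: U.P.a_ac U.P.m_ac U.P.r_distr)
  have alg: "algebra R (poly_algebra S)"
    by (rule algebraI) (simp_all add: RS.is_cring Pc rsm U.UP_smult_l_distr U.UP_smult_r_distr
        U.UP_smult_assoc1 RS.smult_l_distr rm U.UP_smult_assoc2)
  have ch: "(\<lambda>s. up_ring.monom (UP S) s 0) \<in> ring_hom S (poly_algebra S)"
    using U.const_ring_hom by (simp add: ring_hom_def)
  have mon: "up_ring.monom (UP S) s n = (\<lambda>i. if i = n then s else \<zero>\<^bsub>S\<^esub>)" if "s \<in> carrier S" for s n
    using that by (simp add: UP_def)
  have pow: "up_ring.monom (UP S) \<one>\<^bsub>S\<^esub> (Suc 0) [^]\<^bsub>poly_algebra S\<^esub> j = up_ring.monom (UP S) \<one>\<^bsub>S\<^esub> j" for j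
  proof (induction j)
    case (Suc j)
    then show ?case using U.monom_one_Suc[of j] U.monom_one_mult[of j 1] by simp
  qed simp
  interpret PA: cring "poly_algebra S" by (rule Pc)
  show ?thesis
  proof (intro polynomial_algebra.intro poly_ring.intro poly_ring_axioms.intro polynomial_algebra_axioms.intro
      S.is_cring Pc ch S alg)
    show "up_ring.monom (UP S) \<one>\<^bsub>S\<^esub> 1 \<in> carrier (poly_algebra S)" by simp
    show "(\<lambda>s. up_ring.monom (UP S) s 0) \<in> alg_hom R S (poly_algebra S)"
      using ch by (auto simp: alg_hom_def mon)
    show "(\<lambda>p. p j) \<in> module_hom R (poly_algebra S) S" for j
      by (rule module_homI) (auto simp: cl addj)
  next
    fix p q j assume p: "p \<in> carrier (poly_algebra S)"
    show "p j \<in> carrier S" using p by (simp add: cl)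
    show "(p \<oplus>\<^bsub>poly_algebra S\<^esub> q) j = p j \<oplus>\<^bsub>S\<^esub> q j" if "q \<in> carrier (poly_algebra S)"
      using p that by (simp add: addj)
    show "(up_ring.monom (UP S) z 0 \<otimes>\<^bsub>poly_algebra S\<^esub> p) j = z \<otimes>\<^bsub>S\<^esub> p j" if "z \<in> carrier S" for z
      using p that by (simp add: U.monom_mult_is_smult smj)
    show "(up_ring.monom (UP S) \<one>\<^bsub>S\<^esub> 1 \<otimes>\<^bsub>poly_algebra S\<^esub> p) j = (case j of 0 \<Rightarrow> \<zero>\<^bsub>S\<^esub> | Suc i \<Rightarrow> p i)"
    proof -
      have p': "p \<in> carrier (UP S)" using p by simp
      let ?X = "up_ring.monom (UP S) \<one>\<^bsub>S\<^esub> (Suc 0)"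
      have X: "?X \<in> carrier (UP S)" by simp
      have "(?X \<otimes>\<^bsub>UP S\<^esub> p) j = (\<Oplus>\<^bsub>S\<^esub>i\<in>{..j}. ?X i \<otimes>\<^bsub>S\<^esub> p (j - i))"
        using p' X by (simp add: UP_def)
      also have "\<dots> = (\<Oplus>\<^bsub>S\<^esub>i\<in>{..j}. if Suc 0 = i then p (j - 1) else \<zero>\<^bsub>S\<^esub>)"
        by (intro S.finsum_cong') (auto simp: mon cl p')
      also have "\<dots> = (case j of 0 \<Rightarrow> \<zero>\<^bsub>S\<^esub> | Suc i \<Rightarrow> p i)"
      proof (cases j)
        case (Suc i)
        have "(\<Oplus>\<^bsub>S\<^esub>i\<in>{..j}. if Suc 0 = i then p (j - 1) else \<zero>\<^bsub>S\<^esub>) = p (j - 1)"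
          using Suc cl[OF p'] by (intro S.finsum_singleton[of "Suc 0" "{..j}" "\<lambda>_. p (j - 1)"]) auto
        then show ?thesis using Suc by simp
      qed simp
      finally show ?thesis by simp
    qed
    show "\<exists>N. \<forall>n\<ge>N. p = (\<Oplus>\<^bsub>poly_algebra S\<^esub>j\<in>{..<n}. up_ring.monom (UP S) (p j) 0 \<otimes>\<^bsub>poly_algebra S\<^esub>
        up_ring.monom (UP S) \<one>\<^bsub>S\<^esub> 1 [^]\<^bsub>poly_algebra S\<^esub> j)"
    proof (intro exI allI impI)
      have p': "p \<in> carrier (UP S)" using p by simp
      fix n assume n: "n \<ge> Suc (deg S p)"
      have sumj: "(\<Oplus>\<^bsub>poly_algebra S\<^esub>j\<in>{..<n}. up_ring.monom (UP S) (p j) j) i = (if i < n then p i else \<zero>\<^bsub>S\<^esub>)" for n i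
      proof (induction n)
        case 0 then show ?case by (simp add: UP_def)
      next
        case (Suc n)
        have m: "\<And>j. up_ring.monom (UP S) (p j) j \<in> carrier (poly_algebra S)" using cl[OF p'] by simp
        have "(\<Oplus>\<^bsub>poly_algebra S\<^esub>j\<in>{..<n}. up_ring.monom (UP S) (p j) j) \<in> carrier (poly_algebra S)"
          using m by (intro PA.finsum_closed) auto
        then show ?case using Suc m cl[OF p']
          by (subst PA.finsum_lessThan_Suc) (auto simp: addj mon less_Suc_eq)
      qed
      have "(\<Oplus>\<^bsub>poly_algebra S\<^esub>j\<in>{..<n}. up_ring.monom (UP S) (p j) 0 \<otimes>\<^bsub>poly_algebra S\<^esub>
        up_ring.monom (UP S) \<one>\<^bsub>S\<^esub> 1 [^]\<^bsub>poly_algebra S\<^esub> j) = (\<Oplus>\<^bsub>poly_algebra S\<^esub>j\<in>{..<n}. up_ring.monom (UP S) (p j) j)"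
      proof (intro PA.finsum_cong' refl)
        fix j
        show "up_ring.monom (UP S) (p j) 0 \<otimes>\<^bsub>poly_algebra S\<^esub> up_ring.monom (UP S) \<one>\<^bsub>S\<^esub> 1 [^]\<^bsub>poly_algebra S\<^esub> j = up_ring.monom (UP S) (p j) j"
          using cl[OF p', of j] U.monom_mult[of "p j" "\<one>\<^bsub>S\<^esub>" 0 j] by (simp add: pow)
      qed (use cl[OF p'] in auto)
      also have "\<dots> = p"
      proof
        fix i
        have "p i = \<zero>\<^bsub>S\<^esub>" if "\<not> i < n" using U.deg_aboveD[of p i] p' n that by (simp add: co)
        then show "(\<Oplus>\<^bsub>poly_algebra S\<^esub>j\<in>{..<n}. up_ring.monom (UP S) (p j) j) i = p i"
          by (simp add: sumj)
      qed
      finally show "p = (\<Oplus>\<^bsub>poly_algebra S\<^esub>j\<in>{..<n}. up_ring.monom (UP S) (p j) 0 \<otimes>\<^bsub>poly_algebra S\<^esub>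
        up_ring.monom (UP S) \<one>\<^bsub>S\<^esub> 1 [^]\<^bsub>poly_algebra S\<^esub> j)" by simp
    qed
  next
    show "\<one>\<^bsub>poly_algebra S\<^esub> j = (if j = 0 then \<one>\<^bsub>S\<^esub> else \<zero>\<^bsub>S\<^esub>)" for j by (simp add: one0)
  qed
qed

text \<open>
  Laws and divisibility conditions are only tested on algebras carried by the type \<open>'u\<close>, whereas the
  proof needs them on \<open>S[X]\<close>, whose elements are functions. Since \<open>'u\<close> is infinite, the finitely
  supported sequences in \<open>'u\<close> inject into \<open>'u\<close>, and the algebra structure is moved along such an
  injection.
\<close>

definition transport_algebra :: "('p \<Rightarrow> 'q) \<Rightarrow> ('r, 'p) module \<Rightarrow> ('r, 'q) module" where
  "transport_algebra f P = (let g = inv_into (carrier P) f in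
     \<lparr>carrier = f ` carrier P, monoid.mult = (\<lambda>x y. f (g x \<otimes>\<^bsub>P\<^esub> g y)), monoid.one = f \<one>\<^bsub>P\<^esub>,
      ring.zero = f \<zero>\<^bsub>P\<^esub>, ring.add = (\<lambda>x y. f (g x \<oplus>\<^bsub>P\<^esub> g y)), module.smult = (\<lambda>r x. f (r \<odot>\<^bsub>P\<^esub> g x))\<rparr>)"

lemma transport_algebra:
  fixes P :: "('r, 'p) module"
  assumes P: "algebra R P" and f: "inj_on f (carrier P)"
  shows "algebra R (transport_algebra f P)" "f \<in> alg_hom R P (transport_algebra f P)"
    "inv_into (carrier P) f \<in> alg_hom R (transport_algebra f P) P"
    "carrier (transport_algebra f P) = f ` carrier P"
proof -
  interpret P: cring P using P by (rule algebra_facts)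
  interpret RP: module R P using P by (rule algebra_facts)
  let ?T = "transport_algebra f P"
  have simps: "carrier ?T = f ` carrier P" "\<one>\<^bsub>?T\<^esub> = f \<one>\<^bsub>P\<^esub>" "\<zero>\<^bsub>?T\<^esub> = f \<zero>\<^bsub>P\<^esub>"
    "\<And>x y. x \<in> carrier P \<Longrightarrow> y \<in> carrier P \<Longrightarrow> f x \<otimes>\<^bsub>?T\<^esub> f y = f (x \<otimes>\<^bsub>P\<^esub> y)"
    "\<And>x y. x \<in> carrier P \<Longrightarrow> y \<in> carrier P \<Longrightarrow> f x \<oplus>\<^bsub>?T\<^esub> f y = f (x \<oplus>\<^bsub>P\<^esub> y)"
    "\<And>r x. x \<in> carrier P \<Longrightarrow> r \<odot>\<^bsub>?T\<^esub> f x = f (r \<odot>\<^bsub>P\<^esub> x)"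
    "\<And>x. x \<in> carrier P \<Longrightarrow> inv_into (carrier P) f (f x) = x"
    using f by (simp_all add: transport_algebra_def Let_def)
  have neg: "\<exists>y\<in>carrier P. f (x \<oplus>\<^bsub>P\<^esub> y) = f \<zero>\<^bsub>P\<^esub>" if "x \<in> carrier P" for x
    using that by (intro bexI[of _ "\<ominus>\<^bsub>P\<^esub> x"]) (simp_all add: P.r_neg)
  have "cring ?T"
    by (rule cringI) (auto intro!: abelian_groupI comm_monoidI simp: simps P.a_ac P.m_ac P.r_distr neg)
  then show "algebra R ?T"
    by (intro algebraI) (auto simp: RP.is_cring simps RP.smult_l_distr RP.smult_r_distr RP.smult_assoc1
        algebra_facts(4)[OF P])
  show "f \<in> alg_hom R P ?T" by (rule alg_homI) (auto simp: simps)
  show "inv_into (carrier P) f \<in> alg_hom R ?T P" by (rule alg_homI) (auto simp: simps)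
  show "carrier ?T = f ` carrier P" by (rule simps)
qed

text \<open>
  A polynomial is determined by the list of its coefficients up to a degree bound, and an infinite
  type is equinumerous with the type of its lists.
\<close>

lemma ex_inj_on_polynomials:
  fixes S :: "('u, 'x) ring_scheme"
  assumes "infinite (UNIV :: 'u set)"
  shows "\<exists>f :: (nat \<Rightarrow> 'u) \<Rightarrow> 'u. inj_on f (carrier (UP S))"
proof -
  obtain e :: "'u list \<Rightarrow> 'u" where e: "bij_betw e (lists UNIV) UNIV"
    using lists_infinite_bij_betw[OF assms] by (auto dest: bij_betw_inv)
  then have e: "inj e" by (simp add: bij_betw_def lists_UNIV)
  define N where "N p = (SOME n. bound \<zero>\<^bsub>S\<^esub> n p)" for p :: "nat \<Rightarrow> 'u"
  have N: "bound \<zero>\<^bsub>S\<^esub> (N p) p" if "p \<in> carrier (UP S)" for p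
    unfolding N_def using that by (intro someI_ex[of "\<lambda>n. bound \<zero>\<^bsub>S\<^esub> n p"]) (auto simp: UP_def up_def)
  have "inj_on (\<lambda>p. map p [0..<Suc (N p)]) (carrier (UP S))"
  proof (rule inj_onI)
    fix p q assume p: "p \<in> carrier (UP S)" and q: "q \<in> carrier (UP S)"
      and eq: "map p [0..<Suc (N p)] = map q [0..<Suc (N q)]"
    from arg_cong[OF eq, of length] have Neq: "N p = N q" by simp
    show "p = q"
    proof
      fix i
      show "p i = q i"
      proof (cases "i \<le> N p")
        case True
        then show ?thesis using arg_cong[OF eq, of "\<lambda>l. l ! i"] Neq by (simp del: upt_Suc)
      next
        case False
        then show ?thesis using N[OF p] N[OF q] Neq by (simp add: bound_def)
      qed
    qed
  qed
  from comp_inj_on[OF this inj_on_subset[OF e subset_UNIV]] show ?thesis by blast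
qed

definition universe_code :: "('u, 'x) ring_scheme \<Rightarrow> (nat \<Rightarrow> 'u) \<Rightarrow> 'u" where
  "universe_code S = (SOME f. inj_on f (carrier (UP S)))"

definition poly_u :: "('u, 'u) module \<Rightarrow> ('u, 'u) module" where
  "poly_u S = transport_algebra (universe_code S) (poly_algebra S)"

definition poly_u_const :: "('u, 'u) module \<Rightarrow> 'u \<Rightarrow> 'u" where
  "poly_u_const S s = universe_code S (up_ring.monom (UP S) s 0)"

definition poly_u_var :: "('u, 'u) module \<Rightarrow> 'u" where
  "poly_u_var S = universe_code S (up_ring.monom (UP S) \<one>\<^bsub>S\<^esub> 1)"

definition poly_u_coef :: "('u, 'u) module \<Rightarrow> nat \<Rightarrow> 'u \<Rightarrow> 'u" where
  "poly_u_coef S j p = inv_into (carrier (UP S)) (universe_code S) p j"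

lemma universe_code_inj:
  "infinite (UNIV :: 'u set) \<Longrightarrow> inj_on (universe_code (S :: ('u, 'x) ring_scheme)) (carrier (UP S))"
  unfolding universe_code_def
  by (rule someI_ex[of "\<lambda>f. inj_on f (carrier (UP S))"]) (rule ex_inj_on_polynomials)

lemma universe_code_alg_hom:
  fixes S :: "('u, 'u) module"
  assumes inf: "infinite (UNIV :: 'u set)" and S: "algebra R S"
  shows "universe_code S \<in> alg_hom R (poly_algebra S) (poly_u S)"
  using transport_algebra(2)[OF polynomial_algebra.alg_P[OF poly_algebra_polynomial[OF S]]]
    universe_code_inj[OF inf, of S] by (simp add: poly_u_def)

lemma poly_u_polynomial:
  fixes S :: "('u, 'u) module"
  assumes inf: "infinite (UNIV :: 'u set)" and S: "algebra R S"
  shows "polynomial_algebra R S (poly_u S) (poly_u_const S) (poly_u_var S) (poly_u_coef S)"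
proof -
  interpret P: polynomial_algebra R S "poly_algebra S" "\<lambda>s. up_ring.monom (UP S) s 0"
    "up_ring.monom (UP S) \<one>\<^bsub>S\<^esub> 1" "\<lambda>j p. p j"
    using S by (rule poly_algebra_polynomial)
  let ?f = "universe_code S"
  let ?g = "inv_into (carrier (UP S)) ?f"
  have inj: "inj_on ?f (carrier (UP S))" by (rule universe_code_inj) (rule inf)
  note tr = transport_algebra[OF P.alg_P, unfolded poly_algebra_simps, OF inj, folded poly_u_def]
  interpret Pu: cring "poly_u S" using tr(1) by (rule algebra_facts)
  have f: "?f \<in> ring_hom (poly_algebra S) (poly_u S)" using tr(2) by (rule alg_homD)
  have g: "?g \<in> ring_hom (poly_u S) (poly_algebra S)" using tr(3) by (rule alg_homD)
  interpret f: ring_hom_cring "poly_algebra S" "poly_u S" ?f by unfold_locales (rule f)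
  interpret g: ring_hom_cring "poly_u S" "poly_algebra S" ?g by unfold_locales (rule g)
  have gf: "?g (?f p) = p" if "p \<in> carrier (UP S)" for p using that inj by simp
  have fg: "?f (?g p) = p" if "p \<in> carrier (poly_u S)" for p using that tr(4) by (simp add: f_inv_into_f)
  have cc: "\<And>s. s \<in> carrier S \<Longrightarrow> up_ring.monom (UP S) s 0 \<in> carrier (UP S)" using P.c_closed by simp
  have XX: "up_ring.monom (UP S) \<one>\<^bsub>S\<^esub> (Suc 0) \<in> carrier (UP S)" using P.X_closed by simp
  have gcl: "\<And>p. p \<in> carrier (poly_u S) \<Longrightarrow> ?g p \<in> carrier (UP S)" using g.hom_closed by simp
  have hom: "?f \<circ> (\<lambda>s. up_ring.monom (UP S) s 0) \<in> alg_hom R S (poly_u S)"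
    by (rule alg_hom_comp[OF P.c_alg tr(2)])
  have hom': "poly_u_const S \<in> alg_hom R S (poly_u S)"
    using hom by (simp add: o_def poly_u_const_def[abs_def])
  have powX: "poly_u_var S [^]\<^bsub>poly_u S\<^esub> j = ?f (up_ring.monom (UP S) \<one>\<^bsub>S\<^esub> 1 [^]\<^bsub>poly_algebra S\<^esub> j)" for j :: nat
  proof (induction j)
    case (Suc j)
    show ?case
      using f.hom_mult[OF P.Q.nat_pow_closed[OF P.X_closed, of j] P.X_closed]
      by (simp only: P.Q.nat_pow_Suc Pu.nat_pow_Suc Suc[unfolded poly_u_var_def] poly_u_var_def)
  qed (use f.hom_one in simp)
  show ?thesis
  proof (intro polynomial_algebra.intro poly_ring.intro poly_ring_axioms.intro polynomial_algebra_axioms.intro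
      P.Z.is_cring Pu.is_cring S tr(1) hom' alg_homD(6)[OF hom'])
    show "poly_u_var S \<in> carrier (poly_u S)" using f.hom_closed XX by (simp add: poly_u_var_def)
    show "poly_u_coef S j \<in> module_hom R (poly_u S) S" for j
      using module_hom_comp[OF alg_hom_module_hom[OF tr(3)] P.coef_hom[of j]]
      by (simp add: poly_u_coef_def[abs_def] o_def)
  next
    fix p q j assume p: "p \<in> carrier (poly_u S)"
    show "poly_u_coef S j p \<in> carrier S" using P.coef_closed[of "?g p" j] gcl[OF p] by (simp add: poly_u_coef_def)
    show "poly_u_coef S j (p \<oplus>\<^bsub>poly_u S\<^esub> q) = poly_u_coef S j p \<oplus>\<^bsub>S\<^esub> poly_u_coef S j q"
      if "q \<in> carrier (poly_u S)"
      using P.coef_add[of "?g p" "?g q" j] p that by (simp add: poly_u_coef_def gcl)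
    show "poly_u_coef S j (poly_u_const S z \<otimes>\<^bsub>poly_u S\<^esub> p) = z \<otimes>\<^bsub>S\<^esub> poly_u_coef S j p" if "z \<in> carrier S" for z
      using P.coef_const_mult[of z "?g p" j] p that f.hom_closed[of "up_ring.monom (UP S) z 0"]
      by (simp add: poly_u_coef_def poly_u_const_def gcl cc gf)
    show "poly_u_coef S j (poly_u_var S \<otimes>\<^bsub>poly_u S\<^esub> p) = (case j of 0 \<Rightarrow> \<zero>\<^bsub>S\<^esub> | Suc i \<Rightarrow> poly_u_coef S i p)"
      using P.coef_X_mult[of "?g p" j] p f.hom_closed[of "up_ring.monom (UP S) \<one>\<^bsub>S\<^esub> (Suc 0)"]
      by (cases j) (simp_all add: poly_u_coef_def poly_u_var_def gcl XX gf)
    show "\<exists>N. \<forall>n\<ge>N. p = (\<Oplus>\<^bsub>poly_u S\<^esub>j\<in>{..<n}. poly_u_const S (poly_u_coef S j p) \<otimes>\<^bsub>poly_u S\<^esub> poly_u_var S [^]\<^bsub>poly_u S\<^esub> j)"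
    proof -
      have gp: "?g p \<in> carrier (poly_algebra S)" using gcl[OF p] by simp
      obtain N where N: "\<forall>n\<ge>N. ?g p = (\<Oplus>\<^bsub>poly_algebra S\<^esub>j\<in>{..<n}. up_ring.monom (UP S) (?g p j) 0 \<otimes>\<^bsub>poly_algebra S\<^esub>
        up_ring.monom (UP S) \<one>\<^bsub>S\<^esub> 1 [^]\<^bsub>poly_algebra S\<^esub> j)"
        using P.expand[OF gp] by (elim exE)
      have "p = (\<Oplus>\<^bsub>poly_u S\<^esub>j\<in>{..<n}. poly_u_const S (poly_u_coef S j p) \<otimes>\<^bsub>poly_u S\<^esub> poly_u_var S [^]\<^bsub>poly_u S\<^esub> j)"
        if n: "n \<ge> N" for n
      proof -
        let ?t = "\<lambda>j. up_ring.monom (UP S) (?g p j) 0 \<otimes>\<^bsub>poly_algebra S\<^esub> up_ring.monom (UP S) \<one>\<^bsub>S\<^esub> 1 [^]\<^bsub>poly_algebra S\<^esub> j"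
        have c1: "up_ring.monom (UP S) (?g p j) 0 \<in> carrier (poly_algebra S)" for j
          by (rule P.c_closed) (rule P.coef_closed[OF gp])
        have c2: "up_ring.monom (UP S) \<one>\<^bsub>S\<^esub> 1 [^]\<^bsub>poly_algebra S\<^esub> j \<in> carrier (poly_algebra S)" for j :: nat
          by (rule P.Q.nat_pow_closed) (rule P.X_closed)
        have "p = ?f (?g p)" using fg[OF p] by simp
        also have "?g p = (\<Oplus>\<^bsub>poly_algebra S\<^esub>j\<in>{..<n}. ?t j)" using N n by blast
        also have "?f \<dots> = (\<Oplus>\<^bsub>poly_u S\<^esub>j\<in>{..<n}. ?f (?t j))"
          using c1 c2 by (subst f.hom_finsum) (auto simp: o_def simp del: poly_algebra_simps intro!: P.Q.m_closed)
        also have "\<dots> = (\<Oplus>\<^bsub>poly_u S\<^esub>j\<in>{..<n}. poly_u_const S (poly_u_coef S j p) \<otimes>\<^bsub>poly_u S\<^esub> poly_u_var S [^]\<^bsub>poly_u S\<^esub> j)"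
          by (simp only: f.hom_mult[OF c1 c2] powX poly_u_const_def poly_u_coef_def)
        finally show ?thesis .
      qed
      then show ?thesis by blast
    qed
  next
    show "poly_u_coef S j \<one>\<^bsub>poly_u S\<^esub> = (if j = 0 then \<one>\<^bsub>S\<^esub> else \<zero>\<^bsub>S\<^esub>)" for j
      using P.coef_one[of j] g.hom_one by (simp add: poly_u_coef_def)
  qed
qed

section \<open>Localization\<close>

text \<open>
  Addition and multiplication of the localization are unions over representatives. Such a union over
  a class on which the summand is constant is that constant, so everything reduces to the usual
  formulas for fractions.
\<close>

locale localization_at = primeideal P R for P and R :: "('r, 'x) ring_scheme" (structure)
begin

abbreviation "N \<equiv> carrier R - P"
abbreviation "L \<equiv> localization R P"
abbreviation "fr \<equiv> fraction R P"

lemma N_one: "\<one> \<in> N"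
  using I_notcarr one_imp_carrier by blast

lemma N_mult: "s \<in> N \<Longrightarrow> t \<in> N \<Longrightarrow> s \<otimes> t \<in> N"
  using I_prime by auto

lemma N_closed: "s \<in> N \<Longrightarrow> s \<in> carrier R" by auto

lemma fr_iff: "(b, t) \<in> fr a s \<longleftrightarrow> b \<in> carrier R \<and> t \<in> N \<and> (\<exists>u\<in>N. u \<otimes> (t \<otimes> a) = u \<otimes> (s \<otimes> b))"
  by (simp add: fraction_def)

lemma fr_refl: "a \<in> carrier R \<Longrightarrow> s \<in> N \<Longrightarrow> (a, s) \<in> fr a s"
  using N_one by (auto simp: fr_iff)

lemma fr_sym: "a \<in> carrier R \<Longrightarrow> s \<in> N \<Longrightarrow> (b, t) \<in> fr a s \<Longrightarrow> (a, s) \<in> fr b t"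
  unfolding fr_iff by (metis)

lemma fr_trans:
  assumes a: "a \<in> carrier R" "s \<in> N" and 1: "(b, t) \<in> fr a s" and 2: "(d, r) \<in> fr b t"
  shows "(d, r) \<in> fr a s"
proof -
  obtain u where u: "u \<in> N" "u \<otimes> (t \<otimes> a) = u \<otimes> (s \<otimes> b)" using 1 by (auto simp: fr_iff)
  obtain v where v: "v \<in> N" "v \<otimes> (r \<otimes> b) = v \<otimes> (t \<otimes> d)" using 2 by (auto simp: fr_iff)
  have N': "b \<in> carrier R" "t \<in> N" "d \<in> carrier R" "r \<in> N" using 1 2 by (auto simp: fr_iff)
  note cl = a N_closed[OF a(2)] N' N_closed[OF N'(2)] N_closed[OF N'(4)] N_closed[OF u(1)] N_closed[OF v(1)]
  have "(u \<otimes> v \<otimes> t) \<otimes> (r \<otimes> a) = (v \<otimes> r) \<otimes> (u \<otimes> (t \<otimes> a))" using cl by (simp add: m_ac)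
  also have "\<dots> = (u \<otimes> s) \<otimes> (v \<otimes> (r \<otimes> b))" unfolding u(2) using cl by (simp add: m_ac)
  also have "\<dots> = (u \<otimes> v \<otimes> t) \<otimes> (s \<otimes> d)" unfolding v(2) using cl by (simp add: m_ac)
  finally show ?thesis using u v N' by (auto simp: fr_iff intro!: bexI[of _ "u \<otimes> v \<otimes> t"] N_mult)
qed

lemma fr_eq_iff:
  assumes "a \<in> carrier R" "s \<in> N" "b \<in> carrier R" "t \<in> N"
  shows "fr a s = fr b t \<longleftrightarrow> (b, t) \<in> fr a s"
proof
  assume "fr a s = fr b t" then show "(b, t) \<in> fr a s" using assms fr_refl by blast
next
  assume 1: "(b, t) \<in> fr a s"
  then have 2: "(a, s) \<in> fr b t" by (rule fr_sym[OF assms(1,2)])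
  show "fr a s = fr b t"
    using fr_trans[OF assms(1,2) 1] fr_trans[OF assms(3,4) 2] by auto
qed

lemma fr_eqI:
  "\<lbrakk>a \<in> carrier R; s \<in> N; b \<in> carrier R; t \<in> N; t \<otimes> a = s \<otimes> b\<rbrakk> \<Longrightarrow> fr a s = fr b t"
  using N_one by (subst fr_eq_iff) (auto simp: fr_iff)

lemma frE: "x \<in> carrier L \<Longrightarrow> (\<And>a s. a \<in> carrier R \<Longrightarrow> s \<in> N \<Longrightarrow> s \<in> carrier R \<Longrightarrow> x = fr a s \<Longrightarrow> thesis) \<Longrightarrow> thesis"
  by (auto simp: localization_def)

lemma fr_closed: "a \<in> carrier R \<Longrightarrow> s \<in> N \<Longrightarrow> fr a s \<in> carrier L"
  by (auto simp: localization_def)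

lemma fr_UN:
  assumes "a \<in> carrier R" "s \<in> N" "\<And>b t. (b, t) \<in> fr a s \<Longrightarrow> F b t = F a s"
  shows "(\<Union>(b, t)\<in>fr a s. F b t) = F a s"
proof -
  have "(\<Union>(b, t)\<in>fr a s. F b t) = (\<Union>x\<in>fr a s. F a s)"
    using assms(3) by (intro SUP_cong) auto
  then show ?thesis using fr_refl[OF assms(1,2)] by auto
qed

lemma fr_mult_cong:
  assumes a: "a \<in> carrier R" "s \<in> N" and b: "b \<in> carrier R" "t \<in> N"
    and a': "(a', s') \<in> fr a s" and b': "(b', t') \<in> fr b t"
  shows "fr (a' \<otimes> b') (s' \<otimes> t') = fr (a \<otimes> b) (s \<otimes> t)"
    and "fr (a' \<otimes> t' \<oplus> b' \<otimes> s') (s' \<otimes> t') = fr (a \<otimes> t \<oplus> b \<otimes> s) (s \<otimes> t)"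
proof -
  obtain u where u: "u \<in> N" "u \<otimes> (s' \<otimes> a) = u \<otimes> (s \<otimes> a')" using a' by (auto simp: fr_iff)
  obtain v where v: "v \<in> N" "v \<otimes> (t' \<otimes> b) = v \<otimes> (t \<otimes> b')" using b' by (auto simp: fr_iff)
  have N': "a' \<in> carrier R" "s' \<in> N" "b' \<in> carrier R" "t' \<in> N" using a' b' by (auto simp: fr_iff)
  note cl = a b N' N_closed[OF a(2)] N_closed[OF b(2)] N_closed[OF N'(2)] N_closed[OF N'(4)] N_closed[OF u(1)] N_closed[OF v(1)]
  have "(u \<otimes> v) \<otimes> (s' \<otimes> t' \<otimes> (a \<otimes> b)) = (u \<otimes> (s' \<otimes> a)) \<otimes> (v \<otimes> (t' \<otimes> b))" using cl by (simp add: m_ac)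
  also have "\<dots> = (u \<otimes> v) \<otimes> (s \<otimes> t \<otimes> (a' \<otimes> b'))" unfolding u v using cl by (simp add: m_ac)
  finally have "(a' \<otimes> b', s' \<otimes> t') \<in> fr (a \<otimes> b) (s \<otimes> t)"
    unfolding fr_iff
    by (intro conjI bexI[of _ "u \<otimes> v"]) (use cl N_mult[OF u(1) v(1)] N_mult[OF N'(2) N'(4)] in \<open>simp_all del: Diff_iff\<close>)
  then show "fr (a' \<otimes> b') (s' \<otimes> t') = fr (a \<otimes> b) (s \<otimes> t)"
    using cl N_mult[OF a(2) b(2)] N_mult[OF N'(2) N'(4)] by (intro fr_eq_iff[THEN iffD2, symmetric]) auto
  have "(u \<otimes> v) \<otimes> (s' \<otimes> t' \<otimes> (a \<otimes> t \<oplus> b \<otimes> s)) =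
      (v \<otimes> t \<otimes> t') \<otimes> (u \<otimes> (s' \<otimes> a)) \<oplus> (u \<otimes> s \<otimes> s') \<otimes> (v \<otimes> (t' \<otimes> b))"
    using cl by (simp add: m_ac r_distr)
  also have "\<dots> = (u \<otimes> v) \<otimes> (s \<otimes> t \<otimes> (a' \<otimes> t' \<oplus> b' \<otimes> s'))"
    unfolding u v using cl by (simp add: m_ac r_distr)
  finally have "(a' \<otimes> t' \<oplus> b' \<otimes> s', s' \<otimes> t') \<in> fr (a \<otimes> t \<oplus> b \<otimes> s) (s \<otimes> t)"
    unfolding fr_iff
    by (intro conjI bexI[of _ "u \<otimes> v"]) (use cl N_mult[OF u(1) v(1)] N_mult[OF N'(2) N'(4)] in \<open>simp_all del: Diff_iff\<close>)
  then show "fr (a' \<otimes> t' \<oplus> b' \<otimes> s') (s' \<otimes> t') = fr (a \<otimes> t \<oplus> b \<otimes> s) (s \<otimes> t)"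
    using cl N_mult[OF a(2) b(2)] N_mult[OF N'(2) N'(4)] by (intro fr_eq_iff[THEN iffD2, symmetric]) auto
qed

lemma
  assumes a: "a \<in> carrier R" "s \<in> N" and b: "b \<in> carrier R" "t \<in> N"
  shows fr_mult: "fr a s \<otimes>\<^bsub>L\<^esub> fr b t = fr (a \<otimes> b) (s \<otimes> t)"
    and fr_add: "fr a s \<oplus>\<^bsub>L\<^esub> fr b t = fr (a \<otimes> t \<oplus> b \<otimes> s) (s \<otimes> t)"
proof -
  have N1: "\<And>a' s'. (a', s') \<in> fr a s \<Longrightarrow> a' \<in> carrier R \<and> s' \<in> N" by (auto simp: fr_iff)
  have "(\<Union>(a', s')\<in>fr a s. \<Union>(b', t')\<in>fr b t. fr (a' \<otimes> b') (s' \<otimes> t')) =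
      (\<Union>(b', t')\<in>fr b t. fr (a \<otimes> b') (s \<otimes> t'))"
  proof (rule fr_UN[OF a])
    fix a' s' assume "(a', s') \<in> fr a s"
    then show "(\<Union>(b', t')\<in>fr b t. fr (a' \<otimes> b') (s' \<otimes> t')) = (\<Union>(b', t')\<in>fr b t. fr (a \<otimes> b') (s \<otimes> t'))"
      using fr_mult_cong(1)[OF a b _ _] fr_refl[OF a] by (intro SUP_cong) auto
  qed
  also have "\<dots> = fr (a \<otimes> b) (s \<otimes> t)"
    by (rule fr_UN[OF b]) (rule fr_mult_cong(1)[OF a b fr_refl[OF a]])
  finally show "fr a s \<otimes>\<^bsub>L\<^esub> fr b t = fr (a \<otimes> b) (s \<otimes> t)" by (simp add: localization_def)
  have "(\<Union>(a', s')\<in>fr a s. \<Union>(b', t')\<in>fr b t. fr (a' \<otimes> t' \<oplus> b' \<otimes> s') (s' \<otimes> t')) =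
      (\<Union>(b', t')\<in>fr b t. fr (a \<otimes> t' \<oplus> b' \<otimes> s) (s \<otimes> t'))"
  proof (rule fr_UN[OF a])
    fix a' s' assume "(a', s') \<in> fr a s"
    then show "(\<Union>(b', t')\<in>fr b t. fr (a' \<otimes> t' \<oplus> b' \<otimes> s') (s' \<otimes> t')) = (\<Union>(b', t')\<in>fr b t. fr (a \<otimes> t' \<oplus> b' \<otimes> s) (s \<otimes> t'))"
      using fr_mult_cong(2)[OF a b _ _] fr_refl[OF a] by (intro SUP_cong) auto
  qed
  also have "\<dots> = fr (a \<otimes> t \<oplus> b \<otimes> s) (s \<otimes> t)"
    by (rule fr_UN[OF b]) (rule fr_mult_cong(2)[OF a b fr_refl[OF a]])
  finally show "fr a s \<oplus>\<^bsub>L\<^esub> fr b t = fr (a \<otimes> t \<oplus> b \<otimes> s) (s \<otimes> t)" by (simp add: localization_def)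
qed

lemma fr_smult:
  assumes r: "r \<in> carrier R" and a: "a \<in> carrier R" "s \<in> N"
  shows "r \<odot>\<^bsub>L\<^esub> fr a s = fr (r \<otimes> a) s"
proof -
  have "(\<Union>(a', s')\<in>fr a s. fr (r \<otimes> a') s') = fr (r \<otimes> a) s"
  proof (rule fr_UN[OF a])
    fix a' s' assume a': "(a', s') \<in> fr a s"
    have "fr (r \<otimes> a') (\<one> \<otimes> s') = fr (r \<otimes> a) (\<one> \<otimes> s)"
      by (rule fr_mult_cong(1)[OF r N_one a fr_refl[OF r N_one] a'])
    then show "fr (r \<otimes> a') s' = fr (r \<otimes> a) s" using a a' by (simp add: fr_iff)
  qed
  then show ?thesis by (simp add: localization_def)
qed

lemma fr_zero: "\<zero>\<^bsub>L\<^esub> = fr \<zero> \<one>" and fr_one: "\<one>\<^bsub>L\<^esub> = fr \<one> \<one>"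
  by (simp_all add: localization_def)

lemmas fr_simps = fr_mult fr_add fr_smult fr_zero fr_one N_mult N_one

lemma localization_algebra: "algebra R L"
proof -
  have "cring L"
  proof (rule cringI)
    show "abelian_group L"
    proof (rule abelian_groupI)
      fix x y z assume "x \<in> carrier L" "y \<in> carrier L" "z \<in> carrier L"
      then show "(x \<oplus>\<^bsub>L\<^esub> y) \<oplus>\<^bsub>L\<^esub> z = x \<oplus>\<^bsub>L\<^esub> (y \<oplus>\<^bsub>L\<^esub> z)"
      proof (elim frE)
        fix a s b t d r assume a: "a \<in> carrier R" "s \<in> carrier R" "b \<in> carrier R" "t \<in> carrier R"
          "d \<in> carrier R" "r \<in> carrier R" and n: "s \<in> N" "t \<in> N" "r \<in> N"
          and x: "x = fr a s" "y = fr b t" "z = fr d r"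
        have "(a \<otimes> t \<oplus> b \<otimes> s) \<otimes> r \<oplus> d \<otimes> (s \<otimes> t) = a \<otimes> (t \<otimes> r) \<oplus> (b \<otimes> r \<oplus> d \<otimes> t) \<otimes> s"
          using a by (simp add: l_distr) (simp add: m_ac a_assoc)
        moreover have "s \<otimes> t \<otimes> r = s \<otimes> (t \<otimes> r)" using a by (simp add: m_assoc)
        ultimately show ?thesis unfolding x using a n by (simp add: fr_simps del: Diff_iff)
      qed
    next
      fix x y assume "x \<in> carrier L" "y \<in> carrier L"
      then show "x \<oplus>\<^bsub>L\<^esub> y = y \<oplus>\<^bsub>L\<^esub> x" "x \<oplus>\<^bsub>L\<^esub> y \<in> carrier L"
        by (elim frE; simp add: fr_simps fr_closed m_ac a_ac del: Diff_iff)+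
    next
      show "\<zero>\<^bsub>L\<^esub> \<in> carrier L" by (simp add: fr_zero fr_closed N_one del: Diff_iff)
      fix x assume "x \<in> carrier L"
      then show "\<zero>\<^bsub>L\<^esub> \<oplus>\<^bsub>L\<^esub> x = x" by (elim frE) (simp add: fr_simps del: Diff_iff)
      show "\<exists>y\<in>carrier L. y \<oplus>\<^bsub>L\<^esub> x = \<zero>\<^bsub>L\<^esub>" using \<open>x \<in> carrier L\<close>
      proof (elim frE)
        fix a s assume a: "a \<in> carrier R" "s \<in> N" "s \<in> carrier R" "x = fr a s"
        have "fr (\<ominus> a \<otimes> s \<oplus> a \<otimes> s) (s \<otimes> s) = fr \<zero> \<one>"
          using a by (intro fr_eqI) (simp_all add: fr_simps l_minus l_neg del: Diff_iff)
        then show ?thesis using a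
          by (intro bexI[of _ "fr (\<ominus> a) s"]) (simp_all add: fr_simps fr_closed del: Diff_iff)
      qed
    qed
    show "Group.comm_monoid L"
    proof (rule comm_monoidI)
      show "\<one>\<^bsub>L\<^esub> \<in> carrier L" by (simp add: fr_one fr_closed N_one del: Diff_iff)
    qed (elim frE; simp add: fr_simps fr_closed m_ac del: Diff_iff)+
    fix x y z assume "x \<in> carrier L" "y \<in> carrier L" "z \<in> carrier L"
    then show "(x \<oplus>\<^bsub>L\<^esub> y) \<otimes>\<^bsub>L\<^esub> z = x \<otimes>\<^bsub>L\<^esub> z \<oplus>\<^bsub>L\<^esub> y \<otimes>\<^bsub>L\<^esub> z"
    proof (elim frE)
      fix a s b t d r assume a: "a \<in> carrier R" "s \<in> carrier R" "b \<in> carrier R" "t \<in> carrier R"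
        "d \<in> carrier R" "r \<in> carrier R" and n: "s \<in> N" "t \<in> N" "r \<in> N"
        and x: "x = fr a s" "y = fr b t" "z = fr d r"
      have "fr ((a \<otimes> t \<oplus> b \<otimes> s) \<otimes> d) (s \<otimes> t \<otimes> r) =
          fr (a \<otimes> d \<otimes> (t \<otimes> r) \<oplus> b \<otimes> d \<otimes> (s \<otimes> r)) (s \<otimes> r \<otimes> (t \<otimes> r))"
      proof (rule fr_eqI)
        have 1: "(s \<otimes> r \<otimes> (t \<otimes> r)) \<otimes> ((a \<otimes> t) \<otimes> d) = s \<otimes> t \<otimes> r \<otimes> (a \<otimes> d \<otimes> (t \<otimes> r))"
          "(s \<otimes> r \<otimes> (t \<otimes> r)) \<otimes> ((b \<otimes> s) \<otimes> d) = s \<otimes> t \<otimes> r \<otimes> (b \<otimes> d \<otimes> (s \<otimes> r))"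
          using a by (simp_all add: m_ac)
        show "(s \<otimes> r \<otimes> (t \<otimes> r)) \<otimes> ((a \<otimes> t \<oplus> b \<otimes> s) \<otimes> d) =
            s \<otimes> t \<otimes> r \<otimes> (a \<otimes> d \<otimes> (t \<otimes> r) \<oplus> b \<otimes> d \<otimes> (s \<otimes> r))"
          using a by (simp only: l_distr[of "a \<otimes> t" "b \<otimes> s" d] r_distr m_closed 1)
      qed (use a n in \<open>simp_all add: N_mult del: Diff_iff\<close>)
      then show ?thesis unfolding x using a n by (simp add: fr_simps del: Diff_iff)
    qed
  qed
  then show ?thesis
  proof (intro algebraI is_cring)
    fix a b x y assume "a \<in> carrier R" "b \<in> carrier R" "x \<in> carrier L" "y \<in> carrier L"
    show "(a \<oplus> b) \<odot>\<^bsub>L\<^esub> x = a \<odot>\<^bsub>L\<^esub> x \<oplus>\<^bsub>L\<^esub> b \<odot>\<^bsub>L\<^esub> x" using \<open>x \<in> carrier L\<close>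
    proof (elim frE)
      fix d s assume d: "d \<in> carrier R" "s \<in> carrier R" "s \<in> N" and x: "x = fr d s"
      have "fr ((a \<oplus> b) \<otimes> d) s = fr (a \<otimes> d \<otimes> s \<oplus> b \<otimes> d \<otimes> s) (s \<otimes> s)"
      proof (rule fr_eqI)
        show "s \<otimes> s \<otimes> ((a \<oplus> b) \<otimes> d) = s \<otimes> (a \<otimes> d \<otimes> s \<oplus> b \<otimes> d \<otimes> s)"
        proof -
          have "s \<otimes> s \<otimes> (c \<otimes> d) = s \<otimes> (c \<otimes> d \<otimes> s)" if "c \<in> carrier R" for c
            using that d(1,2) by (simp add: m_ac)
          then show ?thesis
            using \<open>a \<in> carrier R\<close> \<open>b \<in> carrier R\<close> d(1,2) by (simp only: l_distr[of a b d] r_distr m_closed)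
        qed
      qed (use \<open>a \<in> carrier R\<close> \<open>b \<in> carrier R\<close> d in \<open>simp_all add: N_mult del: Diff_iff\<close>)
      then show ?thesis unfolding x using \<open>a \<in> carrier R\<close> \<open>b \<in> carrier R\<close> d by (simp add: fr_simps del: Diff_iff)
    qed
    show "a \<odot>\<^bsub>L\<^esub> (x \<oplus>\<^bsub>L\<^esub> y) = a \<odot>\<^bsub>L\<^esub> x \<oplus>\<^bsub>L\<^esub> a \<odot>\<^bsub>L\<^esub> y" using \<open>x \<in> carrier L\<close> \<open>y \<in> carrier L\<close>
      by (elim frE) (simp add: fr_simps r_distr m_assoc \<open>a \<in> carrier R\<close> del: Diff_iff)
  qed (assumption | (elim frE; simp add: fr_simps fr_closed m_ac del: Diff_iff))+
qed

lemma fr_structure: "r \<in> carrier R \<Longrightarrow> r \<odot>\<^bsub>L\<^esub> \<one>\<^bsub>L\<^esub> = fr r \<one>"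
  by (simp add: fr_simps del: Diff_iff)

lemma fr_eq_zeroD:
  assumes "r \<in> carrier R" "r \<odot>\<^bsub>L\<^esub> \<one>\<^bsub>L\<^esub> = \<zero>\<^bsub>L\<^esub>" shows "\<exists>u\<in>N. u \<otimes> r = \<zero>"
proof -
  have "(\<zero>, \<one>) \<in> fr r \<one>" using assms fr_eq_iff[of r \<one> \<zero> \<one>] N_one by (simp add: fr_structure fr_zero)
  then show ?thesis using assms by (auto simp: fr_iff)
qed

end

text \<open>
  By Zorn's lemma there is a maximal element among the ideals that contain \<open>I\<close> and not \<open>1\<close>; it is a
  maximal ideal, hence prime.
\<close>

lemma (in cring) exists_prime_above:
  assumes I: "ideal I R" and one: "\<one> \<notin> I"
  shows "\<exists>P. primeideal P R \<and> I \<subseteq> P"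
proof -
  let ?A = "{J. ideal J R \<and> I \<subseteq> J \<and> \<one> \<notin> J}"
  have "\<exists>M\<in>?A. \<forall>X\<in>?A. M \<subseteq> X \<longrightarrow> X = M"
  proof (rule subset_Zorn_nonempty)
    show "?A \<noteq> {}" using I one by blast
    fix C assume C: "C \<noteq> {}" "subset.chain ?A C"
    from C(2) have "subset.chain {I. ideal I R} C" unfolding subset_chain_def by blast
    then have "ideal (\<Union>C) R" using chain_Union_is_ideal[of C] C(1) by simp
    moreover obtain J where "J \<in> C" using C(1) by blast
    moreover have "\<forall>J\<in>C. I \<subseteq> J \<and> \<one> \<notin> J" using C(2) unfolding subset_chain_def by blast
    ultimately show "\<Union>C \<in> ?A" by blast
  qed
  then obtain M where "M \<in> ?A" and max': "\<forall>X\<in>?A. M \<subseteq> X \<longrightarrow> X = M" by (elim bexE)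
  then have M: "ideal M R" "I \<subseteq> M" "\<one> \<notin> M" by simp_all
  have max: "X = M" if "ideal X R" "I \<subseteq> X" "\<one> \<notin> X" "M \<subseteq> X" for X
    using bspec[OF max', of X] that by simp
  have "maximalideal M R"
  proof (rule maximalidealI[OF M(1)])
    show "carrier R \<noteq> M" using M(3) by blast
    fix J assume J: "ideal J R" "M \<subseteq> J" "J \<subseteq> carrier R"
    show "J = M \<or> J = carrier R"
    proof (cases "\<one> \<in> J")
      case True then show ?thesis using ideal.one_imp_carrier[OF J(1)] by simp
    next
      case False then show ?thesis using max[OF J(1) order_trans[OF M(2) J(2)] _ J(2)] by simp
    qed
  qed
  from maximalideal_prime[OF this] show ?thesis using M(2) by (intro exI[of _ M] conjI)
qed

text \<open>
  If \<open>d \<noteq> 0\<close>, the annihilator of \<open>d\<close> is a proper ideal, and \<open>d\<close> stays nonzero in the localization at any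
  prime that contains it.
\<close>

lemma (in cring) eq_zero_if_locally:
  assumes d: "d \<in> carrier R"
    and loc: "\<And>P. primeideal P R \<Longrightarrow> d \<odot>\<^bsub>localization R P\<^esub> \<one>\<^bsub>localization R P\<^esub> = \<zero>\<^bsub>localization R P\<^esub>"
  shows "d = \<zero>"
proof (rule ccontr)
  assume nz: "d \<noteq> \<zero>"
  let ?I = "{r \<in> carrier R. r \<otimes> d = \<zero>}"
  have "ideal ?I R"
  proof (rule idealI[OF ring_axioms])
    show "subgroup ?I (add_monoid R)"
      by (rule add.subgroupI) (use d in \<open>auto simp: l_distr l_minus a_inv_def[symmetric] intro!: exI[of _ \<zero>]\<close>)
    fix r x assume r: "r \<in> ?I" and x: "x \<in> carrier R"
    then show "x \<otimes> r \<in> ?I" using d by (simp add: m_assoc)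
    have "r \<otimes> x \<otimes> d = x \<otimes> (r \<otimes> d)" using r x d by (simp add: m_comm[of r x] m_assoc)
    then show "r \<otimes> x \<in> ?I" using r x by simp
  qed
  moreover have "\<one> \<notin> ?I" using nz d by simp
  ultimately obtain P where P: "primeideal P R" "?I \<subseteq> P" using exists_prime_above by blast
  interpret localization_at P R using P(1) by (simp add: localization_at_def)
  obtain u where "u \<in> carrier R - P" "u \<otimes> d = \<zero>" using fr_eq_zeroD[OF d loc[OF P(1)]] by blast
  then show False using P(2) by blast
qed

lemma (in abelian_group) add_minus_cancel:
  "x \<in> carrier G \<Longrightarrow> y \<in> carrier G \<Longrightarrow> x \<oplus> (y \<ominus> x) = y"
  by (simp add: a_minus_def a_lcomm[of x y "\<ominus> x"] r_neg)

lemma (in abelian_group) minus_telescope: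
  assumes "x \<in> carrier G" "y \<in> carrier G" "z \<in> carrier G"
  shows "(y \<ominus> x) \<oplus> (z \<ominus> y) = z \<ominus> x"
proof -
  have "(y \<ominus> x) \<oplus> (z \<ominus> y) = \<ominus> x \<oplus> (y \<oplus> (z \<ominus> y))"
    using assms by (simp add: minus_eq a_comm[of y "\<ominus> x"] a_assoc)
  also have "\<dots> = z \<ominus> x"
    using assms by (simp only: add_minus_cancel) (simp add: minus_eq a_comm)
  finally show ?thesis .
qed

section \<open>Dual bases and the determinant of an endomorphism\<close>

lemma module_hom_finsum:
  assumes h: "h \<in> module_hom S M N" and M: "module S M" and N: "module S N"
    and f: "\<And>x. x \<in> I \<Longrightarrow> f x \<in> carrier M"
  shows "h (\<Oplus>\<^bsub>M\<^esub>x\<in>I. f x) = (\<Oplus>\<^bsub>N\<^esub>x\<in>I. h (f x))"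
proof -
  interpret M: module S M by fact
  interpret N: module S N by fact
  show ?thesis using f
  proof (induction I rule: infinite_finite_induct)
    case (insert x I)
    have "(\<Oplus>\<^bsub>M\<^esub>x\<in>I. f x) \<in> carrier M" using insert.prems by (auto intro!: M.finsum_closed)
    then show ?case using insert
      by (simp add: Pi_def module_homD[OF h])
  qed (simp_all add: module_hom_zero[OF h M N])
qed

abbreviation linear_forms :: "('s, 'x) ring_scheme \<Rightarrow> ('s, 'm) module \<Rightarrow> ('m \<Rightarrow> 's) set" where
  "linear_forms S M \<equiv> module_hom S M (self_algebra S)"

lemma linear_form_finsum:
  assumes l: "l \<in> linear_forms S M" and M: "module S M"
    and c: "\<And>j. j \<in> I \<Longrightarrow> c j \<in> carrier S" and x: "\<And>j. j \<in> I \<Longrightarrow> x j \<in> carrier M"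
  shows "l (\<Oplus>\<^bsub>M\<^esub>j\<in>I. c j \<odot>\<^bsub>M\<^esub> x j) = (\<Oplus>\<^bsub>S\<^esub>j\<in>I. c j \<otimes>\<^bsub>S\<^esub> l (x j))"
proof -
  interpret M: module S M by fact
  have "l (\<Oplus>\<^bsub>M\<^esub>j\<in>I. c j \<odot>\<^bsub>M\<^esub> x j) = (\<Oplus>\<^bsub>self_algebra S\<^esub>j\<in>I. l (c j \<odot>\<^bsub>M\<^esub> x j))"
    using c x by (intro module_hom_finsum[OF l M algebra_facts(2)[OF self_algebra_algebra[OF M.is_cring]]]) simp
  also have "\<dots> = (\<Oplus>\<^bsub>S\<^esub>j\<in>I. l (c j \<odot>\<^bsub>M\<^esub> x j))"
    unfolding finsum_def finprod_def by (simp add: self_algebra_def)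
  also have "\<dots> = (\<Oplus>\<^bsub>S\<^esub>j\<in>I. c j \<otimes>\<^bsub>S\<^esub> l (x j))"
    using c x module_homD[OF l] by (intro M.R.finsum_cong') auto
  finally show ?thesis .
qed

text \<open>
  Elements \<open>g\<^sub>j\<close> and linear forms \<open>l\<^sub>j\<close> with \<open>x = \<Sum> l\<^sub>j(x) g\<^sub>j\<close>: the coordinate version of a retraction from
  \<open>S\<^sup>k\<close> onto \<open>M\<close>. Unlike a complement of \<open>M\<close> in \<open>S\<^sup>k\<close>, it is visibly compatible with base change.
\<close>

definition dual_basis ::
  "('s, 'x) ring_scheme \<Rightarrow> ('s, 'm) module \<Rightarrow> nat \<Rightarrow> (nat \<Rightarrow> 'm \<Rightarrow> 's) \<Rightarrow> (nat \<Rightarrow> 'm) \<Rightarrow> bool" where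
  "dual_basis S M k l g \<longleftrightarrow> (\<forall>i<k. l i \<in> linear_forms S M) \<and> (\<forall>j<k. g j \<in> carrier M) \<and>
     (\<forall>x\<in>carrier M. x = (\<Oplus>\<^bsub>M\<^esub>j\<in>{..<k}. l j x \<odot>\<^bsub>M\<^esub> g j))"

lemma dual_basisD:
  assumes "dual_basis S M k l g"
  shows "i < k \<Longrightarrow> l i \<in> linear_forms S M" "j < k \<Longrightarrow> g j \<in> carrier M"
    "x \<in> carrier M \<Longrightarrow> (\<Oplus>\<^bsub>M\<^esub>j\<in>{..<k}. l j x \<odot>\<^bsub>M\<^esub> g j) = x"
  using assms by (auto simp: dual_basis_def)

lemma free_module_hom_expand:
  assumes M: "module S M" and p: "p \<in> module_hom S (free_module S I) M"
    and J: "finite J" "J \<subseteq> I" and f: "f \<in> carrier (free_module S I)" "\<And>i. i \<in> I - J \<Longrightarrow> f i = \<zero>\<^bsub>S\<^esub>"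
  shows "p f = (\<Oplus>\<^bsub>M\<^esub>j\<in>J. f j \<odot>\<^bsub>M\<^esub> p (\<lambda>i\<in>I. if i = j then \<one>\<^bsub>S\<^esub> else \<zero>\<^bsub>S\<^esub>))"
proof -
  interpret M: module S M by fact
  let ?F = "free_module S I"
  let ?e = "\<lambda>j. \<lambda>i\<in>I. if i = j then \<one>\<^bsub>S\<^esub> else \<zero>\<^bsub>S\<^esub>"
  have Fc: "h \<in> carrier ?F \<longleftrightarrow> h \<in> I \<rightarrow>\<^sub>E carrier S \<and> finite {i \<in> I. h i \<noteq> \<zero>\<^bsub>S\<^esub>}" for h
    by (simp add: free_module_def)
  have e: "?e j \<in> carrier ?F" for j
    by (auto simp: Fc intro: finite_subset[of _ "{j}"])
  show ?thesis using J f
  proof (induction J arbitrary: f)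
    case empty
    then have f0: "f = (\<lambda>i\<in>I. \<zero>\<^bsub>S\<^esub>)" by (auto simp: Fc fun_eq_iff PiE_def extensional_def)
    have "p f = p (\<zero>\<^bsub>S\<^esub> \<odot>\<^bsub>?F\<^esub> f)" by (rule arg_cong[where f=p]) (simp add: f0 free_module_def fun_eq_iff)
    also have "\<dots> = \<zero>\<^bsub>S\<^esub> \<odot>\<^bsub>M\<^esub> p f" using empty.prems by (intro module_homD[OF p]) auto
    also have "\<dots> = \<zero>\<^bsub>M\<^esub>" using module_homD(1)[OF p empty.prems(2)] by simp
    finally show ?case by simp
  next
    case (insert j J)
    define f' where "f' = (\<lambda>i\<in>I. if i = j then \<zero>\<^bsub>S\<^esub> else f i)"
    have fi: "f i \<in> carrier S" if "i \<in> I" for i using insert.prems that by (auto simp: Fc)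
    have f': "f' \<in> carrier ?F"
      using insert.prems(2) by (auto simp: Fc f'_def elim!: rev_finite_subset)
    have s: "f j \<odot>\<^bsub>?F\<^esub> ?e j \<in> carrier ?F"
      using insert.prems fi by (auto simp: free_module_def intro: finite_subset[of _ "{j}"])
    have "f = f' \<oplus>\<^bsub>?F\<^esub> (f j \<odot>\<^bsub>?F\<^esub> ?e j)"
    proof
      fix i show "f i = (f' \<oplus>\<^bsub>?F\<^esub> (f j \<odot>\<^bsub>?F\<^esub> ?e j)) i"
        using insert.prems fi by (auto simp: free_module_def f'_def extensional_def PiE_def)
    qed
    then have "p f = p f' \<oplus>\<^bsub>M\<^esub> f j \<odot>\<^bsub>M\<^esub> p (?e j)"
      using module_homD(2)[OF p f' s] module_homD(3)[OF p fi e, of j j] insert.prems by simp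
    also have "p f' = (\<Oplus>\<^bsub>M\<^esub>i\<in>J. f' i \<odot>\<^bsub>M\<^esub> p (?e i))"
    proof (rule insert.IH[OF _ f'])
      show "J \<subseteq> I" using insert.prems by simp
      show "f' i = \<zero>\<^bsub>S\<^esub>" if "i \<in> I - J" for i using insert.prems(3)[of i] that by (auto simp: f'_def)
    qed
    also have "\<dots> = (\<Oplus>\<^bsub>M\<^esub>i\<in>J. f i \<odot>\<^bsub>M\<^esub> p (?e i))"
      using insert fi by (intro M.M.finsum_cong') (auto simp: f'_def module_homD(1)[OF p e])
    also have "(\<Oplus>\<^bsub>M\<^esub>i\<in>J. f i \<odot>\<^bsub>M\<^esub> p (?e i)) \<oplus>\<^bsub>M\<^esub> f j \<odot>\<^bsub>M\<^esub> p (?e j) =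
        (\<Oplus>\<^bsub>M\<^esub>i\<in>insert j J. f i \<odot>\<^bsub>M\<^esub> p (?e i))"
    proof -
      have t: "f i \<odot>\<^bsub>M\<^esub> p (?e i) \<in> carrier M" if "i \<in> insert j J" for i
        using fi that insert.prems(1) module_homD(1)[OF p e] by blast
      then have "(\<Oplus>\<^bsub>M\<^esub>i\<in>insert j J. f i \<odot>\<^bsub>M\<^esub> p (?e i)) = f j \<odot>\<^bsub>M\<^esub> p (?e j) \<oplus>\<^bsub>M\<^esub> (\<Oplus>\<^bsub>M\<^esub>i\<in>J. f i \<odot>\<^bsub>M\<^esub> p (?e i))"
        using insert.hyps by (intro M.M.finsum_insert) (auto simp del: restrict_apply)
      then show ?thesis using t by (subst M.M.a_comm) (auto intro!: M.M.finsum_closed simp del: restrict_apply)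
    qed
    finally show ?case .
  qed
qed

lemma retract_dual_basis:
  assumes M: "module S M" and r: "retract_of_free S M {..<k} \<iota> \<pi>"
  shows "dual_basis S M k (\<lambda>i x. \<iota> x i) (\<lambda>j. \<pi> (free_basis S k j))"
proof -
  interpret M: module S M by fact
  let ?F = "free_module S {..<k}"
  have i: "\<iota> \<in> module_hom S M ?F" and p: "\<pi> \<in> module_hom S ?F M" and pi: "\<And>x. x \<in> carrier M \<Longrightarrow> \<pi> (\<iota> x) = x"
    using r by (auto simp: retract_of_free_def)
  have "(\<lambda>x. \<iota> x j) \<in> linear_forms S M" if "j < k" for j
  proof (rule module_homI)
    show "x \<in> carrier M \<Longrightarrow> \<iota> x j \<in> carrier (self_algebra S)" for x
      using module_homD(1)[OF i] that by (auto simp: free_module_def)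
  qed (use that in \<open>simp_all add: module_homD(2,3)[OF i], simp_all add: free_module_def\<close>)
  moreover have "free_basis S k j \<in> carrier ?F" for j
    by (auto simp: free_module_def free_basis_def)
  moreover have "x = (\<Oplus>\<^bsub>M\<^esub>j\<in>{..<k}. \<iota> x j \<odot>\<^bsub>M\<^esub> \<pi> (free_basis S k j))" if "x \<in> carrier M" for x
    using free_module_hom_expand[OF M p, of "{..<k}" "\<iota> x"] module_homD(1)[OF i that] pi[OF that]
    by (simp add: free_basis_def)
  ultimately show ?thesis by (simp add: dual_basis_def module_homD(1)[OF p])
qed

lemma dual_basis_retract:
  assumes M: "module S M" and d: "dual_basis S M k l g"
  shows "retract_of_free S M {..<k} (\<lambda>x. \<lambda>i\<in>{..<k}. l i x) (\<lambda>f. \<Oplus>\<^bsub>M\<^esub>j\<in>{..<k}. f j \<odot>\<^bsub>M\<^esub> g j)"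
proof -
  interpret M: module S M by fact
  note l = dual_basisD(1)[OF d] and g = dual_basisD(2)[OF d]
  note lh = module_homD[OF l]
  show ?thesis unfolding retract_of_free_def
  proof (intro conjI module_homI ballI)
    fix f f' assume "f \<in> carrier (free_module S {..<k})" "f' \<in> carrier (free_module S {..<k})"
    then have f: "\<And>j. j < k \<Longrightarrow> f j \<in> carrier S" "\<And>j. j < k \<Longrightarrow> f' j \<in> carrier S" by (auto simp: free_module_def)
    show "(\<Oplus>\<^bsub>M\<^esub>j\<in>{..<k}. f j \<odot>\<^bsub>M\<^esub> g j) \<in> carrier M"
      using f g by (auto intro!: M.finsum_closed)
    have "(\<Oplus>\<^bsub>M\<^esub>j\<in>{..<k}. (f \<oplus>\<^bsub>free_module S {..<k}\<^esub> f') j \<odot>\<^bsub>M\<^esub> g j) =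
      (\<Oplus>\<^bsub>M\<^esub>j\<in>{..<k}. f j \<odot>\<^bsub>M\<^esub> g j \<oplus>\<^bsub>M\<^esub> f' j \<odot>\<^bsub>M\<^esub> g j)"
      using f g by (intro M.M.finsum_cong') (auto simp: free_module_def M.smult_l_distr)
    then show "(\<Oplus>\<^bsub>M\<^esub>j\<in>{..<k}. (f \<oplus>\<^bsub>free_module S {..<k}\<^esub> f') j \<odot>\<^bsub>M\<^esub> g j) =
      (\<Oplus>\<^bsub>M\<^esub>j\<in>{..<k}. f j \<odot>\<^bsub>M\<^esub> g j) \<oplus>\<^bsub>M\<^esub> (\<Oplus>\<^bsub>M\<^esub>j\<in>{..<k}. f' j \<odot>\<^bsub>M\<^esub> g j)"
      using f g by (simp add: M.M.finsum_addf Pi_def)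
  next
    fix s f assume s: "s \<in> carrier S" and "f \<in> carrier (free_module S {..<k})"
    then have f: "\<And>j. j < k \<Longrightarrow> f j \<in> carrier S" by (auto simp: free_module_def)
    have "(\<Oplus>\<^bsub>M\<^esub>j\<in>{..<k}. (s \<odot>\<^bsub>free_module S {..<k}\<^esub> f) j \<odot>\<^bsub>M\<^esub> g j) =
      (\<Oplus>\<^bsub>M\<^esub>j\<in>{..<k}. s \<odot>\<^bsub>M\<^esub> (f j \<odot>\<^bsub>M\<^esub> g j))"
      using f g s by (intro M.M.finsum_cong') (auto simp: free_module_def M.smult_assoc1)
    also have "\<dots> = s \<odot>\<^bsub>M\<^esub> (\<Oplus>\<^bsub>M\<^esub>j\<in>{..<k}. f j \<odot>\<^bsub>M\<^esub> g j)"
      using s f g by (intro module_hom_finsum[OF _ M M, of "\<lambda>x. s \<odot>\<^bsub>M\<^esub> x", symmetric])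
        (auto intro!: module_homI simp: M.smult_r_distr M.smult_assoc1[symmetric] M.R.m_comm)
    finally show "(\<Oplus>\<^bsub>M\<^esub>j\<in>{..<k}. (s \<odot>\<^bsub>free_module S {..<k}\<^esub> f) j \<odot>\<^bsub>M\<^esub> g j) =
      s \<odot>\<^bsub>M\<^esub> (\<Oplus>\<^bsub>M\<^esub>j\<in>{..<k}. f j \<odot>\<^bsub>M\<^esub> g j)" .
  next
    fix x assume x: "x \<in> carrier M"
    then show "(\<lambda>i\<in>{..<k}. l i x) \<in> carrier (free_module S {..<k})"
      using lh(1) by (auto simp: free_module_def)
    show "(\<Oplus>\<^bsub>M\<^esub>j\<in>{..<k}. (\<lambda>i\<in>{..<k}. l i x) j \<odot>\<^bsub>M\<^esub> g j) = x"
    proof -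
      have "(\<Oplus>\<^bsub>M\<^esub>j\<in>{..<k}. (\<lambda>i\<in>{..<k}. l i x) j \<odot>\<^bsub>M\<^esub> g j) = (\<Oplus>\<^bsub>M\<^esub>j\<in>{..<k}. l j x \<odot>\<^bsub>M\<^esub> g j)"
        using x g lh(1) by (intro M.M.finsum_cong') auto
      then show ?thesis using dual_basisD(3)[OF d x] by simp
    qed
  qed (auto simp: free_module_def fun_eq_iff lh(2,3))
qed

text \<open>
  The matrix of the endomorphism of \<open>S\<^sup>k\<close> that is \<open>\<phi>\<close> on \<open>M\<close> and the identity on the complement of \<open>M\<close>:
  it differs from the identity by \<open>\<phi> - id\<close>, composed with the projection to \<open>M\<close> and the inclusion.
\<close>

definition dual_det :: "('s, 'x) ring_scheme \<Rightarrow> ('s, 'm) module \<Rightarrow> nat \<Rightarrow> (nat \<Rightarrow> 'm \<Rightarrow> 's) \<Rightarrow> (nat \<Rightarrow> 'm) \<Rightarrow> ('m \<Rightarrow> 'm) \<Rightarrow> 's" where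
  "dual_det S M k l g \<phi> = matrix_det S k (\<lambda>i j. (if i = j then \<one>\<^bsub>S\<^esub> else \<zero>\<^bsub>S\<^esub>) \<oplus>\<^bsub>S\<^esub> l i (\<phi> (g j) \<ominus>\<^bsub>M\<^esub> g j))"

lemma minus_id_hom:
  assumes M: "module S M" and f: "\<phi> \<in> module_hom S M M"
  shows "(\<lambda>x. \<phi> x \<ominus>\<^bsub>M\<^esub> x) \<in> module_hom S M M"
proof -
  interpret M: module S M by fact
  show ?thesis
    by (rule module_homI)
      (auto simp: module_homD[OF f] a_minus_def M.minus_add M.a_ac M.smult_r_distr M.smult_r_minus)
qed

text \<open>
  With \<open>\<psi> = \<phi> - id\<close>, the matrix \<open>(l\<^sub>i(\<psi> g\<^sub>j))\<close> is the product of \<open>U = (l\<^sub>i(g'\<^sub>a))\<close> and \<open>V = (l'\<^sub>a(\<psi> g\<^sub>j))\<close>, while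
  \<open>V U\<close> is the matrix of \<open>\<psi>\<close> in the other dual basis. Hence the claim is \<open>det (1 + U V) = det (1 + V U)\<close>,
  which also allows the two bases to have different lengths.
\<close>

lemma dual_det_unique:
  assumes M: "module S M" and d: "dual_basis S M k l g" and d': "dual_basis S M k' l' g'"
    and f: "\<phi> \<in> module_hom S M M"
  shows "dual_det S M k l g \<phi> = dual_det S M k' l' g' \<phi>"
proof -
  interpret M: module S M by fact
  define \<psi> where "\<psi> x = \<phi> x \<ominus>\<^bsub>M\<^esub> x" for x
  have psi: "\<psi> \<in> module_hom S M M" unfolding \<psi>_def using minus_id_hom[OF M f] .
  note g = dual_basisD(2)[OF d] and g' = dual_basisD(2)[OF d']
  note l = dual_basisD(1)[OF d] and l' = dual_basisD(1)[OF d']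
  note lc = module_homD(1)[OF l, simplified] and lc' = module_homD(1)[OF l', simplified]
  note p = module_homD(1)[OF psi]
  have 1: "(\<Oplus>\<^bsub>S\<^esub>a\<in>{..<k'}. l i (g' a) \<otimes>\<^bsub>S\<^esub> l' a (\<psi> (g j))) = l i (\<psi> (g j))" if "i < k" "j < k" for i j
  proof -
    have "l i (\<psi> (g j)) = l i (\<Oplus>\<^bsub>M\<^esub>a\<in>{..<k'}. l' a (\<psi> (g j)) \<odot>\<^bsub>M\<^esub> g' a)"
      using dual_basisD(3)[OF d' p[OF g[OF that(2)]]] by simp
    also have "\<dots> = (\<Oplus>\<^bsub>S\<^esub>a\<in>{..<k'}. l' a (\<psi> (g j)) \<otimes>\<^bsub>S\<^esub> l i (g' a))"
      using that g g' lc' p by (intro linear_form_finsum[OF l[OF that(1)] M]) auto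
    also have "\<dots> = (\<Oplus>\<^bsub>S\<^esub>a\<in>{..<k'}. l i (g' a) \<otimes>\<^bsub>S\<^esub> l' a (\<psi> (g j)))"
      using that g g' lc lc' p by (intro M.R.finsum_cong') (auto simp: M.R.m_comm)
    finally show ?thesis by simp
  qed
  have 2: "(\<Oplus>\<^bsub>S\<^esub>i\<in>{..<k}. l' a (\<psi> (g i)) \<otimes>\<^bsub>S\<^esub> l i (g' b)) = l' a (\<psi> (g' b))" if "a < k'" "b < k'" for a b
  proof -
    have "\<psi> (g' b) = \<psi> (\<Oplus>\<^bsub>M\<^esub>i\<in>{..<k}. l i (g' b) \<odot>\<^bsub>M\<^esub> g i)"
      using dual_basisD(3)[OF d g'[OF that(2)]] by simp
    also have "\<dots> = (\<Oplus>\<^bsub>M\<^esub>i\<in>{..<k}. \<psi> (l i (g' b) \<odot>\<^bsub>M\<^esub> g i))"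
      using g lc[OF _ g'[OF that(2)]] by (intro module_hom_finsum[OF psi M M]) auto
    also have "\<dots> = (\<Oplus>\<^bsub>M\<^esub>i\<in>{..<k}. l i (g' b) \<odot>\<^bsub>M\<^esub> \<psi> (g i))"
      using g lc[OF _ g'[OF that(2)]] p by (intro M.M.finsum_cong') (auto simp: module_homD(3)[OF psi])
    finally have "l' a (\<psi> (g' b)) = l' a (\<Oplus>\<^bsub>M\<^esub>i\<in>{..<k}. l i (g' b) \<odot>\<^bsub>M\<^esub> \<psi> (g i))" by simp
    also have "\<dots> = (\<Oplus>\<^bsub>S\<^esub>i\<in>{..<k}. l i (g' b) \<otimes>\<^bsub>S\<^esub> l' a (\<psi> (g i)))"
      using g lc[OF _ g'[OF that(2)]] p by (intro linear_form_finsum[OF l'[OF that(1)] M]) auto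
    also have "\<dots> = (\<Oplus>\<^bsub>S\<^esub>i\<in>{..<k}. l' a (\<psi> (g i)) \<otimes>\<^bsub>S\<^esub> l i (g' b))"
      using that g g' lc lc' p by (intro M.R.finsum_cong') (auto simp: M.R.m_comm)
    finally show ?thesis by simp
  qed
  have "dual_det S M k l g \<phi> = matrix_det S k (\<lambda>i j. (if i = j then \<one>\<^bsub>S\<^esub> else \<zero>\<^bsub>S\<^esub>) \<oplus>\<^bsub>S\<^esub>
      (\<Oplus>\<^bsub>S\<^esub>a\<in>{..<k'}. l i (g' a) \<otimes>\<^bsub>S\<^esub> l' a (\<psi> (g j))))"
    unfolding dual_det_def \<psi>_def[symmetric] using g lc p by (intro M.R.matrix_det_cong) (auto simp: 1)
  also have "\<dots> = matrix_det S k' (\<lambda>a b. (if a = b then \<one>\<^bsub>S\<^esub> else \<zero>\<^bsub>S\<^esub>) \<oplus>\<^bsub>S\<^esub>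
      (\<Oplus>\<^bsub>S\<^esub>i\<in>{..<k}. l' a (\<psi> (g i)) \<otimes>\<^bsub>S\<^esub> l i (g' b)))"
    using g g' lc lc' p by (intro M.R.matrix_det_one_plus_mult_commute) auto
  also have "\<dots> = dual_det S M k' l' g' \<phi>"
    unfolding dual_det_def \<psi>_def[symmetric] using g' lc' p by (intro M.R.matrix_det_cong) (auto simp: 2)
  finally show ?thesis .
qed

text \<open>
  Every retraction of a free module onto \<open>M\<close> yields a dual basis, for which the defining matrix of the
  determinant is that of \<^const>\<open>dual_det\<close>. So all choices give the same value and the description is
  unique.
\<close>

lemma endo_det_eq:
  assumes M: "module S M" and d: "dual_basis S M k l g" and f: "\<phi> \<in> module_hom S M M"
  shows "endo_det S M \<phi> = dual_det S M k l g \<phi>"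
proof -
  interpret M: module S M by fact
  have *: "matrix_det S k' (\<lambda>i j. (free_basis S k' j i \<ominus>\<^bsub>S\<^esub> \<iota> (\<pi> (free_basis S k' j)) i)
        \<oplus>\<^bsub>S\<^esub> \<iota> (\<phi> (\<pi> (free_basis S k' j))) i) = dual_det S M k l g \<phi>"
    if r: "retract_of_free S M {..<k'} \<iota> \<pi>" for k' \<iota> \<pi>
  proof -
    let ?g = "\<lambda>j. \<pi> (free_basis S k' j)"
    have d': "dual_basis S M k' (\<lambda>i x. \<iota> x i) ?g" by (rule retract_dual_basis[OF M r])
    note li = module_homD[OF dual_basisD(1)[OF d'], simplified] and g' = dual_basisD(2)[OF d']
    have "matrix_det S k' (\<lambda>i j. (free_basis S k' j i \<ominus>\<^bsub>S\<^esub> \<iota> (?g j) i) \<oplus>\<^bsub>S\<^esub> \<iota> (\<phi> (?g j)) i) =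
        dual_det S M k' (\<lambda>i x. \<iota> x i) ?g \<phi>"
      unfolding dual_det_def
    proof (rule M.R.matrix_det_cong)
      fix i j assume ij: "i < k'" "j < k'"
      have fg: "\<phi> (?g j) \<in> carrier M" using module_homD(1)[OF f g'] ij by simp
      have "\<iota> (\<phi> (?g j) \<ominus>\<^bsub>M\<^esub> ?g j) i = \<iota> (\<phi> (?g j)) i \<oplus>\<^bsub>S\<^esub> \<iota> ((\<ominus>\<^bsub>S\<^esub> \<one>\<^bsub>S\<^esub>) \<odot>\<^bsub>M\<^esub> ?g j) i"
        using ij fg g' by (simp add: a_minus_def li M.smult_l_minus)
      also have "\<dots> = \<iota> (\<phi> (?g j)) i \<ominus>\<^bsub>S\<^esub> \<iota> (?g j) i"
        using ij fg g' li(1) by (simp add: li(3) a_minus_def M.R.l_minus)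
      finally have eq: "\<iota> (\<phi> (?g j) \<ominus>\<^bsub>M\<^esub> ?g j) i = \<iota> (\<phi> (?g j)) i \<ominus>\<^bsub>S\<^esub> \<iota> (?g j) i" .
      show "(if i = j then \<one>\<^bsub>S\<^esub> else \<zero>\<^bsub>S\<^esub>) \<oplus>\<^bsub>S\<^esub> \<iota> (\<phi> (?g j) \<ominus>\<^bsub>M\<^esub> ?g j) i \<in> carrier S"
        using ij fg g' li(1) by (simp add: eq)
      show "(free_basis S k' j i \<ominus>\<^bsub>S\<^esub> \<iota> (?g j) i) \<oplus>\<^bsub>S\<^esub> \<iota> (\<phi> (?g j)) i =
        (if i = j then \<one>\<^bsub>S\<^esub> else \<zero>\<^bsub>S\<^esub>) \<oplus>\<^bsub>S\<^esub> \<iota> (\<phi> (?g j) \<ominus>\<^bsub>M\<^esub> ?g j) i"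
        unfolding eq using ij fg g' li(1)[OF ij(1) fg] li(1)[OF ij(1) g'[OF ij(2)]]
        by (simp add: free_basis_def a_minus_def M.R.a_ac)
    qed
    then show ?thesis using dual_det_unique[OF M d' d f] by simp
  qed
  show ?thesis unfolding endo_det_def
  proof (rule the_equality)
    show "\<exists>k' \<iota> \<pi>. retract_of_free S M {..<k'} \<iota> \<pi> \<and> dual_det S M k l g \<phi> =
       matrix_det S k' (\<lambda>i j. (free_basis S k' j i \<ominus>\<^bsub>S\<^esub> \<iota> (\<pi> (free_basis S k' j)) i)
        \<oplus>\<^bsub>S\<^esub> \<iota> (\<phi> (\<pi> (free_basis S k' j))) i)"
      by (intro exI conjI, rule dual_basis_retract[OF M d], rule *[OF dual_basis_retract[OF M d], symmetric])
  next
    fix e assume "\<exists>k' \<iota> \<pi>. retract_of_free S M {..<k'} \<iota> \<pi> \<and> e =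
       matrix_det S k' (\<lambda>i j. (free_basis S k' j i \<ominus>\<^bsub>S\<^esub> \<iota> (\<pi> (free_basis S k' j)) i)
        \<oplus>\<^bsub>S\<^esub> \<iota> (\<phi> (\<pi> (free_basis S k' j))) i)"
    then obtain k' \<iota> \<pi> where r: "retract_of_free S M {..<k'} \<iota> \<pi>" and e: "e =
       matrix_det S k' (\<lambda>i j. (free_basis S k' j i \<ominus>\<^bsub>S\<^esub> \<iota> (\<pi> (free_basis S k' j)) i)
        \<oplus>\<^bsub>S\<^esub> \<iota> (\<phi> (\<pi> (free_basis S k' j))) i)" by (elim exE conjE)
    show "e = dual_det S M k l g \<phi>" unfolding e by (rule *[OF r])
  qed
qed

lemma dual_det_mult:
  assumes M: "module S M" and d: "dual_basis S M k l g"
    and f: "\<phi> \<in> module_hom S M M" and h: "\<psi> \<in> module_hom S M M"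
  shows "dual_det S M k l g (\<phi> \<circ> \<psi>) = dual_det S M k l g \<phi> \<otimes>\<^bsub>S\<^esub> dual_det S M k l g \<psi>"
proof -
  interpret M: module S M by fact
  let ?d = "\<lambda>i j. if i = j then \<one>\<^bsub>S\<^esub> else \<zero>\<^bsub>S\<^esub>"
  let ?U = "\<lambda>i j. ?d i j \<oplus>\<^bsub>S\<^esub> l i (\<phi> (g j) \<ominus>\<^bsub>M\<^esub> g j)"
  let ?V = "\<lambda>i j. ?d i j \<oplus>\<^bsub>S\<^esub> l i (\<psi> (g j) \<ominus>\<^bsub>M\<^esub> g j)"
  note g = dual_basisD(2)[OF d] and l = dual_basisD(1)[OF d]
  note lc = module_homD(1)[OF l, simplified] and ladd = module_homD(2)[OF l, simplified]
  note f' = minus_id_hom[OF M f]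
  have unit_entry: "((if b then \<one>\<^bsub>S\<^esub> else \<zero>\<^bsub>S\<^esub>) \<oplus>\<^bsub>S\<^esub> u) \<otimes>\<^bsub>S\<^esub> v = (if b then v else \<zero>\<^bsub>S\<^esub>) \<oplus>\<^bsub>S\<^esub> v \<otimes>\<^bsub>S\<^esub> u"
    if "v \<in> carrier S" "u \<in> carrier S" for b u v
    using that M.R.m_comm[of u v] by (cases b) (simp_all add: M.R.l_distr)
  have U: "?U i j \<in> carrier S" if "i < k" "j < k" for i j
    using that g lc module_homD(1)[OF f] by auto
  have V: "?V i j \<in> carrier S" if "i < k" "j < k" for i j
    using that g lc module_homD(1)[OF h] by auto
  have col: "(\<Oplus>\<^bsub>M\<^esub>a\<in>{..<k}. ?V a j \<odot>\<^bsub>M\<^esub> g a) = \<psi> (g j)" if j: "j < k" for j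
  proof -
    have pj: "\<psi> (g j) \<ominus>\<^bsub>M\<^esub> g j \<in> carrier M" using g[OF j] module_homD(1)[OF h] by simp
    have "(\<Oplus>\<^bsub>M\<^esub>a\<in>{..<k}. ?V a j \<odot>\<^bsub>M\<^esub> g a) =
      (\<Oplus>\<^bsub>M\<^esub>a\<in>{..<k}. (if j = a then g a else \<zero>\<^bsub>M\<^esub>) \<oplus>\<^bsub>M\<^esub> l a (\<psi> (g j) \<ominus>\<^bsub>M\<^esub> g j) \<odot>\<^bsub>M\<^esub> g a)"
      using g lc[OF _ pj] pj by (intro M.M.finsum_cong') (auto simp: M.smult_l_distr)
    also have "\<dots> = (\<Oplus>\<^bsub>M\<^esub>a\<in>{..<k}. if j = a then g a else \<zero>\<^bsub>M\<^esub>) \<oplus>\<^bsub>M\<^esub>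
        (\<Oplus>\<^bsub>M\<^esub>a\<in>{..<k}. l a (\<psi> (g j) \<ominus>\<^bsub>M\<^esub> g j) \<odot>\<^bsub>M\<^esub> g a)"
      using g lc[OF _ pj] by (intro M.M.finsum_addf) auto
    also have "(\<Oplus>\<^bsub>M\<^esub>a\<in>{..<k}. if j = a then g a else \<zero>\<^bsub>M\<^esub>) = g j"
      using g j by (intro M.M.finsum_singleton) auto
    also have "(\<Oplus>\<^bsub>M\<^esub>a\<in>{..<k}. l a (\<psi> (g j) \<ominus>\<^bsub>M\<^esub> g j) \<odot>\<^bsub>M\<^esub> g a) = \<psi> (g j) \<ominus>\<^bsub>M\<^esub> g j"
      by (rule dual_basisD(3)[OF d pj])
    also have "g j \<oplus>\<^bsub>M\<^esub> (\<psi> (g j) \<ominus>\<^bsub>M\<^esub> g j) = \<psi> (g j)"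
      using g[OF j] module_homD(1)[OF h] by (simp add: M.add_minus_cancel)
    finally show ?thesis .
  qed
  have "(\<Oplus>\<^bsub>S\<^esub>a\<in>{..<k}. ?U i a \<otimes>\<^bsub>S\<^esub> ?V a j) = ?d i j \<oplus>\<^bsub>S\<^esub> l i ((\<phi> \<circ> \<psi>) (g j) \<ominus>\<^bsub>M\<^esub> g j)"
    if i: "i < k" and j: "j < k" for i j
  proof -
    have pj: "\<psi> (g j) \<in> carrier M" using g[OF j] module_homD(1)[OF h] by simp
    have fpj: "\<phi> (\<psi> (g j)) \<in> carrier M" using pj module_homD(1)[OF f] by simp
    have fa: "\<And>a. a < k \<Longrightarrow> \<phi> (g a) \<ominus>\<^bsub>M\<^esub> g a \<in> carrier M" using g module_homD(1)[OF f] by simp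
    have "(\<Oplus>\<^bsub>S\<^esub>a\<in>{..<k}. ?U i a \<otimes>\<^bsub>S\<^esub> ?V a j) =
      (\<Oplus>\<^bsub>S\<^esub>a\<in>{..<k}. (if i = a then ?V a j else \<zero>\<^bsub>S\<^esub>) \<oplus>\<^bsub>S\<^esub> ?V a j \<otimes>\<^bsub>S\<^esub> l i (\<phi> (g a) \<ominus>\<^bsub>M\<^esub> g a))"
    proof (intro M.R.finsum_cong' refl)
      fix a assume "a \<in> {..<k}"
      then have "?V a j \<in> carrier S" "l i (\<phi> (g a) \<ominus>\<^bsub>M\<^esub> g a) \<in> carrier S" using V[OF _ j] lc[OF i fa] by auto
      then show "?U i a \<otimes>\<^bsub>S\<^esub> ?V a j = (if i = a then ?V a j else \<zero>\<^bsub>S\<^esub>) \<oplus>\<^bsub>S\<^esub> ?V a j \<otimes>\<^bsub>S\<^esub> l i (\<phi> (g a) \<ominus>\<^bsub>M\<^esub> g a)"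
        by (rule unit_entry)
    qed (use V[OF _ j] lc[OF i fa] in \<open>auto simp del: M.R.add.m_closed\<close>)
    also have "\<dots> = (\<Oplus>\<^bsub>S\<^esub>a\<in>{..<k}. if i = a then ?V a j else \<zero>\<^bsub>S\<^esub>) \<oplus>\<^bsub>S\<^esub>
        (\<Oplus>\<^bsub>S\<^esub>a\<in>{..<k}. ?V a j \<otimes>\<^bsub>S\<^esub> l i (\<phi> (g a) \<ominus>\<^bsub>M\<^esub> g a))"
      using V[OF _ j] lc[OF i fa] by (intro M.R.finsum_addf) (auto simp del: M.R.add.m_closed)
    also have "(\<Oplus>\<^bsub>S\<^esub>a\<in>{..<k}. if i = a then ?V a j else \<zero>\<^bsub>S\<^esub>) = ?V i j"
      using V[OF _ j] i by (intro M.R.finsum_singleton[of i "{..<k}" "\<lambda>a. ?V a j"]) (auto simp del: M.R.add.m_closed)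
    also have "(\<Oplus>\<^bsub>S\<^esub>a\<in>{..<k}. ?V a j \<otimes>\<^bsub>S\<^esub> l i (\<phi> (g a) \<ominus>\<^bsub>M\<^esub> g a)) =
        l i (\<Oplus>\<^bsub>M\<^esub>a\<in>{..<k}. ?V a j \<odot>\<^bsub>M\<^esub> (\<phi> (g a) \<ominus>\<^bsub>M\<^esub> g a))"
      using V[OF _ j] fa by (intro linear_form_finsum[OF l[OF i] M, symmetric]) (auto simp del: M.R.add.m_closed)
    also have "(\<Oplus>\<^bsub>M\<^esub>a\<in>{..<k}. ?V a j \<odot>\<^bsub>M\<^esub> (\<phi> (g a) \<ominus>\<^bsub>M\<^esub> g a)) =
        (\<Oplus>\<^bsub>M\<^esub>a\<in>{..<k}. \<phi> (?V a j \<odot>\<^bsub>M\<^esub> g a) \<ominus>\<^bsub>M\<^esub> ?V a j \<odot>\<^bsub>M\<^esub> g a)"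
    proof (intro M.M.finsum_cong' refl)
      fix a assume "a \<in> {..<k}"
      then have "?V a j \<in> carrier S" "g a \<in> carrier M" using V[OF _ j] g by auto
      then show "?V a j \<odot>\<^bsub>M\<^esub> (\<phi> (g a) \<ominus>\<^bsub>M\<^esub> g a) = \<phi> (?V a j \<odot>\<^bsub>M\<^esub> g a) \<ominus>\<^bsub>M\<^esub> ?V a j \<odot>\<^bsub>M\<^esub> g a"
        using module_homD(3)[OF f', of "?V a j" "g a"] by simp
    next
      show "(\<lambda>a. \<phi> (?V a j \<odot>\<^bsub>M\<^esub> g a) \<ominus>\<^bsub>M\<^esub> ?V a j \<odot>\<^bsub>M\<^esub> g a) \<in> {..<k} \<rightarrow> carrier M"
        using V[OF _ j] g module_homD(1)[OF f] by (auto simp del: M.R.add.m_closed)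
    qed simp
    also have "\<dots> = \<phi> (\<psi> (g j)) \<ominus>\<^bsub>M\<^esub> \<psi> (g j)"
      using V[OF _ j] g by (subst module_hom_finsum[OF f' M M, symmetric]) (auto simp: col[OF j] simp del: M.R.add.m_closed)
    also have "?V i j \<oplus>\<^bsub>S\<^esub> l i (\<phi> (\<psi> (g j)) \<ominus>\<^bsub>M\<^esub> \<psi> (g j)) =
      ?d i j \<oplus>\<^bsub>S\<^esub> l i ((\<psi> (g j) \<ominus>\<^bsub>M\<^esub> g j) \<oplus>\<^bsub>M\<^esub> (\<phi> (\<psi> (g j)) \<ominus>\<^bsub>M\<^esub> \<psi> (g j)))"
      using pj fpj g[OF j] lc[OF i] by (simp add: ladd[OF i] M.R.a_assoc)
    also have "(\<psi> (g j) \<ominus>\<^bsub>M\<^esub> g j) \<oplus>\<^bsub>M\<^esub> (\<phi> (\<psi> (g j)) \<ominus>\<^bsub>M\<^esub> \<psi> (g j)) = (\<phi> \<circ> \<psi>) (g j) \<ominus>\<^bsub>M\<^esub> g j"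
      using M.minus_telescope[OF g[OF j] pj fpj] by simp
    finally show ?thesis .
  qed
  note entry = this
  have "dual_det S M k l g (\<phi> \<circ> \<psi>) = matrix_det S k (\<lambda>i j. \<Oplus>\<^bsub>S\<^esub>a\<in>{..<k}. ?U i a \<otimes>\<^bsub>S\<^esub> ?V a j)"
    unfolding dual_det_def
  proof (rule M.R.matrix_det_cong)
    fix i j assume ij: "i < k" "j < k"
    show "?d i j \<oplus>\<^bsub>S\<^esub> l i ((\<phi> \<circ> \<psi>) (g j) \<ominus>\<^bsub>M\<^esub> g j) = (\<Oplus>\<^bsub>S\<^esub>a\<in>{..<k}. ?U i a \<otimes>\<^bsub>S\<^esub> ?V a j)"
      by (rule entry[OF ij, symmetric])
    show "(\<Oplus>\<^bsub>S\<^esub>a\<in>{..<k}. ?U i a \<otimes>\<^bsub>S\<^esub> ?V a j) \<in> carrier S"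
      using U[OF ij(1)] V[OF _ ij(2)] by (intro M.R.finsum_closed) (auto simp del: M.R.add.m_closed)
  qed
  also have "\<dots> = matrix_det S k ?U \<otimes>\<^bsub>S\<^esub> matrix_det S k ?V"
    using U V by (intro M.R.matrix_det_mult)
  finally show ?thesis by (simp add: dual_det_def)
qed

section \<open>Base change of dual bases\<close>

text \<open>
  Of the coordinate forms of an embedding into a free module only finitely many are nonzero on the
  generators, and the others vanish on the whole module.
\<close>

lemma finitely_generated_projective_dual_basis:
  fixes M :: "('r, 'm) module"
  assumes M: "module R M" and fg: "finitely_generated_module R M" and pr: "projective_module R M"
  shows "\<exists>k l g. dual_basis R M k l g"
proof -
  interpret M: module R M by fact
  obtain G where G: "finite G" "G \<subseteq> carrier M"
    and gen: "\<forall>y\<in>carrier M. \<exists>c\<in>G \<rightarrow> carrier R. y = (\<Oplus>\<^bsub>M\<^esub>x\<in>G. c x \<odot>\<^bsub>M\<^esub> x)"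
    using fg unfolding finitely_generated_module_def by (elim exE conjE)
  obtain I :: "'m set" and \<iota> \<pi> where r: "retract_of_free R M I \<iota> \<pi>" using pr unfolding projective_module_def by (elim exE)
  let ?F = "free_module R I"
  let ?e = "\<lambda>j. \<lambda>i\<in>I. if i = j then \<one>\<^bsub>R\<^esub> else \<zero>\<^bsub>R\<^esub>"
  have i: "\<iota> \<in> module_hom R M ?F" and p: "\<pi> \<in> module_hom R ?F M" and pi: "\<And>x. x \<in> carrier M \<Longrightarrow> \<pi> (\<iota> x) = x"
    using r by (auto simp: retract_of_free_def)
  have e: "?e j \<in> carrier ?F" for j
    by (auto simp: free_module_def intro: finite_subset[of _ "{j}"])
  have form: "(\<lambda>x. \<iota> x j) \<in> linear_forms R M" if "j \<in> I" for j
  proof (rule module_homI)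
    show "x \<in> carrier M \<Longrightarrow> \<iota> x j \<in> carrier (self_algebra R)" for x
      using module_homD(1)[OF i] that by (auto simp: free_module_def)
  qed (use that in \<open>simp_all add: module_homD(2,3)[OF i], simp_all add: free_module_def\<close>)
  define J where "J = (\<Union>x\<in>G. {j \<in> I. \<iota> x j \<noteq> \<zero>\<^bsub>R\<^esub>})"
  have J: "finite J" "J \<subseteq> I"
    using G module_homD(1)[OF i] by (auto simp: J_def free_module_def)
  have zero: "\<iota> y j = \<zero>\<^bsub>R\<^esub>" if y: "y \<in> carrier M" and j: "j \<in> I - J" for y j
  proof -
    obtain c where c: "c \<in> G \<rightarrow> carrier R" "y = (\<Oplus>\<^bsub>M\<^esub>x\<in>G. c x \<odot>\<^bsub>M\<^esub> x)" using bspec[OF gen y] by (elim bexE)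
    have "\<iota> y j = (\<Oplus>\<^bsub>R\<^esub>x\<in>G. c x \<otimes>\<^bsub>R\<^esub> \<iota> x j)"
      unfolding c(2) using c(1) G j by (intro linear_form_finsum[OF form M]) auto
    also have "\<dots> = (\<Oplus>\<^bsub>R\<^esub>x\<in>G. \<zero>\<^bsub>R\<^esub>)"
      using funcset_mem[OF c(1)] G j by (intro M.R.finsum_cong') (auto simp: J_def)
    finally show ?thesis by simp
  qed
  obtain h where h: "bij_betw h {..<card J} J"
    using ex_bij_betw_nat_finite[OF J(1)] by (auto simp: lessThan_atLeast0)
  then have hJ: "h j \<in> J" if "j < card J" for j using that by (auto simp: bij_betw_def)
  have "dual_basis R M (card J) (\<lambda>j x. \<iota> x (h j)) (\<lambda>j. \<pi> (?e (h j)))"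
    unfolding dual_basis_def
  proof (intro conjI allI impI ballI)
    show "(\<lambda>x. \<iota> x (h j)) \<in> linear_forms R M" if "j < card J" for j using hJ[OF that] J by (intro form) auto
    show "\<pi> (?e (h j)) \<in> carrier M" for j by (rule module_homD(1)[OF p e])
    fix x assume x: "x \<in> carrier M"
    have t: "\<iota> x j \<odot>\<^bsub>M\<^esub> \<pi> (?e j) \<in> carrier M" if "j \<in> J" for j
      using module_homD(1)[OF form x, of j] module_homD(1)[OF p e, of j] that J by (intro M.smult_closed) auto
    have "x = \<pi> (\<iota> x)" using pi[OF x] by simp
    also have "\<dots> = (\<Oplus>\<^bsub>M\<^esub>j\<in>J. \<iota> x j \<odot>\<^bsub>M\<^esub> \<pi> (?e j))"
      by (rule free_module_hom_expand[OF M p J module_homD(1)[OF i x] zero[OF x]])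
    also have "J = h ` {..<card J}" using h by (simp add: bij_betw_def)
    also have "(\<Oplus>\<^bsub>M\<^esub>j\<in>h ` {..<card J}. \<iota> x j \<odot>\<^bsub>M\<^esub> \<pi> (?e j)) = (\<Oplus>\<^bsub>M\<^esub>j\<in>{..<card J}. \<iota> x (h j) \<odot>\<^bsub>M\<^esub> \<pi> (?e (h j)))"
      using h t by (intro M.M.finsum_reindex) (auto simp: bij_betw_def simp del: restrict_apply)
    finally show "x = (\<Oplus>\<^bsub>M\<^esub>j\<in>{..<card J}. \<iota> x (h j) \<odot>\<^bsub>M\<^esub> \<pi> (?e (h j)))" .
  qed
  then show ?thesis by blast
qed

definition base_form :: "('r, 'x) ring_scheme \<Rightarrow> ('r, 'm) module \<Rightarrow> ('r, 's) module \<Rightarrow> ('m \<Rightarrow> 'r) \<Rightarrow>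
    ('m \<times> 's) multiset set \<Rightarrow> 's" where
  "base_form R M S l = (SOME l'. l' \<in> linear_forms S (tensor R M S) \<and>
     (\<forall>x\<in>carrier M. \<forall>s\<in>carrier S. l' (pure_tensor R M S x s) = l x \<odot>\<^bsub>S\<^esub> s))"

context base_change
begin

lemma base_form:
  assumes "l \<in> linear_forms R M"
  shows "base_form R M S l \<in> linear_forms S T"
    and "x \<in> carrier M \<Longrightarrow> s \<in> carrier S \<Longrightarrow> base_form R M S l (pure x s) = l x \<odot>\<^bsub>S\<^esub> s"
proof -
  have "\<exists>l'. l' \<in> linear_forms S T \<and> (\<forall>x\<in>carrier M. \<forall>s\<in>carrier S. l' (pure x s) = l x \<odot>\<^bsub>S\<^esub> s)"
    by (rule linear_form_lift[OF assms]) blast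
  from someI_ex[OF this]
  have *: "base_form R M S l \<in> linear_forms S T \<and>
      (\<forall>x\<in>carrier M. \<forall>s\<in>carrier S. base_form R M S l (pure x s) = l x \<odot>\<^bsub>S\<^esub> s)"
    unfolding base_form_def .
  then show "base_form R M S l \<in> linear_forms S T" by simp
  show "base_form R M S l (pure x s) = l x \<odot>\<^bsub>S\<^esub> s" if "x \<in> carrier M" "s \<in> carrier S"
    using * that by simp
qed

lemma base_form_zero: "l \<in> linear_forms R M \<Longrightarrow> base_form R M S l \<zero>\<^bsub>T\<^esub> = \<zero>\<^bsub>S\<^esub>"
  using module_hom_zero[OF base_form(1) tensor_module algebra_facts(2)[OF self_algebra_algebra[OF S.is_cring]]]
  by simp

lemma pure_finsum:
  assumes "finite I" "\<And>j. j \<in> I \<Longrightarrow> f j \<in> carrier M" and s: "s \<in> carrier S"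
  shows "pure (\<Oplus>\<^bsub>M\<^esub>j\<in>I. f j) s = (\<Oplus>\<^bsub>T\<^esub>j\<in>I. pure (f j) s)"
  using assms(1,2)
proof (induction I)
  case (insert j I)
  then have "(\<Oplus>\<^bsub>M\<^esub>i\<in>I. f i) \<in> carrier M" by (auto intro!: M.finsum_closed)
  then show ?case using insert s by (simp add: pure_add_left pure_closed Pi_def)
qed (simp add: pure_zero_left s)

lemma dual_basis_base_change:
  assumes d: "dual_basis R M k l g"
  shows "dual_basis S T k (\<lambda>i. base_form R M S (l i)) (\<lambda>j. pure (g j) \<one>\<^bsub>S\<^esub>)"
proof -
  note l = dual_basisD(1)[OF d] and g = dual_basisD(2)[OF d]
  note lc = module_homD(1)[OF l, simplified]
  note bf = base_form[OF l]
  note bfc = module_homD(1)[OF bf(1), simplified] and bfa = module_homD(2)[OF bf(1), simplified]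
  have "a = (\<Oplus>\<^bsub>T\<^esub>j\<in>{..<k}. base_form R M S (l j) a \<odot>\<^bsub>T\<^esub> pure (g j) \<one>\<^bsub>S\<^esub>)" if "a \<in> carrier T" for a
    using that
  proof (induction rule: tensor_induct)
    case zero
    have "(\<Oplus>\<^bsub>T\<^esub>j\<in>{..<k}. base_form R M S (l j) \<zero>\<^bsub>T\<^esub> \<odot>\<^bsub>T\<^esub> pure (g j) \<one>\<^bsub>S\<^esub>) = (\<Oplus>\<^bsub>T\<^esub>j\<in>{..<k}. \<zero>\<^bsub>T\<^esub>)"
      using g by (intro tensor.finsum_cong') (auto simp: base_form_zero[OF l] zero_smult pure_closed)
    then show ?case by simp
  next
    case (add a b)
    have "(\<Oplus>\<^bsub>T\<^esub>j\<in>{..<k}. base_form R M S (l j) (a \<oplus>\<^bsub>T\<^esub> b) \<odot>\<^bsub>T\<^esub> pure (g j) \<one>\<^bsub>S\<^esub>) =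
      (\<Oplus>\<^bsub>T\<^esub>j\<in>{..<k}. base_form R M S (l j) a \<odot>\<^bsub>T\<^esub> pure (g j) \<one>\<^bsub>S\<^esub> \<oplus>\<^bsub>T\<^esub> base_form R M S (l j) b \<odot>\<^bsub>T\<^esub> pure (g j) \<one>\<^bsub>S\<^esub>)"
      using g add(1,2) bfc
      by (intro tensor.finsum_cong') (auto simp: bfa add_smult pure_closed smult_closed)
    also have "\<dots> = (\<Oplus>\<^bsub>T\<^esub>j\<in>{..<k}. base_form R M S (l j) a \<odot>\<^bsub>T\<^esub> pure (g j) \<one>\<^bsub>S\<^esub>) \<oplus>\<^bsub>T\<^esub> (\<Oplus>\<^bsub>T\<^esub>j\<in>{..<k}. base_form R M S (l j) b \<odot>\<^bsub>T\<^esub> pure (g j) \<one>\<^bsub>S\<^esub>)"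
      using g add(1,2) bfc by (intro tensor.finsum_addf) (auto simp: pure_closed smult_closed)
    finally show ?case using add(3,4) by simp
  next
    case (pure x s)
    have "pure x s = pure (\<Oplus>\<^bsub>M\<^esub>j\<in>{..<k}. l j x \<odot>\<^bsub>M\<^esub> g j) s"
      using dual_basisD(3)[OF d pure(1)] by simp
    also have "\<dots> = (\<Oplus>\<^bsub>T\<^esub>j\<in>{..<k}. pure (l j x \<odot>\<^bsub>M\<^esub> g j) s)"
      using lc g pure by (intro pure_finsum) auto
    also have "\<dots> = (\<Oplus>\<^bsub>T\<^esub>j\<in>{..<k}. base_form R M S (l j) (pure x s) \<odot>\<^bsub>T\<^esub> pure (g j) \<one>\<^bsub>S\<^esub>)"
      using lc g pure by (intro tensor.finsum_cong') (auto simp: bf(2) smult_pure pure_smult pure_closed)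
    finally show ?case .
  qed
  then show ?thesis unfolding dual_basis_def using bf(1) g by (auto intro: pure_closed)
qed

end

lemma base_form_natural:
  assumes M: "module R M" and S: "algebra R S" and U: "algebra R U" and h: "h \<in> alg_hom R S U"
    and l: "l \<in> linear_forms R M" and a: "a \<in> carrier (tensor R M S)"
  shows "h (base_form R M S l a) = base_form R M U l (tensor_map R M U id h a)"
proof -
  interpret A: base_change_map R M S M U id h
    by (rule base_change_mapI[OF M S M U module_hom_id alg_hom_module_hom[OF h]])
  note bf = module_homD(1,2)[OF A.base_form(1)[OF l], simplified]
  note bf' = module_homD(1,2)[OF A.target.base_form(1)[OF l], simplified]
  show ?thesis using a
    by (induction rule: A.tensor_induct)
      (simp_all add: id_def[symmetric] A.base_form_zero[OF l] A.target.base_form_zero[OF l] A.tm_zero alg_hom_zero[OF h S U]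
        A.tm_pure A.base_form(2)[OF l] A.target.base_form(2)[OF l] alg_homD[OF h] module_homD(1)[OF l, simplified]
        A.tm_add bf bf' A.tm_closed)
qed

section \<open>The norm\<close>

lemma (in algebra_base_change) mult_left_hom:
  "a \<in> carrier T \<Longrightarrow> (\<lambda>x. a \<otimes>\<^bsub>T\<^esub> x) \<in> module_hom S T T"
  by (rule module_homI)
    (simp_all add: mult_closed mult_add_right mult_comm[of a] smult_closed smult_mult_assoc)

locale dual_basis_algebra =
  fixes R :: "('r, 'x) ring_scheme" and A :: "('r, 'a) module" and k l g
  assumes alg_A: "algebra R A" and dual: "dual_basis R A k l g"
begin

lemmas l = dual_basisD(1)[OF dual] and g = dual_basisD(2)[OF dual]

lemma bc: "algebra R S \<Longrightarrow> algebra_base_change R A S"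
  by (simp add: algebra_base_change_def alg_A)

lemma norm_eq:
  assumes S: "algebra R S" and a: "a \<in> carrier (tensor R A S)"
  shows "algebra_norm R A S a = dual_det S (tensor R A S) k (\<lambda>i. base_form R A S (l i))
    (\<lambda>j. pure_tensor R A S (g j) \<one>\<^bsub>S\<^esub>) (\<lambda>x. a \<otimes>\<^bsub>tensor R A S\<^esub> x)"
proof -
  interpret B: algebra_base_change R A S using S by (rule bc)
  show ?thesis unfolding algebra_norm_def
    by (rule endo_det_eq[OF B.tensor_module B.dual_basis_base_change[OF dual] B.mult_left_hom[OF a]])
qed

lemma norm_closed:
  assumes S: "algebra R S" and a: "a \<in> carrier (tensor R A S)"
  shows "algebra_norm R A S a \<in> carrier S"
proof -
  interpret B: algebra_base_change R A S using S by (rule bc)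
  note bf = module_homD(1)[OF B.base_form(1)[OF l], simplified]
  show ?thesis unfolding norm_eq[OF S a] dual_det_def
    using a g bf by (intro B.S.matrix_det_closed) (auto simp: B.pure_closed)
qed

lemma norm_mult:
  assumes S: "algebra R S" and a: "a \<in> carrier (tensor R A S)" and b: "b \<in> carrier (tensor R A S)"
  shows "algebra_norm R A S (a \<otimes>\<^bsub>tensor R A S\<^esub> b) = algebra_norm R A S a \<otimes>\<^bsub>S\<^esub> algebra_norm R A S b"
proof -
  interpret B: algebra_base_change R A S using S by (rule bc)
  note d = B.dual_basis_base_change[OF dual]
  let ?T = "tensor R A S"
  have "dual_det S ?T k (\<lambda>i. base_form R A S (l i)) (\<lambda>j. pure_tensor R A S (g j) \<one>\<^bsub>S\<^esub>) (\<lambda>x. a \<otimes>\<^bsub>?T\<^esub> b \<otimes>\<^bsub>?T\<^esub> x) =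
      dual_det S ?T k (\<lambda>i. base_form R A S (l i)) (\<lambda>j. pure_tensor R A S (g j) \<one>\<^bsub>S\<^esub>) ((\<lambda>x. a \<otimes>\<^bsub>?T\<^esub> x) \<circ> (\<lambda>x. b \<otimes>\<^bsub>?T\<^esub> x))"
    unfolding dual_det_def using a b g module_homD(1)[OF B.base_form(1)[OF l], simplified]
    by (intro B.S.matrix_det_cong) (auto simp: B.pure_closed B.mult_assoc B.mult_closed)
  then show ?thesis
    using dual_det_mult[OF B.tensor_module d B.mult_left_hom[OF a] B.mult_left_hom[OF b]]
    by (simp add: norm_eq S a b B.mult_closed)
qed

lemma norm_hom:
  assumes S: "algebra R S" and U: "algebra R U" and h: "h \<in> alg_hom R S U"
    and a: "a \<in> carrier (tensor R A S)"
  shows "h (algebra_norm R A S a) = algebra_norm R A U (tensor_map R A U id h a)"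
proof -
  interpret B: algebra_base_change_map R A S A U id h
    by (rule algebra_base_change_mapI[OF alg_A S alg_A U alg_hom_id h])
  interpret h: ring_hom_cring S U h by unfold_locales (rule alg_homD(6)[OF h])
  note bf = module_homD(1)[OF B.base_form(1)[OF l], simplified]
  let ?y = "\<lambda>j. a \<otimes>\<^bsub>B.T\<^esub> B.pure (g j) \<one>\<^bsub>S\<^esub> \<ominus>\<^bsub>B.T\<^esub> B.pure (g j) \<one>\<^bsub>S\<^esub>"
  have y: "?y j \<in> carrier B.T" if "j < k" for j
    using a g[OF that] by (simp add: B.pure_closed)
  have ty: "B.tm (?y j) = B.tm a \<otimes>\<^bsub>B.target.T\<^esub> B.target.pure (g j) \<one>\<^bsub>U\<^esub> \<ominus>\<^bsub>B.target.T\<^esub> B.target.pure (g j) \<one>\<^bsub>U\<^esub>" if "j < k" for j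
  proof -
    have t: "B.tm (B.pure (g j) \<one>\<^bsub>S\<^esub>) = B.target.pure (g j) \<one>\<^bsub>U\<^esub>" using g[OF that] by (subst B.tm_pure) simp_all
    have p: "B.pure (g j) \<one>\<^bsub>S\<^esub> \<in> carrier B.T" using g[OF that] by (simp add: B.pure_closed)
    show ?thesis unfolding a_minus_def using a p by (simp only: B.tm.hom_add B.tm.hom_a_inv B.tm_mult B.mult_closed B.tensor.a_inv_closed t)
  qed
  have "h (algebra_norm R A S a) = matrix_det U k (\<lambda>i j. h ((if i = j then \<one>\<^bsub>S\<^esub> else \<zero>\<^bsub>S\<^esub>) \<oplus>\<^bsub>S\<^esub> base_form R A S (l i) (?y j)))"
    unfolding norm_eq[OF S a] dual_det_def
    using bf y by (intro matrix_det_hom B.S.is_cring B.target.S.is_cring alg_homD(6)[OF h]) auto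
  also have "\<dots> = algebra_norm R A U (B.tm a)"
    unfolding norm_eq[OF U B.tm_closed[OF a]] dual_det_def
  proof (rule B.target.S.matrix_det_cong)
    fix i j assume ij: "i < k" "j < k"
    have "h (base_form R A S (l i) (?y j)) = base_form R A U (l i) (B.tm (?y j))"
      by (rule base_form_natural[OF B.module_M S U h l[OF ij(1)] y[OF ij(2)]])
    then show *: "h ((if i = j then \<one>\<^bsub>S\<^esub> else \<zero>\<^bsub>S\<^esub>) \<oplus>\<^bsub>S\<^esub> base_form R A S (l i) (?y j)) =
        (if i = j then \<one>\<^bsub>U\<^esub> else \<zero>\<^bsub>U\<^esub>) \<oplus>\<^bsub>U\<^esub> base_form R A U (l i)
          (B.tm a \<otimes>\<^bsub>B.target.T\<^esub> B.target.pure (g j) \<one>\<^bsub>U\<^esub> \<ominus>\<^bsub>B.target.T\<^esub> B.target.pure (g j) \<one>\<^bsub>U\<^esub>)"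
      using bf[OF ij(1) y[OF ij(2)]] by (simp add: ty[OF ij(2)])
    show "(if i = j then \<one>\<^bsub>U\<^esub> else \<zero>\<^bsub>U\<^esub>) \<oplus>\<^bsub>U\<^esub> base_form R A U (l i)
          (B.tm a \<otimes>\<^bsub>B.target.T\<^esub> B.target.pure (g j) \<one>\<^bsub>U\<^esub> \<ominus>\<^bsub>B.target.T\<^esub> B.target.pure (g j) \<one>\<^bsub>U\<^esub>) \<in> carrier U"
      unfolding *[symmetric] using bf[OF ij(1) y[OF ij(2)]] by simp
  qed
  finally show ?thesis .
qed

text \<open>
  Over \<open>L\<close> the algebra has a basis of \<open>n\<close> elements. Expanding the dual basis in this basis and conversely
  writes the idempotent matrix \<open>(l\<^sub>i(g\<^sub>j))\<close> as \<open>U V\<close> with \<open>V U\<close> the identity matrix of size \<open>n\<close>.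
\<close>

lemma local_trace_factorization:
  assumes P: "algebra R L" and fr: "free_of_rank L (tensor R A L) n"
  obtains U V where "\<And>i a. i < k \<Longrightarrow> a < n \<Longrightarrow> U i a \<in> carrier L" "\<And>a j. a < n \<Longrightarrow> j < k \<Longrightarrow> V a j \<in> carrier L"
    "\<And>i j. i < k \<Longrightarrow> j < k \<Longrightarrow> (\<Oplus>\<^bsub>L\<^esub>a\<in>{..<n}. U i a \<otimes>\<^bsub>L\<^esub> V a j) = l i (g j) \<odot>\<^bsub>L\<^esub> \<one>\<^bsub>L\<^esub>"
    "\<And>a b. a < n \<Longrightarrow> b < n \<Longrightarrow> (\<Oplus>\<^bsub>L\<^esub>i\<in>{..<k}. V a i \<otimes>\<^bsub>L\<^esub> U i b) = (if a = b then \<one>\<^bsub>L\<^esub> else \<zero>\<^bsub>L\<^esub>)"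
proof -
  interpret B: algebra_base_change R A L using P by (rule bc)
  let ?T = "tensor R A L" and ?F = "free_module L {..<n}"
  interpret T: module L ?T by (rule B.tensor_module)
  let ?l = "\<lambda>i. base_form R A L (l i)" and ?g = "\<lambda>j. pure_tensor R A L (g j) \<one>\<^bsub>L\<^esub>"
  have d: "dual_basis L ?T k ?l ?g" by (rule B.dual_basis_base_change[OF dual])
  obtain h where h: "h \<in> module_hom L ?T ?F" and bij: "bij_betw h (carrier ?T) (carrier ?F)"
    using fr unfolding free_of_rank_def by (elim bexE)
  define p where "p = inv_into (carrier ?T) h"
  have ph: "p (h x) = x" if "x \<in> carrier ?T" for x
    using that bij by (auto simp: p_def bij_betw_def)
  have hp: "h (p y) = y" and pc: "p y \<in> carrier ?T" if "y \<in> carrier ?F" for y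
    using that bij unfolding p_def by (auto simp: bij_betw_def f_inv_into_f intro: inv_into_into)
  have "p \<in> module_hom L ?F ?T"
  proof (rule module_homI)
    fix x y assume x: "x \<in> carrier ?F" and y: "y \<in> carrier ?F"
    show "p x \<in> carrier ?T" using x by (rule pc)
    have "p (x \<oplus>\<^bsub>?F\<^esub> y) = p (h (p x \<oplus>\<^bsub>?T\<^esub> p y))"
      using x y by (simp add: module_homD(2)[OF h] pc hp)
    then show "p (x \<oplus>\<^bsub>?F\<^esub> y) = p x \<oplus>\<^bsub>?T\<^esub> p y" using x y by (simp add: ph pc)
  next
    fix s x assume s: "s \<in> carrier L" and x: "x \<in> carrier ?F"
    have "p (s \<odot>\<^bsub>?F\<^esub> x) = p (h (s \<odot>\<^bsub>?T\<^esub> p x))"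
      using s x by (simp add: module_homD(3)[OF h] pc hp)
    then show "p (s \<odot>\<^bsub>?F\<^esub> x) = s \<odot>\<^bsub>?T\<^esub> p x" using s x by (simp add: ph pc)
  qed
  then have r: "retract_of_free L ?T {..<n} h p" using h ph by (simp add: retract_of_free_def)
  let ?l' = "\<lambda>a x. h x a" and ?g' = "\<lambda>b. p (free_basis L n b)"
  have d': "dual_basis L ?T n ?l' ?g'" by (rule retract_dual_basis[OF B.tensor_module r])
  note lc = module_homD(1)[OF dual_basisD(1)[OF d], simplified] and lc' = module_homD(1)[OF dual_basisD(1)[OF d'], simplified]
  note gc = dual_basisD(2)[OF d] and gc' = dual_basisD(2)[OF d']
  have fb: "free_basis L n b \<in> carrier ?F" for b by (auto simp: free_module_def free_basis_def)
  show ?thesis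
  proof (rule that[of "\<lambda>i a. ?l i (?g' a)" "\<lambda>a j. ?l' a (?g j)"])
    fix i a assume "i < k" "a < n" then show "?l i (?g' a) \<in> carrier L" "?l' a (?g i) \<in> carrier L"
      using lc gc' lc' gc by auto
  next
    fix i j assume ij: "i < k" "j < k"
    have "l i (g j) \<odot>\<^bsub>L\<^esub> \<one>\<^bsub>L\<^esub> = ?l i (?g j)" using ij g by (simp add: B.base_form(2)[OF l])
    also have "\<dots> = ?l i (\<Oplus>\<^bsub>?T\<^esub>a\<in>{..<n}. ?l' a (?g j) \<odot>\<^bsub>?T\<^esub> ?g' a)"
      using dual_basisD(3)[OF d' gc[OF ij(2)]] by simp
    also have "\<dots> = (\<Oplus>\<^bsub>L\<^esub>a\<in>{..<n}. ?l' a (?g j) \<otimes>\<^bsub>L\<^esub> ?l i (?g' a))"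
      using ij lc' gc gc' by (intro linear_form_finsum[OF dual_basisD(1)[OF d] B.tensor_module]) auto
    also have "\<dots> = (\<Oplus>\<^bsub>L\<^esub>a\<in>{..<n}. ?l i (?g' a) \<otimes>\<^bsub>L\<^esub> ?l' a (?g j))"
      using ij lc lc' gc gc' by (intro B.S.finsum_cong') (auto simp: B.S.m_comm)
    finally show "(\<Oplus>\<^bsub>L\<^esub>a\<in>{..<n}. ?l i (?g' a) \<otimes>\<^bsub>L\<^esub> ?l' a (?g j)) = l i (g j) \<odot>\<^bsub>L\<^esub> \<one>\<^bsub>L\<^esub>" by simp
  next
    fix a b assume ab: "a < n" "b < n"
    have "(if a = b then \<one>\<^bsub>L\<^esub> else \<zero>\<^bsub>L\<^esub>) = ?l' a (?g' b)" using ab by (simp add: hp fb) (simp add: free_basis_def)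
    also have "\<dots> = ?l' a (\<Oplus>\<^bsub>?T\<^esub>i\<in>{..<k}. ?l i (?g' b) \<odot>\<^bsub>?T\<^esub> ?g i)"
      using dual_basisD(3)[OF d gc'[OF ab(2)]] by simp
    also have "\<dots> = (\<Oplus>\<^bsub>L\<^esub>i\<in>{..<k}. ?l i (?g' b) \<otimes>\<^bsub>L\<^esub> ?l' a (?g i))"
      using ab lc gc gc' by (intro linear_form_finsum[OF dual_basisD(1)[OF d'] B.tensor_module]) auto
    also have "\<dots> = (\<Oplus>\<^bsub>L\<^esub>i\<in>{..<k}. ?l' a (?g i) \<otimes>\<^bsub>L\<^esub> ?l i (?g' b))"
      using ab lc lc' gc gc' by (intro B.S.finsum_cong') (auto simp: B.S.m_comm)
    finally show "(\<Oplus>\<^bsub>L\<^esub>i\<in>{..<k}. ?l' a (?g i) \<otimes>\<^bsub>L\<^esub> ?l i (?g' b)) = (if a = b then \<one>\<^bsub>L\<^esub> else \<zero>\<^bsub>L\<^esub>)" by simp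
  qed
qed

text \<open>
  The norm of the scalar \<open>X\<close> is \<open>det (1 + (X - 1) E)\<close> for the idempotent matrix \<open>E = (l\<^sub>i(g\<^sub>j))\<close> over \<open>R\<close>.
  The equality with \<open>X\<^sup>n\<close> in \<open>R[X]\<close> may be checked coefficientwise after localization at every prime.
  There \<open>E = U V\<close> with \<open>V U = 1\<close>, so the determinant is \<open>det (1 + (X - 1) V U) = det (X \<cdot> 1\<^sub>n) = X\<^sup>n\<close>.
  The scalar is taken to be generic because the rank is only known at primes of \<open>R\<close>, and not at those of
  an arbitrary \<open>R\<close>-algebra.
\<close>

lemma generic_norm_scalar:
  assumes rk: "\<And>P. primeideal P R \<Longrightarrow> free_of_rank (localization R P) (tensor R A (localization R P)) n"
  defines "Q \<equiv> poly_algebra (self_algebra R)"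
  defines "X \<equiv> up_ring.monom (UP (self_algebra R)) \<one>\<^bsub>self_algebra R\<^esub> 1"
  shows "matrix_det Q k (\<lambda>i j. (if i = j then \<one>\<^bsub>Q\<^esub> else \<zero>\<^bsub>Q\<^esub>) \<oplus>\<^bsub>Q\<^esub>
     (X \<ominus>\<^bsub>Q\<^esub> \<one>\<^bsub>Q\<^esub>) \<otimes>\<^bsub>Q\<^esub> up_ring.monom (UP (self_algebra R)) (l i (g j)) 0) = X [^]\<^bsub>Q\<^esub> n"
    (is "?F = _")
proof -
  interpret R: cring R using alg_A by (rule algebra_facts)
  have selfR: "algebra R (self_algebra R)" by (rule self_algebra_algebra[OF R.is_cring])
  let ?c = "\<lambda>s. up_ring.monom (UP (self_algebra R)) s 0"
  interpret Q: polynomial_algebra R "self_algebra R" Q ?c X "\<lambda>j p. p j"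
    unfolding Q_def X_def by (rule poly_algebra_polynomial[OF selfR])
  note lc = module_homD(1)[OF l, simplified]
  have E: "l i (g j) \<in> carrier (self_algebra R)" if "i < k" "j < k" for i j using lc g that by simp
  have entry: "(if i = j then \<one>\<^bsub>Q\<^esub> else \<zero>\<^bsub>Q\<^esub>) \<oplus>\<^bsub>Q\<^esub> (X \<ominus>\<^bsub>Q\<^esub> \<one>\<^bsub>Q\<^esub>) \<otimes>\<^bsub>Q\<^esub> ?c (l i (g j)) \<in> carrier Q"
    if "i < k" "j < k" for i j using Q.c_closed[OF E[OF that]] by simp
  have Fc: "?F \<in> carrier Q" by (intro Q.Q.matrix_det_closed entry)
  have Xn: "X [^]\<^bsub>Q\<^esub> n \<in> carrier Q" by simp
  let ?D = "?F \<ominus>\<^bsub>Q\<^esub> X [^]\<^bsub>Q\<^esub> n"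
  have Dc: "?D \<in> carrier Q" using Fc Xn by simp
  have "?D = \<zero>\<^bsub>Q\<^esub>"
  proof (rule Q.coef_eqI[OF Dc Q.Q.zero_closed])
    fix j
    have coef: "?D j \<in> carrier R" using Q.coef_closed[OF Dc, of j] by simp
    have "?D j = \<zero>\<^bsub>R\<^esub>"
    proof (rule R.eq_zero_if_locally[OF coef])
      fix P assume P: "primeideal P R"
      interpret localization_at P R using P by (simp add: localization_at_def)
      let ?L = "localization R P"
      have algL: "algebra R ?L" by (rule localization_algebra)
      interpret L: cring ?L using algL by (rule algebra_facts)
      let ?Q' = "poly_algebra ?L" and ?c' = "\<lambda>s. up_ring.monom (UP ?L) s 0" and ?X' = "up_ring.monom (UP ?L) \<one>\<^bsub>?L\<^esub> 1"
      interpret Q': polynomial_algebra R ?L ?Q' ?c' ?X' "\<lambda>j p. p j"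
        by (rule poly_algebra_polynomial[OF algL])
      let ?f = "\<lambda>r. r \<odot>\<^bsub>?L\<^esub> \<one>\<^bsub>?L\<^esub>"
      have f: "?f \<in> ring_hom (self_algebra R) ?L" by (rule alg_homD(6)[OF structure_map[OF algL]])
      obtain G where G: "G \<in> ring_hom Q ?Q'" "\<forall>z\<in>carrier (self_algebra R). G (?c z) = ?c' (?f z)" "G X = ?X'"
        "\<forall>p\<in>carrier Q. \<forall>j. G p j = ?f (p j)"
        using poly_ring_map[OF Q.poly_ring_axioms Q'.poly_ring_axioms f] by (elim bexE conjE)
      interpret G: ring_hom_cring Q ?Q' G by unfold_locales (rule G(1))
      obtain U V where U: "\<And>i a. i < k \<Longrightarrow> a < n \<Longrightarrow> U i a \<in> carrier ?L" and V: "\<And>a j. a < n \<Longrightarrow> j < k \<Longrightarrow> V a j \<in> carrier ?L"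
        and UV: "\<And>i j. i < k \<Longrightarrow> j < k \<Longrightarrow> (\<Oplus>\<^bsub>?L\<^esub>a\<in>{..<n}. U i a \<otimes>\<^bsub>?L\<^esub> V a j) = l i (g j) \<odot>\<^bsub>?L\<^esub> \<one>\<^bsub>?L\<^esub>"
        and VU: "\<And>a b. a < n \<Longrightarrow> b < n \<Longrightarrow> (\<Oplus>\<^bsub>?L\<^esub>i\<in>{..<k}. V a i \<otimes>\<^bsub>?L\<^esub> U i b) = (if a = b then \<one>\<^bsub>?L\<^esub> else \<zero>\<^bsub>?L\<^esub>)"
        by (rule local_trace_factorization[OF algL rk[OF P]]) blast
      let ?Y = "?X' \<ominus>\<^bsub>?Q'\<^esub> \<one>\<^bsub>?Q'\<^esub>"
      have Y: "?Y \<in> carrier ?Q'" by (rule Q'.Q.minus_closed[OF Q'.X_closed Q'.Q.one_closed])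
      let ?U' = "\<lambda>i a. ?Y \<otimes>\<^bsub>?Q'\<^esub> ?c' (U i a)" and ?V' = "\<lambda>a j. ?c' (V a j)"
      have U': "?U' i a \<in> carrier ?Q'" if "i < k" "a < n" for i a
        by (rule Q'.Q.m_closed[OF Y Q'.c_closed[OF U[OF that]]])
      have V': "?V' a i \<in> carrier ?Q'" if "i < k" "a < n" for i a
        by (rule Q'.c_closed[OF V[OF that(2,1)]])
      let ?d = "\<lambda>i j. if i = j then \<one>\<^bsub>?Q'\<^esub> else \<zero>\<^bsub>?Q'\<^esub>"
      have 1: "G ((if i = j then \<one>\<^bsub>Q\<^esub> else \<zero>\<^bsub>Q\<^esub>) \<oplus>\<^bsub>Q\<^esub> (X \<ominus>\<^bsub>Q\<^esub> \<one>\<^bsub>Q\<^esub>) \<otimes>\<^bsub>Q\<^esub> ?c (l i (g j))) =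
          ?d i j \<oplus>\<^bsub>?Q'\<^esub> (\<Oplus>\<^bsub>?Q'\<^esub>a\<in>{..<n}. ?U' i a \<otimes>\<^bsub>?Q'\<^esub> ?V' a j)" if ij: "i < k" "j < k" for i j
      proof -
        have uv: "U i a \<otimes>\<^bsub>?L\<^esub> V a j \<in> carrier ?L" if "a < n" for a using U V ij that by simp
        have "(\<Oplus>\<^bsub>?Q'\<^esub>a\<in>{..<n}. ?U' i a \<otimes>\<^bsub>?Q'\<^esub> ?V' a j) = (\<Oplus>\<^bsub>?Q'\<^esub>a\<in>{..<n}. ?Y \<otimes>\<^bsub>?Q'\<^esub> ?c' (U i a \<otimes>\<^bsub>?L\<^esub> V a j))"
        proof (rule Q'.Q.finsum_cong'[OF HOL.refl])
          show "(\<lambda>a. ?Y \<otimes>\<^bsub>?Q'\<^esub> ?c' (U i a \<otimes>\<^bsub>?L\<^esub> V a j)) \<in> {..<n} \<rightarrow> carrier ?Q'"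
            using Q'.Q.m_closed[OF Y Q'.c_closed[OF uv]] by blast
          fix a assume "a \<in> {..<n}"
          then have a: "a < n" by simp
          show "?U' i a \<otimes>\<^bsub>?Q'\<^esub> ?V' a j = ?Y \<otimes>\<^bsub>?Q'\<^esub> ?c' (U i a \<otimes>\<^bsub>?L\<^esub> V a j)"
            by (simp only: Q'.c.hom_mult[OF U[OF ij(1) a] V[OF a ij(2)]]
                Q'.Q.m_assoc[OF Y Q'.c_closed[OF U[OF ij(1) a]] Q'.c_closed[OF V[OF a ij(2)]]])
        qed
        also have "\<dots> = ?Y \<otimes>\<^bsub>?Q'\<^esub> (\<Oplus>\<^bsub>?Q'\<^esub>a\<in>{..<n}. ?c' (U i a \<otimes>\<^bsub>?L\<^esub> V a j))"
          using Q'.c_closed[OF uv] by (intro Q'.Q.finsum_rdistr[symmetric, OF _ Y]) blast+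
        also have "(\<Oplus>\<^bsub>?Q'\<^esub>a\<in>{..<n}. ?c' (U i a \<otimes>\<^bsub>?L\<^esub> V a j)) = ?c' (\<Oplus>\<^bsub>?L\<^esub>a\<in>{..<n}. U i a \<otimes>\<^bsub>?L\<^esub> V a j)"
          using uv by (subst Q'.c.hom_finsum) (simp_all add: o_def)
        also have "\<dots> = ?c' (?f (l i (g j)))" by (simp only: UV[OF ij])
        finally have s: "(\<Oplus>\<^bsub>?Q'\<^esub>a\<in>{..<n}. ?U' i a \<otimes>\<^bsub>?Q'\<^esub> ?V' a j) = ?Y \<otimes>\<^bsub>?Q'\<^esub> ?c' (?f (l i (g j)))" .
        have dd: "(if i = j then \<one>\<^bsub>Q\<^esub> else \<zero>\<^bsub>Q\<^esub>) \<in> carrier Q" "G (if i = j then \<one>\<^bsub>Q\<^esub> else \<zero>\<^bsub>Q\<^esub>) = ?d i j"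
          using G.hom_one G.hom_zero by (cases "i = j"; simp only: if_True if_False Q.Q.one_closed Q.Q.zero_closed)+
        have X1: "X \<ominus>\<^bsub>Q\<^esub> \<one>\<^bsub>Q\<^esub> \<in> carrier Q" "G (X \<ominus>\<^bsub>Q\<^esub> \<one>\<^bsub>Q\<^esub>) = ?Y"
          using G(3) G.hom_one by (simp_all only: a_minus_def G.hom_add G.hom_a_inv Q.X_closed Q.Q.one_closed Q.Q.a_inv_closed Q.Q.add.m_closed)
        show ?thesis
          unfolding s using bspec[OF G(2) E[OF ij]] X1 dd Q.c_closed[OF E[OF ij]]
          by (simp only: G.hom_add G.hom_mult Q.Q.m_closed)
      qed
      have "G ?F = matrix_det ?Q' k (\<lambda>i j. G ((if i = j then \<one>\<^bsub>Q\<^esub> else \<zero>\<^bsub>Q\<^esub>) \<oplus>\<^bsub>Q\<^esub> (X \<ominus>\<^bsub>Q\<^esub> \<one>\<^bsub>Q\<^esub>) \<otimes>\<^bsub>Q\<^esub> ?c (l i (g j))))"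
        by (rule matrix_det_hom[OF Q.Q.is_cring Q'.Q.is_cring G(1) entry])
      also have "\<dots> = matrix_det ?Q' k (\<lambda>i j. ?d i j \<oplus>\<^bsub>?Q'\<^esub> (\<Oplus>\<^bsub>?Q'\<^esub>a\<in>{..<n}. ?U' i a \<otimes>\<^bsub>?Q'\<^esub> ?V' a j))"
      proof (rule Q'.Q.matrix_det_cong)
        fix i j assume ij: "i < k" "j < k"
        show "?d i j \<oplus>\<^bsub>?Q'\<^esub> (\<Oplus>\<^bsub>?Q'\<^esub>a\<in>{..<n}. ?U' i a \<otimes>\<^bsub>?Q'\<^esub> ?V' a j) \<in> carrier ?Q'"
          using G.hom_closed[OF entry[OF ij]] unfolding 1[OF ij] .
      qed (rule 1)
      also have "\<dots> = matrix_det ?Q' n (\<lambda>a b. ?d a b \<oplus>\<^bsub>?Q'\<^esub> (\<Oplus>\<^bsub>?Q'\<^esub>i\<in>{..<k}. ?V' a i \<otimes>\<^bsub>?Q'\<^esub> ?U' i b))"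
        using U' V' by (intro Q'.Q.matrix_det_one_plus_mult_commute)
      also have "\<dots> = matrix_det ?Q' n (\<lambda>a b. if a = b then ?X' else \<zero>\<^bsub>?Q'\<^esub>)"
      proof (rule Q'.Q.matrix_det_cong)
        fix a b assume ab: "a < n" "b < n"
        have vu: "V a i \<otimes>\<^bsub>?L\<^esub> U i b \<in> carrier ?L" if "i < k" for i using U V ab that by simp
        have "(\<Oplus>\<^bsub>?Q'\<^esub>i\<in>{..<k}. ?V' a i \<otimes>\<^bsub>?Q'\<^esub> ?U' i b) = (\<Oplus>\<^bsub>?Q'\<^esub>i\<in>{..<k}. ?Y \<otimes>\<^bsub>?Q'\<^esub> ?c' (V a i \<otimes>\<^bsub>?L\<^esub> U i b))"
        proof (rule Q'.Q.finsum_cong'[OF HOL.refl])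
          show "(\<lambda>i. ?Y \<otimes>\<^bsub>?Q'\<^esub> ?c' (V a i \<otimes>\<^bsub>?L\<^esub> U i b)) \<in> {..<k} \<rightarrow> carrier ?Q'"
            using Q'.Q.m_closed[OF Y Q'.c_closed[OF vu]] by blast
          fix i assume "i \<in> {..<k}"
          then have i: "i < k" by simp
          show "?V' a i \<otimes>\<^bsub>?Q'\<^esub> ?U' i b = ?Y \<otimes>\<^bsub>?Q'\<^esub> ?c' (V a i \<otimes>\<^bsub>?L\<^esub> U i b)"
            by (simp only: Q'.c.hom_mult[OF V[OF ab(1) i] U[OF i ab(2)]]
                Q'.Q.m_lcomm[OF Q'.c_closed[OF V[OF ab(1) i]] Y Q'.c_closed[OF U[OF i ab(2)]]])
        qed
        also have "\<dots> = ?Y \<otimes>\<^bsub>?Q'\<^esub> (\<Oplus>\<^bsub>?Q'\<^esub>i\<in>{..<k}. ?c' (V a i \<otimes>\<^bsub>?L\<^esub> U i b))"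
          using Q'.c_closed[OF vu] by (intro Q'.Q.finsum_rdistr[symmetric, OF _ Y]) blast+
        also have "(\<Oplus>\<^bsub>?Q'\<^esub>i\<in>{..<k}. ?c' (V a i \<otimes>\<^bsub>?L\<^esub> U i b)) = ?c' (\<Oplus>\<^bsub>?L\<^esub>i\<in>{..<k}. V a i \<otimes>\<^bsub>?L\<^esub> U i b)"
          using vu by (subst Q'.c.hom_finsum) (simp_all add: o_def)
        also have "\<dots> = ?d a b"
          unfolding VU[OF ab] using Q'.c.hom_one Q'.c.hom_zero by (cases "a = b") simp_all
        finally have s: "(\<Oplus>\<^bsub>?Q'\<^esub>i\<in>{..<k}. ?V' a i \<otimes>\<^bsub>?Q'\<^esub> ?U' i b) = ?Y \<otimes>\<^bsub>?Q'\<^esub> ?d a b" .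
        have x1: "\<one>\<^bsub>?Q'\<^esub> \<oplus>\<^bsub>?Q'\<^esub> ?Y \<otimes>\<^bsub>?Q'\<^esub> \<one>\<^bsub>?Q'\<^esub> = ?X'"
          using Q'.Q.r_one[OF Y] Q'.Q.add_minus_cancel[OF Q'.Q.one_closed Q'.X_closed] by (simp only:)
        have x0: "\<zero>\<^bsub>?Q'\<^esub> \<oplus>\<^bsub>?Q'\<^esub> ?Y \<otimes>\<^bsub>?Q'\<^esub> \<zero>\<^bsub>?Q'\<^esub> = \<zero>\<^bsub>?Q'\<^esub>"
          using Q'.Q.r_null[OF Y] Q'.Q.l_zero[OF Q'.Q.zero_closed] by (simp only:)
        show "?d a b \<oplus>\<^bsub>?Q'\<^esub> (\<Oplus>\<^bsub>?Q'\<^esub>i\<in>{..<k}. ?V' a i \<otimes>\<^bsub>?Q'\<^esub> ?U' i b) = (if a = b then ?X' else \<zero>\<^bsub>?Q'\<^esub>)"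
          unfolding s by (cases "a = b") (simp_all only: if_True if_False simp_thms x0 x1)
        show "(if a = b then ?X' else \<zero>\<^bsub>?Q'\<^esub>) \<in> carrier ?Q'"
          by (cases "a = b") (simp_all only: if_True if_False simp_thms Q'.X_closed Q'.Q.zero_closed)
      qed
      also have "\<dots> = ?X' [^]\<^bsub>?Q'\<^esub> n" by (rule Q'.Q.matrix_det_scalar[OF Q'.X_closed])
      also have "\<dots> = G (X [^]\<^bsub>Q\<^esub> n)" using G(3) G.hom_pow[OF Q.X_closed, of n] by simp
      finally have FX: "G ?F = G (X [^]\<^bsub>Q\<^esub> n)" .
      have "G ?D = G ?F \<ominus>\<^bsub>?Q'\<^esub> G (X [^]\<^bsub>Q\<^esub> n)"
        using Fc Xn by (simp only: a_minus_def G.hom_add G.hom_a_inv Q.Q.a_inv_closed)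
      also have "\<dots> = G (X [^]\<^bsub>Q\<^esub> n) \<ominus>\<^bsub>?Q'\<^esub> G (X [^]\<^bsub>Q\<^esub> n)" by (simp only: FX)
      also have "\<dots> = \<zero>\<^bsub>?Q'\<^esub>"
        using Q'.Q.r_neg[OF G.hom_closed[OF Xn]] by (simp only: Q'.Q.minus_eq)
      finally have "G ?D j = \<zero>\<^bsub>?Q'\<^esub> j" by simp
      then show "?f (?D j) = \<zero>\<^bsub>?L\<^esub>" using G(4) Dc Q'.coef_zero[of j] by simp
    qed
    then show "?D j = \<zero>\<^bsub>Q\<^esub> j" using Q.coef_zero[of j] by simp
  qed
  then have "X [^]\<^bsub>Q\<^esub> n \<oplus>\<^bsub>Q\<^esub> ?D = X [^]\<^bsub>Q\<^esub> n" using Xn by simp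
  then show ?thesis using Q.Q.add_minus_cancel[OF Xn Fc] by simp
qed

text \<open>
  The determinant in question is the image of the generic one under \<open>R[X] \<rightarrow> S\<close>, \<open>X \<mapsto> s\<close>.
\<close>

lemma norm_scalar:
  assumes rk: "\<And>P. primeideal P R \<Longrightarrow> free_of_rank (localization R P) (tensor R A (localization R P)) n"
    and S: "algebra R S" and s: "s \<in> carrier S"
  shows "algebra_norm R A S (s \<odot>\<^bsub>tensor R A S\<^esub> \<one>\<^bsub>tensor R A S\<^esub>) = s [^]\<^bsub>S\<^esub> n"
proof -
  interpret R: cring R using alg_A by (rule algebra_facts)
  interpret B: algebra_base_change R A S using S by (rule bc)
  have selfR: "algebra R (self_algebra R)" by (rule self_algebra_algebra[OF R.is_cring])
  let ?c = "\<lambda>s. up_ring.monom (UP (self_algebra R)) s 0"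
  let ?Q = "poly_algebra (self_algebra R)"
  let ?X = "up_ring.monom (UP (self_algebra R)) \<one>\<^bsub>self_algebra R\<^esub> 1"
  interpret Q: polynomial_algebra R "self_algebra R" ?Q ?c ?X "\<lambda>j p. p j"
    by (rule poly_algebra_polynomial[OF selfR])
  note lc = module_homD(1)[OF l, simplified]
  note bf = module_homD[OF B.base_form(1)[OF l], simplified]
  have E: "l i (g j) \<in> carrier (self_algebra R)" if "i < k" "j < k" for i j using lc g that by simp
  obtain G where G: "G \<in> alg_hom R ?Q S" "\<forall>z\<in>carrier (self_algebra R). G (?c z) = z \<odot>\<^bsub>S\<^esub> \<one>\<^bsub>S\<^esub>" "G ?X = s"
    using Q.alg_evaluation[OF S structure_map[OF S] s] by (elim bexE conjE)
  interpret G: ring_hom_cring ?Q S G by unfold_locales (rule alg_homD(6)[OF G(1)])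
  have entry: "(if i = j then \<one>\<^bsub>?Q\<^esub> else \<zero>\<^bsub>?Q\<^esub>) \<oplus>\<^bsub>?Q\<^esub> (?X \<ominus>\<^bsub>?Q\<^esub> \<one>\<^bsub>?Q\<^esub>) \<otimes>\<^bsub>?Q\<^esub> ?c (l i (g j)) \<in> carrier ?Q"
    and Gentry: "G ((if i = j then \<one>\<^bsub>?Q\<^esub> else \<zero>\<^bsub>?Q\<^esub>) \<oplus>\<^bsub>?Q\<^esub> (?X \<ominus>\<^bsub>?Q\<^esub> \<one>\<^bsub>?Q\<^esub>) \<otimes>\<^bsub>?Q\<^esub> ?c (l i (g j))) =
      (if i = j then \<one>\<^bsub>S\<^esub> else \<zero>\<^bsub>S\<^esub>) \<oplus>\<^bsub>S\<^esub> (s \<ominus>\<^bsub>S\<^esub> \<one>\<^bsub>S\<^esub>) \<otimes>\<^bsub>S\<^esub> (l i (g j) \<odot>\<^bsub>S\<^esub> \<one>\<^bsub>S\<^esub>)"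
    if ij: "i < k" "j < k" for i j
  proof -
    have dd: "(if i = j then \<one>\<^bsub>?Q\<^esub> else \<zero>\<^bsub>?Q\<^esub>) \<in> carrier ?Q" "G (if i = j then \<one>\<^bsub>?Q\<^esub> else \<zero>\<^bsub>?Q\<^esub>) = (if i = j then \<one>\<^bsub>S\<^esub> else \<zero>\<^bsub>S\<^esub>)"
      using G.hom_one G.hom_zero by (cases "i = j"; simp only: if_True if_False Q.Q.one_closed Q.Q.zero_closed)+
    have X1: "?X \<ominus>\<^bsub>?Q\<^esub> \<one>\<^bsub>?Q\<^esub> \<in> carrier ?Q" "G (?X \<ominus>\<^bsub>?Q\<^esub> \<one>\<^bsub>?Q\<^esub>) = s \<ominus>\<^bsub>S\<^esub> \<one>\<^bsub>S\<^esub>"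
      using G(3) G.hom_one by (simp_all only: a_minus_def G.hom_add G.hom_a_inv Q.X_closed Q.Q.one_closed Q.Q.a_inv_closed Q.Q.add.m_closed)
    show "(if i = j then \<one>\<^bsub>?Q\<^esub> else \<zero>\<^bsub>?Q\<^esub>) \<oplus>\<^bsub>?Q\<^esub> (?X \<ominus>\<^bsub>?Q\<^esub> \<one>\<^bsub>?Q\<^esub>) \<otimes>\<^bsub>?Q\<^esub> ?c (l i (g j)) \<in> carrier ?Q"
      by (intro Q.Q.add.m_closed Q.Q.m_closed dd X1 Q.c_closed E ij)
    show "G ((if i = j then \<one>\<^bsub>?Q\<^esub> else \<zero>\<^bsub>?Q\<^esub>) \<oplus>\<^bsub>?Q\<^esub> (?X \<ominus>\<^bsub>?Q\<^esub> \<one>\<^bsub>?Q\<^esub>) \<otimes>\<^bsub>?Q\<^esub> ?c (l i (g j))) =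
      (if i = j then \<one>\<^bsub>S\<^esub> else \<zero>\<^bsub>S\<^esub>) \<oplus>\<^bsub>S\<^esub> (s \<ominus>\<^bsub>S\<^esub> \<one>\<^bsub>S\<^esub>) \<otimes>\<^bsub>S\<^esub> (l i (g j) \<odot>\<^bsub>S\<^esub> \<one>\<^bsub>S\<^esub>)"
      using bspec[OF G(2) E[OF ij]] X1 dd Q.c_closed[OF E[OF ij]]
      by (simp only: G.hom_add G.hom_mult Q.Q.m_closed)
  qed
  have "s [^]\<^bsub>S\<^esub> n = G (?X [^]\<^bsub>?Q\<^esub> n)" using G(3) G.hom_pow[OF Q.X_closed, of n] by simp
  also have "?X [^]\<^bsub>?Q\<^esub> n = matrix_det ?Q k (\<lambda>i j. (if i = j then \<one>\<^bsub>?Q\<^esub> else \<zero>\<^bsub>?Q\<^esub>) \<oplus>\<^bsub>?Q\<^esub> (?X \<ominus>\<^bsub>?Q\<^esub> \<one>\<^bsub>?Q\<^esub>) \<otimes>\<^bsub>?Q\<^esub> ?c (l i (g j)))"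
    by (rule generic_norm_scalar[OF rk, symmetric])
  also have "G \<dots> = matrix_det S k (\<lambda>i j. G ((if i = j then \<one>\<^bsub>?Q\<^esub> else \<zero>\<^bsub>?Q\<^esub>) \<oplus>\<^bsub>?Q\<^esub> (?X \<ominus>\<^bsub>?Q\<^esub> \<one>\<^bsub>?Q\<^esub>) \<otimes>\<^bsub>?Q\<^esub> ?c (l i (g j))))"
    by (rule matrix_det_hom[OF Q.Q.is_cring B.S.is_cring alg_homD(6)[OF G(1)] entry])
  also have "\<dots> = algebra_norm R A S (s \<odot>\<^bsub>B.T\<^esub> \<one>\<^bsub>B.T\<^esub>)"
  proof -
    have s1: "s \<odot>\<^bsub>B.T\<^esub> \<one>\<^bsub>B.T\<^esub> \<in> carrier B.T" using s by (intro B.smult_closed) simp_all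
    show ?thesis unfolding norm_eq[OF S s1] dual_det_def
    proof (rule B.S.matrix_det_cong)
      fix i j assume ij: "i < k" "j < k"
      let ?g = "B.pure (g j) \<one>\<^bsub>S\<^esub>"
      have gc: "?g \<in> carrier B.T" using g[OF ij(2)] by (simp add: B.pure_closed)
      have "(s \<odot>\<^bsub>B.T\<^esub> \<one>\<^bsub>B.T\<^esub>) \<otimes>\<^bsub>B.T\<^esub> ?g \<ominus>\<^bsub>B.T\<^esub> ?g = s \<odot>\<^bsub>B.T\<^esub> ?g \<ominus>\<^bsub>B.T\<^esub> ?g"
        using gc s by (simp add: B.smult_mult_assoc)
      also have "\<dots> = (s \<ominus>\<^bsub>S\<^esub> \<one>\<^bsub>S\<^esub>) \<odot>\<^bsub>B.T\<^esub> ?g"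
        using gc s by (simp only: a_minus_def B.add_smult B.S.a_inv_closed B.S.one_closed B.tensor.smult_l_minus B.one_smult)
      finally have "base_form R A S (l i) ((s \<odot>\<^bsub>B.T\<^esub> \<one>\<^bsub>B.T\<^esub>) \<otimes>\<^bsub>B.T\<^esub> ?g \<ominus>\<^bsub>B.T\<^esub> ?g) = (s \<ominus>\<^bsub>S\<^esub> \<one>\<^bsub>S\<^esub>) \<otimes>\<^bsub>S\<^esub> (l i (g j) \<odot>\<^bsub>S\<^esub> \<one>\<^bsub>S\<^esub>)"
        using gc s g[OF ij(2)] by (simp add: bf(3)[OF ij(1)] B.base_form(2)[OF l[OF ij(1)]])
      then show *: "G ((if i = j then \<one>\<^bsub>?Q\<^esub> else \<zero>\<^bsub>?Q\<^esub>) \<oplus>\<^bsub>?Q\<^esub> (?X \<ominus>\<^bsub>?Q\<^esub> \<one>\<^bsub>?Q\<^esub>) \<otimes>\<^bsub>?Q\<^esub> ?c (l i (g j))) =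
        (if i = j then \<one>\<^bsub>S\<^esub> else \<zero>\<^bsub>S\<^esub>) \<oplus>\<^bsub>S\<^esub> base_form R A S (l i) ((s \<odot>\<^bsub>B.T\<^esub> \<one>\<^bsub>B.T\<^esub>) \<otimes>\<^bsub>B.T\<^esub> ?g \<ominus>\<^bsub>B.T\<^esub> ?g)"
        by (simp only: Gentry[OF ij])
      show "(if i = j then \<one>\<^bsub>S\<^esub> else \<zero>\<^bsub>S\<^esub>) \<oplus>\<^bsub>S\<^esub> base_form R A S (l i) ((s \<odot>\<^bsub>B.T\<^esub> \<one>\<^bsub>B.T\<^esub>) \<otimes>\<^bsub>B.T\<^esub> ?g \<ominus>\<^bsub>B.T\<^esub> ?g) \<in> carrier S"
        unfolding *[symmetric] by (rule G.hom_closed[OF entry[OF ij]])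
    qed
  qed
  finally show ?thesis by simp
qed

end

section \<open>Base change along polynomial extensions\<close>

lemma
  assumes B: "algebra R B" and S: "algebra R S" and T: "algebra R T" and h: "h \<in> alg_hom R S T"
  shows base_map_hom: "tensor_map R B T id h \<in> ring_hom (tensor R B S) (tensor R B T)"
    and base_map_pure: "b \<in> carrier B \<Longrightarrow> s \<in> carrier S \<Longrightarrow>
      tensor_map R B T id h (pure_tensor R B S b s) = pure_tensor R B T b (h s)"
    and base_map_smult: "s \<in> carrier S \<Longrightarrow> a \<in> carrier (tensor R B S) \<Longrightarrow>
      tensor_map R B T id h (s \<odot>\<^bsub>tensor R B S\<^esub> a) = h s \<odot>\<^bsub>tensor R B T\<^esub> tensor_map R B T id h a"
proof -
  interpret M: algebra_base_change_map R B S B T id h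
    by (rule algebra_base_change_mapI[OF B S B T alg_hom_id h])
  show "M.tm \<in> ring_hom (tensor R B S) (tensor R B T)" by (rule M.tm_ring_hom)
  show "b \<in> carrier B \<Longrightarrow> s \<in> carrier S \<Longrightarrow> M.tm (pure_tensor R B S b s) = pure_tensor R B T b (h s)"
    by (simp add: M.tm_pure)
  show "s \<in> carrier S \<Longrightarrow> a \<in> carrier (tensor R B S) \<Longrightarrow> M.tm (s \<odot>\<^bsub>tensor R B S\<^esub> a) = h s \<odot>\<^bsub>tensor R B T\<^esub> M.tm a"
    by (rule M.tm_alg_smult)
qed

lemma base_map_comp:
  assumes B: "algebra R B" and S: "algebra R S" and T: "algebra R T" and U: "algebra R U"
    and h: "h \<in> alg_hom R S T" and k: "k \<in> alg_hom R T U"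
    and e: "e \<in> alg_hom R S U" "\<And>s. s \<in> carrier S \<Longrightarrow> k (h s) = e s" and a: "a \<in> carrier (tensor R B S)"
  shows "tensor_map R B U id k (tensor_map R B T id h a) = tensor_map R B U id e a"
proof -
  note mB = algebra_facts(2)[OF B]
  have bc: "base_change_map R B S' B T' id f" if "algebra R S'" "algebra R T'" "f \<in> alg_hom R S' T'" for S' T' f
    by (rule base_change_mapI[OF mB that(1) mB that(2) module_hom_id alg_hom_module_hom[OF that(3)]])
  have "tensor_map R B U id k (tensor_map R B T id h a) = tensor_map R B U (id \<circ> id) (k \<circ> h) a"
    by (rule tensor_map_comp[OF bc[OF S T h] bc[OF T U k] a])
  also have "\<dots> = tensor_map R B U id e a"
    using bc[OF S U alg_hom_comp[OF h k]] e by (intro tensor_map_cong[OF _ bc[OF S U e(1)] _ _ a]) simp_all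
  finally show ?thesis .
qed

lemma base_map_ident:
  assumes B: "algebra R B" and S: "algebra R S" and T: "algebra R T"
    and h: "h \<in> alg_hom R S T" and k: "k \<in> alg_hom R T S"
    and e: "\<And>s. s \<in> carrier S \<Longrightarrow> k (h s) = s" and a: "a \<in> carrier (tensor R B S)"
  shows "tensor_map R B S id k (tensor_map R B T id h a) = a"
proof -
  have "tensor_map R B S id k (tensor_map R B T id h a) = tensor_map R B S id id a"
    by (rule base_map_comp[OF B S T S h k alg_hom_id _ a]) (simp add: e)
  then show ?thesis using tensor_map_id[OF algebra_facts(2)[OF B] S a] by simp
qed

lemma coefficient_map_commute:
  assumes A: "algebra R A" and B: "algebra R B" and S: "algebra R S" and T: "algebra R T"
    and b: "\<beta> \<in> alg_hom R A B" and h: "h \<in> alg_hom R S T" and a: "a \<in> carrier (tensor R A S)"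
  shows "tensor_map R B T \<beta> id (tensor_map R A T id h a) = tensor_map R B T id h (tensor_map R B S \<beta> id a)"
proof -
  note mA = algebra_facts(2)[OF A] and mB = algebra_facts(2)[OF B]
  note b' = alg_hom_module_hom[OF b] and h' = alg_hom_module_hom[OF h]
  have 1: "base_change_map R A S A T id h" by (rule base_change_mapI[OF mA S mA T module_hom_id h'])
  have 2: "base_change_map R A T B T \<beta> id" by (rule base_change_mapI[OF mA T mB T b' module_hom_id])
  have 3: "base_change_map R A S B S \<beta> id" by (rule base_change_mapI[OF mA S mB S b' module_hom_id])
  have 4: "base_change_map R B S B T id h" by (rule base_change_mapI[OF mB S mB T module_hom_id h'])
  show ?thesis
    using tensor_map_comp[OF 1 2 a] tensor_map_comp[OF 3 4 a] by simp
qed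

context algebra_base_change
begin

lemma smult_eq_mult: "s \<in> carrier S \<Longrightarrow> a \<in> carrier T \<Longrightarrow> s \<odot>\<^bsub>T\<^esub> a = pure \<one>\<^bsub>A\<^esub> s \<otimes>\<^bsub>T\<^esub> a"
proof -
  assume s: "s \<in> carrier S" and a: "a \<in> carrier T"
  have "s \<odot>\<^bsub>T\<^esub> a = s \<odot>\<^bsub>T\<^esub> (\<one>\<^bsub>T\<^esub> \<otimes>\<^bsub>T\<^esub> a)" using a by simp
  also have "\<dots> = (s \<odot>\<^bsub>T\<^esub> \<one>\<^bsub>T\<^esub>) \<otimes>\<^bsub>T\<^esub> a" using s a by (intro smult_mult_assoc[symmetric]) simp_all
  also have "s \<odot>\<^bsub>T\<^esub> \<one>\<^bsub>T\<^esub> = pure \<one>\<^bsub>A\<^esub> s" using s by (simp add: one_cls smult_pure)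
  finally show ?thesis .
qed

lemma pure_one_hom: "(\<lambda>s. pure \<one>\<^bsub>A\<^esub> s) \<in> ring_hom S T"
  by (rule ring_hom_memI) (simp_all add: pure_closed mult_pure pure_add_right one_cls)

end

section \<open>Laws that are homogeneous of degree one are linear\<close>

lemma poly_lawD:
  assumes "poly_law R M N f"
  shows "algebra R S \<Longrightarrow> x \<in> carrier (tensor R M S) \<Longrightarrow> f S x \<in> carrier (tensor R N S)"
    and "algebra R S \<Longrightarrow> algebra R T \<Longrightarrow> h \<in> alg_hom R S T \<Longrightarrow> x \<in> carrier (tensor R M S) \<Longrightarrow>
        f T (tensor_map R M T id h x) = tensor_map R N T id h (f S x)"
  using assms by (auto simp: poly_law_def)

text \<open>
  Let \<open>d(X) = f(x + X y)\<close> and \<open>z(V, X) = f(V x + X y)\<close>, where \<open>V\<close> and \<open>X\<close> are variables. Homogeneity gives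
  \<open>z(V, V X) = V d(X)\<close>, that is, \<open>V\<^sup>j z\<^sub>j(V) = V d\<^sub>j\<close> for the coefficients of \<open>X\<^sup>j\<close>. For \<open>j \<ge> 1\<close> cancel \<open>V\<close> and
  put \<open>V = 0\<close>: the right side remains \<open>d\<^sub>j\<close>, and the left side is zero for \<open>j \<ge> 2\<close> and \<open>z\<^sub>1(0)\<close> for \<open>j = 1\<close>.
  As \<open>z(0, X) = f(X y) = X f(y)\<close>, this shows \<open>d(X) = d\<^sub>0 + X f(y)\<close>. Now \<open>X = 0\<close> yields \<open>d\<^sub>0 = f(x)\<close>, and
  \<open>X = 1\<close> is the claim.
\<close>

lemma homogeneous_one_additive:
  fixes R :: "'u ring" and A B S :: "('u, 'u) module"
  assumes inf: "infinite (UNIV :: 'u set)"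
    and A: "algebra R A" and B: "algebra R B" and S: "algebra R S"
    and law: "poly_law R A B f" and hom: "homogeneous_law R A B 1 f"
    and x: "x \<in> carrier (tensor R A S)" and y: "y \<in> carrier (tensor R A S)"
  shows "f S (x \<oplus>\<^bsub>tensor R A S\<^esub> y) = f S x \<oplus>\<^bsub>tensor R B S\<^esub> f S y"
proof -
  define S1 where "S1 = poly_u S"
  define c1 where "c1 = poly_u_const S"
  define X1 where "X1 = poly_u_var S"
  define k1 where "k1 = poly_u_coef S"
  define S2 where "S2 = poly_u S1"
  define c2 where "c2 = poly_u_const S1"
  define X2 where "X2 = poly_u_var S1"
  define k2 where "k2 = poly_u_coef S1"
  interpret p1: polynomial_algebra R S S1 c1 X1 k1
    unfolding S1_def c1_def X1_def k1_def by (rule poly_u_polynomial[OF inf S])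
  note S1 = p1.alg_P
  interpret p2: polynomial_algebra R S1 S2 c2 X2 k2
    unfolding S2_def c2_def X2_def k2_def by (rule poly_u_polynomial[OF inf S1])
  note S2 = p2.alg_P
  interpret AS: algebra_base_change R A S by (rule algebra_base_change.intro[OF A S])
  interpret A1: algebra_base_change R A S1 by (rule algebra_base_change.intro[OF A S1])
  interpret A2: algebra_base_change R A S2 by (rule algebra_base_change.intro[OF A S2])
  interpret BS: algebra_base_change R B S by (rule algebra_base_change.intro[OF B S])
  interpret B1: algebra_base_change R B S1 by (rule algebra_base_change.intro[OF B S1])
  interpret B2: algebra_base_change R B S2 by (rule algebra_base_change.intro[OF B S2])
  let ?tA = "\<lambda>T h. tensor_map R A T id h" and ?tB = "\<lambda>T h. tensor_map R B T id h"
  have fc: "\<And>S x. algebra R S \<Longrightarrow> x \<in> carrier (tensor R A S) \<Longrightarrow> f S x \<in> carrier (tensor R B S)"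
    by (rule poly_lawD[OF law])
  have fn: "\<And>S T h x. algebra R S \<Longrightarrow> algebra R T \<Longrightarrow> h \<in> alg_hom R S T \<Longrightarrow> x \<in> carrier (tensor R A S) \<Longrightarrow>
        f T (?tA T h x) = ?tB T h (f S x)" by (rule poly_lawD[OF law])
  have fh: "f T (s \<odot>\<^bsub>tensor R A T\<^esub> x) = s \<odot>\<^bsub>tensor R B T\<^esub> f T x"
    if "algebra R T" "s \<in> carrier T" "x \<in> carrier (tensor R A T)" for T s x
  proof -
    interpret T: cring T using that(1) by (rule algebra_facts)
    show ?thesis using hom that by (simp add: homogeneous_law_def)
  qed
  \<comment> \<open>The substitutions: \<open>e0\<close> and \<open>e1\<close> put \<open>X = 0\<close> and \<open>X = 1\<close>; \<open>\<phi>\<close> is \<open>(V, X) \<mapsto> (V, V X)\<close>; \<open>\<psi>\<close> embeds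
    \<open>S[X]\<close> in \<open>S[V][X]\<close>; \<open>\<theta>\<close> puts \<open>V = 0\<close>. Here \<open>S1\<close> serves as \<open>S[X]\<close> for \<open>d\<close> and as \<open>S[V]\<close> below \<open>S2\<close>.\<close>
  obtain e0 where e0: "e0 \<in> alg_hom R S1 S" "\<forall>z\<in>carrier S. e0 (c1 z) = id z" "e0 X1 = \<zero>\<^bsub>S\<^esub>"
    using p1.alg_evaluation[OF S alg_hom_id p1.Z.zero_closed] by (elim bexE conjE)
  obtain e1 where e1: "e1 \<in> alg_hom R S1 S" "\<forall>z\<in>carrier S. e1 (c1 z) = id z" "e1 X1 = \<one>\<^bsub>S\<^esub>"
    using p1.alg_evaluation[OF S alg_hom_id p1.Z.one_closed] by (elim bexE conjE)
  have cX: "c2 X1 \<otimes>\<^bsub>S2\<^esub> X2 \<in> carrier S2" by simp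
  obtain \<phi> where phi: "\<phi> \<in> alg_hom R S2 S2" "\<forall>z\<in>carrier S1. \<phi> (c2 z) = c2 z" "\<phi> X2 = c2 X1 \<otimes>\<^bsub>S2\<^esub> X2"
    using p2.alg_evaluation[OF S2 p2.c_alg cX] by (elim bexE conjE)
  have cc: "c2 \<circ> c1 \<in> alg_hom R S S2" by (rule alg_hom_comp[OF p1.c_alg p2.c_alg])
  obtain \<psi> where psi: "\<psi> \<in> alg_hom R S1 S2" "\<forall>z\<in>carrier S. \<psi> (c1 z) = (c2 \<circ> c1) z" "\<psi> X1 = X2"
    using p1.alg_evaluation[OF S2 cc p2.X_closed] by (elim bexE conjE)
  have ce: "c1 \<circ> e0 \<in> alg_hom R S1 S1" by (rule alg_hom_comp[OF e0(1) p1.c_alg])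
  obtain \<theta> where theta: "\<theta> \<in> alg_hom R S2 S1" "\<forall>z\<in>carrier S1. \<theta> (c2 z) = (c1 \<circ> e0) z" "\<theta> X2 = X1"
    using p2.alg_evaluation[OF S1 ce p1.X_closed] by (elim bexE conjE)
  define cx where "cx = ?tA S1 c1 x"
  define cy where "cy = ?tA S1 c1 y"
  define ccx where "ccx = ?tA S2 c2 cx"
  define ccy where "ccy = ?tA S2 c2 cy"
  have cxy: "cx \<in> carrier (tensor R A S1)" "cy \<in> carrier (tensor R A S1)"
    using ring_hom_closed[OF base_map_hom[OF A S S1 p1.c_alg]] x y by (simp_all add: cx_def cy_def)
  have ccxy: "ccx \<in> carrier (tensor R A S2)" "ccy \<in> carrier (tensor R A S2)"
    using ring_hom_closed[OF base_map_hom[OF A S1 S2 p2.c_alg]] cxy by (simp_all add: ccx_def ccy_def)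
  define w1 where "w1 = cx \<oplus>\<^bsub>tensor R A S1\<^esub> X1 \<odot>\<^bsub>tensor R A S1\<^esub> cy"
  define w2 where "w2 = c2 X1 \<odot>\<^bsub>tensor R A S2\<^esub> ccx \<oplus>\<^bsub>tensor R A S2\<^esub> X2 \<odot>\<^bsub>tensor R A S2\<^esub> ccy"
  have w1: "w1 \<in> carrier (tensor R A S1)" using cxy by (simp add: w1_def A1.smult_closed)
  have w2: "w2 \<in> carrier (tensor R A S2)" using ccxy by (simp add: w2_def A2.smult_closed)
  define d where "d = f S1 w1"
  define z where "z = f S2 w2"
  have d: "d \<in> carrier (tensor R B S1)" and z: "z \<in> carrier (tensor R B S2)"
    using fc[OF S1 w1] fc[OF S2 w2] by (simp_all add: d_def z_def)
  note tA_add = ring_hom_add[OF base_map_hom[OF A]] and tA_sm = base_map_smult[OF A]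
  have e0c: "?tA S e0 cx = x" "?tA S e0 cy = y"
    unfolding cx_def cy_def using e0(2) x y by (auto intro!: base_map_ident[OF A S S1 p1.c_alg e0(1)])
  have e1c: "?tA S e1 cx = x" "?tA S e1 cy = y"
    unfolding cx_def cy_def using e1(2) x y by (auto intro!: base_map_ident[OF A S S1 p1.c_alg e1(1)])
  have e0w: "?tA S e0 w1 = x"
    using cxy x y unfolding w1_def
    by (simp add: tA_add[OF S1 S e0(1)] tA_sm[OF S1 S e0(1)] A1.smult_closed e0c e0(3) AS.zero_smult)
  have e1w: "?tA S e1 w1 = x \<oplus>\<^bsub>tensor R A S\<^esub> y"
    using cxy x y unfolding w1_def
    by (simp add: tA_add[OF S1 S e1(1)] tA_sm[OF S1 S e1(1)] A1.smult_closed e1c e1(3) AS.one_smult)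
  have phic: "?tA S2 \<phi> ccx = ccx" "?tA S2 \<phi> ccy = ccy"
    unfolding ccx_def ccy_def using phi(2) cxy by (auto intro!: base_map_comp[OF A S1 S2 S2 p2.c_alg phi(1) p2.c_alg])
  have psic: "?tA S2 \<psi> cx = ccx" "?tA S2 \<psi> cy = ccy"
  proof -
    have "?tA S2 \<psi> (?tA S1 c1 v) = ?tA S2 c2 (?tA S1 c1 v)" if v: "v \<in> carrier (tensor R A S)" for v
      using base_map_comp[OF A S S1 S2 p1.c_alg psi(1) cc _ v] base_map_comp[OF A S S1 S2 p1.c_alg p2.c_alg cc _ v] psi(2)
      by simp
    then show "?tA S2 \<psi> cx = ccx" "?tA S2 \<psi> cy = ccy" using x y by (simp_all add: cx_def cy_def ccx_def ccy_def)
  qed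
  have thetac: "?tA S1 \<theta> ccx = cx" "?tA S1 \<theta> ccy = cy"
  proof -
    have "?tA S1 \<theta> (?tA S2 c2 (?tA S1 c1 v)) = ?tA S1 c1 v" if v: "v \<in> carrier (tensor R A S)" for v
    proof -
      have cv: "?tA S1 c1 v \<in> carrier (tensor R A S1)" by (rule ring_hom_closed[OF base_map_hom[OF A S S1 p1.c_alg] v])
      have "?tA S1 \<theta> (?tA S2 c2 (?tA S1 c1 v)) = ?tA S1 (c1 \<circ> e0) (?tA S1 c1 v)"
        using theta(2) by (intro base_map_comp[OF A S1 S2 S1 p2.c_alg theta(1) ce _ cv]) simp
      also have "\<dots> = ?tA S1 c1 v"
        using e0(2) by (intro base_map_comp[OF A S S1 S1 p1.c_alg ce p1.c_alg _ v]) simp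
      finally show ?thesis .
    qed
    then show "?tA S1 \<theta> ccx = cx" "?tA S1 \<theta> ccy = cy" using x y by (simp_all add: cx_def cy_def ccx_def ccy_def)
  qed
  have "?tA S2 \<phi> w2 = c2 X1 \<odot>\<^bsub>tensor R A S2\<^esub> ?tA S2 \<psi> w1"
    using cxy ccxy unfolding w1_def w2_def
    by (simp add: tA_add[OF S2 S2 phi(1)] tA_sm[OF S2 S2 phi(1)] tA_add[OF S1 S2 psi(1)] tA_sm[OF S1 S2 psi(1)]
        A1.smult_closed A2.smult_closed phic psic phi(2,3) psi(3) A2.mult_smult A2.smult_add)
  then have eq1: "?tB S2 \<phi> z = c2 X1 \<odot>\<^bsub>tensor R B S2\<^esub> ?tB S2 \<psi> d"
    using fn[OF S2 S2 phi(1) w2] fn[OF S1 S2 psi(1) w1] fh[OF S2, of "c2 X1" "?tA S2 \<psi> w1"]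
      ring_hom_closed[OF base_map_hom[OF A S1 S2 psi(1)] w1] by (simp add: z_def d_def)
  have "?tA S1 \<theta> w2 = X1 \<odot>\<^bsub>tensor R A S1\<^esub> cy"
    using cxy ccxy unfolding w2_def
    by (simp add: tA_add[OF S2 S1 theta(1)] tA_sm[OF S2 S1 theta(1)] A2.smult_closed A1.smult_closed thetac theta(2,3) e0(3) A1.zero_smult)
  then have eq2: "?tB S1 \<theta> z = X1 \<odot>\<^bsub>tensor R B S1\<^esub> ?tB S1 c1 (f S y)"
    using fn[OF S2 S1 theta(1) w2] fh[OF S1 p1.X_closed cxy(2)] fn[OF S S1 p1.c_alg y] by (simp add: z_def cy_def)
  have eq0: "?tB S e0 d = f S x" using fn[OF S1 S e0(1) w1] e0w by (simp add: d_def)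
  have eq3: "?tB S e1 d = f S (x \<oplus>\<^bsub>tensor R A S\<^esub> y)" using fn[OF S1 S e1(1) w1] e1w by (simp add: d_def)
  let ?X1 = "pure_tensor R B S1 \<one>\<^bsub>B\<^esub> X1" and ?X2 = "pure_tensor R B S2 \<one>\<^bsub>B\<^esub> X2"
  let ?k1 = "\<lambda>j. tensor_map R B S id (k1 j)" and ?k2 = "\<lambda>j. tensor_map R B S1 id (k2 j)"
  have P1: "poly_ring (tensor R B S) (tensor R B S1) (?tB S1 c1) ?X1 ?k1"
    by (rule p1.base_change_poly_ring[OF B])
  have P2: "poly_ring (tensor R B S1) (tensor R B S2) (?tB S2 c2) ?X2 ?k2"
    by (rule p2.base_change_poly_ring[OF B])
  interpret P1: poly_ring "tensor R B S" "tensor R B S1" "?tB S1 c1" ?X1 ?k1 by (rule P1)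
  interpret P2: poly_ring "tensor R B S1" "tensor R B S2" "?tB S2 c2" ?X2 ?k2 by (rule P2)
  interpret he0: ring_hom_cring "tensor R B S1" "tensor R B S" "?tB S e0"
    by unfold_locales (rule base_map_hom[OF B S1 S e0(1)])
  have e0c1: "?tB S e0 (?tB S1 c1 v) = v" if "v \<in> carrier (tensor R B S)" for v
    using e0(2) that by (intro base_map_ident[OF B S S1 p1.c_alg e0(1)]) simp_all
  have e0X: "?tB S e0 ?X1 = \<zero>\<^bsub>tensor R B S\<^esub>"
    by (simp add: base_map_pure[OF B S1 S e0(1)] e0(3) BS.pure_zero_right)
  \<comment> \<open>Coefficients in \<open>(B \<otimes> S)[V][X]\<close>: those of \<open>z(V, V X)\<close> are \<open>V\<^sup>j z\<^sub>j(V)\<close>, and those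
    of the image of \<open>d\<close> are the constants \<open>d\<^sub>j\<close>.\<close>
  have kphi: "?k2 j (?tB S2 \<phi> z) = ?k2 j z \<otimes>\<^bsub>tensor R B S1\<^esub> ?X1 [^]\<^bsub>tensor R B S1\<^esub> j" for j
  proof -
    have "?k2 j (?tB S2 \<phi> z) = id (?k2 j z) \<otimes>\<^bsub>tensor R B S1\<^esub> ?X1 [^]\<^bsub>tensor R B S1\<^esub> j"
    proof (rule poly_ring_hom_coef[OF P2 P2 id_ring_hom base_map_hom[OF B S2 S2 phi(1)] _ P1.X_closed _ z])
      fix v assume v: "v \<in> carrier (tensor R B S1)"
      show "?tB S2 \<phi> (?tB S2 c2 v) = ?tB S2 c2 (id v)"
        using phi(2) base_map_comp[OF B S1 S2 S2 p2.c_alg phi(1) p2.c_alg _ v] by simp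
    next
      show "?tB S2 \<phi> ?X2 = ?tB S2 c2 ?X1 \<otimes>\<^bsub>tensor R B S2\<^esub> ?X2"
        by (simp add: base_map_pure[OF B S2 S2 phi(1)] base_map_pure[OF B S1 S2 p2.c_alg] phi(3) B2.mult_pure)
    qed
    then show ?thesis by simp
  qed
  have kpsi: "?k2 j (?tB S2 \<psi> d) = ?tB S1 c1 (?k1 j d)" for j
  proof -
    have "?k2 j (?tB S2 \<psi> d) = ?tB S1 c1 (?k1 j d) \<otimes>\<^bsub>tensor R B S1\<^esub> \<one>\<^bsub>tensor R B S1\<^esub> [^]\<^bsub>tensor R B S1\<^esub> j"
    proof (rule poly_ring_hom_coef[OF P1 P2 P1.c_hom base_map_hom[OF B S1 S2 psi(1)] _ B1.tensor.one_closed _ d])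
      fix v assume v: "v \<in> carrier (tensor R B S)"
      show "?tB S2 \<psi> (?tB S1 c1 v) = ?tB S2 c2 (?tB S1 c1 v)"
        using psi(2) base_map_comp[OF B S S1 S2 p1.c_alg psi(1) cc _ v] base_map_comp[OF B S S1 S2 p1.c_alg p2.c_alg cc _ v]
        by simp
    next
      show "?tB S2 \<psi> ?X1 = ?tB S2 c2 \<one>\<^bsub>tensor R B S1\<^esub> \<otimes>\<^bsub>tensor R B S2\<^esub> ?X2"
        using P2.c.hom_one P2.X_closed by (simp add: base_map_pure[OF B S1 S2 psi(1)] psi(3))
    qed
    then show ?thesis using d by simp
  qed
  have ktheta: "?k1 j (?tB S1 \<theta> z) = ?tB S e0 (?k2 j z)" for j
  proof -
    have "?k1 j (?tB S1 \<theta> z) = ?tB S e0 (?k2 j z) \<otimes>\<^bsub>tensor R B S\<^esub> \<one>\<^bsub>tensor R B S\<^esub> [^]\<^bsub>tensor R B S\<^esub> j"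
    proof (rule poly_ring_hom_coef[OF P2 P1 base_map_hom[OF B S1 S e0(1)] base_map_hom[OF B S2 S1 theta(1)] _ BS.tensor.one_closed _ z])
      fix v assume v: "v \<in> carrier (tensor R B S1)"
      show "?tB S1 \<theta> (?tB S2 c2 v) = ?tB S1 c1 (?tB S e0 v)"
        using theta(2) base_map_comp[OF B S1 S2 S1 p2.c_alg theta(1) ce _ v] base_map_comp[OF B S1 S S1 e0(1) p1.c_alg ce _ v]
        by simp
    next
      show "?tB S1 \<theta> ?X2 = ?tB S1 c1 \<one>\<^bsub>tensor R B S\<^esub> \<otimes>\<^bsub>tensor R B S1\<^esub> ?X1"
        using P1.c.hom_one P1.X_closed by (simp add: base_map_pure[OF B S2 S1 theta(1)] theta(3))
    qed
    then show ?thesis using z by simp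
  qed
  have psid: "?tB S2 \<psi> d \<in> carrier (tensor R B S2)" by (rule ring_hom_closed[OF base_map_hom[OF B S1 S2 psi(1)] d])
  have key: "?X1 \<otimes>\<^bsub>tensor R B S1\<^esub> ?tB S1 c1 (?k1 j d) = ?k2 j z \<otimes>\<^bsub>tensor R B S1\<^esub> ?X1 [^]\<^bsub>tensor R B S1\<^esub> j" for j
  proof -
    have "c2 X1 \<odot>\<^bsub>tensor R B S2\<^esub> ?tB S2 \<psi> d = ?tB S2 c2 ?X1 \<otimes>\<^bsub>tensor R B S2\<^esub> ?tB S2 \<psi> d"
      using psid by (simp add: B2.smult_eq_mult base_map_pure[OF B S1 S2 p2.c_alg])
    then have "?k2 j (?tB S2 \<phi> z) = ?X1 \<otimes>\<^bsub>tensor R B S1\<^esub> ?k2 j (?tB S2 \<psi> d)"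
      using eq1 P2.coef_const_mult[OF P1.X_closed psid] by simp
    then show ?thesis by (simp add: kphi kpsi)
  qed
  have X1_cancel: "v = w" if "?X1 \<otimes>\<^bsub>tensor R B S1\<^esub> v = ?X1 \<otimes>\<^bsub>tensor R B S1\<^esub> w"
    "v \<in> carrier (tensor R B S1)" "w \<in> carrier (tensor R B S1)" for v w
  proof (rule P1.coef_eqI[OF that(2,3)])
    fix j
    show "?k1 j v = ?k1 j w"
      using P1.coef_X_mult[OF that(2), of "Suc j"] P1.coef_X_mult[OF that(3), of "Suc j"] that(1) by simp
  qed
  have key': "?tB S1 c1 (?k1 (Suc j) d) = ?k2 (Suc j) z \<otimes>\<^bsub>tensor R B S1\<^esub> ?X1 [^]\<^bsub>tensor R B S1\<^esub> j" for j
  proof (rule X1_cancel)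
    have k: "?k2 (Suc j) z \<in> carrier (tensor R B S1)" using z by simp
    have "?k2 (Suc j) z \<otimes>\<^bsub>tensor R B S1\<^esub> ?X1 [^]\<^bsub>tensor R B S1\<^esub> Suc j =
        ?X1 \<otimes>\<^bsub>tensor R B S1\<^esub> (?k2 (Suc j) z \<otimes>\<^bsub>tensor R B S1\<^esub> ?X1 [^]\<^bsub>tensor R B S1\<^esub> j)"
      using k P1.X_closed by (simp add: B1.tensor.m_ac)
    then show "?X1 \<otimes>\<^bsub>tensor R B S1\<^esub> ?tB S1 c1 (?k1 (Suc j) d) = ?X1 \<otimes>\<^bsub>tensor R B S1\<^esub> (?k2 (Suc j) z \<otimes>\<^bsub>tensor R B S1\<^esub> ?X1 [^]\<^bsub>tensor R B S1\<^esub> j)"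
      using key[of "Suc j"] by simp
  qed (use d z in simp_all)
  have fy: "f S y \<in> carrier (tensor R B S)" by (rule fc[OF S y])
  have kd: "?k1 (Suc j) d = (if j = 0 then f S y else \<zero>\<^bsub>tensor R B S\<^esub>)" for j
  proof -
    have kc: "?k1 (Suc j) d \<in> carrier (tensor R B S)" "?k2 (Suc j) z \<in> carrier (tensor R B S1)" using d z by simp_all
    have "?k1 (Suc j) d = ?tB S e0 (?tB S1 c1 (?k1 (Suc j) d))" using e0c1[OF kc(1)] by simp
    also have "\<dots> = ?tB S e0 (?k2 (Suc j) z) \<otimes>\<^bsub>tensor R B S\<^esub> \<zero>\<^bsub>tensor R B S\<^esub> [^]\<^bsub>tensor R B S\<^esub> j"
      unfolding key' using kc(2) by (simp add: he0.hom_pow e0X)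
    also have "?tB S e0 (?k2 (Suc j) z) = ?k1 (Suc j) (?tB S1 \<theta> z)" by (simp add: ktheta)
    also have "\<dots> = ?k1 j (?tB S1 c1 (f S y))"
      using fy by (simp add: eq2 B1.smult_eq_mult P1.coef_X_mult)
    finally have 1: "?k1 (Suc j) d = ?k1 j (?tB S1 c1 (f S y)) \<otimes>\<^bsub>tensor R B S\<^esub> \<zero>\<^bsub>tensor R B S\<^esub> [^]\<^bsub>tensor R B S\<^esub> j" .
    have "?k1 0 (?tB S1 c1 (f S y)) = f S y"
      using P1.coef_const_mult[OF fy B1.tensor.one_closed, of 0] fy by (simp add: P1.coef_one)
    then show ?thesis using 1 fy by (cases j) simp_all
  qed
  define d0 where "d0 = ?k1 0 d"
  have d0: "d0 \<in> carrier (tensor R B S)" using d by (simp add: d0_def)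
  have k1c: "?k1 j (?tB S1 c1 v) = (if j = 0 then v else \<zero>\<^bsub>tensor R B S\<^esub>)" if "v \<in> carrier (tensor R B S)" for v j
    using P1.coef_const_mult[OF that B1.tensor.one_closed, of j] that by (simp add: P1.coef_one)
  have dd: "d = ?tB S1 c1 d0 \<oplus>\<^bsub>tensor R B S1\<^esub> ?X1 \<otimes>\<^bsub>tensor R B S1\<^esub> ?tB S1 c1 (f S y)"
  proof (rule P1.coef_eqI[OF d])
    fix j
    show "?k1 j d = ?k1 j (?tB S1 c1 d0 \<oplus>\<^bsub>tensor R B S1\<^esub> ?X1 \<otimes>\<^bsub>tensor R B S1\<^esub> ?tB S1 c1 (f S y))"
      using d0 fy by (cases j) (simp_all add: P1.coef_add P1.coef_X_mult k1c kd, simp add: d0_def)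
  qed (use d0 fy in simp)
  have "f S x = ?tB S e0 d" by (simp add: eq0)
  also have "\<dots> = d0" using d0 fy by (subst dd) (simp add: e0c1 e0X)
  finally have x0: "f S x = d0" .
  interpret he1: ring_hom_cring "tensor R B S1" "tensor R B S" "?tB S e1"
    by unfold_locales (rule base_map_hom[OF B S1 S e1(1)])
  have e1c1: "?tB S e1 (?tB S1 c1 v) = v" if "v \<in> carrier (tensor R B S)" for v
    using e1(2) that by (intro base_map_ident[OF B S S1 p1.c_alg e1(1)]) simp_all
  have e1X: "?tB S e1 ?X1 = \<one>\<^bsub>tensor R B S\<^esub>"
    by (simp add: base_map_pure[OF B S1 S e1(1)] e1(3) BS.one_cls)
  have "f S (x \<oplus>\<^bsub>tensor R A S\<^esub> y) = ?tB S e1 d" by (simp add: eq3)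
  also have "\<dots> = d0 \<oplus>\<^bsub>tensor R B S\<^esub> f S y" using d0 fy by (subst dd) (simp add: e1c1 e1X)
  finally show ?thesis by (simp add: x0)
qed

section \<open>Translates by the polynomial variable\<close>

text \<open>
  The element \<open>X + a\<close> of \<open>A \<otimes>\<^sub>R S[X]\<close>. A sum is more convenient than \<open>X - a\<close>: it specializes to \<open>a\<close> itself
  at \<open>X = 0\<close>.
\<close>

definition translate :: "'u ring \<Rightarrow> ('u, 'u) module \<Rightarrow> ('u, 'u) module \<Rightarrow> ('u \<times> 'u) multiset set \<Rightarrow>
    ('u \<times> 'u) multiset set" where
  "translate R A S a = pure_tensor R A (poly_u S) \<one>\<^bsub>A\<^esub> (poly_u_var S) \<oplus>\<^bsub>tensor R A (poly_u S)\<^esub>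
     tensor_map R A (poly_u S) id (poly_u_const S) a"

definition at_zero :: "'u ring \<Rightarrow> ('u, 'u) module \<Rightarrow> 'u \<Rightarrow> 'u" where
  "at_zero R S = (SOME e. e \<in> alg_hom R (poly_u S) S \<and> (\<forall>s\<in>carrier S. e (poly_u_const S s) = s) \<and>
     e (poly_u_var S) = \<zero>\<^bsub>S\<^esub>)"

text \<open>
  The divisibility condition of the \<open>m\<close>-closure at \<open>-a\<close> instead of \<open>a\<close>, stated in the coded polynomial
  algebra: \<open>\<Prod>(X + \<beta>\<^sub>i(a))\<close> divides the norm of \<open>X + a\<close>.
\<close>

definition translates_divide ::
  "'u ring \<Rightarrow> ('u, 'u) module \<Rightarrow> nat \<Rightarrow> ('u, 'u) module \<Rightarrow> (nat \<Rightarrow> 'u \<Rightarrow> 'u) \<Rightarrow> bool" where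
  "translates_divide R A m B \<beta> \<longleftrightarrow> (\<forall>S a. algebra R S \<and> a \<in> carrier (tensor R A S) \<longrightarrow>
     (\<exists>q\<in>carrier (tensor R B (poly_u S)).
        pure_tensor R B (poly_u S) \<one>\<^bsub>B\<^esub> (algebra_norm R A (poly_u S) (translate R A S a)) =
        (\<Otimes>\<^bsub>tensor R B (poly_u S)\<^esub>i\<in>{..<m}. translate R B S (tensor_map R B S (\<beta> i) id a))
          \<otimes>\<^bsub>tensor R B (poly_u S)\<^esub> q))"

locale universe =
  fixes R :: "'u ring"
  assumes inf: "infinite (UNIV :: 'u set)" and R_cring: "cring R"
begin

lemmas poly_u = poly_u_polynomial[OF inf, of R]
lemmas poly_u_alg = polynomial_algebra.alg_P[OF poly_u]
lemmas const_alg = polynomial_algebra.c_alg[OF poly_u]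

lemma var_closed: "algebra R S \<Longrightarrow> poly_u_var S \<in> carrier (poly_u S)"
  by (rule poly_ring.X_closed[OF polynomial_algebra.axioms(1)[OF poly_u]])

lemma at_zero:
  assumes S: "algebra R S"
  shows "at_zero R S \<in> alg_hom R (poly_u S) S" "s \<in> carrier S \<Longrightarrow> at_zero R S (poly_u_const S s) = s"
    "at_zero R S (poly_u_var S) = \<zero>\<^bsub>S\<^esub>"
proof -
  interpret S: cring S using S by (rule algebra_facts)
  have "\<exists>e. e \<in> alg_hom R (poly_u S) S \<and> (\<forall>s\<in>carrier S. e (poly_u_const S s) = s) \<and> e (poly_u_var S) = \<zero>\<^bsub>S\<^esub>"
    using polynomial_algebra.alg_evaluation[OF poly_u[OF S] S alg_hom_id S.zero_closed] by auto
  from someI_ex[OF this]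
  have *: "at_zero R S \<in> alg_hom R (poly_u S) S \<and> (\<forall>s\<in>carrier S. at_zero R S (poly_u_const S s) = s) \<and>
     at_zero R S (poly_u_var S) = \<zero>\<^bsub>S\<^esub>" unfolding at_zero_def .
  show "at_zero R S \<in> alg_hom R (poly_u S) S" using * by simp
  show "s \<in> carrier S \<Longrightarrow> at_zero R S (poly_u_const S s) = s" using * by simp
  show "at_zero R S (poly_u_var S) = \<zero>\<^bsub>S\<^esub>" using * by simp
qed

lemma poly_u_functorial:
  assumes S: "algebra R S" and T: "algebra R T" and h: "h \<in> alg_hom R S T"
  shows "\<exists>H\<in>alg_hom R (poly_u S) (poly_u T). (\<forall>s\<in>carrier S. H (poly_u_const S s) = poly_u_const T (h s)) \<and>
    H (poly_u_var S) = poly_u_var T"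
  using polynomial_algebra.alg_evaluation[OF poly_u[OF S] poly_u_alg[OF T]
      alg_hom_comp[OF h const_alg[OF T]] var_closed[OF T]] by simp

lemma translate_closed:
  assumes A: "algebra R A" and S: "algebra R S" and a: "a \<in> carrier (tensor R A S)"
  shows "translate R A S a \<in> carrier (tensor R A (poly_u S))"
proof -
  interpret P: algebra_base_change R A "poly_u S" by (rule algebra_base_change.intro[OF A poly_u_alg[OF S]])
  show ?thesis
    using ring_hom_closed[OF base_map_hom[OF A S poly_u_alg[OF S] const_alg[OF S]] a]
    by (simp add: translate_def P.pure_closed var_closed[OF S])
qed

lemma translate_coefficient_map:
  assumes A: "algebra R A" and B: "algebra R B" and S: "algebra R S" and b: "\<beta> \<in> alg_hom R A B"
    and a: "a \<in> carrier (tensor R A S)"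
  shows "tensor_map R B (poly_u S) \<beta> id (translate R A S a) = translate R B S (tensor_map R B S \<beta> id a)"
proof -
  note P = poly_u_alg[OF S]
  interpret b: algebra_base_change_map R A "poly_u S" B "poly_u S" \<beta> id
    by (rule algebra_base_change_mapI[OF A P B P b alg_hom_id])
  show ?thesis
    using ring_hom_closed[OF base_map_hom[OF A S P const_alg[OF S]] a]
    by (simp add: translate_def b.tm_add b.pure_closed var_closed[OF S] b.tm_pure alg_homD(4)[OF b]
        coefficient_map_commute[OF A B S P b const_alg[OF S] a])
qed

lemma translate_base_map:
  assumes A: "algebra R A" and S: "algebra R S" and T: "algebra R T" and h: "h \<in> alg_hom R S T"
    and H: "H \<in> alg_hom R (poly_u S) (poly_u T)" "\<And>s. s \<in> carrier S \<Longrightarrow> H (poly_u_const S s) = poly_u_const T (h s)"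
      "H (poly_u_var S) = poly_u_var T"
    and a: "a \<in> carrier (tensor R A S)"
  shows "tensor_map R A (poly_u T) id H (translate R A S a) = translate R A T (tensor_map R A T id h a)"
proof -
  note PS = poly_u_alg[OF S] and PT = poly_u_alg[OF T]
  interpret P: algebra_base_change R A "poly_u S" by (rule algebra_base_change.intro[OF A PS])
  interpret A: cring A using A by (rule algebra_facts)
  note hc = alg_hom_comp[OF h const_alg[OF T]]
  have "tensor_map R A (poly_u T) id H (tensor_map R A (poly_u S) id (poly_u_const S) a) =
      tensor_map R A (poly_u T) id (poly_u_const T) (tensor_map R A T id h a)"
    using base_map_comp[OF A S PS PT const_alg[OF S] H(1) hc _ a] base_map_comp[OF A S T PT h const_alg[OF T] hc _ a] H(2)
    by simp
  then show ?thesis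
    using ring_hom_closed[OF base_map_hom[OF A S PS const_alg[OF S]] a]
    by (simp add: translate_def ring_hom_add[OF base_map_hom[OF A PS PT H(1)]] P.pure_closed var_closed[OF S]
        base_map_pure[OF A PS PT H(1)] H(3))
qed

lemma translate_at_zero:
  assumes A: "algebra R A" and S: "algebra R S" and a: "a \<in> carrier (tensor R A S)"
  shows "tensor_map R A S id (at_zero R S) (translate R A S a) = a"
proof -
  note PS = poly_u_alg[OF S]
  interpret P: algebra_base_change R A "poly_u S" by (rule algebra_base_change.intro[OF A PS])
  interpret AS: algebra_base_change R A S by (rule algebra_base_change.intro[OF A S])
  note e = at_zero[OF S]
  have "tensor_map R A S id (at_zero R S) (tensor_map R A (poly_u S) id (poly_u_const S) a) = a"
    by (rule base_map_ident[OF A S PS const_alg[OF S] e(1) e(2) a])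
  then show ?thesis
    using a ring_hom_closed[OF base_map_hom[OF A S PS const_alg[OF S]] a]
    by (simp add: translate_def ring_hom_add[OF base_map_hom[OF A PS S e(1)]] P.pure_closed var_closed[OF S]
        base_map_pure[OF A PS S e(1)] e(3) AS.pure_zero_right)
qed

text \<open>
  \<open>\<Prod>(X + z\<^sub>i)\<close> is a monic polynomial over \<open>B \<otimes>\<^sub>R S\<close> and hence no zero divisor.
\<close>

lemma prod_translate_cancel:
  fixes m :: nat
  assumes B: "algebra R B" and S: "algebra R S" and z: "\<And>i. i < m \<Longrightarrow> z i \<in> carrier (tensor R B S)"
    and v: "v \<in> carrier (tensor R B (poly_u S))" and w: "w \<in> carrier (tensor R B (poly_u S))"
    and eq: "(\<Otimes>\<^bsub>tensor R B (poly_u S)\<^esub>i\<in>{..<m}. translate R B S (z i)) \<otimes>\<^bsub>tensor R B (poly_u S)\<^esub> v =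
      (\<Otimes>\<^bsub>tensor R B (poly_u S)\<^esub>i\<in>{..<m}. translate R B S (z i)) \<otimes>\<^bsub>tensor R B (poly_u S)\<^esub> w"
  shows "v = w"
  by (rule poly_ring.prod_X_plus_const_cancel[where z = z and I = "{..<m}",
        OF polynomial_algebra.base_change_poly_ring[OF poly_u[OF S] B] finite_lessThan _ v w])
    (use z eq in \<open>simp_all add: translate_def\<close>)

end

section \<open>Algebras of rank \<open>n\<close>\<close>

locale rank_algebra = universe R + dual_basis_algebra R A k l g
  for R :: "'u ring" and A :: "('u, 'u) module" and k l g +
  fixes n m :: nat
  assumes rank: "\<And>P. primeideal P R \<Longrightarrow> free_of_rank (localization R P) (tensor R A (localization R P)) n"
    and m_le: "m \<le> n"
begin

text \<open>
  \<open>P\<^sub>a(X) = N(X - a)\<close>, and forming the norm commutes with the isomorphism from \<open>S[X]\<close> to its coded copy.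
\<close>

lemma char_poly_code:
  assumes S: "algebra R S" and a: "a \<in> carrier (tensor R A S)"
  shows "char_poly R A S a \<in> carrier (UP S)"
    and "universe_code S (char_poly R A S a) = algebra_norm R A (poly_u S) (translate R A S (\<ominus>\<^bsub>tensor R A S\<^esub> a))"
proof -
  let ?Q = "poly_algebra S" and ?P = "poly_u S" and ?e = "universe_code S"
  let ?c = "\<lambda>s. up_ring.monom (UP S) s 0" and ?X = "up_ring.monom (UP S) \<one>\<^bsub>S\<^esub> 1"
  interpret Q: polynomial_algebra R S ?Q ?c ?X "\<lambda>j p. p j" by (rule poly_algebra_polynomial[OF S])
  note P = poly_u_alg[OF S] and e = universe_code_alg_hom[OF inf S]
  interpret AS: algebra_base_change R A S by (rule bc[OF S])
  interpret AQ: algebra_base_change R A ?Q by (rule bc[OF Q.alg_P])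
  interpret AP: algebra_base_change R A ?P by (rule bc[OF P])
  have hc: "tensor_map R A ?Q id ?c \<in> ring_hom (tensor R A S) (tensor R A ?Q)" by (rule base_map_hom[OF alg_A S Q.alg_P Q.c_alg])
  have he: "tensor_map R A ?P id ?e \<in> ring_hom (tensor R A ?Q) (tensor R A ?P)" by (rule base_map_hom[OF alg_A Q.alg_P P e])
  have hu: "tensor_map R A ?P id (poly_u_const S) \<in> ring_hom (tensor R A S) (tensor R A ?P)" by (rule base_map_hom[OF alg_A S P const_alg[OF S]])
  interpret he: ring_hom_cring "tensor R A ?Q" "tensor R A ?P" "tensor_map R A ?P id ?e" by unfold_locales (rule he)
  interpret hu: ring_hom_cring "tensor R A S" "tensor R A ?P" "tensor_map R A ?P id (poly_u_const S)" by unfold_locales (rule hu)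
  let ?w = "pure_tensor R A ?Q \<one>\<^bsub>A\<^esub> ?X \<ominus>\<^bsub>tensor R A ?Q\<^esub> tensor_map R A ?Q id ?c a"
  have ca: "tensor_map R A ?Q id ?c a \<in> carrier (tensor R A ?Q)" by (rule ring_hom_closed[OF hc a])
  have px: "pure_tensor R A ?Q \<one>\<^bsub>A\<^esub> ?X \<in> carrier (tensor R A ?Q)" by (rule AQ.pure_closed[OF AS.A.one_closed Q.X_closed])
  have w: "?w \<in> carrier (tensor R A ?Q)" using ca px by (rule AQ.tensor.minus_closed[rotated])
  show "char_poly R A S a \<in> carrier (UP S)"
    using norm_closed[OF Q.alg_P w] by (simp add: char_poly_def)
  have "?e (char_poly R A S a) = algebra_norm R A ?P (tensor_map R A ?P id ?e ?w)"
    unfolding char_poly_def by (rule norm_hom[OF Q.alg_P P e w])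
  also have "tensor_map R A ?P id ?e ?w = tensor_map R A ?P id ?e (pure_tensor R A ?Q \<one>\<^bsub>A\<^esub> ?X) \<oplus>\<^bsub>tensor R A ?P\<^esub>
      \<ominus>\<^bsub>tensor R A ?P\<^esub> tensor_map R A ?P id ?e (tensor_map R A ?Q id ?c a)"
    using ca px by (simp only: AQ.tensor.minus_eq he.hom_add he.hom_a_inv AQ.tensor.a_inv_closed)
  also have "tensor_map R A ?P id ?e (pure_tensor R A ?Q \<one>\<^bsub>A\<^esub> ?X) = pure_tensor R A ?P \<one>\<^bsub>A\<^esub> (poly_u_var S)"
    unfolding poly_u_var_def by (rule base_map_pure[OF alg_A Q.alg_P P e AS.A.one_closed Q.X_closed])
  also have "tensor_map R A ?P id ?e (tensor_map R A ?Q id ?c a) = tensor_map R A ?P id (poly_u_const S) a"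
    by (rule base_map_comp[OF alg_A S Q.alg_P P Q.c_alg e const_alg[OF S] _ a]) (simp add: poly_u_const_def)
  also have "\<ominus>\<^bsub>tensor R A ?P\<^esub> tensor_map R A ?P id (poly_u_const S) a = tensor_map R A ?P id (poly_u_const S) (\<ominus>\<^bsub>tensor R A S\<^esub> a)"
    using a by simp
  finally show "?e (char_poly R A S a) = algebra_norm R A ?P (translate R A S (\<ominus>\<^bsub>tensor R A S\<^esub> a))"
    by (simp add: translate_def)
qed

text \<open>
  The isomorphism \<open>(B \<otimes>\<^sub>R S)[X] \<rightarrow> B \<otimes>\<^sub>R S[X]\<close> sends \<open>X - \<beta>\<^sub>i(a)\<close> to \<open>X + \<beta>\<^sub>i(-a)\<close> and \<open>P\<^sub>a\<close> to the norm of \<open>X - a\<close>.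
\<close>

lemma linear_factors_divide_iff_at:
  assumes B: "algebra R B" and b: "\<And>i. i < m \<Longrightarrow> \<beta> i \<in> alg_hom R A B"
    and S: "algebra R S" and a: "a \<in> carrier (tensor R A S)"
  shows "(\<Otimes>\<^bsub>UP (tensor R B S)\<^esub>i\<in>{..<m}.
            up_ring.monom (UP (tensor R B S)) \<one>\<^bsub>tensor R B S\<^esub> 1
              \<ominus>\<^bsub>UP (tensor R B S)\<^esub>
            up_ring.monom (UP (tensor R B S)) (tensor_map R B S (\<beta> i) id a) 0)
        divides\<^bsub>UP (tensor R B S)\<^esub>
        (\<lambda>j. pure_tensor R B S \<one>\<^bsub>B\<^esub> (char_poly R A S a j)) \<longleftrightarrow>
     (\<exists>q\<in>carrier (tensor R B (poly_u S)).
        pure_tensor R B (poly_u S) \<one>\<^bsub>B\<^esub> (algebra_norm R A (poly_u S) (translate R A S (\<ominus>\<^bsub>tensor R A S\<^esub> a))) =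
        (\<Otimes>\<^bsub>tensor R B (poly_u S)\<^esub>i\<in>{..<m}. translate R B S (tensor_map R B S (\<beta> i) id (\<ominus>\<^bsub>tensor R A S\<^esub> a)))
          \<otimes>\<^bsub>tensor R B (poly_u S)\<^esub> q)"
    (is "?prod divides\<^bsub>?U\<^esub> ?char \<longleftrightarrow> (\<exists>q\<in>carrier ?Q. ?norm = ?prod' \<otimes>\<^bsub>?Q\<^esub> q)")
proof -
  let ?Z = "tensor R B S" and ?P = "poly_u S"
  note P = poly_u_alg[OF S]
  interpret pp: polynomial_algebra R S ?P "poly_u_const S" "poly_u_var S" "poly_u_coef S" by (rule poly_u[OF S])
  interpret BS: algebra_base_change R B S by (rule algebra_base_change.intro[OF B S])
  interpret BP: algebra_base_change R B ?P by (rule algebra_base_change.intro[OF B P])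
  interpret AS: algebra_base_change R A S by (rule bc[OF S])
  interpret U: UP_cring ?Z ?U by unfold_locales
  interpret pr: poly_ring ?Z ?Q "tensor_map R B ?P id (poly_u_const S)" "pure_tensor R B ?P \<one>\<^bsub>B\<^esub> (poly_u_var S)"
    "\<lambda>j. tensor_map R B S id (poly_u_coef S j)" by (rule pp.base_change_poly_ring[OF B])
  let ?co = "\<lambda>j. tensor_map R B S id (poly_u_coef S j)"
  obtain E where E': "E \<in> ring_hom ?U ?Q \<and> (\<forall>p\<in>carrier ?U. \<forall>j. ?co j (E p) = p j) \<and>
    (\<forall>w\<in>carrier ?Q. (\<lambda>j. ?co j w) \<in> carrier ?U \<and> E (\<lambda>j. ?co j w) = w) \<and>
    (\<forall>z\<in>carrier ?Z. E (up_ring.monom ?U z 0) = tensor_map R B ?P id (poly_u_const S) z) \<and>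
    E (up_ring.monom ?U \<one>\<^bsub>?Z\<^esub> 1) = pure_tensor R B ?P \<one>\<^bsub>B\<^esub> (poly_u_var S)" using pr.UP_iso by (elim exE)
  then have E: "E \<in> ring_hom ?U ?Q"
    and Eco: "\<And>p j. p \<in> carrier ?U \<Longrightarrow> ?co j (E p) = p j"
    and Einv: "\<And>w. w \<in> carrier ?Q \<Longrightarrow> (\<lambda>j. ?co j w) \<in> carrier ?U" "\<And>w. w \<in> carrier ?Q \<Longrightarrow> E (\<lambda>j. ?co j w) = w"
    and Ec: "\<And>z. z \<in> carrier ?Z \<Longrightarrow> E (up_ring.monom ?U z 0) = tensor_map R B ?P id (poly_u_const S) z"
    and EX: "E (up_ring.monom ?U \<one>\<^bsub>?Z\<^esub> 1) = pure_tensor R B ?P \<one>\<^bsub>B\<^esub> (poly_u_var S)"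
    by blast+
  interpret E: ring_hom_cring ?U ?Q E by unfold_locales (rule E)
  have inj: "p = q" if "p \<in> carrier ?U" "q \<in> carrier ?U" "E p = E q" for p q
  proof
    fix j show "p j = q j" using Eco[OF that(1), of j] Eco[OF that(2), of j] that(3) by simp
  qed
  have bh: "tensor_map R B S (\<beta> i) id \<in> ring_hom (tensor R A S) ?Z" if "i < m" for i
    by (rule algebra_base_change_map.tm_ring_hom[OF algebra_base_change_mapI[OF alg_A S B S b[OF that] alg_hom_id]])
  have ba: "tensor_map R B S (\<beta> i) id a \<in> carrier ?Z" if "i < m" for i
    by (rule ring_hom_closed[OF bh[OF that] a])
  let ?F = "\<lambda>i. up_ring.monom ?U \<one>\<^bsub>?Z\<^esub> 1 \<ominus>\<^bsub>?U\<^esub> up_ring.monom ?U (tensor_map R B S (\<beta> i) id a) 0"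
  have Fc: "?F i \<in> carrier ?U" if "i < m" for i
    by (rule U.P.minus_closed[OF U.monom_closed[OF BS.tensor.one_closed] U.monom_closed[OF ba[OF that]]])
  have EF: "E (?F i) = translate R B S (tensor_map R B S (\<beta> i) id (\<ominus>\<^bsub>tensor R A S\<^esub> a))" if i: "i < m" for i
  proof -
    interpret bh: ring_hom_cring "tensor R A S" ?Z "tensor_map R B S (\<beta> i) id" by unfold_locales (rule bh[OF i])
    have X1: "up_ring.monom ?U \<one>\<^bsub>?Z\<^esub> 1 \<in> carrier ?U" by (rule U.monom_closed[OF BS.tensor.one_closed])
    have m0: "up_ring.monom ?U (tensor_map R B S (\<beta> i) id a) 0 \<in> carrier ?U" by (rule U.monom_closed[OF ba[OF i]])
    have "E (?F i) = E (up_ring.monom ?U \<one>\<^bsub>?Z\<^esub> 1) \<oplus>\<^bsub>?Q\<^esub> \<ominus>\<^bsub>?Q\<^esub> E (up_ring.monom ?U (tensor_map R B S (\<beta> i) id a) 0)"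
      by (simp only: U.P.minus_eq E.hom_add E.hom_a_inv X1 m0 U.P.a_inv_closed)
    also have "\<dots> = translate R B S (\<ominus>\<^bsub>?Z\<^esub> tensor_map R B S (\<beta> i) id a)"
      unfolding translate_def EX Ec[OF ba[OF i]] using pr.c.hom_a_inv[OF ba[OF i]] by simp
    also have "\<ominus>\<^bsub>?Z\<^esub> tensor_map R B S (\<beta> i) id a = tensor_map R B S (\<beta> i) id (\<ominus>\<^bsub>tensor R A S\<^esub> a)"
      using bh.hom_a_inv[OF a] by simp
    finally show ?thesis .
  qed
  have prodc: "?prod \<in> carrier ?U" using Fc by (intro U.P.finprod_closed) blast
  have "E ?prod = (\<Otimes>\<^bsub>?Q\<^esub>i\<in>{..<m}. E (?F i))"
    using Fc by (subst E.hom_finprod) (auto simp only: o_def Pi_def lessThan_iff)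
  also have "\<dots> = ?prod'"
  proof (rule BP.tensor.finprod_cong'[OF HOL.refl])
    have "E (?F i) \<in> carrier ?Q" if "i < m" for i by (rule E.hom_closed[OF Fc[OF that]])
    then show "(\<lambda>i. translate R B S (tensor_map R B S (\<beta> i) id (\<ominus>\<^bsub>tensor R A S\<^esub> a))) \<in> {..<m} \<rightarrow> carrier ?Q"
      using EF by auto
  qed (use EF in simp)
  finally have Eprod: "E ?prod = ?prod'" .
  have ma: "\<ominus>\<^bsub>tensor R A S\<^esub> a \<in> carrier (tensor R A S)" using a by simp
  have nc: "algebra_norm R A ?P (translate R A S (\<ominus>\<^bsub>tensor R A S\<^esub> a)) \<in> carrier ?P"
    by (rule norm_closed[OF P translate_closed[OF alg_A S ma]])
  have normc: "?norm \<in> carrier ?Q" by (rule BP.pure_closed[OF BS.A.one_closed nc])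
  have char: "(\<lambda>j. ?co j ?norm) = ?char"
  proof
    fix j
    interpret co: base_change_map R B ?P B S id "poly_u_coef S j"
      by (rule base_change_mapI[OF algebra_facts(2)[OF B] P algebra_facts(2)[OF B] S module_hom_id pp.coef_hom])
    have "?co j ?norm = pure_tensor R B S \<one>\<^bsub>B\<^esub> (poly_u_coef S j (universe_code S (char_poly R A S a)))"
      using nc by (simp add: co.tm_pure char_poly_code(2)[OF S a])
    also have "poly_u_coef S j (universe_code S (char_poly R A S a)) = char_poly R A S a j"
      using char_poly_code(1)[OF S a] universe_code_inj[OF inf, of S] by (simp add: poly_u_coef_def)
    finally show "?co j ?norm = ?char j" .
  qed
  have charc: "?char \<in> carrier ?U" and Echar: "E ?char = ?norm"
    using Einv[OF normc] unfolding char by simp_all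
  show ?thesis
  proof
    assume "?prod divides\<^bsub>?U\<^esub> ?char"
    then obtain c where c: "c \<in> carrier ?U" "?char = ?prod \<otimes>\<^bsub>?U\<^esub> c" unfolding factor_def by (elim bexE)
    have "?norm = ?prod' \<otimes>\<^bsub>?Q\<^esub> E c"
      using arg_cong[OF c(2), of E] E.hom_mult[OF prodc c(1)] by (simp only: Echar Eprod)
    then show "\<exists>q\<in>carrier ?Q. ?norm = ?prod' \<otimes>\<^bsub>?Q\<^esub> q" using E.hom_closed[OF c(1)] by (rule bexI)
  next
    assume "\<exists>q\<in>carrier ?Q. ?norm = ?prod' \<otimes>\<^bsub>?Q\<^esub> q"
    then obtain q where q: "q \<in> carrier ?Q" "?norm = ?prod' \<otimes>\<^bsub>?Q\<^esub> q" by (elim bexE)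
    let ?c = "\<lambda>j. ?co j q"
    have "E ?char = E (?prod \<otimes>\<^bsub>?U\<^esub> ?c)"
      using E.hom_mult[OF prodc Einv(1)[OF q(1)]] by (simp only: Echar Eprod Einv(2)[OF q(1)] q(2))
    then have "?char = ?prod \<otimes>\<^bsub>?U\<^esub> ?c"
      by (rule inj[OF charc U.P.m_closed[OF prodc Einv(1)[OF q(1)]]])
    then show "?prod divides\<^bsub>?U\<^esub> ?char" unfolding factor_def using Einv(1)[OF q(1)] by (rule bexI)
  qed
qed

lemma linear_factors_divide_iff:
  assumes B: "algebra R B" and b: "\<And>i. i < m \<Longrightarrow> \<beta> i \<in> alg_hom R A B"
  shows "linear_factors_divide R A m B \<beta> \<longleftrightarrow> translates_divide R A m B \<beta>"
proof
  assume lf: "linear_factors_divide R A m B \<beta>"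
  show "translates_divide R A m B \<beta>" unfolding translates_divide_def
  proof (intro allI impI, elim conjE)
    fix S :: "('u, 'u) module" and a assume S: "algebra R S" and a: "a \<in> carrier (tensor R A S)"
    interpret AS: algebra_base_change R A S by (rule bc[OF S])
    have ma: "\<ominus>\<^bsub>tensor R A S\<^esub> a \<in> carrier (tensor R A S)" and mm: "\<ominus>\<^bsub>tensor R A S\<^esub> (\<ominus>\<^bsub>tensor R A S\<^esub> a) = a"
      using a by simp_all
    from lf[unfolded linear_factors_divide_def, rule_format, OF conjI[OF S ma]]
    show "\<exists>q\<in>carrier (tensor R B (poly_u S)).
        pure_tensor R B (poly_u S) \<one>\<^bsub>B\<^esub> (algebra_norm R A (poly_u S) (translate R A S a)) =
        (\<Otimes>\<^bsub>tensor R B (poly_u S)\<^esub>i\<in>{..<m}. translate R B S (tensor_map R B S (\<beta> i) id a))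
          \<otimes>\<^bsub>tensor R B (poly_u S)\<^esub> q"
      by (rule linear_factors_divide_iff_at[OF B _ S ma, THEN iffD1, rotated, unfolded mm]) (rule b)
  qed
next
  assume td: "translates_divide R A m B \<beta>"
  show "linear_factors_divide R A m B \<beta>" unfolding linear_factors_divide_def
  proof (intro allI impI, elim conjE)
    fix S :: "('u, 'u) module" and a assume S: "algebra R S" and a: "a \<in> carrier (tensor R A S)"
    interpret AS: algebra_base_change R A S by (rule bc[OF S])
    have ma: "\<ominus>\<^bsub>tensor R A S\<^esub> a \<in> carrier (tensor R A S)" using a by simp
    from td[unfolded translates_divide_def, rule_format, OF conjI[OF S ma]]
    show "(\<Otimes>\<^bsub>UP (tensor R B S)\<^esub>i\<in>{..<m}.
            up_ring.monom (UP (tensor R B S)) \<one>\<^bsub>tensor R B S\<^esub> 1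
              \<ominus>\<^bsub>UP (tensor R B S)\<^esub>
            up_ring.monom (UP (tensor R B S)) (tensor_map R B S (\<beta> i) id a) 0)
        divides\<^bsub>UP (tensor R B S)\<^esub>
        (\<lambda>j. pure_tensor R B S \<one>\<^bsub>B\<^esub> (char_poly R A S a j))"
      by (rule linear_factors_divide_iff_at[OF B _ S a, THEN iffD2, rotated]) (rule b)
  qed
qed

end

section \<open>The cofactor law\<close>

text \<open>
  A point of the functor that is represented by the \<open>m\<close>-closure. The aim is to complete the roots \<open>\<beta>\<^sub>i\<close>
  to a factorization of the norm, in exactly one way.
\<close>

locale root_system = rank_algebra R A k l g n m
  for R :: "'u ring" and A :: "('u, 'u) module" and k l g n m +
  fixes B :: "('u, 'u) module" and \<beta> :: "nat \<Rightarrow> 'u \<Rightarrow> 'u"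
  assumes alg_B: "algebra R B" and roots: "i < m \<Longrightarrow> \<beta> i \<in> alg_hom R A B"
    and divides: "translates_divide R A m B \<beta>"
begin

abbreviation "branch i S \<equiv> tensor_map R B S (\<beta> i) id"

definition root_prod :: "('u, 'u) module \<Rightarrow> ('u \<times> 'u) multiset set \<Rightarrow> ('u \<times> 'u) multiset set" where
  "root_prod S a = (\<Otimes>\<^bsub>tensor R B S\<^esub>i\<in>{..<m}. branch i S a)"

text \<open>
  The quotient of \<open>N(X + a)\<close> by \<open>\<Prod>(X + \<beta>\<^sub>i(a))\<close>. The divisor is regular
  here, which the product of the \<open>\<beta>\<^sub>i(a)\<close> need not be; the value at \<open>a\<close> is then recovered by \<open>X = 0\<close>.
\<close>

definition quotient :: "('u, 'u) module \<Rightarrow> ('u \<times> 'u) multiset set \<Rightarrow> ('u \<times> 'u) multiset set" where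
  "quotient S a = (SOME q. q \<in> carrier (tensor R B (poly_u S)) \<and>
     root_prod (poly_u S) (translate R A S a) \<otimes>\<^bsub>tensor R B (poly_u S)\<^esub> q =
     norm_law R A B (poly_u S) (translate R A S a))"

definition cofactor :: "'u law" where
  "cofactor S a = tensor_map R B S id (at_zero R S) (quotient S a)"

lemma bcB: "algebra R S \<Longrightarrow> algebra_base_change R B S"
  by (simp add: algebra_base_change_def alg_B)

lemma root_map: "algebra R S \<Longrightarrow> i < m \<Longrightarrow> algebra_base_change_map R A S B S (\<beta> i) id"
  by (rule algebra_base_change_mapI[OF alg_A _ alg_B _ roots alg_hom_id])

lemma root_hom: "algebra R S \<Longrightarrow> i < m \<Longrightarrow> branch i S \<in> ring_hom (tensor R A S) (tensor R B S)"
  by (rule algebra_base_change_map.tm_ring_hom[OF root_map])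

lemma root_closed: "algebra R S \<Longrightarrow> i < m \<Longrightarrow> a \<in> carrier (tensor R A S) \<Longrightarrow> branch i S a \<in> carrier (tensor R B S)"
  by (rule ring_hom_closed[OF root_hom])

lemma root_prod_closed:
  assumes S: "algebra R S" and a: "a \<in> carrier (tensor R A S)"
  shows "root_prod S a \<in> carrier (tensor R B S)"
proof -
  interpret BS: algebra_base_change R B S by (rule bcB[OF S])
  show ?thesis unfolding root_prod_def using root_closed[OF S _ a] by (intro BS.tensor.finprod_closed) auto
qed

lemma norm_law_mult:
  assumes S: "algebra R S" and a: "a \<in> carrier (tensor R A S)" and b: "b \<in> carrier (tensor R A S)"
  shows "norm_law R A B S (a \<otimes>\<^bsub>tensor R A S\<^esub> b) = norm_law R A B S a \<otimes>\<^bsub>tensor R B S\<^esub> norm_law R A B S b"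
proof -
  interpret BS: algebra_base_change R B S by (rule bcB[OF S])
  show ?thesis unfolding norm_law_def norm_mult[OF S a b]
    by (rule ring_hom_mult[OF BS.pure_one_hom norm_closed[OF S a] norm_closed[OF S b]])
qed

lemma norm_law_natural:
  assumes S: "algebra R S" and T: "algebra R T" and h: "h \<in> alg_hom R S T" and a: "a \<in> carrier (tensor R A S)"
  shows "tensor_map R B T id h (norm_law R A B S a) = norm_law R A B T (tensor_map R A T id h a)"
proof -
  interpret B: cring B using alg_B by (rule algebra_facts)
  show ?thesis unfolding norm_law_def
    by (simp add: base_map_pure[OF alg_B S T h B.one_closed norm_closed[OF S a]] norm_hom[OF S T h a])
qed

lemma root_natural:
  assumes S: "algebra R S" and T: "algebra R T" and h: "h \<in> alg_hom R S T" and a: "a \<in> carrier (tensor R A S)"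
    and i: "i < m"
  shows "branch i T (tensor_map R A T id h a) = tensor_map R B T id h (branch i S a)"
  by (rule coefficient_map_commute[OF alg_A alg_B S T roots[OF i] h a])

lemma root_prod_natural:
  assumes S: "algebra R S" and T: "algebra R T" and h: "h \<in> alg_hom R S T" and a: "a \<in> carrier (tensor R A S)"
  shows "tensor_map R B T id h (root_prod S a) = root_prod T (tensor_map R A T id h a)"
proof -
  interpret BS: algebra_base_change R B S by (rule bcB[OF S])
  interpret BT: algebra_base_change R B T by (rule bcB[OF T])
  interpret h: ring_hom_cring "tensor R B S" "tensor R B T" "tensor_map R B T id h"
    by unfold_locales (rule base_map_hom[OF alg_B S T h])
  have "tensor_map R B T id h (root_prod S a) = (\<Otimes>\<^bsub>tensor R B T\<^esub>i\<in>{..<m}. tensor_map R B T id h (branch i S a))"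
    unfolding root_prod_def using root_closed[OF S _ a] by (subst h.hom_finprod) (auto simp: o_def)
  also have "\<dots> = root_prod T (tensor_map R A T id h a)"
    unfolding root_prod_def
    using root_closed[OF T _ ring_hom_closed[OF base_map_hom[OF alg_A S T h] a]]
    by (intro BT.tensor.finprod_cong') (auto simp: root_natural[OF S T h a])
  finally show ?thesis .
qed

lemma root_prod_mult:
  assumes S: "algebra R S" and a: "a \<in> carrier (tensor R A S)" and b: "b \<in> carrier (tensor R A S)"
  shows "root_prod S (a \<otimes>\<^bsub>tensor R A S\<^esub> b) = root_prod S a \<otimes>\<^bsub>tensor R B S\<^esub> root_prod S b"
proof -
  interpret BS: algebra_base_change R B S by (rule bcB[OF S])
  have "root_prod S (a \<otimes>\<^bsub>tensor R A S\<^esub> b) = (\<Otimes>\<^bsub>tensor R B S\<^esub>i\<in>{..<m}. branch i S a \<otimes>\<^bsub>tensor R B S\<^esub> branch i S b)"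
    unfolding root_prod_def using root_closed[OF S _ a] root_closed[OF S _ b]
    by (intro BS.tensor.finprod_cong') (auto simp: ring_hom_mult[OF root_hom[OF S] a b])
  then show ?thesis
    unfolding root_prod_def using root_closed[OF S _ a] root_closed[OF S _ b]
    by (simp add: BS.tensor.finprod_multf Pi_def)
qed

lemma root_prod_translate:
  assumes S: "algebra R S" and a: "a \<in> carrier (tensor R A S)"
  shows "root_prod (poly_u S) (translate R A S a) =
    (\<Otimes>\<^bsub>tensor R B (poly_u S)\<^esub>i\<in>{..<m}. translate R B S (branch i S a))"
proof -
  interpret BP: algebra_base_change R B "poly_u S" by (rule bcB[OF poly_u_alg[OF S]])
  show ?thesis unfolding root_prod_def
    using translate_closed[OF alg_B S root_closed[OF S _ a]]
    by (intro BP.tensor.finprod_cong') (auto simp: translate_coefficient_map[OF alg_A alg_B S roots a])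
qed

lemma root_prod_translate_cancel:
  assumes S: "algebra R S" and a: "a \<in> carrier (tensor R A S)"
    and v: "v \<in> carrier (tensor R B (poly_u S))" and w: "w \<in> carrier (tensor R B (poly_u S))"
    and eq: "root_prod (poly_u S) (translate R A S a) \<otimes>\<^bsub>tensor R B (poly_u S)\<^esub> v =
      root_prod (poly_u S) (translate R A S a) \<otimes>\<^bsub>tensor R B (poly_u S)\<^esub> w"
  shows "v = w"
  by (rule prod_translate_cancel[OF alg_B S root_closed[OF S _ a] v w eq[unfolded root_prod_translate[OF S a]]])

lemma quotient:
  assumes S: "algebra R S" and a: "a \<in> carrier (tensor R A S)"
  shows "quotient S a \<in> carrier (tensor R B (poly_u S))"
    and "root_prod (poly_u S) (translate R A S a) \<otimes>\<^bsub>tensor R B (poly_u S)\<^esub> quotient S a =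
     norm_law R A B (poly_u S) (translate R A S a)"
proof -
  obtain q where q: "q \<in> carrier (tensor R B (poly_u S))"
    "pure_tensor R B (poly_u S) \<one>\<^bsub>B\<^esub> (algebra_norm R A (poly_u S) (translate R A S a)) =
        (\<Otimes>\<^bsub>tensor R B (poly_u S)\<^esub>i\<in>{..<m}. translate R B S (branch i S a)) \<otimes>\<^bsub>tensor R B (poly_u S)\<^esub> q"
    using divides[unfolded translates_divide_def, rule_format, OF conjI[OF S a]] by (elim bexE)
  then have "\<exists>q. q \<in> carrier (tensor R B (poly_u S)) \<and>
     root_prod (poly_u S) (translate R A S a) \<otimes>\<^bsub>tensor R B (poly_u S)\<^esub> q =
     norm_law R A B (poly_u S) (translate R A S a)"
    by (intro exI[of _ q]) (simp add: root_prod_translate[OF S a] norm_law_def)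
  from someI_ex[OF this]
  have "quotient S a \<in> carrier (tensor R B (poly_u S)) \<and>
     root_prod (poly_u S) (translate R A S a) \<otimes>\<^bsub>tensor R B (poly_u S)\<^esub> quotient S a =
     norm_law R A B (poly_u S) (translate R A S a)" unfolding quotient_def .
  then show "quotient S a \<in> carrier (tensor R B (poly_u S))"
    "root_prod (poly_u S) (translate R A S a) \<otimes>\<^bsub>tensor R B (poly_u S)\<^esub> quotient S a =
     norm_law R A B (poly_u S) (translate R A S a)" by simp_all
qed

lemma quotient_unique:
  assumes S: "algebra R S" and a: "a \<in> carrier (tensor R A S)"
    and q: "q \<in> carrier (tensor R B (poly_u S))"
    "root_prod (poly_u S) (translate R A S a) \<otimes>\<^bsub>tensor R B (poly_u S)\<^esub> q =
     norm_law R A B (poly_u S) (translate R A S a)"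
  shows "q = quotient S a"
  by (rule root_prod_translate_cancel[OF S a q(1) quotient(1)[OF S a]]) (simp add: q(2) quotient(2)[OF S a])

lemma cofactor_closed:
  assumes S: "algebra R S" and a: "a \<in> carrier (tensor R A S)"
  shows "cofactor S a \<in> carrier (tensor R B S)"
  unfolding cofactor_def
  by (rule ring_hom_closed[OF base_map_hom[OF alg_B poly_u_alg[OF S] S at_zero(1)[OF S]] quotient(1)[OF S a]])

text \<open>
  The map \<open>S[X] \<rightarrow> T[X]\<close> induced by \<open>h\<close> takes the quotient for \<open>a\<close> to one for the image of \<open>a\<close>, and the
  quotient is unique.
\<close>

lemma cofactor_natural:
  assumes S: "algebra R S" and T: "algebra R T" and h: "h \<in> alg_hom R S T" and a: "a \<in> carrier (tensor R A S)"
  shows "cofactor T (tensor_map R A T id h a) = tensor_map R B T id h (cofactor S a)"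
proof -
  note PS = poly_u_alg[OF S] and PT = poly_u_alg[OF T]
  obtain H where H: "H \<in> alg_hom R (poly_u S) (poly_u T)" "\<forall>s\<in>carrier S. H (poly_u_const S s) = poly_u_const T (h s)"
    "H (poly_u_var S) = poly_u_var T" using poly_u_functorial[OF S T h] by (elim bexE conjE)
  have Hc: "\<And>s. s \<in> carrier S \<Longrightarrow> H (poly_u_const S s) = poly_u_const T (h s)" using H(2) by simp
  have ha: "tensor_map R A T id h a \<in> carrier (tensor R A T)" by (rule ring_hom_closed[OF base_map_hom[OF alg_A S T h] a])
  note tr = translate_closed[OF alg_A S a]
  note q = quotient[OF S a]
  note hH = base_map_hom[OF alg_B PS PT H(1)]
  have "tensor_map R B (poly_u T) id H (quotient S a) = quotient T (tensor_map R A T id h a)"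
  proof (rule quotient_unique[OF T ha ring_hom_closed[OF hH q(1)]])
    have "root_prod (poly_u T) (translate R A T (tensor_map R A T id h a)) \<otimes>\<^bsub>tensor R B (poly_u T)\<^esub>
        tensor_map R B (poly_u T) id H (quotient S a) =
      tensor_map R B (poly_u T) id H (root_prod (poly_u S) (translate R A S a) \<otimes>\<^bsub>tensor R B (poly_u S)\<^esub> quotient S a)"
      by (simp add: ring_hom_mult[OF hH root_prod_closed[OF PS tr] q(1)] root_prod_natural[OF PS PT H(1) tr]
          translate_base_map[OF alg_A S T h H(1) Hc H(3) a])
    also have "\<dots> = norm_law R A B (poly_u T) (translate R A T (tensor_map R A T id h a))"
      by (simp add: q(2) norm_law_natural[OF PS PT H(1) tr] translate_base_map[OF alg_A S T h H(1) Hc H(3) a])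
    finally show "root_prod (poly_u T) (translate R A T (tensor_map R A T id h a)) \<otimes>\<^bsub>tensor R B (poly_u T)\<^esub>
        tensor_map R B (poly_u T) id H (quotient S a) =
      norm_law R A B (poly_u T) (translate R A T (tensor_map R A T id h a))" .
  qed
  moreover have "tensor_map R B T id (at_zero R T) (tensor_map R B (poly_u T) id H (quotient S a)) =
      tensor_map R B T id h (tensor_map R B S id (at_zero R S) (quotient S a))"
  proof -
    interpret pp: polynomial_algebra R S "poly_u S" "poly_u_const S" "poly_u_var S" "poly_u_coef S" by (rule poly_u[OF S])
    note c1 = alg_hom_comp[OF H(1) at_zero(1)[OF T]] and c2 = alg_hom_comp[OF at_zero(1)[OF S] h]
    have eq: "(at_zero R T \<circ> H) p = (h \<circ> at_zero R S) p" if p: "p \<in> carrier (poly_u S)" for p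
    proof (rule pp.ring_hom_eqI[OF algebra_facts(1)[OF T] alg_homD(6)[OF c1] alg_homD(6)[OF c2] _ _ p])
      show "(at_zero R T \<circ> H) (poly_u_const S z) = (h \<circ> at_zero R S) (poly_u_const S z)" if "z \<in> carrier S" for z
        using that alg_homD(1)[OF h that] by (simp add: Hc at_zero(2)[OF S] at_zero(2)[OF T])
      show "(at_zero R T \<circ> H) (poly_u_var S) = (h \<circ> at_zero R S) (poly_u_var S)"
        by (simp add: H(3) at_zero(3)[OF S] at_zero(3)[OF T] alg_hom_zero[OF h S T])
    qed
    show ?thesis
      using base_map_comp[OF alg_B PS PT T H(1) at_zero(1)[OF T] c2 _ q(1)]
        base_map_comp[OF alg_B PS S T at_zero(1)[OF S] h c2 _ q(1)] eq by simp
  qed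
  ultimately show ?thesis by (simp add: cofactor_def)
qed

lemma cofactor_prod:
  assumes S: "algebra R S" and a: "a \<in> carrier (tensor R A S)"
  shows "root_prod S a \<otimes>\<^bsub>tensor R B S\<^esub> cofactor S a = norm_law R A B S a"
proof -
  note P = poly_u_alg[OF S] and e = at_zero(1)[OF S]
  note tr = translate_closed[OF alg_A S a] and q = quotient[OF S a]
  note he = base_map_hom[OF alg_B P S e]
  have "root_prod S a \<otimes>\<^bsub>tensor R B S\<^esub> cofactor S a =
      tensor_map R B S id (at_zero R S) (root_prod (poly_u S) (translate R A S a) \<otimes>\<^bsub>tensor R B (poly_u S)\<^esub> quotient S a)"
    by (simp add: ring_hom_mult[OF he root_prod_closed[OF P tr] q(1)] root_prod_natural[OF P S e tr]
        translate_at_zero[OF alg_A S a] cofactor_def)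
  then show ?thesis by (simp add: q(2) norm_law_natural[OF P S e tr] translate_at_zero[OF alg_A S a])
qed

text \<open>
  At \<open>X + a\<close> such a law is a quotient of the norm by the product of the roots. Naturality along \<open>X \<mapsto> 0\<close>
  determines it at \<open>a\<close>.
\<close>

lemma cofactor_unique:
  assumes law: "poly_law R A B f"
    and eq: "\<And>S a. algebra R S \<Longrightarrow> a \<in> carrier (tensor R A S) \<Longrightarrow>
      root_prod S a \<otimes>\<^bsub>tensor R B S\<^esub> f S a = norm_law R A B S a"
    and S: "algebra R S" and a: "a \<in> carrier (tensor R A S)"
  shows "f S a = cofactor S a"
proof -
  note P = poly_u_alg[OF S] and tr = translate_closed[OF alg_A S a]
  have "f (poly_u S) (translate R A S a) = quotient S a"
    by (rule quotient_unique[OF S a poly_lawD(1)[OF law P tr] eq[OF P tr]])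
  then show ?thesis
    using poly_lawD(2)[OF law P S at_zero(1)[OF S] tr] by (simp add: translate_at_zero[OF alg_A S a] cofactor_def)
qed

text \<open>
  Compare the two sides at \<open>X + a\<close> and \<open>X + b\<close> first: both become equal to \<open>N(X + a) N(X + b)\<close> after
  multiplication by the regular elements \<open>\<Prod>(X + \<beta>\<^sub>i(a))\<close> and \<open>\<Prod>(X + \<beta>\<^sub>i(b))\<close>. Then put \<open>X = 0\<close>.
\<close>

lemma cofactor_mult:
  assumes S: "algebra R S" and a: "a \<in> carrier (tensor R A S)" and b: "b \<in> carrier (tensor R A S)"
  shows "cofactor S (a \<otimes>\<^bsub>tensor R A S\<^esub> b) = cofactor S a \<otimes>\<^bsub>tensor R B S\<^esub> cofactor S b"
proof -
  note P = poly_u_alg[OF S] and e = at_zero(1)[OF S]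
  let ?x = "translate R A S a" and ?y = "translate R A S b" and ?P = "poly_u S"
  let ?AP = "tensor R A ?P" and ?BP = "tensor R B ?P"
  note x = translate_closed[OF alg_A S a] and y = translate_closed[OF alg_A S b]
  interpret AP: algebra_base_change R A ?P by (rule bc[OF P])
  interpret BP: algebra_base_change R B ?P by (rule bcB[OF P])
  note cx = cofactor_closed[OF P x] and cy = cofactor_closed[OF P y]
  have xy: "?x \<otimes>\<^bsub>?AP\<^esub> ?y \<in> carrier ?AP" by (rule AP.mult_closed[OF x y])
  note rx = root_prod_closed[OF P x] and ry = root_prod_closed[OF P y]
  have "root_prod ?P ?x \<otimes>\<^bsub>?BP\<^esub> (root_prod ?P ?y \<otimes>\<^bsub>?BP\<^esub> cofactor ?P (?x \<otimes>\<^bsub>?AP\<^esub> ?y)) = norm_law R A B ?P (?x \<otimes>\<^bsub>?AP\<^esub> ?y)"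
    using cofactor_prod[OF P xy] rx ry cofactor_closed[OF P xy] by (simp add: root_prod_mult[OF P x y] BP.mult_assoc)
  also have "\<dots> = root_prod ?P ?x \<otimes>\<^bsub>?BP\<^esub> cofactor ?P ?x \<otimes>\<^bsub>?BP\<^esub> (root_prod ?P ?y \<otimes>\<^bsub>?BP\<^esub> cofactor ?P ?y)"
    by (simp add: norm_law_mult[OF P x y] cofactor_prod[OF P x] cofactor_prod[OF P y])
  also have "\<dots> = root_prod ?P ?x \<otimes>\<^bsub>?BP\<^esub> (root_prod ?P ?y \<otimes>\<^bsub>?BP\<^esub> (cofactor ?P ?x \<otimes>\<^bsub>?BP\<^esub> cofactor ?P ?y))"
    using rx ry cx cy by (simp add: BP.tensor.m_ac)
  finally have "root_prod ?P ?y \<otimes>\<^bsub>?BP\<^esub> cofactor ?P (?x \<otimes>\<^bsub>?AP\<^esub> ?y) = root_prod ?P ?y \<otimes>\<^bsub>?BP\<^esub> (cofactor ?P ?x \<otimes>\<^bsub>?BP\<^esub> cofactor ?P ?y)"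
    by (rule root_prod_translate_cancel[OF S a, rotated 2]) (use ry cx cy cofactor_closed[OF P xy] in \<open>simp_all add: BP.mult_closed\<close>)
  then have eq: "cofactor ?P (?x \<otimes>\<^bsub>?AP\<^esub> ?y) = cofactor ?P ?x \<otimes>\<^bsub>?BP\<^esub> cofactor ?P ?y"
    by (rule root_prod_translate_cancel[OF S b, rotated 2]) (use cx cy cofactor_closed[OF P xy] in \<open>simp_all add: BP.mult_closed\<close>)
  have "cofactor S (a \<otimes>\<^bsub>tensor R A S\<^esub> b) = cofactor S (tensor_map R A S id (at_zero R S) (?x \<otimes>\<^bsub>?AP\<^esub> ?y))"
    by (simp add: ring_hom_mult[OF base_map_hom[OF alg_A P S e] x y] translate_at_zero[OF alg_A S a] translate_at_zero[OF alg_A S b])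
  also have "\<dots> = tensor_map R B S id (at_zero R S) (cofactor ?P ?x \<otimes>\<^bsub>?BP\<^esub> cofactor ?P ?y)"
    by (simp add: cofactor_natural[OF P S e xy] eq)
  also have "\<dots> = cofactor S a \<otimes>\<^bsub>tensor R B S\<^esub> cofactor S b"
    by (simp add: ring_hom_mult[OF base_map_hom[OF alg_B P S e] cx cy] cofactor_natural[OF P S e x, symmetric]
        cofactor_natural[OF P S e y, symmetric] translate_at_zero[OF alg_A S a] translate_at_zero[OF alg_A S b])
  finally show ?thesis .
qed

text \<open>
  For the scalar \<open>X = X + 0\<close> the product of the roots is \<open>X\<^sup>m\<close> and the norm is \<open>X\<^sup>n\<close>, so the cofactor is
  \<open>X\<^sup>n\<^sup>-\<^sup>m\<close>, as \<open>X\<^sup>m\<close> is regular. Substitute \<open>s\<close> for \<open>X\<close>.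
\<close>

lemma cofactor_scalar:
  assumes S: "algebra R S" and s: "s \<in> carrier S"
  shows "cofactor S (s \<odot>\<^bsub>tensor R A S\<^esub> \<one>\<^bsub>tensor R A S\<^esub>) = (s [^]\<^bsub>S\<^esub> (n - m)) \<odot>\<^bsub>tensor R B S\<^esub> \<one>\<^bsub>tensor R B S\<^esub>"
proof -
  let ?P = "poly_u S" and ?X = "poly_u_var S"
  let ?AP = "tensor R A ?P" and ?BP = "tensor R B ?P"
  note P = poly_u_alg[OF S]
  interpret pp: polynomial_algebra R S ?P "poly_u_const S" ?X "poly_u_coef S" by (rule poly_u[OF S])
  interpret AS: algebra_base_change R A S by (rule bc[OF S])
  interpret BS: algebra_base_change R B S by (rule bcB[OF S])
  interpret AP: algebra_base_change R A ?P by (rule bc[OF P])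
  interpret BP: algebra_base_change R B ?P by (rule bcB[OF P])
  let ?x = "?X \<odot>\<^bsub>?AP\<^esub> \<one>\<^bsub>?AP\<^esub>" and ?X' = "pure_tensor R B ?P \<one>\<^bsub>B\<^esub> ?X"
  have zeroA: "\<zero>\<^bsub>tensor R A S\<^esub> \<in> carrier (tensor R A S)" by simp
  have pX: "pure_tensor R A ?P \<one>\<^bsub>A\<^esub> ?X = ?x" by (simp add: AP.one_cls AP.smult_pure)
  have x0: "translate R A S \<zero>\<^bsub>tensor R A S\<^esub> = ?x"
  proof -
    interpret h: ring_hom_cring "tensor R A S" ?AP "tensor_map R A ?P id (poly_u_const S)"
      by unfold_locales (rule base_map_hom[OF alg_A S P const_alg[OF S]])
    show ?thesis by (simp add: translate_def pX AP.smult_closed)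
  qed
  have x: "?x \<in> carrier ?AP" by (simp add: AP.smult_closed)
  have X': "?X' \<in> carrier ?BP" by (simp add: BP.pure_closed)
  have "branch i ?P ?x = ?X'" if "i < m" for i
  proof -
    interpret r: algebra_base_change_map R A ?P B ?P "\<beta> i" id by (rule root_map[OF P that])
    show ?thesis by (simp add: pX[symmetric] r.tm_pure alg_homD(4)[OF roots[OF that]])
  qed
  then have "root_prod ?P ?x = (\<Otimes>\<^bsub>?BP\<^esub>i\<in>{..<m}. ?X')"
    unfolding root_prod_def using X' by (intro BP.tensor.finprod_cong') auto
  also have "\<dots> = ?X' [^]\<^bsub>?BP\<^esub> m" using X' by (simp add: BP.tensor.finprod_const)
  finally have rp: "root_prod ?P ?x = ?X' [^]\<^bsub>?BP\<^esub> m" .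
  interpret po: ring_hom_cring ?P ?BP "\<lambda>s. pure_tensor R B ?P \<one>\<^bsub>B\<^esub> s" by unfold_locales (rule BP.pure_one_hom)
  have "norm_law R A B ?P ?x = ?X' [^]\<^bsub>?BP\<^esub> n"
    using po.hom_pow[OF var_closed[OF S], of n] norm_scalar[OF rank P var_closed[OF S]] by (simp add: norm_law_def)
  also have "\<dots> = ?X' [^]\<^bsub>?BP\<^esub> m \<otimes>\<^bsub>?BP\<^esub> ?X' [^]\<^bsub>?BP\<^esub> (n - m)"
    using m_le X' by (simp add: BP.tensor.nat_pow_mult)
  finally have "root_prod ?P ?x \<otimes>\<^bsub>?BP\<^esub> cofactor ?P ?x = root_prod ?P ?x \<otimes>\<^bsub>?BP\<^esub> ?X' [^]\<^bsub>?BP\<^esub> (n - m)"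
    using cofactor_prod[OF P x] by (simp add: rp)
  then have cx: "cofactor ?P ?x = ?X' [^]\<^bsub>?BP\<^esub> (n - m)"
    unfolding x0[symmetric] using X'
    by (intro root_prod_translate_cancel[OF S zeroA cofactor_closed[OF P translate_closed[OF alg_A S zeroA]]]) simp_all
  obtain e where e: "e \<in> alg_hom R ?P S" "e ?X = s"
    using pp.alg_evaluation[OF S alg_hom_id s] by (elim bexE conjE)
  interpret hA: ring_hom_cring ?AP "tensor R A S" "tensor_map R A S id e" by unfold_locales (rule base_map_hom[OF alg_A P S e(1)])
  interpret hB: ring_hom_cring ?BP "tensor R B S" "tensor_map R B S id e" by unfold_locales (rule base_map_hom[OF alg_B P S e(1)])
  interpret ps: ring_hom_cring S "tensor R B S" "\<lambda>s. pure_tensor R B S \<one>\<^bsub>B\<^esub> s" by unfold_locales (rule BS.pure_one_hom)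
  have ex: "tensor_map R A S id e ?x = s \<odot>\<^bsub>tensor R A S\<^esub> \<one>\<^bsub>tensor R A S\<^esub>"
    by (simp only: base_map_smult[OF alg_A P S e(1) var_closed[OF S] AP.tensor.one_closed] hA.hom_one e(2))
  have eX: "tensor_map R B S id e ?X' = pure_tensor R B S \<one>\<^bsub>B\<^esub> s"
    by (simp add: base_map_pure[OF alg_B P S e(1)] e(2))
  have "cofactor S (s \<odot>\<^bsub>tensor R A S\<^esub> \<one>\<^bsub>tensor R A S\<^esub>) = tensor_map R B S id e (cofactor ?P ?x)"
    using cofactor_natural[OF P S e(1) x] by (simp only: ex)
  also have "\<dots> = pure_tensor R B S \<one>\<^bsub>B\<^esub> s [^]\<^bsub>tensor R B S\<^esub> (n - m)"
    using hB.hom_pow[OF X', of "n - m"] by (simp only: cx eX)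
  also have "\<dots> = pure_tensor R B S \<one>\<^bsub>B\<^esub> (s [^]\<^bsub>S\<^esub> (n - m))"
    by (rule ps.hom_pow[OF s, of "n - m", symmetric])
  also have "\<dots> = (s [^]\<^bsub>S\<^esub> (n - m)) \<odot>\<^bsub>tensor R B S\<^esub> \<one>\<^bsub>tensor R B S\<^esub>"
    by (simp only: BS.one_cls BS.smult_pure pp.Z.nat_pow_closed[OF s] BS.A.one_closed pp.Z.one_closed pp.Z.r_one)
  finally show ?thesis .
qed

definition factors :: "nat \<Rightarrow> 'u law" where
  "factors i = (if i < m then branch i else cofactor)"

lemma factors_norm_factorization: "norm_factorization R A (replicate m 1 @ [n - m]) B factors"
proof -
  have cof: "poly_law R A B cofactor \<and> homogeneous_law R A B (n - m) cofactor \<and> multiplicative_law R A B cofactor"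
  proof (intro conjI)
    show "poly_law R A B cofactor"
      unfolding poly_law_def by (simp add: cofactor_closed cofactor_natural Pi_def)
    show "homogeneous_law R A B (n - m) cofactor"
      unfolding homogeneous_law_def
    proof (intro allI impI, elim conjE)
      fix S :: "('u, 'u) module" and s x assume S: "algebra R S" and s: "s \<in> carrier S" and x: "x \<in> carrier (tensor R A S)"
      interpret AS: algebra_base_change R A S by (rule bc[OF S])
      interpret BS: algebra_base_change R B S by (rule bcB[OF S])
      have s1: "s \<odot>\<^bsub>tensor R A S\<^esub> \<one>\<^bsub>tensor R A S\<^esub> \<in> carrier (tensor R A S)" using s by (simp add: AS.smult_closed)
      have "s \<odot>\<^bsub>tensor R A S\<^esub> x = (s \<odot>\<^bsub>tensor R A S\<^esub> \<one>\<^bsub>tensor R A S\<^esub>) \<otimes>\<^bsub>tensor R A S\<^esub> x"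
        using s x by (simp add: AS.smult_mult_assoc)
      then show "cofactor S (s \<odot>\<^bsub>tensor R A S\<^esub> x) = (s [^]\<^bsub>S\<^esub> (n - m)) \<odot>\<^bsub>tensor R B S\<^esub> cofactor S x"
        using s cofactor_closed[OF S x]
        by (simp add: cofactor_mult[OF S s1 x] cofactor_scalar[OF S s] BS.smult_mult_assoc)
    qed
    show "multiplicative_law R A B cofactor"
      unfolding multiplicative_law_def
    proof (intro allI impI conjI ballI)
      fix S :: "('u, 'u) module" assume S: "algebra R S"
      interpret AS: algebra_base_change R A S by (rule bc[OF S])
      interpret BS: algebra_base_change R B S by (rule bcB[OF S])
      show "cofactor S \<one>\<^bsub>tensor R A S\<^esub> = \<one>\<^bsub>tensor R B S\<^esub>"
        using cofactor_scalar[OF S AS.S.one_closed] by (simp add: AS.one_smult BS.one_smult)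
      show "cofactor S (x \<otimes>\<^bsub>tensor R A S\<^esub> y) = cofactor S x \<otimes>\<^bsub>tensor R B S\<^esub> cofactor S y"
        if "x \<in> carrier (tensor R A S)" "y \<in> carrier (tensor R A S)" for x y
        by (rule cofactor_mult[OF S that])
    qed
  qed
  have rt: "poly_law R A B (branch i) \<and> homogeneous_law R A B 1 (branch i) \<and> multiplicative_law R A B (branch i)" if i: "i < m" for i
  proof (intro conjI)
    show "poly_law R A B (branch i)"
      unfolding poly_law_def by (simp add: root_closed[OF _ i] root_natural[OF _ _ _ _ i] Pi_def)
    show "homogeneous_law R A B 1 (branch i)"
      unfolding homogeneous_law_def
    proof (intro allI impI, elim conjE)
      fix S :: "('u, 'u) module" and s x assume S: "algebra R S" and s: "s \<in> carrier S" and x: "x \<in> carrier (tensor R A S)"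
      interpret r: algebra_base_change_map R A S B S "\<beta> i" id by (rule root_map[OF S i])
      show "branch i S (s \<odot>\<^bsub>tensor R A S\<^esub> x) = (s [^]\<^bsub>S\<^esub> (1::nat)) \<odot>\<^bsub>tensor R B S\<^esub> branch i S x"
        using r.tm_alg_smult[OF s x] s by simp
    qed
    show "multiplicative_law R A B (branch i)"
      unfolding multiplicative_law_def by (simp add: ring_hom_mult[OF root_hom[OF _ i]] ring_hom_one[OF root_hom[OF _ i]])
  qed
  have laws: "poly_law R A B (factors i) \<and> homogeneous_law R A B ((replicate m 1 @ [n - m]) ! i) (factors i) \<and>
      multiplicative_law R A B (factors i)" if "i < length (replicate m 1 @ [n - m])" for i
    using that cof rt[of i] by (cases "i < m") (auto simp: factors_def nth_append)
  have prod: "norm_law R A B S a = (\<Otimes>\<^bsub>tensor R B S\<^esub>i\<in>{..<length (replicate m 1 @ [n - m])}. factors i S a)"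
    if S: "algebra R S" and a: "a \<in> carrier (tensor R A S)" for S a
  proof -
    interpret BS: algebra_base_change R B S by (rule bcB[OF S])
    have "(\<Otimes>\<^bsub>tensor R B S\<^esub>i\<in>{..<Suc m}. factors i S a) = cofactor S a \<otimes>\<^bsub>tensor R B S\<^esub> (\<Otimes>\<^bsub>tensor R B S\<^esub>i\<in>{..<m}. factors i S a)"
      unfolding lessThan_Suc using root_closed[OF S _ a] cofactor_closed[OF S a]
      by (subst BS.tensor.finprod_insert) (auto simp: factors_def)
    also have "(\<Otimes>\<^bsub>tensor R B S\<^esub>i\<in>{..<m}. factors i S a) = root_prod S a"
      unfolding root_prod_def using root_closed[OF S _ a] by (intro BS.tensor.finprod_cong') (auto simp: factors_def)
    finally show ?thesis
      using cofactor_prod[OF S a] BS.mult_comm[OF cofactor_closed[OF S a] root_prod_closed[OF S a]] by simp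
  qed
  show ?thesis unfolding norm_factorization_def using laws prod by blast
qed

end

section \<open>From factorizations of the norm to roots\<close>

lemma ex1_eqI: "\<exists>!x. P x \<Longrightarrow> P a \<Longrightarrow> P b \<Longrightarrow> a = b"
  by blast

lemma tensor_self_inj:
  assumes M: "module R M" and y: "y \<in> carrier M" and z: "z \<in> carrier M"
    and eq: "pure_tensor R M (self_algebra R) y \<one>\<^bsub>R\<^esub> = pure_tensor R M (self_algebra R) z \<one>\<^bsub>R\<^esub>"
  shows "y = z"
proof -
  interpret M: module R M by fact
  interpret base_change R M "self_algebra R"
    by (rule base_change.intro[OF M self_algebra_algebra[OF M.is_cring]])
  have "pure y \<one>\<^bsub>R\<^esub> \<in> carrier T" using y by (simp add: pure_closed)
  from ex1_eqI[OF tensor_self_unique[OF M this], of y z] show ?thesis using y z eq by simp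
qed

context rank_algebra
begin

lemma multiplicative_lawD:
  assumes "multiplicative_law R A B f" and "algebra R S"
  shows "f S \<one>\<^bsub>tensor R A S\<^esub> = \<one>\<^bsub>tensor R B S\<^esub>"
    and "x \<in> carrier (tensor R A S) \<Longrightarrow> y \<in> carrier (tensor R A S) \<Longrightarrow>
      f S (x \<otimes>\<^bsub>tensor R A S\<^esub> y) = f S x \<otimes>\<^bsub>tensor R B S\<^esub> f S y"
  using assms by (simp_all add: multiplicative_law_def)

text \<open>
  A law that is homogeneous of degree one is additive, so over every \<open>S\<close> it is \<open>S\<close>-linear and
  determined by its values at \<open>x \<otimes> 1\<close>. By naturality along \<open>R \<rightarrow> S\<close> these come from the map over \<open>R\<close>, which
  is multiplicative by assumption.
\<close>

lemma degree_one_law_is_alg_hom: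
  assumes B: "algebra R B" and law: "poly_law R A B f" and hom: "homogeneous_law R A B 1 f"
    and mult: "multiplicative_law R A B f"
  shows "\<exists>\<alpha>\<in>alg_hom R A B. \<forall>S a. algebra R S \<and> a \<in> carrier (tensor R A S) \<longrightarrow> f S a = tensor_map R B S \<alpha> id a"
proof -
  let ?I = "self_algebra R"
  have I: "algebra R ?I" by (rule self_algebra_algebra[OF R_cring])
  interpret R: cring R by (rule R_cring)
  interpret AI: algebra_base_change R A ?I by (rule bc[OF I])
  interpret BI: algebra_base_change R B ?I by (rule algebra_base_change.intro[OF B I])
  have fh: "f S (s \<odot>\<^bsub>tensor R A S\<^esub> x) = s \<odot>\<^bsub>tensor R B S\<^esub> f S x"
    if "algebra R S" "s \<in> carrier S" "x \<in> carrier (tensor R A S)" for S s x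
  proof -
    interpret S: cring S using that(1) by (rule algebra_facts)
    show ?thesis using hom that by (simp add: homogeneous_law_def)
  qed
  have fadd: "f S (x \<oplus>\<^bsub>tensor R A S\<^esub> y) = f S x \<oplus>\<^bsub>tensor R B S\<^esub> f S y"
    if "algebra R S" "x \<in> carrier (tensor R A S)" "y \<in> carrier (tensor R A S)" for S x y
    by (rule homogeneous_one_additive[OF inf alg_A B that(1) law hom that(2,3)])
  define \<alpha> where "\<alpha> x = (THE y. y \<in> carrier B \<and> f ?I (AI.pure x \<one>\<^bsub>R\<^esub>) = BI.pure y \<one>\<^bsub>R\<^esub>)" for x
  have px: "AI.pure x \<one>\<^bsub>R\<^esub> \<in> carrier AI.T" if "x \<in> carrier A" for x using that by (simp add: AI.pure_closed)
  have al: "\<alpha> x \<in> carrier B \<and> f ?I (AI.pure x \<one>\<^bsub>R\<^esub>) = BI.pure (\<alpha> x) \<one>\<^bsub>R\<^esub>" if "x \<in> carrier A" for x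
    unfolding \<alpha>_def
    by (rule theI') (rule tensor_self_unique[OF algebra_facts(2)[OF B] poly_lawD(1)[OF law I px[OF that]]])
  then have alc: "\<And>x. x \<in> carrier A \<Longrightarrow> \<alpha> x \<in> carrier B" and
    alf: "\<And>x. x \<in> carrier A \<Longrightarrow> f ?I (AI.pure x \<one>\<^bsub>R\<^esub>) = BI.pure (\<alpha> x) \<one>\<^bsub>R\<^esub>" by simp_all
  note inj = tensor_self_inj[OF algebra_facts(2)[OF B]]
  have hom_al: "\<alpha> \<in> alg_hom R A B"
  proof (rule alg_homI)
    fix x y assume x: "x \<in> carrier A" and y: "y \<in> carrier A"
    show "\<alpha> x \<in> carrier B" by (rule alc[OF x])
    have "BI.pure (\<alpha> (x \<oplus>\<^bsub>A\<^esub> y)) \<one>\<^bsub>R\<^esub> = f ?I (AI.pure x \<one>\<^bsub>R\<^esub> \<oplus>\<^bsub>AI.T\<^esub> AI.pure y \<one>\<^bsub>R\<^esub>)"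
      using alf[of "x \<oplus>\<^bsub>A\<^esub> y"] x y by (simp add: AI.pure_add_left)
    also have "\<dots> = BI.pure (\<alpha> x \<oplus>\<^bsub>B\<^esub> \<alpha> y) \<one>\<^bsub>R\<^esub>"
      using x y alc by (simp add: fadd[OF I px px] alf BI.pure_add_left)
    finally show "\<alpha> (x \<oplus>\<^bsub>A\<^esub> y) = \<alpha> x \<oplus>\<^bsub>B\<^esub> \<alpha> y" by (rule inj[rotated 2]) (use x y alc in simp_all)
    have "BI.pure (\<alpha> (x \<otimes>\<^bsub>A\<^esub> y)) \<one>\<^bsub>R\<^esub> = f ?I (AI.pure x \<one>\<^bsub>R\<^esub> \<otimes>\<^bsub>AI.T\<^esub> AI.pure y \<one>\<^bsub>R\<^esub>)"
      using alf[of "x \<otimes>\<^bsub>A\<^esub> y"] x y by (simp add: AI.mult_pure)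
    also have "\<dots> = BI.pure (\<alpha> x \<otimes>\<^bsub>B\<^esub> \<alpha> y) \<one>\<^bsub>R\<^esub>"
      using x y alc by (simp add: multiplicative_lawD(2)[OF mult I px px] alf BI.mult_pure)
    finally show "\<alpha> (x \<otimes>\<^bsub>A\<^esub> y) = \<alpha> x \<otimes>\<^bsub>B\<^esub> \<alpha> y" by (rule inj[rotated 2]) (use x y alc in simp_all)
  next
    have "BI.pure (\<alpha> \<one>\<^bsub>A\<^esub>) \<one>\<^bsub>R\<^esub> = BI.pure \<one>\<^bsub>B\<^esub> \<one>\<^bsub>R\<^esub>"
      using alf[of "\<one>\<^bsub>A\<^esub>"] multiplicative_lawD(1)[OF mult I] AI.one_cls BI.one_cls by simp
    then show "\<alpha> \<one>\<^bsub>A\<^esub> = \<one>\<^bsub>B\<^esub>" by (rule inj[rotated 2]) (use alc in simp_all)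
  next
    fix r x assume r: "r \<in> carrier R" and x: "x \<in> carrier A"
    have rx: "r \<odot>\<^bsub>A\<^esub> x \<in> carrier A" and rax: "r \<odot>\<^bsub>B\<^esub> \<alpha> x \<in> carrier B" using r x alc by simp_all
    have "AI.pure (r \<odot>\<^bsub>A\<^esub> x) \<one>\<^bsub>R\<^esub> = r \<odot>\<^bsub>AI.T\<^esub> AI.pure x \<one>\<^bsub>R\<^esub>"
      using r x by (simp add: AI.pure_smult AI.smult_pure)
    then have "BI.pure (\<alpha> (r \<odot>\<^bsub>A\<^esub> x)) \<one>\<^bsub>R\<^esub> = r \<odot>\<^bsub>BI.T\<^esub> BI.pure (\<alpha> x) \<one>\<^bsub>R\<^esub>"
      using alf[OF rx] r x fh[OF I _ px[OF x], of r] by (simp add: alf)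
    also have "\<dots> = BI.pure (r \<odot>\<^bsub>B\<^esub> \<alpha> x) \<one>\<^bsub>R\<^esub>"
      using r x alc by (simp add: BI.pure_smult BI.smult_pure)
    finally show "\<alpha> (r \<odot>\<^bsub>A\<^esub> x) = r \<odot>\<^bsub>B\<^esub> \<alpha> x" by (rule inj[OF alc[OF rx] rax])
  qed
  have "f S a = tensor_map R B S \<alpha> id a" if S: "algebra R S" and a: "a \<in> carrier (tensor R A S)" for S a
  proof -
    interpret M: algebra_base_change_map R A S B S \<alpha> id
      by (rule algebra_base_change_mapI[OF alg_A S B S hom_al alg_hom_id])
    note str = structure_map[OF S]
    have fc: "\<And>a. a \<in> carrier (tensor R A S) \<Longrightarrow> f S a \<in> carrier (tensor R B S)" by (rule poly_lawD(1)[OF law S])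
    show ?thesis using a
    proof (induction rule: M.tensor_induct)
      case zero
      have z: "\<zero>\<^bsub>M.T\<^esub> \<in> carrier M.T" by simp
      have "f S (\<zero>\<^bsub>S\<^esub> \<odot>\<^bsub>M.T\<^esub> \<zero>\<^bsub>M.T\<^esub>) = \<zero>\<^bsub>S\<^esub> \<odot>\<^bsub>M.target.T\<^esub> f S \<zero>\<^bsub>M.T\<^esub>"
        by (rule fh[OF S M.S.zero_closed z])
      then show ?case using fc[OF z] M.tm_zero by (simp add: M.zero_smult M.target.zero_smult id_def[symmetric])
    next
      case (add a b)
      then show ?case using fadd[OF S add(1,2)] M.tm_add[OF add(1,2)] by (simp add: id_def[symmetric])
    next
      case (pure x s)
      have x1: "M.pure x \<one>\<^bsub>S\<^esub> \<in> carrier M.T" using pure by (simp add: M.pure_closed)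
      have one: "\<one>\<^bsub>R\<^esub> \<odot>\<^bsub>S\<^esub> \<one>\<^bsub>S\<^esub> = \<one>\<^bsub>S\<^esub>" by simp
      have "f S (M.pure x \<one>\<^bsub>S\<^esub>) = f S (tensor_map R A S id (\<lambda>r. r \<odot>\<^bsub>S\<^esub> \<one>\<^bsub>S\<^esub>) (AI.pure x \<one>\<^bsub>R\<^esub>))"
        using pure base_map_pure[OF alg_A I S str, of x "\<one>\<^bsub>R\<^esub>"] by (simp add: one)
      also have "\<dots> = tensor_map R B S id (\<lambda>r. r \<odot>\<^bsub>S\<^esub> \<one>\<^bsub>S\<^esub>) (BI.pure (\<alpha> x) \<one>\<^bsub>R\<^esub>)"
        using poly_lawD(2)[OF law I S str px[OF pure(1)]] by (simp add: alf[OF pure(1)])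
      also have "\<dots> = M.target.pure (\<alpha> x) \<one>\<^bsub>S\<^esub>"
        using base_map_pure[OF B I S str alc[OF pure(1)], of "\<one>\<^bsub>R\<^esub>"] by (simp add: one)
      finally have 1: "f S (M.pure x \<one>\<^bsub>S\<^esub>) = M.target.pure (\<alpha> x) \<one>\<^bsub>S\<^esub>" .
      have "f S (M.pure x s) = f S (s \<odot>\<^bsub>M.T\<^esub> M.pure x \<one>\<^bsub>S\<^esub>)" using pure by (simp add: M.smult_pure)
      also have "\<dots> = M.target.pure (\<alpha> x) s"
        using pure alc[OF pure(1)] by (simp add: fh[OF S pure(2) x1] 1 M.target.smult_pure)
      finally show ?case using M.tm_pure[OF pure] by (simp add: id_def[symmetric])
    qed
  qed
  then show ?thesis using hom_al by blast
qed

text \<open>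
  The first \<open>m\<close> factors are algebra homomorphisms; evaluating the factorization at \<open>X + a\<close> exhibits the
  last factor as the quotient of \<open>N(X + a)\<close> by \<open>\<Prod>(X + \<alpha>\<^sub>i(a))\<close>.
\<close>

lemma factorization_roots:
  assumes B: "algebra R B" and nf: "norm_factorization R A (replicate m 1 @ [n - m]) B \<gamma>"
  shows "\<exists>\<alpha>. (\<forall>i<m. \<alpha> i \<in> alg_hom R A B) \<and>
    (\<forall>i<m. \<forall>S a. algebra R S \<and> a \<in> carrier (tensor R A S) \<longrightarrow> \<gamma> i S a = tensor_map R B S (\<alpha> i) id a) \<and>
    translates_divide R A m B \<alpha>"
proof -
  let ?ns = "replicate m 1 @ [n - m]"
  have laws: "poly_law R A B (\<gamma> i) \<and> homogeneous_law R A B (?ns ! i) (\<gamma> i) \<and> multiplicative_law R A B (\<gamma> i)"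
    if "i < Suc m" for i
    using nf that unfolding norm_factorization_def by simp
  have "\<exists>a\<in>alg_hom R A B. \<forall>S x. algebra R S \<and> x \<in> carrier (tensor R A S) \<longrightarrow> \<gamma> i S x = tensor_map R B S a id x"
    if "i < m" for i
    using laws[of i] that by (intro degree_one_law_is_alg_hom[OF B]) (simp_all add: nth_append)
  then have "\<forall>i\<in>{..<m}. \<exists>a. a \<in> alg_hom R A B \<and> (\<forall>S x. algebra R S \<and> x \<in> carrier (tensor R A S) \<longrightarrow> \<gamma> i S x = tensor_map R B S a id x)"
    by blast
  from bchoice[OF this] obtain \<alpha> where \<alpha>: "\<forall>i\<in>{..<m}. \<alpha> i \<in> alg_hom R A B \<and>
      (\<forall>S x. algebra R S \<and> x \<in> carrier (tensor R A S) \<longrightarrow> \<gamma> i S x = tensor_map R B S (\<alpha> i) id x)" by (elim exE)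
  have "translates_divide R A m B \<alpha>"
    unfolding translates_divide_def
  proof (intro allI impI, elim conjE)
    fix S :: "('u, 'u) module" and a assume S: "algebra R S" and a: "a \<in> carrier (tensor R A S)"
    let ?P = "poly_u S" and ?x = "translate R A S a"
    note P = poly_u_alg[OF S] and x = translate_closed[OF alg_A S a]
    interpret BP: algebra_base_change R B ?P by (rule algebra_base_change.intro[OF B P])
    have gc: "\<gamma> i ?P ?x \<in> carrier (tensor R B ?P)" if "i < Suc m" for i
      using poly_lawD(1)[OF _ P x] laws[OF that] by simp
    have gi: "\<gamma> i ?P ?x = translate R B S (tensor_map R B S (\<alpha> i) id a)" if "i < m" for i
      using \<alpha> that P x translate_coefficient_map[OF alg_A B S _ a, of "\<alpha> i"] by simp
    have "norm_law R A B ?P ?x = (\<Otimes>\<^bsub>tensor R B ?P\<^esub>i\<in>{..<Suc m}. \<gamma> i ?P ?x)"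
      using nf P x unfolding norm_factorization_def by simp
    also have "\<dots> = \<gamma> m ?P ?x \<otimes>\<^bsub>tensor R B ?P\<^esub> (\<Otimes>\<^bsub>tensor R B ?P\<^esub>i\<in>{..<m}. \<gamma> i ?P ?x)"
      unfolding lessThan_Suc using gc by (intro BP.tensor.finprod_insert) auto
    also have "\<dots> = (\<Otimes>\<^bsub>tensor R B ?P\<^esub>i\<in>{..<m}. \<gamma> i ?P ?x) \<otimes>\<^bsub>tensor R B ?P\<^esub> \<gamma> m ?P ?x"
      using gc by (intro BP.mult_comm BP.tensor.finprod_closed) auto
    also have "(\<Otimes>\<^bsub>tensor R B ?P\<^esub>i\<in>{..<m}. \<gamma> i ?P ?x) = (\<Otimes>\<^bsub>tensor R B ?P\<^esub>i\<in>{..<m}. translate R B S (tensor_map R B S (\<alpha> i) id a))"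
    proof -
      have "translate R B S (tensor_map R B S (\<alpha> i) id a) \<in> carrier (tensor R B ?P)" if "i < m" for i
        using gc[of i] gi[OF that] that by simp
      then show ?thesis using gi by (intro BP.tensor.finprod_cong') auto
    qed
    finally show "\<exists>q\<in>carrier (tensor R B ?P).
        pure_tensor R B ?P \<one>\<^bsub>B\<^esub> (algebra_norm R A ?P ?x) =
        (\<Otimes>\<^bsub>tensor R B ?P\<^esub>i\<in>{..<m}. translate R B S (tensor_map R B S (\<alpha> i) id a)) \<otimes>\<^bsub>tensor R B ?P\<^esub> q"
      using gc[of m] by (intro bexI[of _ "\<gamma> m ?P ?x"]) (simp_all add: norm_law_def)
  qed
  then show ?thesis using \<alpha> by (intro exI[of _ \<alpha>]) simp
qed

end

lemma restrict_alg_hom: "h \<in> alg_hom R A B \<Longrightarrow> algebra R A \<Longrightarrow> restrict h (carrier A) \<in> alg_hom R A B"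
  by (rule alg_hom_cong) simp_all

section \<open>The isomorphism\<close>

text \<open>
  The roots of \<open>C\<close> with their cofactor are a factorization of the norm over \<open>C\<close>, and the degree-one
  factors of \<open>D\<close> are roots over \<open>D\<close>. The two universal properties turn these into homomorphisms
  \<open>\<phi>: D \<rightarrow> C\<close> and \<open>\<psi>: C \<rightarrow> D\<close>. Each composition fixes the universal data and is therefore the identity.
\<close>

theorem proposition5p15:
  fixes R :: "'u ring" and A C D :: "('u, 'u) module"
    and \<alpha> :: "nat \<Rightarrow> 'u \<Rightarrow> 'u" and \<delta> :: "nat \<Rightarrow> 'u law" and n m :: nat
  assumes "infinite (UNIV :: 'u set)"
    and "cring R"
    and "algebra_of_rank R A n"
    and "1 \<le> m" and "m \<le> n"
    and "is_m_closure R A m C \<alpha>"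
    and "is_universal_norm_factorization R A (replicate m 1 @ [n - m]) D \<delta>"
  shows "\<exists>\<phi>. \<phi> \<in> alg_iso R C D"
proof -
  let ?ns = "replicate m 1 @ [n - m]"
  have A: "algebra R A" and rk: "module_of_rank R A n" using assms(3) by (simp_all add: algebra_of_rank_def)
  obtain k l g where dual: "dual_basis R A k l g"
    using finitely_generated_projective_dual_basis[of R A] rk unfolding module_of_rank_def by blast
  interpret rank_algebra R A k l g n m
    by (intro rank_algebra.intro universe.intro dual_basis_algebra.intro rank_algebra_axioms.intro)
      (use assms(1,2,5) A dual rk in \<open>simp_all add: module_of_rank_def\<close>)
  have C: "algebra R C" and \<alpha>: "\<And>i. i < m \<Longrightarrow> \<alpha> i \<in> alg_hom R A C" and Clf: "linear_factors_divide R A m C \<alpha>"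
    using assms(6) by (simp_all add: is_m_closure_def)
  have Cuniv: "\<exists>!\<phi>. \<phi> \<in> alg_hom R C B \<and> \<phi> \<in> extensional (carrier C) \<and> (\<forall>i<m. \<forall>x\<in>carrier A. \<phi> (\<alpha> i x) = \<beta> i x)"
    if "algebra R B" "\<forall>i<m. \<beta> i \<in> alg_hom R A B" "linear_factors_divide R A m B \<beta>" for B \<beta>
    using assms(6) that unfolding is_m_closure_def by blast
  have D: "algebra R D" and Dnf: "norm_factorization R A ?ns D \<delta>"
    using assms(7) by (simp_all add: is_universal_norm_factorization_def)
  have Duniv: "\<exists>!\<phi>. \<phi> \<in> alg_hom R D B \<and> \<phi> \<in> extensional (carrier D) \<and>
      (\<forall>i<length ?ns. \<forall>S a. algebra R S \<and> a \<in> carrier (tensor R A S) \<longrightarrow> tensor_map R B S \<phi> id (\<delta> i S a) = \<beta> i S a)"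
    if "algebra R B" "norm_factorization R A ?ns B \<beta>" for B \<beta>
    using assms(7) that unfolding is_universal_norm_factorization_def by blast
  interpret C: root_system R A k l g n m C \<alpha>
    by (intro root_system.intro root_system_axioms.intro rank_algebra_axioms C)
      (use \<alpha> linear_factors_divide_iff[OF C \<alpha>] Clf in simp_all)
  obtain \<alpha>' where \<alpha>': "\<forall>i<m. \<alpha>' i \<in> alg_hom R A D"
    and \<delta>: "\<forall>i<m. \<forall>S a. algebra R S \<and> a \<in> carrier (tensor R A S) \<longrightarrow> \<delta> i S a = tensor_map R D S (\<alpha>' i) id a"
    and td: "translates_divide R A m D \<alpha>'"
    using factorization_roots[OF D Dnf] by (elim exE conjE)
  interpret D: root_system R A k l g n m D \<alpha>'
    by (intro root_system.intro root_system_axioms.intro rank_algebra_axioms D) (use \<alpha>' td in simp_all)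
  obtain \<phi> where \<phi>: "\<phi> \<in> alg_hom R D C"
    and \<phi>\<delta>: "\<And>i S a. i < Suc m \<Longrightarrow> algebra R S \<Longrightarrow> a \<in> carrier (tensor R A S) \<Longrightarrow> tensor_map R C S \<phi> id (\<delta> i S a) = C.factors i S a"
    using Duniv[OF C C.factors_norm_factorization] by auto
  have Dlf: "linear_factors_divide R A m D \<alpha>'" using linear_factors_divide_iff[OF D] \<alpha>' td by simp
  obtain \<psi> where \<psi>: "\<psi> \<in> alg_hom R C D" and \<psi>\<alpha>: "\<And>i x. i < m \<Longrightarrow> x \<in> carrier A \<Longrightarrow> \<psi> (\<alpha> i x) = \<alpha>' i x"
    using Cuniv[OF D \<alpha>' Dlf] by auto
  \<comment> \<open>The universal property of \<open>D\<close> speaks of laws; evaluated over \<open>R\<close> itself, it relates the maps.\<close>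
  have phi_alpha: "\<phi> (\<alpha>' i x) = \<alpha> i x" if i: "i < m" and x: "x \<in> carrier A" for i x
  proof -
    let ?I = "self_algebra R"
    have I: "algebra R ?I" by (rule self_algebra_algebra[OF assms(2)])
    interpret R: cring R by fact
    interpret AI: algebra_base_change R A ?I by (rule bc[OF I])
    interpret a': algebra_base_change_map R A ?I D ?I "\<alpha>' i" id by (rule D.root_map[OF I i])
    interpret a: algebra_base_change_map R A ?I C ?I "\<alpha> i" id by (rule C.root_map[OF I i])
    interpret p: algebra_base_change_map R D ?I C ?I \<phi> id
      by (rule algebra_base_change_mapI[OF D I C I \<phi> alg_hom_id])
    have x1: "AI.pure x \<one>\<^bsub>R\<^esub> \<in> carrier AI.T" using x by (simp add: AI.pure_closed)
    have ax: "\<alpha>' i x \<in> carrier D" "\<alpha> i x \<in> carrier C" by (rule alg_homD(1)[OF \<alpha>'[rule_format, OF i] x], rule alg_homD(1)[OF \<alpha>[OF i] x])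
    have "p.tm (\<delta> i ?I (AI.pure x \<one>\<^bsub>R\<^esub>)) = a.tm (AI.pure x \<one>\<^bsub>R\<^esub>)"
      using \<phi>\<delta>[OF _ I x1, of i] i by (simp add: C.factors_def)
    moreover have "\<delta> i ?I (AI.pure x \<one>\<^bsub>R\<^esub>) = a'.tm (AI.pure x \<one>\<^bsub>R\<^esub>)" using \<delta> i I x1 by simp
    ultimately have eq: "pure_tensor R C ?I (\<phi> (\<alpha>' i x)) \<one>\<^bsub>R\<^esub> = pure_tensor R C ?I (\<alpha> i x) \<one>\<^bsub>R\<^esub>"
      using x ax by (simp add: a'.tm_pure a.tm_pure p.tm_pure)
    show ?thesis by (rule tensor_self_inj[OF algebra_facts(2)[OF C] alg_homD(1)[OF \<phi> ax(1)] ax(2) eq])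
  qed
  have phi_psi: "\<phi> (\<psi> x) = x" if x: "x \<in> carrier C" for x
  proof -
    let ?P = "\<lambda>f. f \<in> alg_hom R C C \<and> f \<in> extensional (carrier C) \<and> (\<forall>i<m. \<forall>x\<in>carrier A. f (\<alpha> i x) = \<alpha> i x)"
    have ac: "\<And>i x. i < m \<Longrightarrow> x \<in> carrier A \<Longrightarrow> \<alpha> i x \<in> carrier C" by (rule alg_homD(1)[OF \<alpha>])
    have all_alpha: "\<forall>i<m. \<alpha> i \<in> alg_hom R A C" using \<alpha> by simp
    \<comment> \<open>Uniqueness holds among extensional maps, whence the restrictions.\<close>
    have 1: "?P (restrict (\<phi> \<circ> \<psi>) (carrier C))"
      using restrict_alg_hom[OF alg_hom_comp[OF \<psi> \<phi>] C] by (simp add: ac \<psi>\<alpha> phi_alpha)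
    have 2: "?P (restrict id (carrier C))"
      using restrict_alg_hom[OF alg_hom_id C] by (simp add: ac)
    have "restrict (\<phi> \<circ> \<psi>) (carrier C) = restrict id (carrier C)"
      by (rule ex1_eqI[where P = ?P, OF Cuniv[OF C all_alpha Clf] 1 2])
    from fun_cong[OF this, of x] show ?thesis using x by simp
  qed
  have psi_phi: "\<psi> (\<phi> x) = x" if x: "x \<in> carrier D" for x
  proof -
    let ?P = "\<lambda>f. f \<in> alg_hom R D D \<and> f \<in> extensional (carrier D) \<and>
      (\<forall>i<length ?ns. \<forall>S a. algebra R S \<and> a \<in> carrier (tensor R A S) \<longrightarrow> tensor_map R D S f id (\<delta> i S a) = \<delta> i S a)"
    have Dlaw: "poly_law R A D (\<delta> i)" if "i < Suc m" for i
      using Dnf that unfolding norm_factorization_def by simp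
    have dc: "\<delta> i S a \<in> carrier (tensor R D S)" if "i < Suc m" "algebra R S" "a \<in> carrier (tensor R A S)" for i S a
      by (rule poly_lawD(1)[OF Dlaw[OF that(1)] that(2,3)])
    note mC = algebra_facts(2)[OF C] and mD = algebra_facts(2)[OF D] and mA = algebra_facts(2)[OF A]
    \<comment> \<open>For the roots this holds by the choice of \<open>\<psi>\<close>. As for the last factor, the image under \<open>\<psi>\<close> of the cofactor over \<open>C\<close> and the last
      factor over \<open>D\<close> both complete the roots \<open>\<alpha>'\<close> to the norm, and there is only one such law.\<close>
    have push: "tensor_map R D S \<psi> id (C.factors i S a) = \<delta> i S a"
      if i: "i < Suc m" and S: "algebra R S" and a: "a \<in> carrier (tensor R A S)" for i S a
    proof (cases "i < m")
      case True
      have "tensor_map R D S \<psi> id (tensor_map R C S (\<alpha> i) id a) = tensor_map R D S (\<psi> \<circ> \<alpha> i) (id \<circ> id) a"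
        by (rule tensor_map_comp[OF base_change_mapI[OF mA S mC S alg_hom_module_hom[OF \<alpha>[OF True]] module_hom_id]
              base_change_mapI[OF mC S mD S alg_hom_module_hom[OF \<psi>] module_hom_id] a])
      also have "\<dots> = tensor_map R D S (\<alpha>' i) id a"
      proof (rule tensor_map_cong[OF _ _ _ _ a])
        show "base_change_map R A S D S (\<psi> \<circ> \<alpha> i) (id \<circ> id)"
          by (rule base_change_mapI[OF mA S mD S alg_hom_module_hom[OF alg_hom_comp[OF \<alpha>[OF True] \<psi>]] module_hom_comp[OF module_hom_id module_hom_id]])
        show "base_change_map R A S D S (\<alpha>' i) id"
          using \<alpha>' True by (intro base_change_mapI[OF mA S mD S alg_hom_module_hom module_hom_id]) simp
      qed (simp_all add: \<psi>\<alpha>[OF True])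
      finally show ?thesis using True \<delta> S a by (simp add: C.factors_def)
    next
      case False
      then have im: "i = m" using i by simp
      let ?f = "\<lambda>S a. tensor_map R D S \<psi> id (C.cofactor S a)"
      have psi_map: "algebra_base_change_map R C S D S \<psi> id" if "algebra R S" for S
        by (rule algebra_base_change_mapI[OF C that D that \<psi> alg_hom_id])
      have psi_hom: "tensor_map R D S \<psi> id \<in> ring_hom (tensor R C S) (tensor R D S)" if "algebra R S" for S
        by (rule algebra_base_change_map.tm_ring_hom[OF psi_map[OF that]])
      have flaw: "poly_law R A D ?f"
        unfolding poly_law_def
      proof (intro conjI allI impI funcsetI; (elim conjE)?)
        fix S :: "('u, 'u) module" and a assume "algebra R S" "a \<in> carrier (tensor R A S)"
        then show "?f S a \<in> carrier (tensor R D S)" by (simp add: ring_hom_closed[OF psi_hom] C.cofactor_closed)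
      next
        fix S T :: "('u, 'u) module" and h a assume h: "algebra R S" "algebra R T" "h \<in> alg_hom R S T" and a: "a \<in> carrier (tensor R A S)"
        have "?f T (tensor_map R A T id h a) = tensor_map R D T \<psi> id (tensor_map R C T id h (C.cofactor S a))"
          by (simp only: C.cofactor_natural[OF h a])
        also have "\<dots> = tensor_map R D T id h (?f S a)"
          by (rule coefficient_map_commute[OF C D h(1,2) \<psi> h(3) C.cofactor_closed[OF h(1) a]])
        finally show "?f T (tensor_map R A T id h a) = tensor_map R D T id h (?f S a)" .
      qed
      have "?f S a = D.cofactor S a"
      proof (rule D.cofactor_unique[OF flaw _ S a])
        fix S :: "('u, 'u) module" and a assume S: "algebra R S" and a: "a \<in> carrier (tensor R A S)"
        interpret p: algebra_base_change_map R C S D S \<psi> id by (rule psi_map[OF S])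
        have "D.root_prod S a = p.tm (C.root_prod S a)"
        proof -
          have "p.tm (C.root_prod S a) = (\<Otimes>\<^bsub>tensor R D S\<^esub>i\<in>{..<m}. p.tm (C.branch i S a))"
            unfolding C.root_prod_def using C.root_closed[OF S _ a] by (subst p.tm.hom_finprod) (auto simp: o_def)
          also have "\<dots> = D.root_prod S a"
            unfolding D.root_prod_def
          proof (rule p.target.tensor.finprod_cong'[OF HOL.refl])
            show "(\<lambda>i. D.branch i S a) \<in> {..<m} \<rightarrow> carrier (tensor R D S)" using D.root_closed[OF S _ a] by auto
            fix i assume "i \<in> {..<m}"
            then have i: "i < m" by simp
            have "p.tm (C.branch i S a) = tensor_map R D S (\<psi> \<circ> \<alpha> i) (id \<circ> id) a"
              by (rule tensor_map_comp[OF base_change_mapI[OF mA S mC S alg_hom_module_hom[OF \<alpha>[OF i]] module_hom_id]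
                    base_change_mapI[OF mC S mD S alg_hom_module_hom[OF \<psi>] module_hom_id] a])
            also have "\<dots> = D.branch i S a"
            proof (rule tensor_map_cong[OF _ _ _ _ a])
              show "base_change_map R A S D S (\<psi> \<circ> \<alpha> i) (id \<circ> id)"
                by (rule base_change_mapI[OF mA S mD S alg_hom_module_hom[OF alg_hom_comp[OF \<alpha>[OF i] \<psi>]] module_hom_comp[OF module_hom_id module_hom_id]])
              show "base_change_map R A S D S (\<alpha>' i) id"
                using \<alpha>' i by (intro base_change_mapI[OF mA S mD S alg_hom_module_hom module_hom_id]) simp
            qed (simp_all add: \<psi>\<alpha>[OF i])
            finally show "p.tm (C.branch i S a) = D.branch i S a" .
          qed
          finally show ?thesis by simp
        qed
        then have "D.root_prod S a \<otimes>\<^bsub>tensor R D S\<^esub> ?f S a = p.tm (norm_law R A C S a)"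
          using p.tm_mult[OF C.root_prod_closed[OF S a] C.cofactor_closed[OF S a]] by (simp add: C.cofactor_prod[OF S a])
        also have "\<dots> = norm_law R A D S a"
          unfolding norm_law_def using norm_closed[OF S a] by (simp add: p.tm_pure alg_homD(4)[OF \<psi>])
        finally show "D.root_prod S a \<otimes>\<^bsub>tensor R D S\<^esub> ?f S a = norm_law R A D S a" .
      qed
      also have "\<dots> = \<delta> m S a"
      proof (rule D.cofactor_unique[OF Dlaw _ S a, symmetric])
        fix S :: "('u, 'u) module" and a assume S: "algebra R S" and a: "a \<in> carrier (tensor R A S)"
        interpret DS: algebra_base_change R D S by (rule D.bcB[OF S])
        have "norm_law R A D S a = (\<Otimes>\<^bsub>tensor R D S\<^esub>i\<in>{..<Suc m}. \<delta> i S a)"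
          using Dnf S a unfolding norm_factorization_def by simp
        also have "\<dots> = \<delta> m S a \<otimes>\<^bsub>tensor R D S\<^esub> (\<Otimes>\<^bsub>tensor R D S\<^esub>i\<in>{..<m}. \<delta> i S a)"
          unfolding lessThan_Suc using dc[OF _ S a] by (intro DS.tensor.finprod_insert) auto
        also have "(\<Otimes>\<^bsub>tensor R D S\<^esub>i\<in>{..<m}. \<delta> i S a) = D.root_prod S a"
          unfolding D.root_prod_def using D.root_closed[OF S _ a] \<delta> S a by (intro DS.tensor.finprod_cong') auto
        finally show "D.root_prod S a \<otimes>\<^bsub>tensor R D S\<^esub> \<delta> m S a = norm_law R A D S a"
          using DS.mult_comm[OF D.root_prod_closed[OF S a] dc[OF _ S a, of m]] by simp
      qed simp
      finally show ?thesis by (simp add: im C.factors_def)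
    qed
    have 1: "?P (restrict (\<psi> \<circ> \<phi>) (carrier D))"
    proof (intro conjI allI impI, goal_cases)
      case 1 show ?case by (rule restrict_alg_hom[OF alg_hom_comp[OF \<phi> \<psi>] D])
    next
      case 2 show ?case by simp
    next
      case (3 i S a)
      then have i: "i < Suc m" and S: "algebra R S" and a: "a \<in> carrier (tensor R A S)" by simp_all
      have "\<delta> i S a = tensor_map R D S \<psi> id (tensor_map R C S \<phi> id (\<delta> i S a))"
        by (simp add: \<phi>\<delta>[OF i S a] push[OF i S a])
      also have "\<dots> = tensor_map R D S (\<psi> \<circ> \<phi>) (id \<circ> id) (\<delta> i S a)"
        by (rule tensor_map_comp[OF base_change_mapI[OF mD S mC S alg_hom_module_hom[OF \<phi>] module_hom_id]
              base_change_mapI[OF mC S mD S alg_hom_module_hom[OF \<psi>] module_hom_id] dc[OF i S a]])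
      also have "\<dots> = tensor_map R D S (restrict (\<psi> \<circ> \<phi>) (carrier D)) id (\<delta> i S a)"
      proof (rule tensor_map_cong[OF _ _ _ _ dc[OF i S a]])
        show "base_change_map R D S D S (\<psi> \<circ> \<phi>) (id \<circ> id)"
          by (rule base_change_mapI[OF mD S mD S alg_hom_module_hom[OF alg_hom_comp[OF \<phi> \<psi>]] module_hom_comp[OF module_hom_id module_hom_id]])
        show "base_change_map R D S D S (restrict (\<psi> \<circ> \<phi>) (carrier D)) id"
          by (rule base_change_mapI[OF mD S mD S alg_hom_module_hom[OF restrict_alg_hom[OF alg_hom_comp[OF \<phi> \<psi>] D]] module_hom_id])
      qed simp_all
      finally show ?case by simp
    qed
    have 2: "?P (restrict id (carrier D))"
    proof (intro conjI allI impI, goal_cases)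
      case 1 show ?case by (rule restrict_alg_hom[OF alg_hom_id D])
    next
      case 2 show ?case by simp
    next
      case (3 i S a)
      then show ?case by (intro tensor_map_ident[OF mD _ _ _ dc]) simp_all
    qed
    have "restrict (\<psi> \<circ> \<phi>) (carrier D) = restrict id (carrier D)"
      by (rule ex1_eqI[where P = ?P, OF Duniv[OF D Dnf] 1 2])
    from fun_cong[OF this, of x] show ?thesis using x by simp
  qed
  show ?thesis
  proof (intro exI[of _ \<psi>])
    have "bij_betw \<psi> (carrier C) (carrier D)"
      by (rule bij_betwI[of _ _ _ \<phi>]) (auto simp: phi_psi psi_phi alg_homD(1)[OF \<psi>] alg_homD(1)[OF \<phi>])
    then show "\<psi> \<in> alg_iso R C D" using \<psi> by (simp add: alg_iso_def)
  qed
qed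

end
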